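(* Let $n\ge 2$, let $0<\alpha\le (n+2)/4$, let $\boldsymbol u_0\in L^2_\sigma(\mathbb R^n)$, and let $\boldsymbol f\in L^1((0,\infty),L^2_\sigma(\mathbb R^n))$ satisfy, for some constants $C_f,K_f>0$ and every $t>0$, $$\|\boldsymbol f(\cdot,t)\|_{L^2(\mathbb R^n)}\le C_f(1+t)^{-\alpha-1}\quad\text{and}\quad \|\boldsymbol f(\cdot,t)\|_{L^n(\mathbb R^n)}\le K_f\,t^{-\alpha-\frac{n+2}{4}}.$$ Let $\boldsymbol u$ be a Leray solution of the forced incompressible Navier--Stokes equations in $\mathbb R^n$ with external force $\boldsymbol f$ and initial datum $\boldsymbol u_0$, and let $\boldsymbol v\in C([0,\infty),L^2_\sigma(\mathbb R^n))$ be the solution of the associated Stokes problem $\boldsymbol v_t=\Delta\boldsymbol v+\boldsymbol f(\cdot,t)$, $\boldsymbol v(\cdot,0)=\boldsymbol u_0$. If $\|\boldsymbol u(\cdot,t)\|_{L^2(\mathbb R^n)}=O(1+t)^{-\alpha}$, then $\|\boldsymbol v(\cdot,t)\|_{L^2(\mathbb R^n)}=O(1+t)^{-\alpha}$ as well.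
   Context: $L^2_\sigma(\mathbb R^n)$ is the space of vector fields $\boldsymbol w=(w_1,\dots,w_n)$ with all $w_i\in L^2(\mathbb R^n)$ and $\operatorname{div}\boldsymbol w=0$ in the sense of distributions. $\dot H^1(\mathbb R^n)$ is the homogeneous Sobolev space with norm $\|D\boldsymbol w\|_{L^2(\mathbb R^n)}$, where $\|D\boldsymbol w\|_{L^2}^2=\sum_i\|\nabla w_i\|_{L^2}^2$. $C_w([0,\infty),L^2_\sigma(\mathbb R^n))$ denotes weakly continuous functions of time with values in $L^2_\sigma(\mathbb R^n)$. $g(t)=O(1+t)^{-\alpha}$ means that $(1+t)^{\alpha}g(t)$ is bounded for $t\ge 0$. The forced Navier--Stokes equations are $$\boldsymbol u_t+\boldsymbol u\cdot\nabla\boldsymbol u+\nabla p=\Delta\boldsymbol u+\boldsymbol f(\cdot,t),\qquad \nabla\cdot\boldsymbol u(\cdot,t)=0,\qquad \boldsymbol u(\cdot,0)=\boldsymbol u_0\in L^2_\sigma(\mathbb R^n).$$ A Leray solution is a mapping $\boldsymbol u\in C_w([0,\infty),L^2_\sigma(\mathbb R^n))\cap L^2((0,\infty),\dot H^1(\mathbb R^n))$ with $\boldsymbol u(\cdot,0)=\boldsymbol u_0$ that satisfies these equations in the weak sense and, in addition, the following. (a) If $2\le n\le 4$: the energy estimate in its strong form, $$\|\boldsymbol u(\cdot,t)\|_{L^2}^2+2\int_s^t\|D\boldsymbol u(\cdot,\tau)\|_{L^2}^2\,d\tau\le\|\boldsymbol u(\cdot,s)\|_{L^2}^2+2\int_s^t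 J(\tau)\,d\tau,\qquad J(\tau)=\int_{\mathbb R^n}\boldsymbol u(x,\tau)\cdot\boldsymbol f(x,\tau)\,dx,$$ for $s=0$ and almost all $s>0$, and every $t>s$. (b) If $n\ge5$: instead of the strong energy estimate for $\boldsymbol u$ itself, one asks (following Wiegner, 1987) that $\boldsymbol u$ is a weak solution obtained as the limit, in $L^2((0,\infty),\dot H^1(\mathbb R^n))$ and in $L^2_{\rm loc}(\mathbb R^n\times\mathbb R^+)$, of a sequence of approximate solutions $\boldsymbol u_k$ of the equations which satisfy $$\|\boldsymbol u_k(\cdot,t)\|_{L^2}^2+2\int_s^t\|D\boldsymbol u_k(\cdot,\tau)\|_{L^2}^2\,d\tau\le\|\boldsymbol u_k(\cdot,s)\|_{L^2}^2+2\int_s^t\int_{\mathbb R^n}\boldsymbol u_k(x,\tau)\cdot\boldsymbol f(x,\tau)\,dx\,d\tau$$ for $s=0$ and almost all $s>0$, and every $t>s$. *)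

theory Defs
  imports "HOL-Analysis.Analysis"
begin

text \<open>
  Vector fields on \<open>R^n\<close> are functions \<open>real^'n \<Rightarrow> real^'n\<close> with \<open>n = CARD('n)\<close>, used as
  representatives of their almost-everywhere classes.  Space-time integrals are written as iterated
  integrals, so that they only depend on the class of \<open>u t\<close> for almost every \<open>t\<close>; no joint
  measurability of the chosen representatives is required.
\<close>

subsection \<open>Lebesgue spaces\<close>

definition in_Lp :: "real \<Rightarrow> ('a::euclidean_space \<Rightarrow> 'b::euclidean_space) \<Rightarrow> bool" where
  "in_Lp p w \<longleftrightarrow> w \<in> borel_measurable lebesgue \<and> integrable lebesgue (\<lambda>x. norm (w x) powr p)"

text \<open>Only meaningful together with \<^const>\<open>in_Lp\<close>: the integral of a non-integrable function is 0.\<close>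
definition Lp_norm :: "real \<Rightarrow> ('a::euclidean_space \<Rightarrow> 'b::euclidean_space) \<Rightarrow> real" where
  "Lp_norm p w = (LINT x|lebesgue. norm (w x) powr p) powr (1 / p)"

text \<open>
  \<open>g \<in> L^q((0,\<infinity>), L^2)\<close> in the sense of Bochner: \<open>g\<close> is almost everywhere the limit, in the
  \<open>L^2\<close> norm, of a sequence of simple \<open>L^2\<close>-valued functions, and the \<open>q\<close>-th power of its norm is
  integrable.
\<close>
definition strongly_measurable_L2 ::
    "(real \<Rightarrow> 'a::euclidean_space \<Rightarrow> 'b::euclidean_space) \<Rightarrow> bool" where
  "strongly_measurable_L2 g \<longleftrightarrow>
     (\<exists>s :: nat \<Rightarrow> real \<Rightarrow> 'a \<Rightarrow> 'b.
        (\<forall>k. simple_function (lebesgue_on {0<..}) (s k) \<and> (\<forall>t>0. in_Lp 2 (s k t))) \<and>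
        (AE t in lebesgue_on {0<..}.
           in_Lp 2 (g t) \<and> (\<lambda>k. Lp_norm 2 (\<lambda>x. s k t x - g t x)) \<longlonglongrightarrow> 0))"

definition bochner_Lq_L2 ::
    "real \<Rightarrow> (real \<Rightarrow> 'a::euclidean_space \<Rightarrow> 'b::euclidean_space) \<Rightarrow> bool" where
  "bochner_Lq_L2 q g \<longleftrightarrow>
     strongly_measurable_L2 g \<and> integrable (lebesgue_on {0<..}) (\<lambda>t. Lp_norm 2 (g t) powr q)"

subsection \<open>Test functions\<close>

definition dderiv ::
    "'a::real_normed_vector \<Rightarrow> ('a \<Rightarrow> 'b::real_normed_vector) \<Rightarrow> 'a \<Rightarrow> 'b" where
  "dderiv v f z = frechet_derivative f (at z) v"

primrec C_k :: "nat \<Rightarrow> ('a::euclidean_space \<Rightarrow> 'b::real_normed_vector) \<Rightarrow> bool" where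
  "C_k 0 f = continuous_on UNIV f"
| "C_k (Suc k) f = ((\<forall>z. f differentiable (at z)) \<and> (\<forall>v. C_k k (dderiv v f)))"

definition test_function :: "('a::euclidean_space \<Rightarrow> 'b::real_normed_vector) \<Rightarrow> bool" where
  "test_function \<phi> \<longleftrightarrow> (\<forall>k. C_k k \<phi>) \<and> compact (closure {z. \<phi> z \<noteq> 0})"

text \<open>Derivatives of functions of \<open>(t, x)\<close>.\<close>

definition dt :: "(real \<times> (real^'n) \<Rightarrow> 'b::real_normed_vector) \<Rightarrow> real \<times> (real^'n) \<Rightarrow> 'b" where
  "dt = dderiv (1, 0)"

definition dx :: "'n \<Rightarrow> (real \<times> (real^'n) \<Rightarrow> 'b::real_normed_vector) \<Rightarrow> real \<times> (real^'n) \<Rightarrow> 'b" where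
  "dx j = dderiv (0, axis j 1)"

definition laplacian_x ::
    "(real \<times> (real^'n) \<Rightarrow> 'b::real_normed_vector) \<Rightarrow> real \<times> (real^'n) \<Rightarrow> 'b" where
  "laplacian_x \<phi> z = (\<Sum>j\<in>UNIV. dx j (dx j \<phi>) z)"

definition div_x :: "(real \<times> (real^'n) \<Rightarrow> real^'n) \<Rightarrow> real \<times> (real^'n) \<Rightarrow> real" where
  "div_x \<phi> z = (\<Sum>j\<in>UNIV. dx j \<phi> z $ j)"

subsection \<open>Solenoidal fields and the homogeneous Sobolev space\<close>

definition L2_sigma :: "(real^'n \<Rightarrow> real^'n) set" where
  "L2_sigma = {w. in_Lp 2 w \<and>
     (\<forall>\<phi> :: real^'n \<Rightarrow> real. test_function \<phi> \<longrightarrow>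
        (LINT x|lebesgue. (\<Sum>j\<in>UNIV. w x $ j * dderiv (axis j 1) \<phi> x)) = 0)}"

text \<open>\<open>G x $ i $ j\<close> is the weak derivative of the \<open>i\<close>-th component of \<open>w\<close> in direction \<open>j\<close>.\<close>
definition has_weak_jacobian ::
    "(real^'n \<Rightarrow> real^'n) \<Rightarrow> (real^'n \<Rightarrow> real^'n^'n) \<Rightarrow> bool" where
  "has_weak_jacobian w G \<longleftrightarrow> in_Lp 2 G \<and>
     (\<forall>i j. \<forall>\<phi> :: real^'n \<Rightarrow> real. test_function \<phi> \<longrightarrow>
        (LINT x|lebesgue. w x $ i * dderiv (axis j 1) \<phi> x)
          = - (LINT x|lebesgue. G x $ i $ j * \<phi> x))"

text \<open>
  The weak Jacobian is unique up to null sets.  The norm of \<open>real^'n^'n\<close> is the Frobenius norm, so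
  \<open>D_norm w\<close> is \<open>(\<Sum>i. \<parallel>\<nabla>w\<^sub>i\<parallel>\<^sup>2)\<^sup>1\<^sup>/\<^sup>2\<close>.  The space \<open>L^2((0,\<infinity>), H)\<close>, for \<open>H\<close> the homogeneous
  Sobolev space, is described through the isometry \<open>w \<mapsto> Dw\<close> into \<open>L^2\<close>.
\<close>
definition weak_jacobian :: "(real^'n \<Rightarrow> real^'n) \<Rightarrow> real^'n \<Rightarrow> real^'n^'n" where
  "weak_jacobian w = (SOME G. has_weak_jacobian w G)"

definition D_norm :: "(real^'n \<Rightarrow> real^'n) \<Rightarrow> real" where
  "D_norm w = Lp_norm 2 (weak_jacobian w)"

definition L2_H1dot :: "(real \<Rightarrow> real^'n \<Rightarrow> real^'n) \<Rightarrow> bool" where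
  "L2_H1dot u \<longleftrightarrow>
     (AE t in lebesgue_on {0<..}. \<exists>G. has_weak_jacobian (u t) G) \<and>
     bochner_Lq_L2 2 (\<lambda>t. weak_jacobian (u t))"

definition L1_L2_sigma :: "(real \<Rightarrow> real^'n \<Rightarrow> real^'n) \<Rightarrow> bool" where
  "L1_L2_sigma f \<longleftrightarrow> (AE t in lebesgue_on {0<..}. f t \<in> L2_sigma) \<and> bochner_Lq_L2 1 f"

definition Cw_L2_sigma :: "(real \<Rightarrow> real^'n \<Rightarrow> real^'n) \<Rightarrow> bool" where
  "Cw_L2_sigma u \<longleftrightarrow> (\<forall>t\<ge>0. u t \<in> L2_sigma) \<and>
     (\<forall>w. in_Lp 2 w \<longrightarrow> continuous_on {0..} (\<lambda>t. LINT x|lebesgue. u t x \<bullet> w x))"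

definition C_L2_sigma :: "(real \<Rightarrow> real^'n \<Rightarrow> real^'n) \<Rightarrow> bool" where
  "C_L2_sigma v \<longleftrightarrow> (\<forall>t\<ge>0. v t \<in> L2_sigma) \<and>
     (\<forall>t\<ge>0. ((\<lambda>s. Lp_norm 2 (\<lambda>x. v s x - v t x)) \<longlongrightarrow> 0) (at t within {0..}))"

subsection \<open>Weak formulations\<close>

text \<open>
  Test fields have compact support in \<open>R \<times> R^n\<close> and are only used for \<open>t \<ge> 0\<close>, so the initial
  datum enters through \<open>\<phi> (0, x)\<close>.
\<close>

definition stokes_form ::
    "(real^'n \<Rightarrow> real^'n) \<Rightarrow> (real \<Rightarrow> real^'n \<Rightarrow> real^'n) \<Rightarrow> (real \<Rightarrow> real^'n \<Rightarrow> real^'n) \<Rightarrow>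
     (real \<times> (real^'n) \<Rightarrow> real^'n) \<Rightarrow> real" where
  "stokes_form u\<^sub>0 f v \<phi> =
     (LINT t|lebesgue_on {0<..}. LINT x|lebesgue.
        v t x \<bullet> dt \<phi> (t, x) + v t x \<bullet> laplacian_x \<phi> (t, x) + f t x \<bullet> \<phi> (t, x))
     + (LINT x|lebesgue. u\<^sub>0 x \<bullet> \<phi> (0, x))"

text \<open>
  For solenoidal \<open>u\<close> the convection term is the divergence of \<open>u \<otimes> u\<close>, so its derivatives are moved
  to the test field.
\<close>
definition navier_stokes_form ::
    "(real^'n \<Rightarrow> real^'n) \<Rightarrow> (real \<Rightarrow> real^'n \<Rightarrow> real^'n) \<Rightarrow> (real \<Rightarrow> real^'n \<Rightarrow> real^'n) \<Rightarrow>
     (real \<times> (real^'n) \<Rightarrow> real^'n) \<Rightarrow> real" where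
  "navier_stokes_form u\<^sub>0 f u \<phi> =
     (LINT t|lebesgue_on {0<..}. LINT x|lebesgue.
        u t x \<bullet> dt \<phi> (t, x) + (\<Sum>j\<in>UNIV. u t x $ j * (u t x \<bullet> dx j \<phi> (t, x)))
        + u t x \<bullet> laplacian_x \<phi> (t, x) + f t x \<bullet> \<phi> (t, x))
     + (LINT x|lebesgue. u\<^sub>0 x \<bullet> \<phi> (0, x))"

text \<open>Solenoidal test fields eliminate the pressure.\<close>
definition solenoidal_test :: "(real \<times> (real^'n) \<Rightarrow> real^'n) \<Rightarrow> bool" where
  "solenoidal_test \<phi> \<longleftrightarrow> test_function \<phi> \<and> (\<forall>z. div_x \<phi> z = 0)"

definition navier_stokes_weak ::
    "(real^'n \<Rightarrow> real^'n) \<Rightarrow> (real \<Rightarrow> real^'n \<Rightarrow> real^'n) \<Rightarrow> (real \<Rightarrow> real^'n \<Rightarrow> real^'n) \<Rightarrow> bool"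
  where
  "navier_stokes_weak u\<^sub>0 f u \<longleftrightarrow> (\<forall>\<phi>. solenoidal_test \<phi> \<longrightarrow> navier_stokes_form u\<^sub>0 f u \<phi> = 0)"

text \<open>
  The equation \<open>v\<^sub>t = \<Delta>v + f\<close> has no pressure term (\<open>f\<close> is solenoidal), so all test fields are
  allowed.
\<close>
definition stokes_solution ::
    "(real^'n \<Rightarrow> real^'n) \<Rightarrow> (real \<Rightarrow> real^'n \<Rightarrow> real^'n) \<Rightarrow> (real \<Rightarrow> real^'n \<Rightarrow> real^'n) \<Rightarrow> bool"
  where
  "stokes_solution u\<^sub>0 f v \<longleftrightarrow>
     C_L2_sigma v \<and>
     (AE x in lebesgue. v 0 x = u\<^sub>0 x) \<and>
     (\<forall>\<phi>. test_function \<phi> \<longrightarrow> stokes_form u\<^sub>0 f v \<phi> = 0)"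

subsection \<open>Leray solutions\<close>

definition energy_estimate_from ::
    "(real \<Rightarrow> real^'n \<Rightarrow> real^'n) \<Rightarrow> (real \<Rightarrow> real^'n \<Rightarrow> real^'n) \<Rightarrow> real \<Rightarrow> bool" where
  "energy_estimate_from f u s \<longleftrightarrow>
     (\<forall>t>s. (Lp_norm 2 (u t))\<^sup>2 + 2 * (LINT \<tau>|lebesgue_on {s..t}. (D_norm (u \<tau>))\<^sup>2)
             \<le> (Lp_norm 2 (u s))\<^sup>2
                + 2 * (LINT \<tau>|lebesgue_on {s..t}. LINT x|lebesgue. u \<tau> x \<bullet> f \<tau> x))"

definition strong_energy_estimate ::
    "(real \<Rightarrow> real^'n \<Rightarrow> real^'n) \<Rightarrow> (real \<Rightarrow> real^'n \<Rightarrow> real^'n) \<Rightarrow> bool" where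
  "strong_energy_estimate f u \<longleftrightarrow>
     energy_estimate_from f u 0 \<and> (AE s in lebesgue_on {0<..}. energy_estimate_from f u s)"

text \<open>
  Approximate solutions: the weak form of the system, initial datum included, is satisfied up to an
  error that vanishes in the limit, for each fixed test field.  No particular regularisation scheme
  is prescribed.  The sequence belongs to the same function spaces as \<open>u\<close>.
\<close>
definition approximable ::
    "(real^'n \<Rightarrow> real^'n) \<Rightarrow> (real \<Rightarrow> real^'n \<Rightarrow> real^'n) \<Rightarrow> (real \<Rightarrow> real^'n \<Rightarrow> real^'n) \<Rightarrow> bool"
  where
  "approximable u\<^sub>0 f u \<longleftrightarrow>
     (\<exists>U :: nat \<Rightarrow> real \<Rightarrow> real^'n \<Rightarrow> real^'n.
        (\<forall>k. Cw_L2_sigma (U k) \<and> L2_H1dot (U k) \<and> strong_energy_estimate f (U k)) \<and>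
        (\<forall>\<phi>. solenoidal_test \<phi> \<longrightarrow> (\<lambda>k. navier_stokes_form u\<^sub>0 f (U k) \<phi>) \<longlonglongrightarrow> 0) \<and>
        (\<lambda>k. LINT t|lebesgue_on {0<..}. (D_norm (\<lambda>x. U k t x - u t x))\<^sup>2) \<longlonglongrightarrow> 0 \<and>
        (\<forall>a b R. 0 < a \<and> a < b \<and> 0 < R \<longrightarrow>
           (\<lambda>k. LINT t|lebesgue_on {a..b}. LINT x|lebesgue_on (cball 0 R).
                  (norm (U k t x - u t x))\<^sup>2) \<longlonglongrightarrow> 0))"

definition leray_solution ::
    "(real^'n \<Rightarrow> real^'n) \<Rightarrow> (real \<Rightarrow> real^'n \<Rightarrow> real^'n) \<Rightarrow> (real \<Rightarrow> real^'n \<Rightarrow> real^'n) \<Rightarrow> bool"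
  where
  "leray_solution u\<^sub>0 f u \<longleftrightarrow>
     Cw_L2_sigma u \<and> L2_H1dot u \<and>
     (AE x in lebesgue. u 0 x = u\<^sub>0 x) \<and>
     navier_stokes_weak u\<^sub>0 f u \<and>
     (2 \<le> CARD('n) \<and> CARD('n) \<le> 4 \<longrightarrow> strong_energy_estimate f u) \<and>
     (5 \<le> CARD('n) \<longrightarrow> approximable u\<^sub>0 f u)"

definition decays_at_rate :: "real \<Rightarrow> (real \<Rightarrow> real) \<Rightarrow> bool" where
  "decays_at_rate \<alpha> g \<longleftrightarrow> bounded ((\<lambda>t. (1 + t) powr \<alpha> * g t) ` {0..})"

end

theory Submission
  imports Defs "HOL-Probability.Distributions"
begin

text \<open>
  Fix a time \<open>S \<ge> 1\<close> and a continuous function \<open>\<psi>\<close> on a box, extended by \<open>0\<close>.  By duality it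
  suffices to bound \<open>\<langle>v\<^sub>i(S), \<psi>\<rangle>\<close> by a multiple of \<open>S\<close> to the power \<open>- \<alpha>\<close> times \<open>\<parallel>\<psi>\<parallel>\<close>, all norms being
  those of \<open>L\<^sup>2\<close> (\<open>Lp2_norm_le_by_testing\<close>).  Let \<open>E\<close> solve the backward heat equation with final value
  \<open>\<psi>\<close> at time \<open>S\<close>.  Duhamel's formula reads
  \<open>\<langle>v\<^sub>i(S), \<psi>\<rangle> = \<langle>v\<^sub>i(s), E(s)\<rangle> + \<integral>\<^sub>s\<^sup>S \<langle>f\<^sub>i, E\<rangle> dt\<close>, and is averaged over \<open>s\<close> between \<open>S/4\<close> and \<open>S/2\<close>.
  As the heat flow contracts \<open>L\<^sup>2\<close>, the force contributes at most \<open>S\<close> times its rate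
  \<open>- \<alpha> - 1\<close>.  In the first term, \<open>v = u + w\<close>, and \<open>u\<close> decays by assumption (\<open>late_time_estimate\<close>).

  There remains the average of \<open>\<langle>w\<^sub>i, E\<rangle>\<close>, where \<open>w\<close> solves the Stokes equation with zero initial value
  and right-hand side \<open>div (u \<otimes> u)\<close> up to a gradient.  A solenoidal test field that sees only the
  component \<open>w\<^sub>i\<close> is \<open>\<Delta>X e\<^sub>i - \<nabla>\<partial>\<^sub>iX\<close> with a scalar \<open>X\<close>: the gradient part is orthogonal to \<open>w\<close>.
  One wants \<open>\<Delta>X = - E\<close>.  The integral \<open>X\<close> of the backward solutions with final times in \<open>[S, S']\<close> solves
  the backward heat equation and satisfies \<open>\<Delta>X = E' - E\<close>, where \<open>E'\<close> is the backward solution with final time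
  \<open>S'\<close>, which tends to \<open>0\<close> in \<open>L\<^sup>2\<close> as \<open>S'\<close> tends to infinity.  So the average is controlled by the
  nonlinear term, at most
  \<open>\<integral> \<parallel>u\<parallel>\<^sup>2 sup |D\<^sup>3X| dt\<close> over \<open>[0, S/2]\<close> (\<open>difference_estimate\<close>).  There the third derivatives of \<open>X\<close> are
  at most a multiple of \<open>S\<close> to the power \<open>- (n + 2)/4\<close> times \<open>\<parallel>\<psi>\<parallel>\<close> (\<open>potential_third_derivative_bound\<close>).
  With \<open>\<beta> = (n + 2)/4 \<ge> 1\<close> and \<open>\<alpha> \<le> \<beta>\<close>, the integral of \<open>(1 + t)\<close> to the power \<open>- 2\<alpha>\<close> grows at most with the exponent
  \<open>\<beta> - \<alpha>\<close> (\<open>kinetic_growth\<close>), and the product has the rate \<open>- \<alpha>\<close>.  For \<open>S \<le> 1\<close> the claim is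
  the continuity of \<open>v\<close>.

  To make \<open>E\<close> and \<open>X\<close> admissible test functions they are cut off in time, which is what produces the averages,
  and at distance about \<open>k\<close> in space.  The heat operator applied to the product leaves, besides the main term,
  commutators with derivatives of the wide cutoff.  They are \<open>O(1/k)\<close> with Gaussian tails, since
  all derivatives of \<open>E\<close> and \<open>X\<close> have these; the predicate \<open>tame\<close> and the locale
  \<open>localized\<close> keep track of this.
  The time integral of the nonlinear term requires the measurability of a quadratic functional of a weakly continuous
  function, which is obtained from convexity (\<open>quadratic_measurable\<close>).
\<close>

section \<open>Calculus of iterated directional derivatives\<close>

lemma dderiv_eqI: "(f has_derivative f') (at z) \<Longrightarrow> dderiv v f z = f' v"
  unfolding dderiv_def using frechet_derivative_at by metis

lemma has_derivative_dderiv: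
  "f differentiable (at z) \<Longrightarrow> (f has_derivative (\<lambda>v. dderiv v f z)) (at z)"
  unfolding dderiv_def using frechet_derivative_works by metis

lemma dderiv_add:
  assumes "f differentiable (at z)" "g differentiable (at z)"
  shows "dderiv v (\<lambda>z. f z + g z) z = dderiv v f z + dderiv v g z"
  by (rule dderiv_eqI, intro has_derivative_add has_derivative_dderiv assms)

lemma dderiv_diff:
  assumes "f differentiable (at z)" "g differentiable (at z)"
  shows "dderiv v (\<lambda>z. f z - g z) z = dderiv v f z - dderiv v g z"
  by (rule dderiv_eqI, intro has_derivative_diff has_derivative_dderiv assms)

lemma dderiv_mult:
  fixes f g :: "'a::real_normed_vector \<Rightarrow> real"
  assumes "f differentiable (at z)" "g differentiable (at z)"
  shows "dderiv v (\<lambda>z. f z * g z) z = dderiv v f z * g z + f z * dderiv v g z"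
proof (rule dderiv_eqI)
  show "((\<lambda>z. f z * g z) has_derivative (\<lambda>v. dderiv v f z * g z + f z * dderiv v g z)) (at z)"
    using has_derivative_mult[OF has_derivative_dderiv[OF assms(1)] has_derivative_dderiv[OF assms(2)]]
    by (simp add: add.commute)
qed

lemma dderiv_const: "dderiv v (\<lambda>z. c) z = 0"
  by (rule dderiv_eqI) simp

lemma dderiv_cong_open:
  assumes "open U" "z \<in> U" "\<And>y. y \<in> U \<Longrightarrow> f y = g y"
  shows "dderiv v f z = dderiv v g z"
proof -
  have "(f has_derivative f') (at z) = (g has_derivative f') (at z)" for f'
    using assms by (metis has_derivative_transform_within_open)
  then show ?thesis unfolding dderiv_def frechet_derivative_def by simp
qed

lemma differentiable_cong_open:
  assumes "open U" "z \<in> U" "\<And>y. y \<in> U \<Longrightarrow> f y = g y" "g differentiable (at z)"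
  shows "f differentiable (at z)"
  using assms unfolding differentiable_def by (metis has_derivative_transform_within_open)

lemma dderiv_sum_Basis:
  fixes f :: "'a::euclidean_space \<Rightarrow> 'b::real_normed_vector"
  assumes "f differentiable (at z)"
  shows "dderiv v f z = (\<Sum>b\<in>Basis. (v \<bullet> b) *\<^sub>R dderiv b f z)"
proof -
  have l: "linear (\<lambda>v. dderiv v f z)"
    using has_derivative_dderiv[OF assms] has_derivative_bounded_linear bounded_linear.linear by blast
  have "dderiv v f z = dderiv (\<Sum>b\<in>Basis. (v \<bullet> b) *\<^sub>R b) f z" by (simp add: euclidean_representation)
  also have "\<dots> = (\<Sum>b\<in>Basis. (v \<bullet> b) *\<^sub>R dderiv b f z)"
    using linear_sum[OF l, of "\<lambda>b. (v \<bullet> b) *\<^sub>R b" Basis] linear_cmul[OF l] by simp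
  finally show ?thesis .
qed

primrec Ds :: "'a::real_normed_vector list \<Rightarrow> ('a \<Rightarrow> 'b::real_normed_vector) \<Rightarrow> 'a \<Rightarrow> 'b" where
  "Ds [] f = f"
| "Ds (v # vs) f = Ds vs (dderiv v f)"

lemma Ds_append: "Ds (vs @ ws) f = Ds ws (Ds vs f)"
  by (induct vs arbitrary: f) auto

lemma Ds_cong_open:
  assumes "open U" "\<And>y. y \<in> U \<Longrightarrow> f y = g y" "z \<in> U"
  shows "Ds vs f z = Ds vs g z"
  using assms(2,3)
proof (induct vs arbitrary: f g z)
  case (Cons v vs)
  have "dderiv v f y = dderiv v g y" if "y \<in> U" for y
    by (rule dderiv_cong_open[OF assms(1) that Cons.prems(1)])
  from Cons.hyps[OF this Cons.prems(2)] show ?case by simp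
qed simp

text \<open>
  Calculus with error control for sequences of smooth functions: on \<open>U\<close>, every iterated derivative
  of \<open>F k\<close> in coordinate directions exists and is dominated by \<open>H k\<close>, with a constant that does not
  depend on \<open>k\<close>.  A single function is a constant sequence.  The weight \<open>H\<close> carries either a
  Gaussian tail in space or a factor \<open>1/k\<close>, and the two combine under products.
\<close>
definition tame ::
  "'a::euclidean_space set \<Rightarrow> (nat \<Rightarrow> 'a \<Rightarrow> real) \<Rightarrow> (nat \<Rightarrow> 'a \<Rightarrow> real) \<Rightarrow> bool" where
  "tame U H F \<longleftrightarrow> (\<forall>vs. set vs \<subseteq> Basis \<longrightarrow>
     (\<forall>k. \<forall>z\<in>U. Ds vs (F k) differentiable (at z)) \<and>
     (\<exists>C. \<forall>k. \<forall>z\<in>U. \<bar>Ds vs (F k) z\<bar> \<le> C * H k z))"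

text \<open>
  All derivatives are controlled at once if a class of sequences is bounded and closed under taking
  coordinate derivatives: for instance sums of products, polynomials in \<open>1/x\<close>
  times \<open>exp (- 1/x)\<close>, or bump functions.
\<close>
lemma tame_coinduct:
  assumes U: "open U" and Q: "Q F"
    and d: "\<And>F k z. Q F \<Longrightarrow> z \<in> U \<Longrightarrow> F k differentiable (at z)"
    and bd: "\<And>F. Q F \<Longrightarrow> \<exists>C. \<forall>k. \<forall>z\<in>U. \<bar>F k z\<bar> \<le> C * H k z"
    and cl: "\<And>F b. Q F \<Longrightarrow> b \<in> Basis \<Longrightarrow> \<exists>F'. Q F' \<and> (\<forall>k. \<forall>z\<in>U. dderiv b (F k) z = F' k z)"
  shows "tame U H F"
proof -
  have "set vs \<subseteq> Basis \<longrightarrow> (\<forall>k. \<forall>z\<in>U. Ds vs (F k) differentiable (at z)) \<and>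
     (\<exists>C. \<forall>k. \<forall>z\<in>U. \<bar>Ds vs (F k) z\<bar> \<le> C * H k z)" for vs
    using Q
  proof (induct vs arbitrary: F)
    case Nil
    then show ?case using d bd by simp
  next
    case (Cons v vs)
    show ?case
    proof
    assume vs: "set (v # vs) \<subseteq> Basis"
    obtain F' where F': "Q F'" "\<And>k z. z \<in> U \<Longrightarrow> dderiv v (F k) z = F' k z"
      using cl[OF Cons.prems, of v] vs by auto
    have e: "Ds vs (dderiv v (F k)) z = Ds vs (F' k) z" if "z \<in> U" for k z
      by (rule Ds_cong_open[OF U _ that]) (rule F'(2))
    have IH: "(\<forall>k. \<forall>z\<in>U. Ds vs (F' k) differentiable (at z)) \<and>
        (\<exists>C. \<forall>k. \<forall>z\<in>U. \<bar>Ds vs (F' k) z\<bar> \<le> C * H k z)"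
      using Cons.hyps[OF F'(1)] vs by simp
    have "Ds vs (dderiv v (F k)) differentiable (at z)" if "z \<in> U" for k z
      by (rule differentiable_cong_open[OF U that, where g="Ds vs (F' k)"]) (use e IH that in auto)
    then show "(\<forall>k. \<forall>z\<in>U. Ds (v # vs) (F k) differentiable (at z)) \<and>
     (\<exists>C. \<forall>k. \<forall>z\<in>U. \<bar>Ds (v # vs) (F k) z\<bar> \<le> C * H k z)"
      using IH by (simp add: e)
    qed
  qed
  then show ?thesis unfolding tame_def by (intro allI)
qed

lemma tame_differentiable: "tame U H F \<Longrightarrow> z \<in> U \<Longrightarrow> F k differentiable (at z)"
  unfolding tame_def by (metis Ds.simps(1) empty_subsetI list.set(1))

lemma tame_Ds_differentiable:
  "tame U H F \<Longrightarrow> set vs \<subseteq> Basis \<Longrightarrow> z \<in> U \<Longrightarrow> Ds vs (F k) differentiable (at z)"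
  unfolding tame_def by blast

lemma tame_Ds_bound:
  assumes "tame U H F" "set vs \<subseteq> Basis"
  obtains C where "\<And>k z. z \<in> U \<Longrightarrow> \<bar>Ds vs (F k) z\<bar> \<le> C * H k z"
  using assms unfolding tame_def by blast

lemma tame_bound:
  assumes "tame U H F"
  obtains C where "\<And>k z. z \<in> U \<Longrightarrow> \<bar>F k z\<bar> \<le> C * H k z"
  using tame_Ds_bound[OF assms, of "[]"] by auto

lemma tame_Ds:
  assumes "tame U H F" "set vs \<subseteq> Basis"
  shows "tame U H (\<lambda>k. Ds vs (F k))"
  unfolding tame_def
proof (intro allI impI)
  fix ws :: "'a list" assume "set ws \<subseteq> Basis"
  then have "set (vs @ ws) \<subseteq> Basis" using assms by auto
  then show "(\<forall>k. \<forall>z\<in>U. Ds ws (Ds vs (F k)) differentiable at z) \<and>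
      (\<exists>C. \<forall>k. \<forall>z\<in>U. \<bar>Ds ws (Ds vs (F k)) z\<bar> \<le> C * H k z)"
    using assms(1) unfolding tame_def Ds_append[symmetric] by blast
qed

lemma tame_dderiv: "tame U H F \<Longrightarrow> b \<in> Basis \<Longrightarrow> tame U H (\<lambda>k. dderiv b (F k))"
  using tame_Ds[of U H F "[b]"] by simp

lemma tame_cong:
  assumes "open U" "\<And>k z. z \<in> U \<Longrightarrow> F k z = G k z" "tame U H G"
  shows "tame U H F"
  unfolding tame_def
proof (intro allI impI)
  fix vs :: "'a list" assume vs: "set vs \<subseteq> Basis"
  have e: "Ds vs (F k) z = Ds vs (G k) z" if "z \<in> U" for k z
    by (rule Ds_cong_open[OF assms(1) _ that]) (rule assms(2))
  have "Ds vs (F k) differentiable (at z)" if "z \<in> U" for k z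
    by (rule differentiable_cong_open[OF assms(1) that, where g="Ds vs (G k)"])
      (use e assms(3) vs that in \<open>auto simp: tame_def\<close>)
  moreover obtain C where "\<And>k z. z \<in> U \<Longrightarrow> \<bar>Ds vs (G k) z\<bar> \<le> C * H k z"
    using tame_Ds_bound[OF assms(3) vs] by blast
  ultimately show "(\<forall>k. \<forall>z\<in>U. Ds vs (F k) differentiable at z) \<and>
      (\<exists>C. \<forall>k. \<forall>z\<in>U. \<bar>Ds vs (F k) z\<bar> \<le> C * H k z)"
    by (intro conjI exI[of _ C] allI ballI) (simp_all add: e)
qed

lemma tame_subset: "tame U H F \<Longrightarrow> V \<subseteq> U \<Longrightarrow> tame V H F"
  unfolding tame_def by (meson subsetD)

text \<open>
  The smallest class that contains the products and is closed under the product rule.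
\<close>
inductive product_sum :: "'a::euclidean_space set \<Rightarrow> (nat \<Rightarrow> 'a \<Rightarrow> real) \<Rightarrow> (nat \<Rightarrow> 'a \<Rightarrow> real) \<Rightarrow>
    (nat \<Rightarrow> 'a \<Rightarrow> real) \<Rightarrow> bool" for U H H' where
  "tame U H F \<Longrightarrow> tame U H' G \<Longrightarrow> product_sum U H H' (\<lambda>k z. F k z * G k z)"
| "product_sum U H H' F \<Longrightarrow> product_sum U H H' G \<Longrightarrow> product_sum U H H' (\<lambda>k z. F k z + G k z)"

lemma product_sum_differentiable:
  "product_sum U H H' F \<Longrightarrow> z \<in> U \<Longrightarrow> F k differentiable (at z)"
proof (induct rule: product_sum.induct)
  case (1 F G)
  then show ?case by (intro differentiable_mult tame_differentiable)
next
  case (2 F G)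
  then show ?case by (intro differentiable_add) auto
qed

lemma product_sum_bound:
  "product_sum U H H' F \<Longrightarrow> \<exists>C. \<forall>k. \<forall>z\<in>U. \<bar>F k z\<bar> \<le> C * (H k z * H' k z)"
proof (induct rule: product_sum.induct)
  case (1 F G)
  obtain C where C: "\<And>k z. z \<in> U \<Longrightarrow> \<bar>F k z\<bar> \<le> C * H k z" using tame_bound[OF 1(1)] by blast
  obtain D where D: "\<And>k z. z \<in> U \<Longrightarrow> \<bar>G k z\<bar> \<le> D * H' k z" using tame_bound[OF 1(2)] by blast
  have "\<bar>F k z * G k z\<bar> \<le> (C * D) * (H k z * H' k z)" if "z \<in> U" for k z
  proof -
    have "\<bar>F k z\<bar> * \<bar>G k z\<bar> \<le> (C * H k z) * (D * H' k z)"
      using C[OF that, of k] D[OF that, of k] by (intro mult_mono) auto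
    then show ?thesis by (simp add: abs_mult mult_ac)
  qed
  then show ?case by blast
next
  case (2 F G)
  then obtain C D where "\<And>k z. z \<in> U \<Longrightarrow> \<bar>F k z\<bar> \<le> C * (H k z * H' k z)"
    "\<And>k z. z \<in> U \<Longrightarrow> \<bar>G k z\<bar> \<le> D * (H k z * H' k z)" by metis
  then have "\<bar>F k z + G k z\<bar> \<le> (C + D) * (H k z * H' k z)" if "z \<in> U" for k z
    using that by (smt (verit) distrib_right)
  then show ?case by blast
qed

lemma product_sum_dderiv:
  assumes U: "open U" and "product_sum U H H' F" "b \<in> Basis"
  shows "\<exists>F'. product_sum U H H' F' \<and> (\<forall>k. \<forall>z\<in>U. dderiv b (F k) z = F' k z)"
  using assms(2)
proof (induct rule: product_sum.induct)
  case (1 F G)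
  let ?F = "\<lambda>k z. dderiv b (F k) z * G k z + F k z * dderiv b (G k) z"
  have "product_sum U H H' ?F"
    by (intro product_sum.intros 1 tame_dderiv assms(3))
  moreover have "dderiv b (\<lambda>z. F k z * G k z) z = ?F k z" if "z \<in> U" for k z
    by (intro dderiv_mult tame_differentiable[OF 1(1) that] tame_differentiable[OF 1(2) that])
  ultimately show ?case by (intro exI[of _ ?F] conjI allI ballI)
next
  case (2 F G)
  obtain F' G' where F': "product_sum U H H' F'" "\<And>k z. z \<in> U \<Longrightarrow> dderiv b (F k) z = F' k z"
    and G': "product_sum U H H' G'" "\<And>k z. z \<in> U \<Longrightarrow> dderiv b (G k) z = G' k z" using 2 by metis
  have "dderiv b (\<lambda>z. F k z + G k z) z = F' k z + G' k z" if "z \<in> U" for k z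
    using dderiv_add[of "F k" z "G k" b] product_sum_differentiable[OF 2(1) that]
      product_sum_differentiable[OF 2(3) that] F'(2) G'(2) that by simp
  with product_sum.intros(2)[OF F'(1) G'(1)] show ?case
    by (intro exI[of _ "\<lambda>k z. F' k z + G' k z"] conjI allI ballI)
qed

lemma product_sum_tame:
  assumes "open U" "product_sum U H H' F"
  shows "tame U (\<lambda>k z. H k z * H' k z) F"
  by (rule tame_coinduct[where Q="product_sum U H H'", OF assms])
    (rule product_sum_differentiable product_sum_bound product_sum_dderiv[OF assms(1)]; assumption)+

lemma tame_mult:
  assumes "open U" "tame U H F" "tame U H' G"
  shows "tame U (\<lambda>k z. H k z * H' k z) (\<lambda>k z. F k z * G k z)"
  by (rule product_sum_tame[OF assms(1) product_sum.intros(1)[OF assms(2,3)]])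

lemma tame_const: "tame U (\<lambda>k z. 1) (\<lambda>k z. c)"
proof -
  have "Ds vs (\<lambda>z. a) = (\<lambda>z. if vs = [] then a else 0)" for vs :: "'a list" and a :: real
    by (induct vs arbitrary: a) (auto simp: dderiv_const[abs_def])
  then show ?thesis unfolding tame_def by (auto intro!: exI[of _ "\<bar>c\<bar>"])
qed

lemma tame_add:
  assumes "open U" "tame U H F" "tame U H G"
  shows "tame U H (\<lambda>k z. F k z + G k z)"
proof -
  have "product_sum U H (\<lambda>k z. 1) (\<lambda>k z. F k z * 1 + G k z * 1)"
    by (intro product_sum.intros assms tame_const)
  from product_sum_tame[OF assms(1) this] show ?thesis by simp
qed

lemma tame_cmult:
  assumes "open U" "tame U H F"
  shows "tame U H (\<lambda>k z. c * F k z)"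
  using tame_mult[OF assms(1) tame_const assms(2), of c] by simp

lemma tame_diff:
  assumes "open U" "tame U H F" "tame U H G"
  shows "tame U H (\<lambda>k z. F k z - G k z)"
  using tame_add[OF assms(1,2) tame_cmult[OF assms(1,3), of "-1"]] by simp

lemma tame_zero: "tame U H (\<lambda>k z. 0)"
proof -
  have "Ds vs (\<lambda>z::'a. 0::real) = (\<lambda>z. 0)" for vs by (induct vs) (auto simp: dderiv_const[abs_def])
  then show ?thesis unfolding tame_def by (auto intro!: exI[of _ 0])
qed

lemma Ds_add:
  assumes "open U" "tame U H (\<lambda>k. f)" "tame U H' (\<lambda>k. g)" "set vs \<subseteq> Basis" "z \<in> U"
  shows "Ds vs (\<lambda>z. f z + g z) z = Ds vs f z + Ds vs g z"
  using assms(2-5)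
proof (induct vs arbitrary: f g z)
  case (Cons v vs)
  have "Ds vs (dderiv v (\<lambda>z. f z + g z)) z = Ds vs (\<lambda>z. dderiv v f z + dderiv v g z) z"
    by (intro Ds_cong_open[OF assms(1)] dderiv_add tame_differentiable[OF Cons.prems(1)]
        tame_differentiable[OF Cons.prems(2)] Cons.prems(4))
  also have "\<dots> = Ds vs (dderiv v f) z + Ds vs (dderiv v g) z"
    using Cons.prems by (intro Cons.hyps tame_dderiv) auto
  finally show ?case by simp
qed simp

lemma tame_family_member: "tame U H F \<Longrightarrow> tame U (\<lambda>_. H k) (\<lambda>_. F k)"
  unfolding tame_def by blast

text \<open>
  A factor whose derivatives are all small may be pulled out of any derivative up to a small error:
  this is how the spatial cutoffs \<open>\<theta>\<^sub>k\<close> disappear from the estimates as \<open>k \<rightarrow> \<infinity>\<close>.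
\<close>
lemma tame_commutator:
  assumes U: "open U" and \<theta>: "tame U (\<lambda>k z. 1) \<theta>" and \<theta>': "\<And>b. b \<in> Basis \<Longrightarrow> tame U \<epsilon> (\<lambda>k. dderiv b (\<theta> k))"
    and W: "tame U H W" and vs: "set vs \<subseteq> Basis"
  shows "tame U (\<lambda>k z. \<epsilon> k z * H k z) (\<lambda>k z. Ds vs (\<lambda>z. \<theta> k z * W k z) z - \<theta> k z * Ds vs (W k) z)"
  using W vs
proof (induct vs arbitrary: W)
  case Nil
  then show ?case by (simp add: tame_zero)
next
  case (Cons v vs)
  have v: "v \<in> Basis" and vs: "set vs \<subseteq> Basis" using Cons.prems by auto
  let ?A = "\<lambda>k z. dderiv v (\<theta> k) z * W k z" and ?B = "\<lambda>k z. \<theta> k z * dderiv v (W k) z"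
  have tA: "tame U (\<lambda>k z. \<epsilon> k z * H k z) ?A" using tame_mult[OF U \<theta>'[OF v] Cons.prems(1)] .
  have tB: "tame U H ?B" using tame_mult[OF U \<theta> tame_dderiv[OF Cons.prems(1) v]] by simp
  have e: "Ds (v # vs) (\<lambda>z. \<theta> k z * W k z) z = Ds vs (?A k) z + Ds vs (?B k) z" if "z \<in> U" for k z
  proof -
    have "Ds vs (dderiv v (\<lambda>z. \<theta> k z * W k z)) z = Ds vs (\<lambda>z. ?A k z + ?B k z) z"
      by (intro Ds_cong_open[OF U] dderiv_mult tame_differentiable[OF \<theta>]
          tame_differentiable[OF Cons.prems(1)] that)
    also have "\<dots> = Ds vs (?A k) z + Ds vs (?B k) z"
      using Ds_add[OF U tame_family_member[OF tA] tame_family_member[OF tB] vs that] .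
    finally show ?thesis by simp
  qed
  have t: "tame U (\<lambda>k z. \<epsilon> k z * H k z) (\<lambda>k z. Ds vs (?A k) z + (Ds vs (?B k) z - \<theta> k z * Ds vs (dderiv v (W k)) z))"
    by (intro tame_add U tame_Ds[OF tA vs] Cons.hyps tame_dderiv[OF Cons.prems(1) v] vs)
  show ?case
  proof (rule tame_cong[OF U _ t])
    fix k z assume "z \<in> U"
    from e[OF this, of k] show "Ds (v # vs) (\<lambda>z. \<theta> k z * W k z) z - \<theta> k z * Ds (v # vs) (W k) z =
      Ds vs (?A k) z + (Ds vs (?B k) z - \<theta> k z * Ds vs (dderiv v (W k)) z)"
      unfolding Ds.simps by linarith
  qed
qed

lemma tame_Un:
  assumes "tame U H F" "tame V H F" "\<And>k z. 0 \<le> H k z"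
  shows "tame (U \<union> V) H F"
  unfolding tame_def
proof (intro allI impI conjI)
  fix vs :: "'a list" assume vs: "set vs \<subseteq> Basis"
  obtain C where C: "\<And>k z. z \<in> U \<Longrightarrow> \<bar>Ds vs (F k) z\<bar> \<le> C * H k z"
    using tame_Ds_bound[OF assms(1) vs] by blast
  obtain D where D: "\<And>k z. z \<in> V \<Longrightarrow> \<bar>Ds vs (F k) z\<bar> \<le> D * H k z"
    using tame_Ds_bound[OF assms(2) vs] by blast
  have "\<bar>Ds vs (F k) z\<bar> \<le> max C D * H k z" if "z \<in> U \<union> V" for k z
    using that C[of z k] D[of z k] mult_right_mono[of C "max C D" "H k z"]
      mult_right_mono[of D "max C D" "H k z"] assms(3)[of k z] by fastforce
  then show "\<exists>C. \<forall>k. \<forall>z\<in>U \<union> V. \<bar>Ds vs (F k) z\<bar> \<le> C * H k z" by blast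
qed (use tame_Ds_differentiable[OF assms(1)] tame_Ds_differentiable[OF assms(2)] in blast)

subsection \<open>Smooth functions in the sense of all test functions\<close>

lemma C_k_add:
  assumes "C_k k f" "C_k k g" shows "C_k k (\<lambda>z. f z + g z)"
  using assms
proof (induct k arbitrary: f g)
  case (Suc k)
  have "dderiv v (\<lambda>z. f z + g z) = (\<lambda>z. dderiv v f z + dderiv v g z)" for v
    using Suc.prems by (intro ext dderiv_add) auto
  then show ?case using Suc by (auto intro: differentiable_add)
qed (auto intro: continuous_intros)

lemma dderiv_scaleR:
  "f differentiable (at z) \<Longrightarrow> dderiv v (\<lambda>z. c *\<^sub>R f z) z = c *\<^sub>R dderiv v f z"
  by (rule dderiv_eqI, rule has_derivative_scaleR_right, rule has_derivative_dderiv)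

lemma dderiv_scaleR_left:
  "f differentiable (at z) \<Longrightarrow> dderiv v (\<lambda>z. f z *\<^sub>R a) z = dderiv v f z *\<^sub>R a"
  by (rule dderiv_eqI, rule has_derivative_scaleR_left, rule has_derivative_dderiv)

lemma C_k_scaleR:
  assumes "C_k k f" shows "C_k k (\<lambda>z. c *\<^sub>R f z)"
  using assms
proof (induct k arbitrary: f)
  case (Suc k)
  have "dderiv v (\<lambda>z. c *\<^sub>R f z) = (\<lambda>z. c *\<^sub>R dderiv v f z)" for v
    using Suc.prems by (intro ext dderiv_scaleR) auto
  then show ?case using Suc by (auto intro: differentiable_scaleR)
qed (auto intro: continuous_intros)

lemma C_k_scaleR_left:
  fixes f :: "'a::euclidean_space \<Rightarrow> real"
  assumes "C_k k f" shows "C_k k (\<lambda>z. f z *\<^sub>R a)"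
  using assms
proof (induct k arbitrary: f)
  case (Suc k)
  have "dderiv v (\<lambda>z. f z *\<^sub>R a) = (\<lambda>z. dderiv v f z *\<^sub>R a)" for v
    using Suc.prems by (intro ext dderiv_scaleR_left) auto
  then show ?case using Suc by (auto intro: differentiable_scaleR)
qed (auto intro: continuous_intros)

lemma C_k_zero: "C_k k (\<lambda>z. 0)"
  by (induct k) (auto simp: dderiv_const[abs_def])

lemma C_k_sum:
  "finite I \<Longrightarrow> (\<And>i. i \<in> I \<Longrightarrow> C_k k (F i)) \<Longrightarrow> C_k k (\<lambda>z. \<Sum>i\<in>I. F i z)"
  by (induct rule: finite_induct) (auto intro: C_k_zero C_k_add)

text \<open>
  Test functions are required to have derivatives in all directions, while \<^const>\<open>tame\<close> speaks of
  coordinate directions only: a derivative in a general direction is a linear combination of those.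
\<close>
lemma tame_imp_C_k:
  assumes "tame UNIV H (\<lambda>_. f)" shows "C_k k f"
  using assms
proof (induct k arbitrary: f)
  case 0
  then have "f differentiable_on UNIV" using tame_differentiable[OF 0]
    by (simp add: differentiable_on_def)
  then show ?case by (simp add: differentiable_imp_continuous_on)
next
  case (Suc k)
  have "C_k k (dderiv v f)" for v
  proof -
    have "C_k k (\<lambda>z. \<Sum>b\<in>Basis. (v \<bullet> b) *\<^sub>R dderiv b f z)"
      by (intro C_k_sum finite_Basis C_k_scaleR Suc.hyps tame_dderiv Suc.prems)
    also have "(\<lambda>z. \<Sum>b\<in>Basis. (v \<bullet> b) *\<^sub>R dderiv b f z) = dderiv v f"
      by (intro ext dderiv_sum_Basis[symmetric] tame_differentiable[OF Suc.prems]) simp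
    finally show ?thesis .
  qed
  then show ?case using tame_differentiable[OF Suc.prems] by simp
qed

lemma tame_continuous: "tame UNIV H (\<lambda>_. f) \<Longrightarrow> continuous_on UNIV f"
  using tame_imp_C_k[of H f 0] by simp

text \<open>
  Schwarz: by the mean value theorem, applied twice, the second difference quotient is a value of
  either mixed derivative near \<open>z\<close>.
\<close>
lemma dderiv_commute:
  fixes f :: "'a::euclidean_space \<Rightarrow> real"
  assumes f: "tame UNIV H (\<lambda>_. f)" and v: "v \<in> Basis" and w: "w \<in> Basis"
  shows "dderiv v (dderiv w f) z = dderiv w (dderiv v f) z"
proof -
  have key: "\<exists>x y. \<bar>x\<bar> \<le> h \<and> \<bar>y\<bar> \<le> h \<and>
      f (z + h *\<^sub>R v + h *\<^sub>R w) - f (z + h *\<^sub>R v) - f (z + h *\<^sub>R w) + f z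
      = h * h * dderiv w (dderiv v f) (z + x *\<^sub>R v + y *\<^sub>R w)"
    if h: "h > 0" and v: "v \<in> Basis" and w: "w \<in> Basis" for h v w
  proof -
    have df: "(f has_derivative (\<lambda>u. dderiv u f y)) (at y)" for y
      using has_derivative_dderiv tame_differentiable[OF f] by blast
    have dv: "(dderiv v f has_derivative (\<lambda>u. dderiv u (dderiv v f) y)) (at y)" for y
      using has_derivative_dderiv tame_differentiable[OF tame_dderiv[OF f v]] by blast
    have lin: "dderiv (c *\<^sub>R u) g y = c * dderiv u g y"
      if "(g has_derivative (\<lambda>u. dderiv u g y)) (at y)" for c u y and g :: "'a \<Rightarrow> real"
      using linear_cmul[OF bounded_linear.linear[OF has_derivative_bounded_linear[OF that]], of c u] by simp
    define \<phi> where "\<phi> x = f (z + x *\<^sub>R v + h *\<^sub>R w) - f (z + x *\<^sub>R v)" for x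
    have "(\<phi> has_real_derivative dderiv v f (z + x *\<^sub>R v + h *\<^sub>R w) - dderiv v f (z + x *\<^sub>R v)) (at x)" for x
    proof -
      have 1: "((\<lambda>x. f (z + x *\<^sub>R v + h *\<^sub>R w)) has_derivative (\<lambda>c. dderiv (c *\<^sub>R v) f (z + x *\<^sub>R v + h *\<^sub>R w))) (at x)"
        by (rule has_derivative_compose[OF _ df]) (auto intro!: derivative_eq_intros)
      have 2: "((\<lambda>x. f (z + x *\<^sub>R v)) has_derivative (\<lambda>c. dderiv (c *\<^sub>R v) f (z + x *\<^sub>R v))) (at x)"
        by (rule has_derivative_compose[OF _ df]) (auto intro!: derivative_eq_intros)
      show ?thesis unfolding \<phi>_def has_field_derivative_def
        by (rule has_derivative_eq_rhs[OF has_derivative_diff[OF 1 2]])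
          (auto simp: lin[OF df] algebra_simps)
    qed
    then obtain x where x: "0 < x" "x < h"
      "\<phi> h - \<phi> 0 = h * (dderiv v f (z + x *\<^sub>R v + h *\<^sub>R w) - dderiv v f (z + x *\<^sub>R v))"
      using MVT2[of 0 h \<phi> "\<lambda>x. dderiv v f (z + x *\<^sub>R v + h *\<^sub>R w) - dderiv v f (z + x *\<^sub>R v)"] h by auto
    have "((\<lambda>y. dderiv v f (z + x *\<^sub>R v + y *\<^sub>R w)) has_real_derivative
        dderiv w (dderiv v f) (z + x *\<^sub>R v + y *\<^sub>R w)) (at y)" for y
    proof -
      have 1: "((\<lambda>y. dderiv v f (z + x *\<^sub>R v + y *\<^sub>R w)) has_derivative
          (\<lambda>c. dderiv (c *\<^sub>R w) (dderiv v f) (z + x *\<^sub>R v + y *\<^sub>R w))) (at y)"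
        by (rule has_derivative_compose[OF _ dv]) (auto intro!: derivative_eq_intros)
      then show ?thesis unfolding has_field_derivative_def
        by (rule has_derivative_eq_rhs) (auto simp: lin[OF dv] mult.commute)
    qed
    then obtain y where y: "0 < y" "y < h"
      "dderiv v f (z + x *\<^sub>R v + h *\<^sub>R w) - dderiv v f (z + x *\<^sub>R v + 0 *\<^sub>R w)
        = h * dderiv w (dderiv v f) (z + x *\<^sub>R v + y *\<^sub>R w)"
      using MVT2[of 0 h "\<lambda>y. dderiv v f (z + x *\<^sub>R v + y *\<^sub>R w)"
          "\<lambda>y. dderiv w (dderiv v f) (z + x *\<^sub>R v + y *\<^sub>R w)"] h by auto
    have "f (z + h *\<^sub>R v + h *\<^sub>R w) - f (z + h *\<^sub>R v) - f (z + h *\<^sub>R w) + f z = \<phi> h - \<phi> 0"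
      by (simp add: \<phi>_def)
    also have "\<dots> = h * h * dderiv w (dderiv v f) (z + x *\<^sub>R v + y *\<^sub>R w)"
      using x(3) y(3) by simp
    finally show ?thesis using x y by (intro exI[of _ x] exI[of _ y]) auto
  qed
  define q where "q h = (f (z + h *\<^sub>R v + h *\<^sub>R w) - f (z + h *\<^sub>R v) - f (z + h *\<^sub>R w) + f z) / (h * h)" for h
  have lim: "(q \<longlongrightarrow> dderiv w (dderiv v f) z) (at_right 0)"
    if v: "v \<in> Basis" and w: "w \<in> Basis"
      and q: "\<And>h. q h = (f (z + h *\<^sub>R v + h *\<^sub>R w) - f (z + h *\<^sub>R v) - f (z + h *\<^sub>R w) + f z) / (h * h)" for v w
  proof (rule tendstoI)
    fix e :: real assume e: "e > 0"
    have "continuous_on UNIV (dderiv w (dderiv v f))"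
      using tame_continuous[OF tame_dderiv[OF tame_dderiv[OF f v] w]] .
    then have "isCont (dderiv w (dderiv v f)) z" by (simp add: continuous_on_eq_continuous_at)
    then obtain d where d: "d > 0" "\<And>y. dist y z < d \<Longrightarrow> dist (dderiv w (dderiv v f) y) (dderiv w (dderiv v f) z) < e"
      using e unfolding continuous_at_eps_delta by (auto simp: dist_norm)
    have "dist (q h) (dderiv w (dderiv v f) z) < e" if h: "0 < h" "h < d / 2" for h
    proof -
      obtain x y where xy: "\<bar>x\<bar> \<le> h" "\<bar>y\<bar> \<le> h"
        "f (z + h *\<^sub>R v + h *\<^sub>R w) - f (z + h *\<^sub>R v) - f (z + h *\<^sub>R w) + f z
          = h * h * dderiv w (dderiv v f) (z + x *\<^sub>R v + y *\<^sub>R w)"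
        using key[OF h(1) v w] by blast
      have "dist (z + x *\<^sub>R v + y *\<^sub>R w) z \<le> \<bar>x\<bar> + \<bar>y\<bar>"
        using norm_triangle_ineq[of "x *\<^sub>R v" "y *\<^sub>R w"] v w by (simp add: dist_norm add.assoc)
      then have "dist (z + x *\<^sub>R v + y *\<^sub>R w) z < d" using xy h by linarith
      then show ?thesis using d(2) xy(3) h by (simp add: q)
    qed
    then show "\<forall>\<^sub>F h in at_right 0. dist (q h) (dderiv w (dderiv v f) z) < e"
      unfolding eventually_at_right_field using d(1) by (intro exI[of _ "d/2"]) auto
  qed
  have "(q \<longlongrightarrow> dderiv w (dderiv v f) z) (at_right 0)" by (rule lim[OF v w]) (simp add: q_def)
  moreover have "(q \<longlongrightarrow> dderiv v (dderiv w f) z) (at_right 0)"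
    by (rule lim[OF w v]) (simp add: q_def algebra_simps)
  ultimately show ?thesis by (metis tendsto_unique trivial_limit_at_right_real)
qed

section \<open>Cutoff functions\<close>

text \<open>
  The derivatives of \<open>exp (- 1/x)\<close>, extended by \<open>0\<close> to \<open>x \<le> 0\<close>, all have this form; the
  coefficient polynomial of the derivative is \<open>y\<^sup>2 (p - p')\<close>.
\<close>
definition flat :: "real poly \<Rightarrow> real \<Rightarrow> real" where
  "flat p x = (if x \<le> 0 then 0 else poly p (1 / x) * exp (- (1 / x)))"

lemma poly_times_exp_decay: "((\<lambda>y::real. y ^ k * poly p y * exp (- y)) \<longlongrightarrow> 0) at_top"
proof (induct p arbitrary: k)
  case (pCons a p)
  have "((\<lambda>y. a * (y ^ k / exp y) + y ^ Suc k * poly p y * exp (- y)) \<longlongrightarrow> a * 0 + 0) at_top"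
    by (intro tendsto_intros tendsto_power_div_exp_0 pCons)
  then show ?case by (simp add: exp_minus field_simps)
qed simp

lemma flat_tendsto_0: "(flat p \<longlongrightarrow> 0) (at 0)"
proof -
  have "((\<lambda>x. poly p (1 / x) * exp (- (1 / x))) \<longlongrightarrow> 0) (at_right (0::real))"
    using filterlim_compose[OF poly_times_exp_decay[of 0 p] filterlim_inverse_at_top_right]
    by (simp add: inverse_eq_divide)
  then have r: "(flat p \<longlongrightarrow> 0) (at_right 0)"
    by (rule filterlim_cong[THEN iffD1, rotated -1])
      (auto simp: flat_def eventually_at_right_field intro!: exI[of _ 1])
  have l: "(flat p \<longlongrightarrow> 0) (at_left 0)"
    by (rule tendsto_eventually) (auto simp: flat_def eventually_at_left_field intro!: exI[of _ "-1"])
  show ?thesis using l r filterlim_at_split by blast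
qed

lemma flat_has_derivative:
  "(flat p has_real_derivative flat ([:0, 0, 1:] * (p - pderiv p)) x) (at x)"
proof -
  consider "x < 0" | "x = 0" | "x > 0" by linarith
  then show ?thesis
  proof cases
    case 1
    have "((\<lambda>x. 0::real) has_real_derivative 0) (at x)" by simp
    then have "(flat p has_real_derivative 0) (at x)"
      by (rule has_field_derivative_transform_within_open[where S="{..<0}"]) (use 1 in \<open>auto simp: flat_def\<close>)
    then show ?thesis using 1 by (simp add: flat_def)
  next
    case 2
    have "(flat p y - flat p 0) / (y - 0) = flat ([:0, 1:] * p) y" if "y \<noteq> 0" for y
      using that by (simp add: flat_def)
    then have "((\<lambda>y. (flat p y - flat p 0) / (y - 0)) \<longlongrightarrow> 0) (at 0)"
      by (intro tendsto_cong[THEN iffD2, OF _ flat_tendsto_0[of "[:0, 1:] * p"]])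
        (auto simp: eventually_at intro!: exI[of _ 1])
    then show ?thesis using 2 by (simp add: has_field_derivative_iff flat_def)
  next
    case 3
    have "((\<lambda>x. poly p (1 / x) * exp (- (1 / x))) has_real_derivative
        flat ([:0, 0, 1:] * (p - pderiv p)) x) (at x)"
      using 3 by (auto simp: flat_def intro!: derivative_eq_intros DERIV_chain2[OF poly_DERIV])
        (simp add: field_simps power2_eq_square)
    then show ?thesis
      by (rule has_field_derivative_transform_within_open[where S="{0<..}"]) (use 3 in \<open>auto simp: flat_def\<close>)
  qed
qed

lemma flat_bounded: "\<exists>C. \<forall>x. \<bar>flat p x\<bar> \<le> C"
proof -
  have "((\<lambda>y. poly p y * exp (- y)) \<longlongrightarrow> 0) at_top" using poly_times_exp_decay[of 0 p] by simp
  then have "\<forall>\<^sub>F y in at_top. \<bar>poly p y * exp (- y)\<bar> < 1"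
    by (auto dest!: tendstoD[where e=1] simp: dist_real_def)
  then obtain N where N: "\<And>y. y \<ge> N \<Longrightarrow> \<bar>poly p y * exp (- y)\<bar> < 1"
    by (auto simp: eventually_at_top_linorder)
  have "compact ((\<lambda>y. poly p y * exp (- y)) ` {0..max 0 N})"
    by (intro compact_continuous_image continuous_intros) auto
  then obtain B where B: "\<And>y. y \<in> {0..max 0 N} \<Longrightarrow> \<bar>poly p y * exp (- y)\<bar> \<le> B"
    by (meson bounded_real compact_imp_bounded imageI)
  have "\<bar>flat p x\<bar> \<le> max 1 B" for x
  proof (cases "x \<le> 0")
    case False
    have "1/x \<ge> N \<or> 1/x \<in> {0..max 0 N}" using False by (auto simp: le_max_iff_disj)
    then have "\<bar>poly p (1/x) * exp (- (1/x))\<bar> \<le> max 1 B"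
      using N[of "1/x"] B[of "1/x"] by (meson le_max_iff_disj less_imp_le)
    then show ?thesis using False by (simp add: flat_def)
  qed (simp add: flat_def)
  then show ?thesis by blast
qed

lemma dderiv_flat_affine:
  "(\<lambda>t. flat p (e * t + d)) differentiable (at t)"
  "dderiv b (\<lambda>t. flat p (e * t + d)) t = (b * e) * flat ([:0, 0, 1:] * (p - pderiv p)) (e * t + d)"
proof -
  have "((\<lambda>t. flat p (e * t + d)) has_real_derivative
      flat ([:0, 0, 1:] * (p - pderiv p)) (e * t + d) * e) (at t)"
    by (rule DERIV_chain2[OF flat_has_derivative]) (auto intro!: derivative_eq_intros)
  then have h: "((\<lambda>t. flat p (e * t + d)) has_derivative
      (\<lambda>b. (b * e) * flat ([:0, 0, 1:] * (p - pderiv p)) (e * t + d))) (at t)"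
    unfolding has_field_derivative_def by (rule has_derivative_eq_rhs) (simp add: fun_eq_iff)
  show "(\<lambda>t. flat p (e * t + d)) differentiable (at t)" using h differentiable_def by blast
  show "dderiv b (\<lambda>t. flat p (e * t + d)) t = (b * e) * flat ([:0, 0, 1:] * (p - pderiv p)) (e * t + d)"
    using dderiv_eqI[OF h] .
qed

lemma tame_flat_affine: "tame UNIV (\<lambda>_ _. 1) (\<lambda>_ t. flat p (e * t + d))"
proof (rule tame_coinduct[where Q="\<lambda>F. \<exists>c p. F = (\<lambda>_ t. c * flat p (e * t + d))"])
  show "\<exists>c q. (\<lambda>_ t. flat p (e * t + d)) = (\<lambda>_ t. c * flat q (e * t + d))" for p
    by (intro exI[of _ 1] exI[of _ p]) simp
next
  fix F :: "nat \<Rightarrow> real \<Rightarrow> real" and k z assume "\<exists>c p. F = (\<lambda>_ t. c * flat p (e * t + d))"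
  then show "F k differentiable at z" by (auto intro!: differentiable_mult dderiv_flat_affine)
next
  fix F :: "nat \<Rightarrow> real \<Rightarrow> real" assume "\<exists>c p. F = (\<lambda>_ t. c * flat p (e * t + d))"
  then obtain c p where F: "F = (\<lambda>_ t. c * flat p (e * t + d))" by blast
  obtain C where "\<And>x. \<bar>flat p x\<bar> \<le> C" using flat_bounded by blast
  then have "\<bar>F k z\<bar> \<le> (\<bar>c\<bar> * C) * 1" for k z by (simp add: F abs_mult mult_left_mono)
  then show "\<exists>C. \<forall>k. \<forall>z\<in>UNIV. \<bar>F k z\<bar> \<le> C * 1" by blast
next
  fix F :: "nat \<Rightarrow> real \<Rightarrow> real" and b assume "\<exists>c p. F = (\<lambda>_ t. c * flat p (e * t + d))"
  then obtain c p where F: "F = (\<lambda>_ t. c * flat p (e * t + d))" by blast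
  let ?q = "[:0, 0, 1:] * (p - pderiv p)"
  have "dderiv b (F k) z = (c * (b * e)) * flat ?q (e * z + d)" for k z
    unfolding F by (subst dderiv_mult) (simp_all only: dderiv_flat_affine dderiv_const differentiable_const mult_zero_left add_0 mult.assoc)
  then show "\<exists>F'. (\<exists>c p. F' = (\<lambda>_ t. c * flat p (e * t + d))) \<and> (\<forall>k. \<forall>z\<in>UNIV. dderiv b (F k) z = F' k z)"
    by (intro exI[of _ "\<lambda>_ t. (c * (b * e)) * flat ?q (e * t + d)"]) blast
qed auto

text \<open>
  A smooth transition \<open>\<sigma>\<close> from \<open>0\<close> to \<open>1\<close> across \<open>[l, r]\<close> together with its derivative \<open>\<rho>\<close>.
  The latter is a probability density on \<open>[l, r]\<close>, and integrating against it averages over these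
  times.
\<close>
definition smooth_step :: "real \<Rightarrow> real \<Rightarrow> (real \<Rightarrow> real) \<Rightarrow> (real \<Rightarrow> real) \<Rightarrow> bool" where
  "smooth_step l r \<sigma> \<rho> \<longleftrightarrow> l < r \<and> tame UNIV (\<lambda>_ _. 1) (\<lambda>_. \<sigma>) \<and> (\<forall>t. (\<sigma> has_real_derivative \<rho> t) (at t)) \<and>
     (\<forall>t. 0 \<le> \<rho> t) \<and> (\<forall>t. t \<le> l \<or> r \<le> t \<longrightarrow> \<rho> t = 0) \<and> continuous_on UNIV \<rho> \<and>
     (\<forall>t\<le>l. \<sigma> t = 0) \<and> (\<forall>t\<ge>r. \<sigma> t = 1) \<and> (\<forall>t. 0 \<le> \<sigma> t \<and> \<sigma> t \<le> 1)"

lemma smooth_step_exists: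
  fixes l r :: real
  assumes "l < r"
  shows "\<exists>\<sigma> \<rho>. smooth_step l r \<sigma> \<rho>"
proof -
  define \<rho>0 where "\<rho>0 t = flat 1 (t - l) * flat 1 (r - t)" for t
  have t0: "tame UNIV (\<lambda>_ _. 1) (\<lambda>_. \<rho>0)"
    using tame_mult[OF open_UNIV tame_flat_affine[of 1 1 "-l"] tame_flat_affine[of 1 "-1" r]]
    by (simp add: \<rho>0_def[abs_def])
  have c0: "continuous_on A \<rho>0" for A using tame_continuous[OF t0] continuous_on_subset by blast
  have pos: "\<rho>0 t \<ge> 0" for t by (simp add: \<rho>0_def flat_def)
  have z: "\<rho>0 t = 0" if "t \<le> l \<or> r \<le> t" for t using that by (auto simp: \<rho>0_def flat_def)
  define J where "J t = integral {l-1..t} \<rho>0" for t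
  have J': "(J has_real_derivative \<rho>0 t) (at t)" for t
  proof (cases "t < l")
    case True
    have J0: "J s = 0" if "s < l" for s
    proof -
      have "J s = integral {l-1..s} (\<lambda>_. 0)" unfolding J_def using that by (intro integral_cong) (auto simp: z)
      then show ?thesis by simp
    qed
    have "(J has_real_derivative 0) (at t)"
    proof (rule has_field_derivative_transform_within_open[where S="{..<l}" and f="\<lambda>_. 0"])
      show "0 = J s" if "s \<in> {..<l}" for s using J0 that by simp
    qed (use True in auto)
    then show ?thesis using True z[of t] by simp
  next
    case False
    have "(J has_real_derivative \<rho>0 t) (at t within {l-1..t+1})"
      unfolding J_def[abs_def] by (rule integral_has_real_derivative[OF c0]) (use False in auto)
    moreover have "at t within {l-1..t+1} = at t" by (rule at_within_interior) (use False in auto)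
    ultimately show ?thesis by simp
  qed
  define I where "I = J r"
  have J0: "J t = 0" if "t \<le> l" for t
  proof -
    have "J t = integral {l-1..t} (\<lambda>_. 0)" unfolding J_def using that by (intro integral_cong) (auto simp: z)
    then show ?thesis by simp
  qed
  have mono: "J s \<le> J t" if "s \<le> t" for s t
    using that J' pos by (metis DERIV_nonneg_imp_nondecreasing)
  have J1: "J t = I" if "t \<ge> r" for t
  proof (cases "t = r")
    case False
    then obtain x where "r < x" "J t - J r = (t - r) * \<rho>0 x"
      using MVT2[of r t J \<rho>0] J' \<open>t \<ge> r\<close> by (metis order_less_le)
    then show ?thesis using z[of x] by (simp add: I_def)
  qed (simp add: I_def)
  have "I > 0"
  proof -
    obtain x where x: "l < x" "x < r" "J r - J l = (r - l) * \<rho>0 x" using MVT2[of l r J \<rho>0] J' assms by metis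
    then have "\<rho>0 x > 0" by (simp add: \<rho>0_def flat_def)
    then show ?thesis using x J0[of l] assms by (simp add: I_def)
  qed
  define \<sigma> where "\<sigma> t = J t / I" for t
  define \<rho> where "\<rho> t = \<rho>0 t / I" for t
  have \<sigma>': "(\<sigma> has_real_derivative \<rho> t) (at t)" for t
    unfolding \<sigma>_def[abs_def] \<rho>_def using DERIV_cdivide[OF J'] by simp
  have t\<rho>: "tame UNIV (\<lambda>_ _. 1) (\<lambda>_. \<rho>)"
    using tame_cmult[OF open_UNIV t0, of "1/I"] by (simp add: \<rho>_def[abs_def])
  have J01: "0 \<le> J t" "J t \<le> I" for t
  proof -
    show "0 \<le> J t" using J0[of t] J0[of l] mono[of l t] by (cases "t \<le> l") auto
    show "J t \<le> I" using J1[of t] mono[of t r] by (cases "r \<le> t") (auto simp: I_def)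
  qed
  have \<sigma>01: "0 \<le> \<sigma> t" "\<sigma> t \<le> 1" for t
    using J01[of t] \<open>I > 0\<close> by (simp_all add: \<sigma>_def)
  have dd: "\<sigma> differentiable (at t)" "dderiv b \<sigma> t = \<rho> t * b" for t b
  proof -
    have "(\<sigma> has_derivative (\<lambda>b. \<rho> t * b)) (at t)" using \<sigma>'[of t] by (simp add: has_field_derivative_def)
    then show "\<sigma> differentiable (at t)" "dderiv b \<sigma> t = \<rho> t * b"
      by (auto simp: differentiable_def dderiv_eqI)
  qed
  have "tame UNIV (\<lambda>_ _. 1) (\<lambda>_. \<sigma>)"
  proof (rule tame_coinduct[where Q="\<lambda>F. F = (\<lambda>_. \<sigma>) \<or> tame UNIV (\<lambda>_ _. 1) F"])
    fix F and b :: real assume F: "F = (\<lambda>_. \<sigma>) \<or> tame UNIV (\<lambda>_ _. 1) F" and b: "b \<in> Basis"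
    show "\<exists>F'. (F' = (\<lambda>_. \<sigma>) \<or> tame UNIV (\<lambda>_ _. 1) F') \<and> (\<forall>k. \<forall>z\<in>UNIV. dderiv b (F k) z = F' k z)"
      using F
    proof
      assume "F = (\<lambda>_. \<sigma>)"
      then show ?thesis using t\<rho> dd(2) b by (intro exI[of _ "\<lambda>_. \<rho>"]) auto
    next
      assume "tame UNIV (\<lambda>_ _. 1) F"
      from tame_dderiv[OF this b] show ?thesis by (intro exI[of _ "\<lambda>k. dderiv b (F k)"]) simp
    qed
  next
    fix F :: "nat \<Rightarrow> real \<Rightarrow> real" assume F: "F = (\<lambda>_. \<sigma>) \<or> tame UNIV (\<lambda>_ _. 1) F"
    then show "\<exists>C. \<forall>k. \<forall>z\<in>UNIV. \<bar>F k z\<bar> \<le> C * 1"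
    proof
      assume "F = (\<lambda>_. \<sigma>)" then show ?thesis using \<sigma>01 by (intro exI[of _ 1]) auto
    next
      assume "tame UNIV (\<lambda>_ _. 1) F"
      then show ?thesis using tame_bound by (metis UNIV_I)
    qed
  next
    fix F :: "nat \<Rightarrow> real \<Rightarrow> real" and k :: nat and z :: real
    assume "F = (\<lambda>_. \<sigma>) \<or> tame UNIV (\<lambda>_ _. 1) F"
    then show "F k differentiable at z" using dd(1) tame_differentiable[of UNIV _ F z k] by auto
  qed auto
  moreover have "continuous_on UNIV \<rho>" using tame_continuous[OF t\<rho>] .
  moreover have "\<sigma> t = 0" if "t \<le> l" for t using J0[OF that] by (simp add: \<sigma>_def)
  moreover have "\<sigma> t = 1" if "t \<ge> r" for t using J1[OF that] \<open>I > 0\<close> by (simp add: \<sigma>_def)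
  moreover have "0 \<le> \<rho> t" for t using pos \<open>I > 0\<close> by (simp add: \<rho>_def)
  moreover have "\<rho> t = 0" if "t \<le> l \<or> r \<le> t" for t using z[OF that] by (simp add: \<rho>_def)
  ultimately have "smooth_step l r \<sigma> \<rho>"
    unfolding smooth_step_def using assms \<sigma>' \<sigma>01 by simp
  then show ?thesis by (intro exI)
qed

lemma dderiv_comp_fst:
  fixes a :: "real \<Rightarrow> real"
  assumes "a differentiable (at (fst z))"
  shows "(\<lambda>z. a (fst z)) differentiable (at z)"
    "dderiv b (\<lambda>z. a (fst z)) z = fst b * dderiv 1 a (fst z)"
proof -
  have l: "dderiv c a (fst z) = c * dderiv 1 a (fst z)" for c
    using linear_cmul[OF bounded_linear.linear[OF has_derivative_bounded_linear[OF has_derivative_dderiv[OF assms]]], of c 1]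
    by simp
  have "((\<lambda>z. a (fst z)) has_derivative (\<lambda>b. dderiv (fst b) a (fst z))) (at z)"
    by (rule has_derivative_compose[where f=fst and g=a, OF _ has_derivative_dderiv[OF assms]]) (auto intro!: derivative_eq_intros)
  then show "(\<lambda>z. a (fst z)) differentiable (at z)"
    "dderiv b (\<lambda>z. a (fst z)) z = fst b * dderiv 1 a (fst z)"
    using l[of "fst b"] by (auto simp: differentiable_def dderiv_eqI)
qed

lemma tame_comp_fst:
  fixes a :: "real \<Rightarrow> real"
  assumes "tame UNIV (\<lambda>_ _. 1) (\<lambda>_. a)"
  shows "tame UNIV (\<lambda>_ _. 1) (\<lambda>_ z::real \<times> 'b::euclidean_space. a (fst z))"
proof (rule tame_coinduct[where Q="\<lambda>F. \<exists>a. tame UNIV (\<lambda>_ _. 1) (\<lambda>_. a) \<and> F = (\<lambda>_ z. a (fst z))"])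
  fix F :: "nat \<Rightarrow> real \<times> 'b \<Rightarrow> real" and b :: "real \<times> 'b"
  assume "\<exists>a. tame UNIV (\<lambda>_ _. 1) (\<lambda>_. a) \<and> F = (\<lambda>_ z. a (fst z))"
  then obtain a where a: "tame UNIV (\<lambda>_ _. 1) (\<lambda>_. a)" and F: "F = (\<lambda>_ z. a (fst z))" by blast
  have "tame UNIV (\<lambda>_ _. 1) (\<lambda>_ t. fst b * dderiv 1 a t)"
    by (intro tame_cmult tame_dderiv a) auto
  moreover have "dderiv b (F k) z = fst b * dderiv 1 a (fst z)" for k z
    unfolding F by (intro dderiv_comp_fst tame_differentiable[OF a]) simp
  ultimately show "\<exists>F'. (\<exists>a. tame UNIV (\<lambda>_ _. 1) (\<lambda>_. a) \<and> F' = (\<lambda>_ z. a (fst z))) \<and>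
      (\<forall>k. \<forall>z\<in>UNIV. dderiv b (F k) z = F' k z)"
    by (intro exI[of _ "\<lambda>_ z. fst b * dderiv 1 a (fst z)"] conjI exI[of _ "\<lambda>t. fst b * dderiv 1 a t"]) auto
next
  fix F :: "nat \<Rightarrow> real \<times> 'b \<Rightarrow> real"
  assume "\<exists>a. tame UNIV (\<lambda>_ _. 1) (\<lambda>_. a) \<and> F = (\<lambda>_ z. a (fst z))"
  then obtain a where a: "tame UNIV (\<lambda>_ _. 1) (\<lambda>_. a)" and F: "F = (\<lambda>_ z. a (fst z))" by blast
  from tame_bound[OF a] obtain C where "\<And>t. \<bar>a t\<bar> \<le> C * 1" by (metis UNIV_I)
  then show "\<exists>C. \<forall>k. \<forall>z\<in>UNIV. \<bar>F k z\<bar> \<le> C * 1" unfolding F by blast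
next
  fix F :: "nat \<Rightarrow> real \<times> 'b \<Rightarrow> real" and k :: nat and z :: "real \<times> 'b"
  assume "\<exists>a. tame UNIV (\<lambda>_ _. 1) (\<lambda>_. a) \<and> F = (\<lambda>_ z. a (fst z))"
  then obtain a where a: "tame UNIV (\<lambda>_ _. 1) (\<lambda>_. a)" and F: "F = (\<lambda>_ z. a (fst z))" by blast
  show "F k differentiable at z" unfolding F by (intro dderiv_comp_fst tame_differentiable[OF a]) simp
qed (use assms in auto)

text \<open>
  A class closed under differentiation that contains the standard bump on the unit ball.
\<close>
inductive bump_poly :: "('b::euclidean_space \<Rightarrow> real) \<Rightarrow> bool" where
  "bump_poly (\<lambda>x. flat p (1 - (norm x)\<^sup>2))"
| "bump_poly F \<Longrightarrow> bump_poly (\<lambda>x. (x \<bullet> c) * F x)"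
| "bump_poly F \<Longrightarrow> bump_poly (\<lambda>x. c * F x)"
| "bump_poly F \<Longrightarrow> bump_poly G \<Longrightarrow> bump_poly (\<lambda>x. F x + G x)"

lemma bump_poly_support: "bump_poly F \<Longrightarrow> norm x \<ge> 1 \<Longrightarrow> F x = 0"
  by (induct rule: bump_poly.induct) (auto simp: flat_def one_le_power)

lemma bump_poly_bounded: "bump_poly F \<Longrightarrow> \<exists>C. \<forall>x. \<bar>F x\<bar> \<le> C"
proof (induct rule: bump_poly.induct)
  case (1 p)
  show ?case using flat_bounded[of p] by blast
next
  case (2 F c)
  then obtain C where C: "\<And>x. \<bar>F x\<bar> \<le> C" by blast
  have "\<bar>(x \<bullet> c) * F x\<bar> \<le> norm c * C" for x
  proof (cases "norm x \<ge> 1")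
    case True
    then show ?thesis using bump_poly_support[OF 2(1)] C[of 0] by simp
  next
    case False
    have "\<bar>x \<bullet> c\<bar> \<le> norm x * norm c" by (rule Cauchy_Schwarz_ineq2)
    also have "\<dots> \<le> norm c" using False mult_right_mono[of "norm x" 1 "norm c"] by simp
    finally show ?thesis unfolding abs_mult by (intro mult_mono C) auto
  qed
  then show ?case by blast
next
  case (3 F c)
  then obtain C where "\<And>x. \<bar>F x\<bar> \<le> C" by blast
  then have "\<bar>c * F x\<bar> \<le> \<bar>c\<bar> * C" for x by (simp add: abs_mult mult_left_mono)
  then show ?case by blast
next
  case (4 F G)
  then obtain C D where "\<And>x. \<bar>F x\<bar> \<le> C" "\<And>x. \<bar>G x\<bar> \<le> D" by blast
  then have "\<bar>F x + G x\<bar> \<le> C + D" for x by (meson abs_triangle_ineq add_mono order_trans)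
  then show ?case by blast
qed

lemma bump_poly_derivative:
  fixes b :: "'b::euclidean_space"
  shows
  "bump_poly F \<Longrightarrow> (\<forall>x. F differentiable (at x)) \<and> (\<exists>F'. bump_poly F' \<and> (\<forall>x. dderiv b F x = F' x))"
proof (induct rule: bump_poly.induct)
  case (1 p)
  let ?q = "[:0, 0, 1:] * (p - pderiv p)"
  have h: "((\<lambda>x. flat p (1 - (norm x)\<^sup>2)) has_derivative (\<lambda>b. (x \<bullet> (-2 *\<^sub>R b)) * flat ?q (1 - (norm x)\<^sup>2))) (at x)" for x :: 'b
  proof -
    have g: "((\<lambda>x. 1 - (norm x)\<^sup>2) has_derivative (\<lambda>b. x \<bullet> (-2 *\<^sub>R b))) (at x)"
      unfolding power2_norm_eq_inner by (auto intro!: derivative_eq_intros simp: inner_commute)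
    from has_derivative_compose[OF this has_field_derivative_imp_has_derivative[OF flat_has_derivative[of p]]]
    show ?thesis by (simp only: mult.commute)
  qed
  have "bump_poly (\<lambda>x. (x \<bullet> (-2 *\<^sub>R b)) * flat ?q (1 - (norm x)\<^sup>2))" by (intro bump_poly.intros)
  moreover have "dderiv b (\<lambda>x. flat p (1 - (norm x)\<^sup>2)) x = (x \<bullet> (-2 *\<^sub>R b)) * flat ?q (1 - (norm x)\<^sup>2)" for x
    by (rule dderiv_eqI[OF h])
  moreover have "(\<lambda>x. flat p (1 - (norm x)\<^sup>2)) differentiable (at x)" for x :: 'b using h differentiable_def by blast
  ultimately show ?case by (intro conjI allI exI)
next
  case (2 F c)
  then obtain F' where F': "bump_poly F'" "\<And>x. dderiv b F x = F' x" by blast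
  have i: "(\<lambda>x. x \<bullet> c) differentiable (at x)" "dderiv b (\<lambda>x. x \<bullet> c) x = b \<bullet> c" for x
  proof -
    have "((\<lambda>x. x \<bullet> c) has_derivative (\<lambda>b. b \<bullet> c)) (at x)" by (auto intro!: derivative_eq_intros)
    then show "(\<lambda>x. x \<bullet> c) differentiable (at x)" "dderiv b (\<lambda>x. x \<bullet> c) x = b \<bullet> c"
      by (auto simp: differentiable_def dderiv_eqI)
  qed
  have "bump_poly (\<lambda>x. (b \<bullet> c) * F x + (x \<bullet> c) * F' x)" by (intro bump_poly.intros 2 F')
  moreover have "dderiv b (\<lambda>x. (x \<bullet> c) * F x) x = (b \<bullet> c) * F x + (x \<bullet> c) * F' x" for x
    using 2 by (subst dderiv_mult) (auto simp: i F')
  moreover have "(\<lambda>x. (x \<bullet> c) * F x) differentiable (at x)" for x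
    using 2 i by (intro differentiable_mult) auto
  ultimately show ?case by (intro conjI allI exI)
next
  case (3 F c)
  then obtain F' where F': "bump_poly F'" "\<And>x. dderiv b F x = F' x" by blast
  have "bump_poly (\<lambda>x. c * F' x)" by (intro bump_poly.intros F')
  moreover have "dderiv b (\<lambda>x. c * F x) x = c * F' x" for x
    using 3 by (subst dderiv_mult) (auto simp: dderiv_const F')
  moreover have "(\<lambda>x. c * F x) differentiable (at x)" for x
    using 3 by (intro differentiable_mult) auto
  ultimately show ?case by (intro conjI allI exI)
next
  case (4 F G)
  then obtain F' G' where F': "bump_poly F'" "\<And>x. dderiv b F x = F' x"
    and G': "bump_poly G'" "\<And>x. dderiv b G x = G' x" by blast
  have "bump_poly (\<lambda>x. F' x + G' x)" by (intro bump_poly.intros F' G')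
  moreover have "dderiv b (\<lambda>x. F x + G x) x = F' x + G' x" for x
    using 4 by (subst dderiv_add) (auto simp: F' G')
  moreover have "(\<lambda>x. F x + G x) differentiable (at x)" for x
    using 4 by (intro differentiable_add) auto
  ultimately show ?case by (intro conjI allI exI)
qed

text \<open>
  Cutoff to the ball of radius \<open>k + 1\<close> in space, constant in time; the factor \<open>exp 1\<close> makes its value
  at the origin \<open>1\<close>.
\<close>
definition cutoff :: "nat \<Rightarrow> real \<times> 'b::euclidean_space \<Rightarrow> real" where
  "cutoff k z = exp 1 * flat 1 (1 - (norm (snd z /\<^sub>R real (Suc k)))\<^sup>2)"

lemma dderiv_comp_snd_scaled:
  fixes f :: "'b::euclidean_space \<Rightarrow> real"
  assumes "\<And>x. f differentiable (at x)"
  shows "(\<lambda>z. f (snd z /\<^sub>R R)) differentiable (at z)"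
    "dderiv b (\<lambda>z. f (snd z /\<^sub>R R)) z = (1 / R) * dderiv (snd b) f (snd z /\<^sub>R R)"
proof -
  have d: "(f has_derivative (\<lambda>c. dderiv c f (snd z /\<^sub>R R))) (at (snd z /\<^sub>R R))"
    using has_derivative_dderiv[OF assms] .
  have l: "dderiv (c /\<^sub>R R) f (snd z /\<^sub>R R) = (1 / R) * dderiv c f (snd z /\<^sub>R R)" for c
    using linear_cmul[OF bounded_linear.linear[OF has_derivative_bounded_linear[OF d]], of "inverse R" c]
    by (simp add: inverse_eq_divide)
  have "((\<lambda>z. f (snd z /\<^sub>R R)) has_derivative (\<lambda>b. dderiv (snd b /\<^sub>R R) f (snd z /\<^sub>R R))) (at z)"
    by (rule has_derivative_compose[where f="\<lambda>z. snd z /\<^sub>R R" and g=f, OF _ d]) (auto intro!: derivative_eq_intros)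
  then show "(\<lambda>z. f (snd z /\<^sub>R R)) differentiable (at z)"
    "dderiv b (\<lambda>z. f (snd z /\<^sub>R R)) z = (1 / R) * dderiv (snd b) f (snd z /\<^sub>R R)"
    using l[of "snd b"] by (auto simp: differentiable_def dderiv_eqI)
qed

text \<open>
  Rescaling a bump to radius \<open>k + 1\<close> makes every derivative gain a factor \<open>1 / (k + 1) \<le> 1\<close>, so that
  the bounds are uniform in \<open>k\<close>.
\<close>
lemma tame_bump_poly_scaled:
  assumes "bump_poly f" "\<And>k. \<bar>c k\<bar> \<le> \<epsilon> k"
  shows "tame UNIV (\<lambda>k z. \<epsilon> k) (\<lambda>k z::real \<times> 'b::euclidean_space. c k * f (snd z /\<^sub>R real (Suc k)))"
proof (rule tame_coinduct[where Q="\<lambda>F. \<exists>c f. bump_poly f \<and> (\<forall>k. \<bar>c k\<bar> \<le> \<epsilon> k) \<and> F = (\<lambda>k z. c k * f (snd z /\<^sub>R real (Suc k)))"])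
  fix F :: "nat \<Rightarrow> real \<times> 'b \<Rightarrow> real" and b :: "real \<times> 'b"
  assume "\<exists>c f. bump_poly f \<and> (\<forall>k. \<bar>c k\<bar> \<le> \<epsilon> k) \<and> F = (\<lambda>k z. c k * f (snd z /\<^sub>R real (Suc k)))"
  then obtain c f where f: "bump_poly f" and c: "\<And>k. \<bar>c k\<bar> \<le> \<epsilon> k" and F: "F = (\<lambda>k z. c k * f (snd z /\<^sub>R real (Suc k)))"
    by blast
  obtain f' where f': "bump_poly f'" "\<And>x. dderiv (snd b) f x = f' x"
    using bump_poly_derivative[OF f, of "snd b"] by blast
  have "\<bar>c k * (1 / real (Suc k))\<bar> \<le> \<epsilon> k" for k
  proof -
    have "\<bar>c k\<bar> * (1 / real (Suc k)) \<le> \<bar>c k\<bar> * 1" by (intro mult_left_mono) auto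
    then show ?thesis using c[of k] by (simp add: abs_mult)
  qed
  moreover have "dderiv b (F k) z = (c k * (1 / real (Suc k))) * f' (snd z /\<^sub>R real (Suc k))" for k z
    unfolding F using bump_poly_derivative[OF f]
    by (subst dderiv_mult) (auto simp only: dderiv_const dderiv_comp_snd_scaled f' mult_zero_left add_0 mult.assoc intro!: differentiable_const dderiv_comp_snd_scaled(1))
  ultimately show "\<exists>F'. (\<exists>c f. bump_poly f \<and> (\<forall>k. \<bar>c k\<bar> \<le> \<epsilon> k) \<and> F' = (\<lambda>k z. c k * f (snd z /\<^sub>R real (Suc k)))) \<and>
      (\<forall>k. \<forall>z\<in>UNIV. dderiv b (F k) z = F' k z)" using f'(1)
    by (intro exI[of _ "\<lambda>k z. (c k * (1 / real (Suc k))) * f' (snd z /\<^sub>R real (Suc k))"] conjI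
        exI[of _ "\<lambda>k. c k * (1 / real (Suc k))"] exI[of _ f']) auto
next
  fix F :: "nat \<Rightarrow> real \<times> 'b \<Rightarrow> real"
  assume "\<exists>c f. bump_poly f \<and> (\<forall>k. \<bar>c k\<bar> \<le> \<epsilon> k) \<and> F = (\<lambda>k z. c k * f (snd z /\<^sub>R real (Suc k)))"
  then obtain c f where f: "bump_poly f" and c: "\<And>k. \<bar>c k\<bar> \<le> \<epsilon> k" and F: "F = (\<lambda>k z. c k * f (snd z /\<^sub>R real (Suc k)))"
    by blast
  obtain C where C: "\<And>x. \<bar>f x\<bar> \<le> C" using bump_poly_bounded[OF f] by blast
  have "\<bar>F k z\<bar> \<le> C * \<epsilon> k" for k z
    unfolding F abs_mult using mult_mono[OF c[of k] C[of "snd z /\<^sub>R real (Suc k)"]] c[of k] by (simp add: mult.commute)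
  then show "\<exists>C. \<forall>k. \<forall>z\<in>UNIV. \<bar>F k z\<bar> \<le> C * \<epsilon> k" by blast
next
  fix F :: "nat \<Rightarrow> real \<times> 'b \<Rightarrow> real" and k :: nat and z :: "real \<times> 'b"
  assume "\<exists>c f. bump_poly f \<and> (\<forall>k. \<bar>c k\<bar> \<le> \<epsilon> k) \<and> F = (\<lambda>k z. c k * f (snd z /\<^sub>R real (Suc k)))"
  then obtain c f where f: "bump_poly f" and F: "F = (\<lambda>k z. c k * f (snd z /\<^sub>R real (Suc k)))"
    by blast
  show "F k differentiable at z" unfolding F using bump_poly_derivative[OF f]
    by (intro differentiable_mult differentiable_const dderiv_comp_snd_scaled(1)) auto
qed (use assms in auto)

lemma tame_cutoff: "tame UNIV (\<lambda>k z. 1) (cutoff :: nat \<Rightarrow> real \<times> 'b::euclidean_space \<Rightarrow> real)"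
  using tame_bump_poly_scaled[of "\<lambda>x. exp 1 * flat 1 (1 - (norm x)\<^sup>2)" "\<lambda>_. 1" "\<lambda>_. 1"]
  by (simp add: cutoff_def[abs_def] bump_poly.intros)

lemma tame_dderiv_cutoff:
  "tame UNIV (\<lambda>k z. 1 / real (Suc k)) (\<lambda>k. dderiv b (cutoff k :: real \<times> 'b::euclidean_space \<Rightarrow> real))"
proof -
  let ?f = "\<lambda>x::'b. exp 1 * flat 1 (1 - (norm x)\<^sup>2)"
  have f: "bump_poly ?f" by (intro bump_poly.intros)
  obtain f' where f': "bump_poly f'" "\<And>x. dderiv (snd b) ?f x = f' x"
    using bump_poly_derivative[OF f, of "snd b"] by blast
  have "dderiv b (cutoff k) z = (1 / real (Suc k)) * f' (snd z /\<^sub>R real (Suc k))" for k and z :: "real \<times> 'b"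
    using dderiv_comp_snd_scaled(2)[of ?f b "real (Suc k)" z] bump_poly_derivative[OF f] f'(2)
    by (simp add: cutoff_def[abs_def])
  then have e: "(\<lambda>k. dderiv b (cutoff k)) = (\<lambda>k z::real \<times> 'b. (1 / real (Suc k)) * f' (snd z /\<^sub>R real (Suc k)))"
    by (intro ext)
  show ?thesis unfolding e by (rule tame_bump_poly_scaled[OF f'(1)]) simp
qed

lemma cutoff_nonneg: "0 \<le> cutoff k z" by (simp add: cutoff_def flat_def)

lemma cutoff_le_1: "cutoff k z \<le> 1"
proof -
  let ?y = "1 - (norm (snd z /\<^sub>R real (Suc k)))\<^sup>2"
  have "?y \<le> 1" by simp
  then have "?y > 0 \<Longrightarrow> 1 \<le> 1 / ?y" by (simp add: le_divide_eq_1)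
  then show ?thesis by (auto simp: cutoff_def flat_def exp_add[symmetric] simp del: norm_scaleR)
qed

lemma cutoff_support: "real (Suc k) \<le> norm (snd z) \<Longrightarrow> cutoff k z = 0"
  by (auto simp: cutoff_def flat_def divide_simps power2_eq_square mult_mono)

lemma cutoff_tendsto_1:
  assumes "filterlim m at_top sequentially"
  shows "(\<lambda>k. cutoff (m k) (s k, x)) \<longlonglongrightarrow> 1"
proof -
  have i: "isCont (flat 1) 1" using flat_has_derivative DERIV_isCont by blast
  have "filterlim (\<lambda>k. real (Suc (m k))) at_top sequentially"
    using filterlim_compose[OF filterlim_real_sequentially filterlim_compose[OF filterlim_Suc assms]] by simp
  then have "(\<lambda>k. inverse (real (Suc (m k)))) \<longlonglongrightarrow> 0"
    by (rule tendsto_inverse_0_at_top)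
  then have "(\<lambda>k. 1 - (norm (x /\<^sub>R real (Suc (m k))))\<^sup>2) \<longlonglongrightarrow> 1 - (norm (0 *\<^sub>R x))\<^sup>2"
    by (intro tendsto_intros)
  then have "(\<lambda>k. exp 1 * flat 1 (1 - (norm (x /\<^sub>R real (Suc (m k))))\<^sup>2)) \<longlonglongrightarrow> exp 1 * flat 1 1"
    by (intro tendsto_intros isCont_tendsto_compose[OF i]) simp
  then show ?thesis by (simp add: cutoff_def flat_def exp_add[symmetric])
qed

section \<open>The heat kernel and its derivatives\<close>

definition heat :: "real \<times> 'b::euclidean_space \<Rightarrow> real" where
  "heat z = (4 * pi * fst z) powr (- (real DIM('b) / 2)) * exp (- ((norm (snd z))\<^sup>2 / (4 * fst z)))"

text \<open>
  Polynomials in \<open>x\<^sub>i / t\<close> and \<open>1 / t\<close>, graded by parabolic scaling: \<open>m\<close> counts half powers of \<open>1/t\<close>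
  when \<open>x\<close> is measured in units of \<open>\<surd>t\<close>.  Every derivative of the heat kernel is such a polynomial times
  the kernel.
\<close>
inductive parabolic :: "nat \<Rightarrow> (real \<times> 'b::euclidean_space \<Rightarrow> real) \<Rightarrow> bool" where
  parabolic_const: "parabolic 0 (\<lambda>z. c)"
| parabolic_zero: "parabolic m (\<lambda>z. 0)"
| parabolic_coord: "parabolic 1 (\<lambda>z. (snd z \<bullet> c) / fst z)"
| parabolic_time: "parabolic 2 (\<lambda>z. 1 / fst z)"
| parabolic_add: "parabolic m q \<Longrightarrow> parabolic m r \<Longrightarrow> parabolic m (\<lambda>z. q z + r z)"
| parabolic_mult: "parabolic m q \<Longrightarrow> parabolic l r \<Longrightarrow> parabolic (m + l) (\<lambda>z. q z * r z)"

lemma parabolic_cmult: "parabolic m q \<Longrightarrow> parabolic m (\<lambda>z. c * q z)"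
  using parabolic_mult[OF parabolic_const] by simp

lemma parabolic_sum: "(\<And>i. i \<in> I \<Longrightarrow> parabolic m (q i)) \<Longrightarrow> parabolic m (\<lambda>z. \<Sum>i\<in>I. q i z)"
  by (induct I rule: infinite_finite_induct) (auto intro: parabolic_zero parabolic_add)

text \<open>
  A time derivative counts as two space derivatives.
\<close>
definition weight :: "real \<times> 'b::euclidean_space \<Rightarrow> nat" where
  "weight b = (if fst b = 0 then 1 else 2)"

lemma parabolic_derivative:
  fixes b :: "real \<times> 'b::euclidean_space"
  assumes b: "b \<in> Basis"
  shows "parabolic m q \<Longrightarrow> (\<forall>z. fst z > 0 \<longrightarrow> q differentiable (at z)) \<and>
    (\<exists>q'. parabolic (m + weight b) q' \<and> (\<forall>z. fst z > 0 \<longrightarrow> dderiv b q z = q' z))"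
proof (induct rule: parabolic.induct)
  case (parabolic_const c)
  show ?case using parabolic_zero by (intro conjI exI[of _ "\<lambda>_. 0"]) (auto simp: dderiv_const)
next
  case (parabolic_zero m)
  show ?case using parabolic.parabolic_zero by (intro conjI exI[of _ "\<lambda>_. 0"]) (auto simp: dderiv_const)
next
  case (parabolic_coord c)
  have h: "((\<lambda>z. (snd z \<bullet> c) / fst z) has_derivative
      (\<lambda>v. (snd v \<bullet> c) / fst z - (snd z \<bullet> c) * fst v / (fst z * fst z))) (at z)"
    if "fst z > 0" for z :: "real \<times> 'b"
    using that by (auto intro!: derivative_eq_intros simp: fun_eq_iff field_simps)
  have "parabolic (1 + weight b) (\<lambda>z. (snd b \<bullet> c) / fst z - (snd z \<bullet> c) * fst b / (fst z * fst z))"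
  proof (cases "fst b = 0")
    case True
    then show ?thesis using parabolic_cmult[OF parabolic_time, of "snd b \<bullet> c"]
      by (simp add: weight_def numeral_2_eq_2)
  next
    case False
    then have "snd b = 0" using b by (auto simp: Basis_prod_def)
    then show ?thesis
      using parabolic_cmult[OF parabolic_mult[OF parabolic.parabolic_coord[of c] parabolic_time], of "- fst b"] False
      by (simp add: weight_def mult_ac)
  qed
  moreover have "(\<lambda>z. (snd z \<bullet> c) / fst z) differentiable (at z)" if "fst z > 0" for z
    using h[OF that] differentiable_def by blast
  ultimately show ?case using dderiv_eqI[OF h]
    by (intro conjI exI[of _ "\<lambda>z. (snd b \<bullet> c) / fst z - (snd z \<bullet> c) * fst b / (fst z * fst z)"]) auto
next
  case parabolic_time
  have h: "((\<lambda>z. 1 / fst z) has_derivative (\<lambda>v. - fst v / (fst z * fst z))) (at z)"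
    if "fst z > 0" for z :: "real \<times> 'b"
    using that by (auto intro!: derivative_eq_intros simp: fun_eq_iff field_simps)
  have "parabolic (2 + weight b) (\<lambda>z. - fst b / (fst z * fst z))"
  proof (cases "fst b = 0")
    case True then show ?thesis by (simp add: parabolic_zero)
  next
    case False
    then show ?thesis
      using parabolic_cmult[OF parabolic_mult[OF parabolic.parabolic_time parabolic.parabolic_time], of "- fst b"]
      by (simp add: weight_def)
  qed
  moreover have "(\<lambda>z. 1 / fst z) differentiable (at z)" if "fst z > 0" for z :: "real \<times> 'b"
    using h[OF that] differentiable_def by blast
  ultimately show ?case using dderiv_eqI[OF h]
    by (intro conjI exI[of _ "\<lambda>z. - fst b / (fst z * fst z)"]) auto
next
  case (parabolic_add m q r)
  then obtain q' r' where q': "parabolic (m + weight b) q'" "\<And>z. fst z > 0 \<Longrightarrow> dderiv b q z = q' z"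
    and r': "parabolic (m + weight b) r'" "\<And>z. fst z > 0 \<Longrightarrow> dderiv b r z = r' z" by blast
  have d: "q differentiable (at z)" "r differentiable (at z)" if "fst z > 0" for z
    using parabolic_add that by blast+
  have "dderiv b (\<lambda>z. q z + r z) z = q' z + r' z" if "fst z > 0" for z
    unfolding dderiv_add[OF d[OF that]] q'(2)[OF that] r'(2)[OF that] ..
  moreover have "(\<lambda>z. q z + r z) differentiable (at z)" if "fst z > 0" for z
    by (intro differentiable_add d that)
  ultimately show ?case using parabolic.parabolic_add[OF q'(1) r'(1)]
    by (intro conjI exI[of _ "\<lambda>z. q' z + r' z"]) auto
next
  case (parabolic_mult m q l r)
  then obtain q' r' where q': "parabolic (m + weight b) q'" "\<And>z. fst z > 0 \<Longrightarrow> dderiv b q z = q' z"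
    and r': "parabolic (l + weight b) r'" "\<And>z. fst z > 0 \<Longrightarrow> dderiv b r z = r' z" by blast
  have d: "q differentiable (at z)" "r differentiable (at z)" if "fst z > 0" for z
    using parabolic_mult that by blast+
  have "dderiv b (\<lambda>z. q z * r z) z = q' z * r z + q z * r' z" if "fst z > 0" for z
    unfolding dderiv_mult[OF d[OF that]] q'(2)[OF that] r'(2)[OF that] ..
  moreover have "(\<lambda>z. q z * r z) differentiable (at z)" if "fst z > 0" for z
    by (intro differentiable_mult d that)
  moreover have "parabolic (m + l + weight b) (\<lambda>z. q' z * r z + q z * r' z)"
  proof (rule parabolic.parabolic_add)
    show "parabolic (m + l + weight b) (\<lambda>z. q' z * r z)"
      using parabolic.parabolic_mult[OF q'(1) parabolic_mult(3)] by (simp add: add_ac)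
    show "parabolic (m + l + weight b) (\<lambda>z. q z * r' z)"
      using parabolic.parabolic_mult[OF parabolic_mult(1) r'(1)] by (simp add: add_ac)
  qed
  ultimately show ?case by (intro conjI exI[of _ "\<lambda>z. q' z * r z + q z * r' z"]) auto
qed

lemma parabolic_bound:
  fixes q :: "real \<times> 'b::euclidean_space \<Rightarrow> real"
  shows "parabolic m q \<Longrightarrow> \<exists>C\<ge>0. \<forall>t x. t > 0 \<longrightarrow> \<bar>q (t, x)\<bar> \<le> C * (t powr (- real m / 2) * (1 + norm x / sqrt t) ^ m)"
proof (induct rule: parabolic.induct)
  case (parabolic_const c)
  then show ?case by (intro exI[of _ "\<bar>c\<bar>"]) auto
next
  case (parabolic_zero m)
  then show ?case by (intro exI[of _ 0]) auto
next
  case (parabolic_coord c)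
  have "\<bar>(x \<bullet> c) / t\<bar> \<le> norm c * (t powr (- 1 / 2) * (1 + norm x / sqrt t))" if "t > 0" for t and x :: 'b
  proof -
    have "\<bar>(x \<bullet> c) / t\<bar> \<le> norm x * norm c / t" using Cauchy_Schwarz_ineq2[of x c] that by (simp add: divide_right_mono)
    also have "\<dots> = norm c * ((1 / sqrt t) * (norm x / sqrt t))" using that by simp
    also have "\<dots> \<le> norm c * ((1 / sqrt t) * (1 + norm x / sqrt t))"
      using that by (intro mult_left_mono) auto
    also have "1 / sqrt t = t powr (- 1 / 2)" using that by (simp add: powr_minus_divide powr_half_sqrt)
    finally show ?thesis .
  qed
  then show ?case by (intro exI[of _ "norm c"]) auto
next
  case parabolic_time
  have "\<bar>1 / t\<bar> \<le> 1 * (t powr (- 1) * (1 + norm x / sqrt t) ^ 2)" if "t > 0" for t and x :: 'b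
  proof -
    have "1 * 1 \<le> (1 + norm x / sqrt t) * (1 + norm x / sqrt t)" using that by (intro mult_mono) auto
    then show ?thesis using that by (simp add: powr_minus_divide power2_eq_square divide_right_mono)
  qed
  then show ?case by (intro exI[of _ 1]) auto
next
  case (parabolic_add m q r)
  obtain C where "C \<ge> 0"
    and C: "\<And>t x. t > 0 \<Longrightarrow> \<bar>q (t, x)\<bar> \<le> C * (t powr (- real m / 2) * (1 + norm x / sqrt t) ^ m)"
    using parabolic_add(2) by blast
  obtain D where "D \<ge> 0"
    and D: "\<And>t x. t > 0 \<Longrightarrow> \<bar>r (t, x)\<bar> \<le> D * (t powr (- real m / 2) * (1 + norm x / sqrt t) ^ m)"
    using parabolic_add(4) by blast
  have "\<bar>q (t, x) + r (t, x)\<bar> \<le> (C + D) * (t powr (- real m / 2) * (1 + norm x / sqrt t) ^ m)" if "t > 0" for t x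
    using C[OF that, of x] D[OF that, of x] abs_triangle_ineq[of "q (t,x)" "r (t,x)"] by (simp add: distrib_right)
  then show ?case using \<open>C \<ge> 0\<close> \<open>D \<ge> 0\<close> by (intro exI[of _ "C + D"]) auto
next
  case (parabolic_mult m q l r)
  obtain C where "C \<ge> 0"
    and C: "\<And>t x. t > 0 \<Longrightarrow> \<bar>q (t, x)\<bar> \<le> C * (t powr (- real m / 2) * (1 + norm x / sqrt t) ^ m)"
    using parabolic_mult(2) by blast
  obtain D where "D \<ge> 0"
    and D: "\<And>t x. t > 0 \<Longrightarrow> \<bar>r (t, x)\<bar> \<le> D * (t powr (- real l / 2) * (1 + norm x / sqrt t) ^ l)"
    using parabolic_mult(4) by blast
  have "\<bar>q (t, x) * r (t, x)\<bar> \<le> (C * D) * (t powr (- real (m + l) / 2) * (1 + norm x / sqrt t) ^ (m + l))"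
    if "t > 0" for t x
  proof -
    have "\<bar>q (t, x)\<bar> * \<bar>r (t, x)\<bar> \<le> (C * (t powr (- real m / 2) * (1 + norm x / sqrt t) ^ m)) *
        (D * (t powr (- real l / 2) * (1 + norm x / sqrt t) ^ l))"
      using C[OF that, of x] D[OF that, of x] by (intro mult_mono) auto
    moreover have "t powr (- real m / 2) * t powr (- real l / 2) = t powr (- real (m + l) / 2)"
      by (simp add: powr_add[symmetric] field_simps)
    ultimately show ?thesis by (simp add: abs_mult power_add mult_ac)
  qed
  then show ?case using \<open>C \<ge> 0\<close> \<open>D \<ge> 0\<close> by (intro exI[of _ "C * D"]) auto
qed

lemma power_times_gaussian_bounded:
  "\<exists>C\<ge>0. \<forall>r\<ge>0::real. (1 + r) ^ m * exp (- (r\<^sup>2 / 8)) \<le> C"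
proof (cases "m = 0")
  case True then show ?thesis by (intro exI[of _ 1]) auto
next
  case False
  have "(1 + r) ^ m * exp (- (r\<^sup>2 / 8)) \<le> real m ^ m * exp 3" if "r \<ge> 0" for r :: real
  proof -
    have "(1 + r) = real m * ((1 + r) / real m)" using False by simp
    also have "\<dots> \<le> real m * exp ((1 + r) / real m)"
      by (intro mult_left_mono) (use exp_ge_add_one_self[of "(1 + r) / real m"] in linarith, simp)
    finally have "(1 + r) ^ m \<le> (real m * exp ((1 + r) / real m)) ^ m" using that by (intro power_mono) auto
    also have "\<dots> = real m ^ m * exp (1 + r)"
      using False by (simp add: power_mult_distrib exp_of_nat_mult[symmetric])
    finally have "(1 + r) ^ m * exp (- (r\<^sup>2 / 8)) \<le> real m ^ m * exp (1 + r) * exp (- (r\<^sup>2 / 8))"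
      by (intro mult_right_mono) auto
    also have "\<dots> = real m ^ m * exp (1 + r - r\<^sup>2 / 8)" by (simp add: exp_add[symmetric] exp_diff exp_minus field_simps)
    also have "\<dots> \<le> real m ^ m * exp 3"
    proof -
      have "0 \<le> (r - 4)\<^sup>2" by simp
      then have "1 + r - r\<^sup>2 / 8 \<le> 3" by (simp add: power2_eq_square algebra_simps)
      then show ?thesis by (intro mult_left_mono) auto
    qed
    finally show ?thesis .
  qed
  then show ?thesis by (intro exI[of _ "real m ^ m * exp 3"]) auto
qed

lemma heat_nonneg [simp]: "heat z \<ge> 0" by (simp add: heat_def)

lemma abs_heat [simp]: "\<bar>heat z\<bar> = heat z" by simp

lemma heat_le: "t > 0 \<Longrightarrow> heat (t, x :: 'b::euclidean_space) \<le> (4 * pi * t) powr (- (real DIM('b) / 2))"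
  unfolding heat_def fst_conv snd_conv by (rule mult_left_le) auto

text \<open>
  The polynomial growth in \<open>|x| / \<surd>t\<close> is absorbed by half of the Gaussian exponent, which turns
  the kernel at time \<open>t\<close> into the kernel at time \<open>2t\<close>.
\<close>
lemma parabolic_heat_bound:
  fixes q :: "real \<times> 'b::euclidean_space \<Rightarrow> real"
  assumes "parabolic m q"
  obtains C where "C \<ge> 0" "\<And>t x. t > 0 \<Longrightarrow> \<bar>q (t, x) * heat (t, x)\<bar> \<le> C * (t powr (- real m / 2) * heat (2 * t, x))"
proof -
  obtain C where "C \<ge> 0" and C: "\<And>t x. t > 0 \<Longrightarrow> \<bar>q (t, x)\<bar> \<le> C * (t powr (- real m / 2) * (1 + norm x / sqrt t) ^ m)"
    using parabolic_bound[OF assms] by blast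
  obtain D where "D \<ge> 0" and D: "\<And>r::real. r \<ge> 0 \<Longrightarrow> (1 + r) ^ m * exp (- (r\<^sup>2 / 8)) \<le> D"
    using power_times_gaussian_bounded by blast
  let ?c = "2 powr (real DIM('b) / 2)"
  have "\<bar>q (t, x) * heat (t, x)\<bar> \<le> (C * D * ?c) * (t powr (- real m / 2) * heat (2 * t, x))"
    if t: "t > 0" for t x
  proof -
    let ?r = "norm x / sqrt t"
    have r: "?r\<^sup>2 = (norm x)\<^sup>2 / t" using t by (simp add: power_divide)
    have "(8 * pi * t) powr (- (real DIM('b) / 2)) = (4 * pi * t) powr (- (real DIM('b) / 2)) * 2 powr (- (real DIM('b) / 2))"
      using t by (subst powr_mult[symmetric]) (auto simp: mult_ac)
    then have "?c * (8 * pi * t) powr (- (real DIM('b) / 2)) = (4 * pi * t) powr (- (real DIM('b) / 2))"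
      by (simp add: powr_minus field_simps)
    moreover have "exp (- ((norm x)\<^sup>2 / (4 * t))) = exp (- (?r\<^sup>2 / 8)) * exp (- ((norm x)\<^sup>2 / (4 * (2 * t))))"
      unfolding r exp_add[symmetric] using t by (simp add: field_simps)
    ultimately have h: "heat (t, x) = ?c * heat (2 * t, x) * exp (- (?r\<^sup>2 / 8))"
      unfolding heat_def by (simp add: mult_ac)
    have "\<bar>q (t, x) * heat (t, x)\<bar> = \<bar>q (t, x)\<bar> * heat (t, x)"
      by (simp add: abs_mult)
    also have "\<dots> \<le> (C * (t powr (- real m / 2) * (1 + ?r) ^ m)) * heat (t, x)"
      by (intro mult_right_mono C t heat_nonneg)
    also have "\<dots> = (C * t powr (- real m / 2) * ?c * heat (2 * t, x)) * ((1 + ?r) ^ m * exp (- (?r\<^sup>2 / 8)))"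
      unfolding h by (simp add: mult_ac)
    also have "\<dots> \<le> (C * t powr (- real m / 2) * ?c * heat (2 * t, x)) * D"
      using \<open>C \<ge> 0\<close> by (intro mult_left_mono D mult_nonneg_nonneg heat_nonneg) (use t in auto)
    finally show ?thesis by (simp add: mult_ac)
  qed
  then show thesis using that[of "C * D * ?c"] \<open>C \<ge> 0\<close> \<open>D \<ge> 0\<close> by auto
qed

lemma heat_has_derivative:
  fixes z :: "real \<times> 'b::euclidean_space"
  assumes "fst z > 0"
  shows "(heat has_derivative (\<lambda>v. (- (real DIM('b) / 2) * fst v / fst z + (norm (snd z))\<^sup>2 * fst v / (4 * (fst z * fst z))
    - (snd z \<bullet> snd v) / (2 * fst z)) * heat z)) (at z)"
proof -
  have 1: "((\<lambda>z. (4 * pi * fst z) powr (- (real DIM('b) / 2))) has_derivative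
      (\<lambda>v. - (real DIM('b) / 2) * fst v / fst z * (4 * pi * fst z) powr (- (real DIM('b) / 2)))) (at z)"
    using assms by (auto intro!: derivative_eq_intros simp: fun_eq_iff field_simps)
  have 2: "((\<lambda>z. exp (- ((norm (snd z))\<^sup>2 / (4 * fst z)))) has_derivative
      (\<lambda>v. ((norm (snd z))\<^sup>2 * fst v / (4 * (fst z * fst z)) - (snd z \<bullet> snd v) / (2 * fst z)) *
        exp (- ((norm (snd z))\<^sup>2 / (4 * fst z))))) (at z)"
    unfolding power2_norm_eq_inner using assms
    by (auto intro!: derivative_eq_intros simp: fun_eq_iff field_simps inner_commute power2_eq_square)
  show ?thesis unfolding heat_def[abs_def]
    by (rule has_derivative_eq_rhs[OF has_derivative_mult[OF 1 2]]) (auto simp: fun_eq_iff algebra_simps)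
qed

lemma dderiv_heat:
  fixes z :: "real \<times> 'b::euclidean_space"
  assumes "fst z > 0"
  shows "heat differentiable (at z)"
    "dderiv (1, 0) heat z = (- (real DIM('b) / 2) / fst z + (norm (snd z))\<^sup>2 / (4 * (fst z * fst z))) * heat z"
    "dderiv (0, c) heat z = - ((snd z \<bullet> c) / (2 * fst z)) * heat z"
  using dderiv_eqI[OF heat_has_derivative[OF assms]] heat_has_derivative[OF assms]
  by (auto simp: differentiable_def)

lemma open_positive_time: "open {z :: real \<times> 'b::euclidean_space. fst z > 0}"
  by (intro open_Collect_less continuous_intros)

lemma Basis_spacetime:
  "b \<in> (Basis :: (real \<times> 'b::euclidean_space) set) \<longleftrightarrow> b = (1, 0) \<or> (\<exists>c\<in>Basis. b = (0, c))"
  by (auto simp: Basis_prod_def)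

lemma parabolic_heat_derivative:
  fixes b :: "real \<times> 'b::euclidean_space"
  assumes b: "b \<in> Basis" and q: "parabolic m q"
  shows "\<exists>q'. parabolic (m + weight b) q' \<and>
    (\<forall>z. fst z > 0 \<longrightarrow> (\<lambda>z. q z * heat z) differentiable (at z) \<and> dderiv b (\<lambda>z. q z * heat z) z = q' z * heat z)"
proof -
  obtain q' where q': "parabolic (m + weight b) q'" "\<And>z. fst z > 0 \<Longrightarrow> dderiv b q z = q' z"
    and dq: "\<And>z. fst z > 0 \<Longrightarrow> q differentiable (at z)"
    using parabolic_derivative[OF b q] by blast
  have "\<exists>l :: real \<times> 'b \<Rightarrow> real. parabolic (weight b) l \<and> (\<forall>z. fst z > 0 \<longrightarrow> dderiv b heat z = l z * heat z)"
    using b unfolding Basis_spacetime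
  proof
    assume b: "b = (1, 0)"
    have s: "(\<Sum>c\<in>Basis. (1/4) * (((x \<bullet> c) / t) * ((x \<bullet> c) / t))) = (norm x)\<^sup>2 / (4 * (t * t))" for x :: 'b and t
      unfolding power2_norm_eq_inner euclidean_inner[of x x] by (simp add: sum_divide_distrib)
    have "parabolic 2 (\<lambda>z::real \<times> 'b. - (real DIM('b) / 2) * (1 / fst z) +
        (\<Sum>c\<in>Basis. (1/4) * (((snd z \<bullet> c) / fst z) * ((snd z \<bullet> c) / fst z))))"
      using parabolic_mult[OF parabolic_coord parabolic_coord]
      by (intro parabolic_add parabolic_cmult parabolic_sum parabolic_time) (simp add: numeral_2_eq_2)
    then show ?thesis using b unfolding s
      by (intro exI[of _ "\<lambda>z::real \<times> 'b. - (real DIM('b) / 2) * (1 / fst z) + (norm (snd z))\<^sup>2 / (4 * (fst z * fst z))"])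
        (auto simp: weight_def dderiv_heat)
  next
    assume "\<exists>c\<in>Basis. b = (0, c)"
    then obtain c where b: "b = (0, c)" by blast
    show ?thesis using b parabolic_cmult[OF parabolic_coord, of "- 1 / 2" c]
      by (intro exI[of _ "\<lambda>z. (- 1 / 2) * ((snd z \<bullet> c) / fst z)"]) (auto simp: weight_def dderiv_heat)
  qed
  then obtain l :: "real \<times> 'b \<Rightarrow> real" where l: "parabolic (weight b) l" "\<And>z. fst z > 0 \<Longrightarrow> dderiv b heat z = l z * heat z"
    by blast
  have "(\<lambda>z. q z * heat z) differentiable (at z)" if "fst z > 0" for z
    by (intro differentiable_mult dq dderiv_heat(1) that)
  moreover have "dderiv b (\<lambda>z. q z * heat z) z = (q' z + q z * l z) * heat z" if "fst z > 0" for z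
    using that by (subst dderiv_mult) (auto simp: dq dderiv_heat q' l algebra_simps)
  moreover have "parabolic (m + weight b) (\<lambda>z. q' z + q z * l z)"
    by (intro parabolic_add q' parabolic_mult q l)
  ultimately show ?thesis by (intro exI[of _ "\<lambda>z. q' z + q z * l z"]) auto
qed

lemma Ds_parabolic_heat:
  fixes q :: "real \<times> 'b::euclidean_space \<Rightarrow> real"
  assumes "parabolic m q" "set vs \<subseteq> Basis"
  shows "\<exists>q'. parabolic (m + sum_list (map weight vs)) q' \<and>
    (\<forall>z. fst z > 0 \<longrightarrow> Ds vs (\<lambda>z. q z * heat z) z = q' z * heat z)"
  using assms
proof (induct vs arbitrary: m q)
  case Nil
  then show ?case by auto
next
  case (Cons v vs)
  obtain r where r: "parabolic (m + weight v) r"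
    "\<And>z. fst z > 0 \<Longrightarrow> dderiv v (\<lambda>z. q z * heat z) z = r z * heat z"
    using parabolic_heat_derivative[of v m q] Cons.prems by auto
  obtain q' where q': "parabolic (m + weight v + sum_list (map weight vs)) q'"
    "\<And>z. fst z > 0 \<Longrightarrow> Ds vs (\<lambda>z. r z * heat z) z = q' z * heat z"
    using Cons.hyps[OF r(1)] Cons.prems by auto
  have "Ds vs (dderiv v (\<lambda>z. q z * heat z)) z = Ds vs (\<lambda>z. r z * heat z) z" if "fst z > 0" for z
    by (rule Ds_cong_open[OF open_positive_time]) (use r that in auto)
  then show ?case using q' by (intro exI[of _ q']) (auto simp: add_ac)
qed

lemma Ds_heat:
  assumes "set vs \<subseteq> Basis"
  obtains q :: "real \<times> 'b::euclidean_space \<Rightarrow> real"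
  where "parabolic (sum_list (map weight vs)) q" "\<And>z. fst z > 0 \<Longrightarrow> Ds vs heat z = q z * heat z"
  using Ds_parabolic_heat[OF parabolic_const[of 1] assms] by auto

lemma Ds_heat_differentiable:
  fixes z :: "real \<times> 'b::euclidean_space"
  assumes "set vs \<subseteq> Basis" "fst z > 0"
  shows "Ds vs heat differentiable (at z)"
proof -
  obtain q :: "real \<times> 'b \<Rightarrow> real" where q: "parabolic (sum_list (map weight vs)) q"
    "\<And>z. fst z > 0 \<Longrightarrow> Ds vs heat z = q z * heat z" using Ds_heat[OF assms(1)] by blast
  obtain b :: "real \<times> 'b" where b: "b \<in> Basis" using nonempty_Basis by blast
  have "(\<lambda>z. q z * heat z) differentiable (at z)"
    using parabolic_heat_derivative[OF b q(1)] assms(2) by blast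
  then show ?thesis using differentiable_cong_open[OF open_positive_time, of z "Ds vs heat" "\<lambda>z. q z * heat z"] q(2) assms(2)
    by auto
qed

lemma Ds_heat_bound:
  assumes "set vs \<subseteq> Basis"
  obtains C where "C \<ge> 0" "\<And>t (x :: 'b::euclidean_space). t > 0 \<Longrightarrow>
    \<bar>Ds vs heat (t, x)\<bar> \<le> C * (t powr (- real (sum_list (map weight vs)) / 2) * heat (2 * t, x))"
proof -
  obtain q :: "real \<times> 'b \<Rightarrow> real" where q: "parabolic (sum_list (map weight vs)) q"
    "\<And>z. fst z > 0 \<Longrightarrow> Ds vs heat z = q z * heat z" using Ds_heat[OF assms(1)] by blast
  obtain C where "C \<ge> 0" "\<And>t x. t > 0 \<Longrightarrow> \<bar>q (t, x) * heat (t, x)\<bar> \<le>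
    C * (t powr (- real (sum_list (map weight vs)) / 2) * heat (2 * t, x))"
    using parabolic_heat_bound[OF q(1)] by blast
  then show thesis using that[of C] q(2) by simp
qed

lemma heat_equation:
  fixes z :: "real \<times> 'b::euclidean_space"
  assumes z: "fst z > 0"
  shows "dderiv (1, 0) heat z = (\<Sum>c\<in>Basis. dderiv (0, c) (dderiv (0, c) heat) z)"
proof -
  have "dderiv (0, c) (dderiv (0, c) heat) z
      = (- 1 / (2 * fst z) + (snd z \<bullet> c) * (snd z \<bullet> c) / (4 * (fst z * fst z))) * heat z" if c: "c \<in> Basis" for c :: 'b
  proof -
    have "dderiv (0, c) (dderiv (0, c) heat) z = dderiv (0, c) (\<lambda>z. - ((snd z \<bullet> c) / (2 * fst z)) * heat z) z"
      by (rule dderiv_cong_open[OF open_positive_time]) (use z dderiv_heat(3) in auto)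
    also have "\<dots> = dderiv (0, c) (\<lambda>z. - ((snd z \<bullet> c) / (2 * fst z))) z * heat z
        + - ((snd z \<bullet> c) / (2 * fst z)) * dderiv (0, c) heat z"
    proof (intro dderiv_mult dderiv_heat z)
      have "((\<lambda>z. - ((snd z \<bullet> c) / (2 * fst z))) has_derivative
         (\<lambda>v. - ((snd v \<bullet> c) / (2 * fst z) - (snd z \<bullet> c) * fst v / (2 * (fst z * fst z))))) (at z)"
        using z by (auto intro!: derivative_eq_intros simp: fun_eq_iff field_simps)
      then show "(\<lambda>z. - ((snd z \<bullet> c) / (2 * fst z))) differentiable (at z)" using differentiable_def by blast
    qed
    also have "dderiv (0, c) (\<lambda>z. - ((snd z \<bullet> c) / (2 * fst z))) z = - 1 / (2 * fst z)"
    proof -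
      have "((\<lambda>z. - ((snd z \<bullet> c) / (2 * fst z))) has_derivative
         (\<lambda>v. - ((snd v \<bullet> c) / (2 * fst z) - (snd z \<bullet> c) * fst v / (2 * (fst z * fst z))))) (at z)"
        using z by (auto intro!: derivative_eq_intros simp: fun_eq_iff field_simps)
      from dderiv_eqI[OF this, of "(0, c)"] show ?thesis using c by simp
    qed
    finally show ?thesis using z by (simp add: dderiv_heat field_simps)
  qed
  then have "(\<Sum>c\<in>Basis. dderiv (0, c) (dderiv (0, c) heat) z)
      = (\<Sum>c\<in>(Basis::'b set). (- 1 / (2 * fst z) + (snd z \<bullet> c) * (snd z \<bullet> c) / (4 * (fst z * fst z)))) * heat z"
    by (simp add: sum_distrib_right)
  also have "(\<Sum>c\<in>(Basis::'b set). (- 1 / (2 * fst z) + (snd z \<bullet> c) * (snd z \<bullet> c) / (4 * (fst z * fst z))))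
      = - (real DIM('b) / 2) / fst z + (norm (snd z))\<^sup>2 / (4 * (fst z * fst z))"
    unfolding power2_norm_eq_inner euclidean_inner[of "snd z" "snd z"]
    by (simp add: sum_subtractf sum_divide_distrib)
  finally show ?thesis using dderiv_heat(2)[OF z] by simp
qed

subsection \<open>Integrals of the heat kernel\<close>

text \<open>
  The kernel is the density of independent normal coordinates with variance \<open>2t\<close>; its mass is obtained
  from that.
\<close>
lemma heat_eq_prod:
  fixes x :: "'b::euclidean_space"
  assumes "t > 0"
  shows "heat (t, x) = (\<Prod>b\<in>Basis. normal_density 0 (sqrt (2 * t)) (x \<bullet> b))"
proof -
  have "(\<Prod>b\<in>Basis. normal_density 0 (sqrt (2 * t)) (x \<bullet> b))
      = (\<Prod>b\<in>(Basis::'b set). 1 / sqrt (4 * pi * t)) * (\<Prod>b\<in>Basis. exp (- ((x \<bullet> b)\<^sup>2 / (4 * t))))"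
    using assms unfolding prod.distrib[symmetric] by (simp add: normal_density_def mult_ac)
  also have "(\<Prod>b\<in>(Basis::'b set). 1 / sqrt (4 * pi * t)) = (4 * pi * t) powr (- (real DIM('b) / 2))"
    using assms by (simp add: powr_half_sqrt[symmetric] powr_minus_divide powr_powr[symmetric] powr_realpow power_one_over
      del: powr_powr) (simp add: powr_powr powr_realpow[symmetric])
  also have "(\<Prod>b\<in>Basis. exp (- ((x \<bullet> b)\<^sup>2 / (4 * t)))) = exp (- ((norm x)\<^sup>2 / (4 * t)))"
    unfolding exp_sum[OF finite_Basis, symmetric] power2_norm_eq_inner euclidean_inner[of x x]
    by (simp add: sum_negf sum_divide_distrib power2_eq_square)
  finally show ?thesis by (simp add: heat_def)
qed

lemma heat_measurable [measurable]: "heat \<in> borel_measurable (borel \<Otimes>\<^sub>M borel)"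
  unfolding heat_def[abs_def] by measurable

lemma has_integral_heat:
  fixes t :: real
  assumes t: "t > 0"
  shows "has_bochner_integral lborel (\<lambda>x::'b::euclidean_space. heat (t, x)) 1"
proof -
  interpret product_sigma_finite "\<lambda>_::'b. lborel :: real measure" by standard
  let ?n = "normal_density 0 (sqrt (2 * t))"
  have s: "0 < sqrt (2 * t)" using t by simp
  have i: "integrable lborel ?n" "(\<integral>x. ?n x \<partial>lborel) = 1" using s by auto
  have e: "(\<lambda>x. heat (t, x)) = (\<lambda>x::'b. \<Prod>b\<in>Basis. ?n (x \<bullet> b))" using heat_eq_prod[OF t] by blast
  have p: "(\<lambda>f. \<Prod>b\<in>Basis. ?n ((\<Sum>c\<in>Basis. f c *\<^sub>R c) \<bullet> b)) = (\<lambda>f. \<Prod>b\<in>(Basis::'b set). ?n (f b))"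
    by (auto intro!: prod.cong simp: inner_sum_left inner_Basis if_distrib sum.delta cong: if_cong)
  have "integrable (\<Pi>\<^sub>M b\<in>(Basis::'b set). lborel) (\<lambda>f. \<Prod>b\<in>(Basis::'b set). ?n (f b))"
    by (rule product_integrable_prod) (use i in auto)
  moreover have "(\<integral>f. (\<Prod>b\<in>(Basis::'b set). ?n (f b)) \<partial>(\<Pi>\<^sub>M b\<in>(Basis::'b set). lborel)) = 1"
    by (subst product_integral_prod) (use i in auto)
  ultimately show ?thesis
    unfolding has_bochner_integral_iff e lborel_eq[where 'a='b]
    by (subst integrable_distr_eq, simp_all add: p) (subst integral_distr, simp_all add: p)
qed

lemma has_integral_heat_translate:
  fixes x :: "'b::euclidean_space"
  assumes t: "t > 0"
  shows "has_bochner_integral lborel (\<lambda>y. heat (t, y - x)) 1" "has_bochner_integral lborel (\<lambda>y. heat (t, x - y)) 1"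
proof -
  have e: "heat (t, x - y) = heat (t, y - x)" for y by (simp add: heat_def norm_minus_commute)
  have "has_bochner_integral lborel (\<lambda>y. heat (t, - x + y)) 1"
    using has_integral_heat[OF t, where 'b='b]
    by (subst (asm) lborel_distr_plus[of "- x", symmetric])
      (simp add: has_bochner_integral_iff integrable_distr_eq integral_distr)
  then show "has_bochner_integral lborel (\<lambda>y. heat (t, y - x)) 1" by simp
  then show "has_bochner_integral lborel (\<lambda>y. heat (t, x - y)) 1" by (simp add: e)
qed

section \<open>Superpositions of heat kernels\<close>

text \<open>
  Kernels with poles at \<open>\<iota> p\<close>, weighted by \<open>\<gamma> p\<close> and reflected.  With poles on a time slice this is a
  solution of the backward heat equation with prescribed final values, with poles in a space-time
  cylinder it is a potential.
\<close>
definition superpose ::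
  "'p::euclidean_space set \<Rightarrow> ('p \<Rightarrow> 'a) \<Rightarrow> ('p \<Rightarrow> real) \<Rightarrow> ('a::euclidean_space \<Rightarrow> real) \<Rightarrow> 'a \<Rightarrow> real"
  where
  "superpose P \<iota> \<gamma> K z = integral P (\<lambda>p. K (\<iota> p - z) * \<gamma> p)"

text \<open>
  Differentiation under the integral sign; the minus sign comes from the reflection.
\<close>
lemma superpose_derivative:
  fixes \<iota> :: "'p::euclidean_space \<Rightarrow> 'a::euclidean_space" and K :: "'a \<Rightarrow> real"
  assumes V: "open V" and U: "open U" "convex U"
    and UV: "\<And>z p. z \<in> U \<Longrightarrow> p \<in> cbox A B \<Longrightarrow> \<iota> p - z \<in> V"
    and \<iota>: "continuous_on (cbox A B) \<iota>" and \<gamma>: "continuous_on (cbox A B) \<gamma>"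
    and K: "\<And>z. z \<in> V \<Longrightarrow> K differentiable (at z)"
    and K': "\<And>b. b \<in> Basis \<Longrightarrow> continuous_on V (dderiv b K)"
    and z: "z \<in> U"
  shows "superpose (cbox A B) \<iota> \<gamma> K differentiable (at z)"
    "b \<in> Basis \<Longrightarrow> dderiv b (superpose (cbox A B) \<iota> \<gamma> K) z = - superpose (cbox A B) \<iota> \<gamma> (dderiv b K) z"
proof -
  define D where "D z p = Blinfun (\<lambda>v. - dderiv v K (\<iota> p - z) * \<gamma> p)" for z p
  have dK: "(K has_derivative (\<lambda>v. dderiv v K y)) (at y)" if "y \<in> V" for y
    using has_derivative_dderiv K that by blast
  have D: "blinfun_apply (D z p) v = - dderiv v K (\<iota> p - z) * \<gamma> p" if "z \<in> U" "p \<in> cbox A B" for z p v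
  proof -
    have "bounded_linear (\<lambda>v. - dderiv v K (\<iota> p - z) * \<gamma> p)"
      using has_derivative_bounded_linear[OF dK[OF UV[OF that]]]
      by (intro bounded_linear_mult_const bounded_linear_minus)
    then show ?thesis unfolding D_def by (simp add: bounded_linear_Blinfun_apply)
  qed
  have Kc: "continuous_on V K"
    using K by (intro continuous_at_imp_continuous_on ballI differentiable_imp_continuous_within) auto
  have i1: "(\<lambda>p. K (\<iota> p - z) * \<gamma> p) integrable_on cbox A B" if "z \<in> U" for z
    using UV that by (intro integrable_continuous continuous_intros continuous_on_compose2[OF Kc] \<iota> \<gamma>) auto
  have c1: "continuous_on (U \<times> cbox A B) (\<lambda>(z, p). D z p)"
  proof (rule continuous_on_blinfun_componentwise)
    fix i :: 'a assume i: "i \<in> Basis"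
    have "continuous_on (U \<times> cbox A B) (\<lambda>x. - dderiv i K (\<iota> (snd x) - fst x) * \<gamma> (snd x))"
      using UV by (intro continuous_intros continuous_on_compose2[OF K'[OF i]]
          continuous_on_compose2[OF \<iota>] continuous_on_compose2[OF \<gamma>]) auto
    then show "continuous_on (U \<times> cbox A B) (\<lambda>x. blinfun_apply (case x of (z, p) \<Rightarrow> D z p) i)"
      by (rule continuous_on_cong[THEN iffD1, rotated -1]) (auto simp: D)
  qed
  have "((\<lambda>z. integral (cbox A B) (\<lambda>p. K (\<iota> p - z) * \<gamma> p)) has_derivative
      blinfun_apply (integral (cbox A B) (D z))) (at z within U)"
  proof (rule leibniz_rule[OF _ i1 c1 z U(2)])
    fix z p assume zp: "z \<in> U" "p \<in> cbox A B"
    have "((\<lambda>z. K (\<iota> p - z)) has_derivative (\<lambda>v. dderiv (- v) K (\<iota> p - z))) (at z within U)"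
      by (rule has_derivative_compose[where f="\<lambda>z. \<iota> p - z" and g=K, OF _ dK[OF UV[OF zp]]])
        (auto intro!: derivative_eq_intros)
    from has_derivative_mult_left[OF this, of "\<gamma> p"]
    have h1: "((\<lambda>z. K (\<iota> p - z) * \<gamma> p) has_derivative (\<lambda>v. dderiv (- v) K (\<iota> p - z) * \<gamma> p)) (at z within U)" .
    have "dderiv (- v) K (\<iota> p - z) = - dderiv v K (\<iota> p - z)" for v
      using linear_neg[OF bounded_linear.linear[OF has_derivative_bounded_linear[OF dK[OF UV[OF zp]]]]] .
    then show "((\<lambda>z. K (\<iota> p - z) * \<gamma> p) has_derivative blinfun_apply (D z p)) (at z within U)"
      by (intro has_derivative_eq_rhs[OF h1]) (simp add: D[OF zp] fun_eq_iff)
  qed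
  then have h: "(superpose (cbox A B) \<iota> \<gamma> K has_derivative blinfun_apply (integral (cbox A B) (D z))) (at z)"
    using at_within_open[OF z U(1)] by (simp add: superpose_def[abs_def])
  then show "superpose (cbox A B) \<iota> \<gamma> K differentiable (at z)" using differentiable_def by blast
  assume b: "b \<in> Basis"
  have "continuous_on (cbox A B) (D z)"
    using continuous_on_compose2[OF c1 continuous_on_Pair[OF continuous_on_const[of _ z] continuous_on_id]] z
    by (simp add: image_subset_iff)
  then have "blinfun_apply (integral (cbox A B) (D z)) b = integral (cbox A B) (\<lambda>p. blinfun_apply (D z p) b)"
    by (intro blinfun_apply_integral integrable_continuous)
  also have "\<dots> = integral (cbox A B) (\<lambda>p. - (dderiv b K (\<iota> p - z) * \<gamma> p))"
    by (intro integral_cong) (simp add: D z)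
  finally show "dderiv b (superpose (cbox A B) \<iota> \<gamma> K) z = - superpose (cbox A B) \<iota> \<gamma> (dderiv b K) z"
    using dderiv_eqI[OF h] by (simp add: superpose_def)
qed

text \<open>
  All poles lie after time \<open>c\<close>, so that before \<open>c\<close> the superposition is as smooth as the heat kernel
  is at positive times.
\<close>
locale heat_superposition =
  fixes A B :: "'p::euclidean_space" and \<iota> :: "'p \<Rightarrow> real \<times> 'b::euclidean_space" and \<gamma> :: "'p \<Rightarrow> real" and c :: real
  assumes \<iota>: "continuous_on (cbox A B) \<iota>" and \<gamma>: "continuous_on (cbox A B) \<gamma>"
    and late: "\<And>p. p \<in> cbox A B \<Longrightarrow> c < fst (\<iota> p)"
begin

abbreviation "F K \<equiv> superpose (cbox A B) \<iota> \<gamma> K"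

lemma open_past: "open {z :: real \<times> 'b. fst z < c}" by (intro open_Collect_less continuous_intros)

lemma Ds_heat_continuous: "set vs \<subseteq> Basis \<Longrightarrow> continuous_on {z :: real \<times> 'b. fst z > 0} (Ds vs heat)"
  by (intro continuous_at_imp_continuous_on ballI differentiable_imp_continuous_within Ds_heat_differentiable) auto

lemma F_derivative:
  assumes vs: "set vs \<subseteq> Basis" and z: "fst z < c"
  shows "F (Ds vs heat) differentiable (at z)"
    "b \<in> Basis \<Longrightarrow> dderiv b (F (Ds vs heat)) z = - F (Ds (vs @ [b]) heat) z"
proof -
  have cv: "convex {z :: real \<times> 'b. fst z < c}"
    using convex_halfspace_lt[of "(1, 0) :: real \<times> 'b" c] by (simp add: inner_prod_def)
  have late': "\<iota> p - z \<in> {z. fst z > 0}" if "z \<in> {z. fst z < c}" "p \<in> cbox A B" for z p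
    using late[OF that(2)] that(1) by auto
  have K': "continuous_on {z :: real \<times> 'b. fst z > 0} (dderiv b (Ds vs heat))" if "b \<in> Basis" for b
    using Ds_heat_continuous[of "vs @ [b]"] vs that by (simp add: Ds_append)
  note d = superpose_derivative[OF open_positive_time open_past cv late' \<iota> \<gamma> Ds_heat_differentiable[OF vs] K']
  show "F (Ds vs heat) differentiable (at z)" by (rule d(1)) (use z in auto)
  show "b \<in> Basis \<Longrightarrow> dderiv b (F (Ds vs heat)) z = - F (Ds (vs @ [b]) heat) z"
    using z by (subst d(2)) (auto simp: Ds_append)
qed

lemma Ds_F:
  assumes "set ws \<subseteq> Basis" "set vs \<subseteq> Basis" "fst z < c"
  shows "Ds vs (\<lambda>z. e * F (Ds ws heat) z) z = (- 1) ^ length vs * e * F (Ds (ws @ vs) heat) z"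
  using assms
proof (induct vs arbitrary: ws e)
  case (Cons v vs)
  have "Ds vs (dderiv v (\<lambda>z. e * F (Ds ws heat) z)) z = Ds vs (\<lambda>z. (- e) * F (Ds (ws @ [v]) heat) z) z"
  proof (rule Ds_cong_open[OF open_past])
    fix y :: "real \<times> 'b" assume "y \<in> {z. fst z < c}"
    then show "dderiv v (\<lambda>z. e * F (Ds ws heat) z) y = (- e) * F (Ds (ws @ [v]) heat) y"
      using F_derivative(1)[OF Cons.prems(1), of y] F_derivative(2)[OF Cons.prems(1), of y v] Cons.prems
      by (subst dderiv_mult) (auto simp: dderiv_const)
  qed (use Cons.prems in auto)
  also have "\<dots> = (- 1) ^ length vs * (- e) * F (Ds ((ws @ [v]) @ vs) heat) z"
    by (rule Cons.hyps) (use Cons.prems in auto)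
  finally show ?case by simp
qed simp

lemma Ds_F_heat:
  assumes "set vs \<subseteq> Basis" "fst z < c"
  shows "Ds vs (F heat) z = (- 1) ^ length vs * F (Ds vs heat) z"
  using Ds_F[of "[]" vs z 1] assms by simp

lemma Ds_F_differentiable:
  assumes "set vs \<subseteq> Basis" "fst z < c"
  shows "Ds vs (F heat) differentiable (at z)"
proof (rule differentiable_cong_open[OF open_past, of z _ "\<lambda>z. (- 1) ^ length vs * F (Ds vs heat) z"])
  show "(\<lambda>z. (- 1) ^ length vs * F (Ds vs heat) z) differentiable (at z)"
    using F_derivative(1)[OF assms] by (intro differentiable_mult differentiable_const)
qed (use assms Ds_F_heat in auto)

lemma integrable_F:
  assumes "set vs \<subseteq> Basis" "fst z < c"
  shows "continuous_on (cbox A B) (\<lambda>p. Ds vs heat (\<iota> p - z) * \<gamma> p)"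
  using late assms(2)
  by (intro continuous_intros continuous_on_compose2[OF Ds_heat_continuous[OF assms(1)]] \<iota> \<gamma>) force+

text \<open>
  The poles lie in a compact set, at a time distance between two positive numbers \<open>\<tau>0\<close> and \<open>\<tau>1\<close>
  from the slab.  Hence every derivative of the superposed kernels has a Gaussian tail whose width
  does not depend on the derivative.
\<close>
lemma tame_F:
  obtains \<kappa> where "\<kappa> > 0"
    "tame {z. l < fst z \<and> fst z < c} (\<lambda>_ z. exp (- (\<kappa> * (norm (snd z))\<^sup>2))) (\<lambda>_. F heat)"
proof (cases "cbox A B = {}")
  case True
  then have "F heat = (\<lambda>z. 0)" by (simp add: superpose_def[abs_def])
  then show thesis by (intro that[of 1]) (simp_all add: tame_zero)
next
  case False
  have cf: "continuous_on (cbox A B) (\<lambda>p. fst (\<iota> p))" by (intro continuous_intros \<iota>)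
  obtain p0 where p0: "p0 \<in> cbox A B" "\<And>p. p \<in> cbox A B \<Longrightarrow> fst (\<iota> p0) \<le> fst (\<iota> p)"
    using continuous_attains_inf[OF compact_cbox False cf] by blast
  define \<tau>0 where "\<tau>0 = fst (\<iota> p0) - c"
  have \<tau>0: "\<tau>0 > 0" using late[OF p0(1)] by (simp add: \<tau>0_def)
  obtain p1 where p1: "p1 \<in> cbox A B" "\<And>p. p \<in> cbox A B \<Longrightarrow> fst (\<iota> p) \<le> fst (\<iota> p1)"
    using continuous_attains_sup[OF compact_cbox False cf] by blast
  define \<tau>1 where "\<tau>1 = \<tau>0 + \<bar>fst (\<iota> p1) - l\<bar>"
  have \<tau>1: "\<tau>1 > 0" using \<tau>0 by (simp add: \<tau>1_def)
  have "bounded ((\<lambda>p. snd (\<iota> p)) ` cbox A B)" "bounded (\<gamma> ` cbox A B)"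
    by (intro compact_imp_bounded compact_continuous_image continuous_intros \<iota> \<gamma> compact_cbox)+
  then obtain R M where R: "\<And>p. p \<in> cbox A B \<Longrightarrow> norm (snd (\<iota> p)) \<le> R" and M: "\<And>p. p \<in> cbox A B \<Longrightarrow> \<bar>\<gamma> p\<bar> \<le> M"
    by (auto simp: bounded_iff)
  \<comment> \<open>The kernel at doubled time \<open>2\<tau>\<close> has exponent \<open>|x - y|\<^sup>2 / 8\<tau>\<close>, and recentring at the origin costs a factor \<open>2\<close>.\<close>
  define \<kappa> where "\<kappa> = 1 / (16 * \<tau>1)"
  have \<kappa>: "\<kappa> > 0" using \<tau>1 by (simp add: \<kappa>_def)
  have "\<exists>C. \<forall>k. \<forall>z\<in>{z. l < fst z \<and> fst z < c}. \<bar>Ds vs (F heat) z\<bar> \<le> C * exp (- (\<kappa> * (norm (snd z))\<^sup>2))"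
    if vs: "set vs \<subseteq> Basis" for vs
  proof -
    let ?m = "sum_list (map weight vs)"
    obtain C where C: "C \<ge> 0" "\<And>t x. t > 0 \<Longrightarrow> \<bar>Ds vs heat (t, x :: 'b)\<bar> \<le> C * (t powr (- real ?m / 2) * heat (2 * t, x))"
      using Ds_heat_bound[OF vs] by blast
    let ?L = "\<tau>0 powr (- real ?m / 2) * (8 * pi * \<tau>0) powr (- (real DIM('b) / 2)) * exp (R\<^sup>2 / (8 * \<tau>1))"
    let ?D = "C * ?L * M"
    have "\<bar>Ds vs (F heat) z\<bar> \<le> (?D * measure lborel (cbox A B)) * exp (- (\<kappa> * (norm (snd z))\<^sup>2))"
      if z: "l < fst z" "fst z < c" for z
    proof -
      have "norm (integral (cbox A B) (\<lambda>p. Ds vs heat (\<iota> p - z) * \<gamma> p))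
          \<le> ?D * exp (- (\<kappa> * (norm (snd z))\<^sup>2)) * measure lborel (cbox A B)"
      proof (rule has_integral_bound[OF _ integrable_integral[OF integrable_continuous[OF integrable_F[OF vs z(2)]]]])
        have "0 \<le> M" using M[OF p0(1)] by linarith
        then show "0 \<le> ?D * exp (- (\<kappa> * (norm (snd z))\<^sup>2))" using C(1) by simp
        fix p assume p: "p \<in> cbox A B"
        let ?t = "fst (\<iota> p) - fst z" and ?x = "snd (\<iota> p) - snd z"
        have t: "\<tau>0 \<le> ?t" "?t \<le> \<tau>1" using p0(2)[OF p] p1(2)[OF p] z \<tau>0 by (auto simp: \<tau>0_def \<tau>1_def)
        have tp: "?t > 0" using t \<tau>0 by linarith
        have h: "heat (2 * ?t, ?x) \<le> (8 * pi * \<tau>0) powr (- (real DIM('b) / 2)) *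
            (exp (R\<^sup>2 / (8 * \<tau>1)) * exp (- (\<kappa> * (norm (snd z))\<^sup>2)))"
          unfolding heat_def fst_conv snd_conv
        proof (rule mult_mono)
          show "(4 * pi * (2 * ?t)) powr (- (real DIM('b) / 2)) \<le> (8 * pi * \<tau>0) powr (- (real DIM('b) / 2))"
            using t \<tau>0 by (intro powr_mono2') auto
          have "(norm (snd z))\<^sup>2 \<le> (norm ?x + norm (snd (\<iota> p)))\<^sup>2"
            using norm_triangle_sub[of "snd z" "snd (\<iota> p)"] by (intro power_mono) (auto simp: norm_minus_commute add.commute)
          also have "\<dots> \<le> 2 * (norm ?x)\<^sup>2 + 2 * (norm (snd (\<iota> p)))\<^sup>2"
            using sum_squares_bound[of "norm ?x" "norm (snd (\<iota> p))"] by (simp add: power2_sum)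
          also have "\<dots> \<le> 2 * (norm ?x)\<^sup>2 + 2 * R\<^sup>2" using R[OF p] by (simp add: power_mono)
          finally have "(norm (snd z))\<^sup>2 / (16 * \<tau>1) \<le> (2 * (norm ?x)\<^sup>2 + 2 * R\<^sup>2) / (16 * \<tau>1)"
            using \<tau>1 by (intro divide_right_mono) auto
          also have "\<dots> = (norm ?x)\<^sup>2 / (8 * \<tau>1) + R\<^sup>2 / (8 * \<tau>1)" using \<tau>1 by (simp add: field_simps)
          also have "(norm ?x)\<^sup>2 / (8 * \<tau>1) \<le> (norm ?x)\<^sup>2 / (4 * (2 * ?t))"
            using t tp by (intro divide_left_mono) auto
          finally have "- ((norm ?x)\<^sup>2 / (4 * (2 * ?t))) \<le> R\<^sup>2 / (8 * \<tau>1) + - (\<kappa> * (norm (snd z))\<^sup>2)"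
            by (simp add: \<kappa>_def)
          then show "exp (- ((norm ?x)\<^sup>2 / (4 * (2 * ?t)))) \<le> exp (R\<^sup>2 / (8 * \<tau>1)) * exp (- (\<kappa> * (norm (snd z))\<^sup>2))"
            unfolding exp_add[symmetric] by simp
        qed auto
        have "\<bar>Ds vs heat (\<iota> p - z)\<bar> \<le> C * (?t powr (- real ?m / 2) * heat (2 * ?t, ?x))"
          using C(2)[OF tp, of ?x] by (simp add: minus_prod_def)
        also have "\<dots> \<le> C * (\<tau>0 powr (- real ?m / 2) * ((8 * pi * \<tau>0) powr (- (real DIM('b) / 2)) *
            (exp (R\<^sup>2 / (8 * \<tau>1)) * exp (- (\<kappa> * (norm (snd z))\<^sup>2)))))"
          using t \<tau>0 by (intro mult_left_mono mult_mono h powr_mono2' C(1)) (auto simp: heat_nonneg)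
        finally have "\<bar>Ds vs heat (\<iota> p - z)\<bar> * \<bar>\<gamma> p\<bar> \<le> (C * ?L * exp (- (\<kappa> * (norm (snd z))\<^sup>2))) * M"
          using M[OF p] C(1) by (intro mult_mono) (auto simp: mult_ac)
        then show "norm (Ds vs heat (\<iota> p - z) * \<gamma> p) \<le> ?D * exp (- (\<kappa> * (norm (snd z))\<^sup>2))"
          by (simp add: abs_mult mult_ac)
      qed
      then show ?thesis unfolding Ds_F_heat[OF vs z(2)] superpose_def by (simp add: abs_mult power_abs mult_ac)
    qed
    then show ?thesis by blast
  qed
  then have "tame {z. l < fst z \<and> fst z < c} (\<lambda>_ z. exp (- (\<kappa> * (norm (snd z))\<^sup>2))) (\<lambda>_. F heat)"
    unfolding tame_def using Ds_F_differentiable by simp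
  then show thesis using that \<kappa> by blast
qed

end

section \<open>Square integrable functions\<close>

lemma in_Lp2_iff:
  "in_Lp 2 w \<longleftrightarrow> w \<in> borel_measurable lebesgue \<and> integrable lebesgue (\<lambda>x. (norm (w x))\<^sup>2)"
  by (simp add: in_Lp_def)

lemma Lp2_norm: "Lp_norm 2 w = sqrt (LINT x|lebesgue. (norm (w x))\<^sup>2)"
  by (simp add: Lp_norm_def powr_half_sqrt)

lemma Lp2_norm_nonneg: "0 \<le> Lp_norm 2 w" by (simp add: Lp2_norm)

lemma Lp2_norm_sq: "(Lp_norm 2 w)\<^sup>2 = (LINT x|lebesgue. (norm (w x))\<^sup>2)"
  by (simp add: Lp2_norm)

lemma in_Lp2_measurable: "in_Lp 2 w \<Longrightarrow> w \<in> borel_measurable lebesgue" by (simp add: in_Lp2_iff)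

lemma in_Lp2_inner_integrable:
  assumes "in_Lp 2 w" "in_Lp 2 k"
  shows "integrable lebesgue (\<lambda>x. w x \<bullet> k x)"
proof (rule Bochner_Integration.integrable_bound)
  show "integrable lebesgue (\<lambda>x. (norm (w x))\<^sup>2 + (norm (k x))\<^sup>2)" using assms by (simp add: in_Lp2_iff)
  show "(\<lambda>x. w x \<bullet> k x) \<in> borel_measurable lebesgue" using assms by (auto simp: in_Lp2_iff)
  have "norm (w x \<bullet> k x) \<le> norm ((norm (w x))\<^sup>2 + (norm (k x))\<^sup>2)" for x
  proof -
    have "\<bar>w x \<bullet> k x\<bar> \<le> norm (w x) * norm (k x)" by (rule Cauchy_Schwarz_ineq2)
    moreover have "2 * norm (w x) * norm (k x) \<le> (norm (w x))\<^sup>2 + (norm (k x))\<^sup>2" by (rule sum_squares_bound)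
    moreover have "0 \<le> norm (w x) * norm (k x)" by simp
    ultimately show ?thesis by simp
  qed
  then show "AE x in lebesgue. norm (w x \<bullet> k x) \<le> norm ((norm (w x))\<^sup>2 + (norm (k x))\<^sup>2)" by simp
qed

lemma in_Lp2_bounded_by:
  assumes "in_Lp 2 w" "k \<in> borel_measurable lebesgue" "\<And>x. norm (k x) \<le> C * norm (w x)" "0 \<le> C"
  shows "in_Lp 2 k" "Lp_norm 2 k \<le> C * Lp_norm 2 w"
proof -
  have i: "integrable lebesgue (\<lambda>x. C\<^sup>2 * (norm (w x))\<^sup>2)" using assms by (simp add: in_Lp2_iff)
  have le: "(norm (k x))\<^sup>2 \<le> C\<^sup>2 * (norm (w x))\<^sup>2" for x
    using power_mono[OF assms(3), of x 2] by (simp add: power_mult_distrib)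
  have ik: "integrable lebesgue (\<lambda>x. (norm (k x))\<^sup>2)"
    by (rule Bochner_Integration.integrable_bound[OF i]) (use assms(2) le in auto)
  then show "in_Lp 2 k" using assms by (simp add: in_Lp2_iff)
  have "(LINT x|lebesgue. (norm (k x))\<^sup>2) \<le> (LINT x|lebesgue. C\<^sup>2 * (norm (w x))\<^sup>2)"
    by (intro integral_mono ik i le)
  then show "Lp_norm 2 k \<le> C * Lp_norm 2 w"
    unfolding Lp2_norm using \<open>0 \<le> C\<close> real_sqrt_le_mono by (fastforce simp: real_sqrt_mult)
qed

lemma in_Lp2_add:
  assumes "in_Lp 2 w" "in_Lp 2 k" shows "in_Lp 2 (\<lambda>x. w x + k x)"
  unfolding in_Lp2_iff
proof
  show "(\<lambda>x. w x + k x) \<in> borel_measurable lebesgue" using assms by (auto simp: in_Lp2_iff)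
  have e: "(norm (w x + k x))\<^sup>2 = (norm (w x))\<^sup>2 + 2 * (w x \<bullet> k x) + (norm (k x))\<^sup>2" for x
    by (simp add: power2_norm_eq_inner inner_add_left inner_add_right inner_commute)
  show "integrable lebesgue (\<lambda>x. (norm (w x + k x))\<^sup>2)"
    unfolding e using assms in_Lp2_inner_integrable[OF assms] by (simp add: in_Lp2_iff)
qed

lemma in_Lp2_scaleR:
  assumes "in_Lp 2 w" shows "in_Lp 2 (\<lambda>x. c *\<^sub>R w x)" "Lp_norm 2 (\<lambda>x. c *\<^sub>R w x) = \<bar>c\<bar> * Lp_norm 2 w"
proof -
  show "in_Lp 2 (\<lambda>x. c *\<^sub>R w x)"
    by (rule in_Lp2_bounded_by(1)[OF assms, of _ "\<bar>c\<bar>"]) (use assms in \<open>auto simp: in_Lp2_iff\<close>)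
  show "Lp_norm 2 (\<lambda>x. c *\<^sub>R w x) = \<bar>c\<bar> * Lp_norm 2 w"
    by (simp add: Lp2_norm power_mult_distrib real_sqrt_mult)
qed

lemma in_Lp2_diff:
  assumes "in_Lp 2 w" "in_Lp 2 k" shows "in_Lp 2 (\<lambda>x. w x - k x)"
  using in_Lp2_add[OF assms(1) in_Lp2_scaleR(1)[OF assms(2), of "-1"]] by simp

lemma Lp2_Cauchy_Schwarz:
  assumes w: "in_Lp 2 w" and k: "in_Lp 2 k"
  shows "\<bar>LINT x|lebesgue. w x \<bullet> k x\<bar> \<le> Lp_norm 2 w * Lp_norm 2 k"
proof -
  let ?A = "LINT x|lebesgue. (norm (w x))\<^sup>2" and ?B = "LINT x|lebesgue. (norm (k x))\<^sup>2"
    and ?I = "LINT x|lebesgue. w x \<bullet> k x"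
  have A: "?A \<ge> 0" and B: "?B \<ge> 0" by simp_all
  have q: "0 \<le> ?A - 2 * t * ?I + t\<^sup>2 * ?B" for t
  proof -
    have e: "(norm (w x - t *\<^sub>R k x))\<^sup>2 = (norm (w x))\<^sup>2 - 2 * t * (w x \<bullet> k x) + t\<^sup>2 * (norm (k x))\<^sup>2" for x
      unfolding power2_norm_eq_inner
      by (simp add: inner_diff_left inner_diff_right inner_commute power2_eq_square algebra_simps)
    have "0 \<le> (LINT x|lebesgue. (norm (w x - t *\<^sub>R k x))\<^sup>2)" by simp
    also have "\<dots> = ?A - 2 * t * ?I + t\<^sup>2 * ?B"
      unfolding e using w k in_Lp2_inner_integrable[OF w k] by (simp add: in_Lp2_iff)
    finally show ?thesis .
  qed
  have "?I\<^sup>2 \<le> ?A * ?B"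
  proof (cases "?B = 0")
    case True
    have "?I = 0"
    proof (rule ccontr)
      assume "?I \<noteq> 0"
      then show False using q[of "(?A + 1) / (2 * ?I)"] True by simp
    qed
    then show ?thesis by (metis A B mult_nonneg_nonneg power_zero_numeral)
  next
    case False
    have "0 \<le> ?B * (?A - 2 * (?I / ?B) * ?I + (?I / ?B)\<^sup>2 * ?B)" using q B by (intro mult_nonneg_nonneg)
    also have "\<dots> = ?A * ?B - ?I\<^sup>2" using False by (simp add: field_simps power2_eq_square)
    finally show ?thesis by simp
  qed
  then have "sqrt (?I\<^sup>2) \<le> sqrt (?A * ?B)" by (rule real_sqrt_le_mono)
  then show ?thesis by (simp add: Lp2_norm real_sqrt_mult)
qed

lemma Lp2_norm_triangle:
  assumes w: "in_Lp 2 w" and k: "in_Lp 2 k"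
  shows "Lp_norm 2 (\<lambda>x. w x + k x) \<le> Lp_norm 2 w + Lp_norm 2 k"
proof -
  have e: "(norm (w x + k x))\<^sup>2 = (norm (w x))\<^sup>2 + 2 * (w x \<bullet> k x) + (norm (k x))\<^sup>2" for x
    by (simp add: power2_norm_eq_inner inner_add_left inner_add_right inner_commute)
  have "(Lp_norm 2 (\<lambda>x. w x + k x))\<^sup>2 = (Lp_norm 2 w)\<^sup>2 + 2 * (LINT x|lebesgue. w x \<bullet> k x) + (Lp_norm 2 k)\<^sup>2"
    unfolding Lp2_norm_sq e using w k in_Lp2_inner_integrable[OF w k] by (simp add: in_Lp2_iff)
  also have "\<dots> \<le> (Lp_norm 2 w + Lp_norm 2 k)\<^sup>2"
    using Lp2_Cauchy_Schwarz[OF w k] by (simp add: power2_sum)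
  finally show ?thesis
    by (rule power2_le_imp_le) (simp add: Lp2_norm_nonneg)
qed

lemma in_Lp2_component:
  fixes w :: "'a::euclidean_space \<Rightarrow> real^'n"
  assumes "in_Lp 2 w"
  shows "in_Lp 2 (\<lambda>x. w x $ i)" "Lp_norm 2 (\<lambda>x. w x $ i) \<le> Lp_norm 2 w"
proof -
  have m: "(\<lambda>x. w x $ i) \<in> borel_measurable lebesgue"
    using assms borel_measurable_inner[of w lebesgue "\<lambda>_. axis i 1"] by (simp add: in_Lp2_iff inner_axis)
  show "in_Lp 2 (\<lambda>x. w x $ i)" "Lp_norm 2 (\<lambda>x. w x $ i) \<le> Lp_norm 2 w"
    using in_Lp2_bounded_by[OF assms m, of 1] component_le_norm_cart by auto
qed

lemma Lp2_norm_components: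
  fixes w :: "'a::euclidean_space \<Rightarrow> real^'n"
  assumes w: "in_Lp 2 w"
  shows "Lp_norm 2 w \<le> (\<Sum>i\<in>UNIV. Lp_norm 2 (\<lambda>x. w x $ i))"
proof (rule power2_le_imp_le)
  have i: "integrable lebesgue (\<lambda>x. (norm (w x $ i))\<^sup>2)" for i using in_Lp2_component(1)[OF w, of i] by (simp add: in_Lp2_iff)
  have "(Lp_norm 2 w)\<^sup>2 = (LINT x|lebesgue. (\<Sum>i\<in>UNIV. (norm (w x $ i))\<^sup>2))"
    unfolding Lp2_norm_sq power2_norm_eq_inner inner_vec_def by simp
  also have "\<dots> = (\<Sum>i\<in>UNIV. (Lp_norm 2 (\<lambda>x. w x $ i))\<^sup>2)" unfolding Lp2_norm_sq by (intro Bochner_Integration.integral_sum i)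
  also have "\<dots> \<le> (\<Sum>i\<in>UNIV. Lp_norm 2 (\<lambda>x. w x $ i) * (\<Sum>i\<in>UNIV. Lp_norm 2 (\<lambda>x. w x $ i)))"
    unfolding power2_eq_square by (intro sum_mono mult_left_mono member_le_sum) (auto simp: Lp2_norm_nonneg)
  also have "\<dots> = (\<Sum>i\<in>UNIV. Lp_norm 2 (\<lambda>x. w x $ i))\<^sup>2" by (simp add: sum_distrib_right power2_eq_square)
  finally show "(Lp_norm 2 w)\<^sup>2 \<le> (\<Sum>i\<in>UNIV. Lp_norm 2 (\<lambda>x. w x $ i))\<^sup>2" .
qed (intro sum_nonneg Lp2_norm_nonneg)

lemma integrable_lebesgue_lborel:
  fixes f :: "'a::euclidean_space \<Rightarrow> 'b::euclidean_space"
  assumes "f \<in> borel_measurable borel"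
  shows "integrable lebesgue f \<longleftrightarrow> integrable lborel f" "integral\<^sup>L lebesgue f = integral\<^sup>L lborel f"
  using assms by (simp_all add: integrable_completion integral_completion)

lemma in_Lp2_lborel:
  fixes w :: "'a::euclidean_space \<Rightarrow> 'b::euclidean_space"
  assumes "w \<in> borel_measurable borel"
  shows "in_Lp 2 w \<longleftrightarrow> integrable lborel (\<lambda>x. (norm (w x))\<^sup>2)"
    "(Lp_norm 2 w)\<^sup>2 = (\<integral>x. (norm (w x))\<^sup>2 \<partial>lborel)"
proof -
  have "(\<lambda>x. (norm (w x))\<^sup>2) \<in> borel_measurable borel" using assms by measurable
  moreover have "w \<in> borel_measurable lebesgue" using assms by (simp add: measurable_completion)
  ultimately show "in_Lp 2 w \<longleftrightarrow> integrable lborel (\<lambda>x. (norm (w x))\<^sup>2)"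
    "(Lp_norm 2 w)\<^sup>2 = (\<integral>x. (norm (w x))\<^sup>2 \<partial>lborel)"
    by (simp_all add: in_Lp2_iff Lp2_norm_sq integrable_lebesgue_lborel)
qed

lemma in_Lp2_gaussian:
  assumes "\<kappa> > 0" shows "in_Lp 2 (\<lambda>x::'b::euclidean_space. exp (- (\<kappa> * (norm x)\<^sup>2)))"
proof -
  have "integrable lborel (\<lambda>x::'b. (4 * pi * (1 / (8 * \<kappa>))) powr (real DIM('b) / 2) * heat (1 / (8 * \<kappa>), x))"
    using has_integral_heat[of "1 / (8 * \<kappa>)", where 'b='b] assms by (simp add: has_bochner_integral_iff)
  moreover have "(4 * pi * (1 / (8 * \<kappa>))) powr (real DIM('b) / 2) * heat (1 / (8 * \<kappa>), x) = (norm (exp (- (\<kappa> * (norm x)\<^sup>2))))\<^sup>2" for x :: 'b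
    using assms by (simp add: heat_def powr_minus field_simps exp_double[symmetric])
  ultimately have "integrable lborel (\<lambda>x::'b. (norm (exp (- (\<kappa> * (norm x)\<^sup>2))))\<^sup>2)" by (simp only:)
  then show ?thesis by (subst in_Lp2_lborel) (auto intro!: borel_measurable_continuous_onI continuous_intros)
qed

section \<open>The heat semigroup\<close>

definition heat_flow :: "real \<Rightarrow> ('b::euclidean_space \<Rightarrow> real) \<Rightarrow> 'b \<Rightarrow> real" where
  "heat_flow t \<psi> x = (\<integral>y. heat (t, y - x) * \<psi> y \<partial>lborel)"

lemma heat_measurable_shift [measurable]:
  "(\<lambda>y. heat (t, y - x :: 'b::euclidean_space)) \<in> borel_measurable borel"
  "(\<lambda>p. heat (t, snd p - fst p :: 'b::euclidean_space)) \<in> borel_measurable (borel \<Otimes>\<^sub>M borel)"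
  by measurable

lemma heat_times_integrable:
  fixes \<phi> :: "'b::euclidean_space \<Rightarrow> real"
  assumes "t > 0" "integrable lborel \<phi>"
  shows "integrable lborel (\<lambda>y. heat (t, y - x) * \<phi> y)"
proof (rule Bochner_Integration.integrable_bound)
  show "integrable lborel (\<lambda>y. (4 * pi * t) powr (- (real DIM('b) / 2)) * \<phi> y)" using assms by simp
  show "AE y in lborel. norm (heat (t, y - x) * \<phi> y) \<le> norm ((4 * pi * t) powr (- (real DIM('b) / 2)) * \<phi> y)"
    using heat_le[OF assms(1), where 'b='b] by (intro AE_I2) (simp add: abs_mult mult_right_mono)
qed (use assms(2) in measurable)

lemma heat_flow_mass:
  fixes \<phi> :: "'b::euclidean_space \<Rightarrow> real"
  assumes t: "t > 0" and \<phi>: "integrable lborel \<phi>" "\<And>y. \<phi> y \<ge> 0"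
  shows "has_bochner_integral lborel (heat_flow t \<phi>) (\<integral>y. \<phi> y \<partial>lborel)"
proof -
  have [measurable]: "\<phi> \<in> borel_measurable borel" using \<phi>(1) by auto
  have nn: "ennreal (heat_flow t \<phi> x) = (\<integral>\<^sup>+y. ennreal (heat (t, y - x) * \<phi> y) \<partial>lborel)" for x
    unfolding heat_flow_def using heat_times_integrable[OF t \<phi>(1)] \<phi>(2)
    by (intro nn_integral_eq_integral[symmetric]) auto
  have "(\<integral>\<^sup>+x. ennreal (heat_flow t \<phi> x) \<partial>lborel)
      = (\<integral>\<^sup>+x. (\<integral>\<^sup>+y. ennreal (heat (t, y - x) * \<phi> y) \<partial>lborel) \<partial>lborel)" unfolding nn ..
  also have "\<dots> = (\<integral>\<^sup>+y. (\<integral>\<^sup>+x. ennreal (heat (t, y - x) * \<phi> y) \<partial>lborel) \<partial>lborel)"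
    by (rule lborel_pair.Fubini') measurable
  also have "\<dots> = (\<integral>\<^sup>+y. ennreal (\<phi> y) \<partial>lborel)"
  proof (rule nn_integral_cong)
    fix y :: 'b
    have "(\<integral>\<^sup>+x. ennreal (heat (t, y - x)) \<partial>lborel) = ennreal 1"
      using has_integral_heat_translate(2)[OF t, of y] heat_nonneg
      by (subst nn_integral_eq_integral) (auto simp: has_bochner_integral_iff)
    then show "(\<integral>\<^sup>+x. ennreal (heat (t, y - x) * \<phi> y) \<partial>lborel) = ennreal (\<phi> y)"
      using heat_nonneg \<phi>(2) by (simp add: ennreal_mult nn_integral_multc)
  qed
  also have "\<dots> = ennreal (\<integral>y. \<phi> y \<partial>lborel)"
    by (rule nn_integral_eq_integral[OF \<phi>(1)]) (use \<phi>(2) in auto)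
  finally show ?thesis
  proof (intro has_bochner_integral_nn_integral)
    show "heat_flow t \<phi> \<in> borel_measurable lborel" unfolding heat_flow_def[abs_def]
      by (intro lborel.borel_measurable_lebesgue_integral) measurable
    show "0 \<le> (\<integral>y. \<phi> y \<partial>lborel)" using \<phi>(2) by simp
    show "AE x in lborel. 0 \<le> heat_flow t \<phi> x"
      using \<phi>(2) heat_nonneg by (intro AE_I2) (simp add: heat_flow_def)
  qed
qed

lemma heat_flow_measurable:
  assumes [measurable]: "\<psi> \<in> borel_measurable borel"
  shows "heat_flow t \<psi> \<in> borel_measurable borel"
proof -
  have "(\<lambda>x. \<integral>y. heat (t, y - x) * \<psi> y \<partial>lborel) \<in> borel_measurable borel"
    by (rule lborel.borel_measurable_lebesgue_integral) measurable
  then show ?thesis by (simp add: heat_flow_def[abs_def])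
qed

text \<open>
  Jensen's inequality for the probability density \<open>heat (t, y - x)\<close>: the variance is nonnegative.
\<close>
lemma heat_flow_sq_le:
  fixes \<psi> :: "'b::euclidean_space \<Rightarrow> real"
  assumes t: "t > 0" and \<psi>: "integrable lborel \<psi>" "integrable lborel (\<lambda>y. (\<psi> y)\<^sup>2)"
  shows "(heat_flow t \<psi> x)\<^sup>2 \<le> heat_flow t (\<lambda>y. (\<psi> y)\<^sup>2) x"
proof -
  let ?m = "heat_flow t \<psi> x"
  have h: "has_bochner_integral lborel (\<lambda>y. heat (t, y - x)) 1" using has_integral_heat_translate(1)[OF t] .
  have i: "integrable lborel (\<lambda>y. heat (t, y - x) * (\<psi> y)\<^sup>2)" "integrable lborel (\<lambda>y. heat (t, y - x) * \<psi> y)"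
    "integrable lborel (\<lambda>y. heat (t, y - x))" "(\<integral>y. heat (t, y - x) \<partial>lborel) = 1"
    using heat_times_integrable[OF t] \<psi> h by (auto simp: has_bochner_integral_iff)
  have "0 \<le> (\<integral>y. heat (t, y - x) * (\<psi> y - ?m)\<^sup>2 \<partial>lborel)" by simp
  also have "\<dots> = (\<integral>y. heat (t, y - x) * (\<psi> y)\<^sup>2 - 2 * ?m * (heat (t, y - x) * \<psi> y) + ?m\<^sup>2 * heat (t, y - x) \<partial>lborel)"
    by (intro Bochner_Integration.integral_cong) (auto simp: power2_eq_square algebra_simps)
  also have "\<dots> = heat_flow t (\<lambda>y. (\<psi> y)\<^sup>2) x - 2 * ?m * ?m + ?m\<^sup>2 * 1"
    using i by (simp add: heat_flow_def)
  finally show ?thesis by (simp add: power2_eq_square)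
qed

lemma heat_flow_L2:
  fixes \<psi> :: "'b::euclidean_space \<Rightarrow> real"
  assumes t: "t > 0" and \<psi>: "integrable lborel \<psi>" "integrable lborel (\<lambda>y. (\<psi> y)\<^sup>2)"
  shows "in_Lp 2 (heat_flow t \<psi>)" "Lp_norm 2 (heat_flow t \<psi>) \<le> Lp_norm 2 \<psi>"
proof -
  have b: "\<psi> \<in> borel_measurable borel" using \<psi>(1) by auto
  have m: "heat_flow t \<psi> \<in> borel_measurable borel" by (rule heat_flow_measurable[OF b])
  have h: "has_bochner_integral lborel (heat_flow t (\<lambda>y. (\<psi> y)\<^sup>2)) (\<integral>y. (\<psi> y)\<^sup>2 \<partial>lborel)"
    by (rule heat_flow_mass[OF t \<psi>(2)]) simp
  have i: "integrable lborel (\<lambda>x. (heat_flow t \<psi> x)\<^sup>2)"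
    by (rule Bochner_Integration.integrable_bound[of _ "heat_flow t (\<lambda>y. (\<psi> y)\<^sup>2)"])
      (use h m heat_flow_sq_le[OF t \<psi>] in \<open>auto simp: has_bochner_integral_iff intro: order_trans[OF _ abs_ge_self]\<close>)
  then show "in_Lp 2 (heat_flow t \<psi>)" using in_Lp2_lborel(1)[OF m] by simp
  have "(\<integral>x. (heat_flow t \<psi> x)\<^sup>2 \<partial>lborel) \<le> (\<integral>x. heat_flow t (\<lambda>y. (\<psi> y)\<^sup>2) x \<partial>lborel)"
    using h by (intro integral_mono i heat_flow_sq_le t \<psi>) (auto simp: has_bochner_integral_iff)
  then have "(Lp_norm 2 (heat_flow t \<psi>))\<^sup>2 \<le> (Lp_norm 2 \<psi>)\<^sup>2"
    using h in_Lp2_lborel(2)[OF m] in_Lp2_lborel(2)[OF b] by (simp add: has_bochner_integral_iff)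
  then show "Lp_norm 2 (heat_flow t \<psi>) \<le> Lp_norm 2 \<psi>"
    by (rule power2_le_imp_le) (rule Lp2_norm_nonneg)
qed

text \<open>
  One factor of the square is estimated by the supremum of the kernel times the \<open>L\<^sup>1\<close> norm; the other
  keeps its \<open>L\<^sup>1\<close> norm under the flow.
\<close>
lemma heat_flow_L1_L2:
  fixes \<psi> :: "'b::euclidean_space \<Rightarrow> real"
  assumes t: "t > 0" and \<psi>: "integrable lborel \<psi>" "integrable lborel (\<lambda>y. (\<psi> y)\<^sup>2)"
  shows "(Lp_norm 2 (heat_flow t \<psi>))\<^sup>2 \<le> (4 * pi * t) powr (- (real DIM('b) / 2)) * (\<integral>y. \<bar>\<psi> y\<bar> \<partial>lborel)\<^sup>2"
proof -
  let ?c = "(4 * pi * t) powr (- (real DIM('b) / 2))" and ?N = "\<integral>y. \<bar>\<psi> y\<bar> \<partial>lborel"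
  have b: "\<psi> \<in> borel_measurable borel" using \<psi>(1) by auto
  have m: "heat_flow t \<psi> \<in> borel_measurable borel" by (rule heat_flow_measurable[OF b])
  have h: "has_bochner_integral lborel (heat_flow t (\<lambda>y. \<bar>\<psi> y\<bar>)) ?N"
    by (rule heat_flow_mass[OF t]) (use \<psi>(1) in auto)
  have i: "integrable lborel (\<lambda>x. (heat_flow t \<psi> x)\<^sup>2)"
    using heat_flow_L2(1)[OF t \<psi>] in_Lp2_lborel(1)[OF m] by simp
  have "(heat_flow t \<psi> x)\<^sup>2 \<le> ?c * ?N * heat_flow t (\<lambda>y. \<bar>\<psi> y\<bar>) x" for x
  proof -
    have a: "\<bar>heat_flow t \<psi> x\<bar> \<le> heat_flow t (\<lambda>y. \<bar>\<psi> y\<bar>) x"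
      unfolding heat_flow_def using integral_abs_bound[of lborel "\<lambda>y. heat (t, y - x) * \<psi> y"]
      by (simp add: abs_mult)
    have "heat_flow t (\<lambda>y. \<bar>\<psi> y\<bar>) x \<le> (\<integral>y. ?c * \<bar>\<psi> y\<bar> \<partial>lborel)"
      unfolding heat_flow_def using heat_times_integrable[OF t integrable_abs[OF \<psi>(1)]] \<psi>(1)
      by (intro integral_mono mult_right_mono heat_le t) auto
    then have "heat_flow t (\<lambda>y. \<bar>\<psi> y\<bar>) x \<le> ?c * ?N" by simp
    then have "\<bar>heat_flow t \<psi> x\<bar> * \<bar>heat_flow t \<psi> x\<bar> \<le> (?c * ?N) * heat_flow t (\<lambda>y. \<bar>\<psi> y\<bar>) x"
      using a by (intro mult_mono) auto
    then show ?thesis by (simp add: power2_eq_square)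
  qed
  then have "(\<integral>x. (heat_flow t \<psi> x)\<^sup>2 \<partial>lborel) \<le> (\<integral>x. ?c * ?N * heat_flow t (\<lambda>y. \<bar>\<psi> y\<bar>) x \<partial>lborel)"
    using h by (intro integral_mono i) (auto simp: has_bochner_integral_iff)
  also have "\<dots> = ?c * ?N * ?N" using h by (simp add: has_bochner_integral_iff)
  finally show ?thesis using in_Lp2_lborel(2)[OF m] by (simp add: power2_eq_square mult_ac)
qed

text \<open>
  By Jensen's inequality the square is at most the flow of the squared data, where the kernel is
  replaced by its supremum.
\<close>
lemma heat_flow_sup_L2:
  fixes \<psi> :: "'b::euclidean_space \<Rightarrow> real"
  assumes t: "t > 0" and \<psi>: "integrable lborel \<psi>" "integrable lborel (\<lambda>y. (\<psi> y)\<^sup>2)"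
  shows "\<bar>heat_flow t \<psi> x\<bar> \<le> (4 * pi * t) powr (- (real DIM('b) / 4)) * Lp_norm 2 \<psi>"
proof -
  let ?c = "(4 * pi * t) powr (- (real DIM('b) / 2))"
  have b: "\<psi> \<in> borel_measurable borel" using \<psi>(1) by auto
  have "(heat_flow t \<psi> x)\<^sup>2 \<le> heat_flow t (\<lambda>y. (\<psi> y)\<^sup>2) x" by (rule heat_flow_sq_le[OF t \<psi>])
  also have "\<dots> \<le> (\<integral>y. ?c * (\<psi> y)\<^sup>2 \<partial>lborel)"
    unfolding heat_flow_def using heat_times_integrable[OF t \<psi>(2)] \<psi>(2)
    by (intro integral_mono mult_right_mono heat_le t) auto
  also have "\<dots> = ?c * (Lp_norm 2 \<psi>)\<^sup>2" using in_Lp2_lborel(2)[OF b] by simp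
  also have "?c = ((4 * pi * t) powr (- (real DIM('b) / 4)))\<^sup>2"
    using t by (simp add: powr_power)
  finally have "(heat_flow t \<psi> x)\<^sup>2 \<le> ((4 * pi * t) powr (- (real DIM('b) / 4)) * Lp_norm 2 \<psi>)\<^sup>2"
    by (simp add: power_mult_distrib)
  then show ?thesis by (simp add: power2_le_iff_abs_le Lp2_norm_nonneg)
qed

section \<open>Backward heat evolution of a continuous function on a box\<close>

context heat_superposition
begin

lemma F_sum:
  assumes "finite I" "\<And>i. i \<in> I \<Longrightarrow> set (vs i) \<subseteq> Basis" "fst z < c"
  shows "(\<Sum>i\<in>I. F (Ds (vs i) heat) z) = integral (cbox A B) (\<lambda>p. (\<Sum>i\<in>I. Ds (vs i) heat (\<iota> p - z)) * \<gamma> p)"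
  unfolding superpose_def sum_distrib_right
  using assms integrable_F by (intro integral_sum[symmetric] integrable_continuous) auto

text \<open>
  The heat equation of the kernel, summed over all poles.
\<close>
lemma laplacian_F:
  assumes "fst z < c"
  shows "(\<Sum>e\<in>Basis. dderiv (0, e) (dderiv (0, e) (F heat)) z) = F (dderiv (1, 0) heat) z"
proof -
  have b: "set [(0, e), (0, e)] \<subseteq> (Basis :: (real \<times> 'b) set)" if "e \<in> Basis" for e using that by (simp add: Basis_spacetime)
  have "(\<Sum>e\<in>Basis. dderiv (0, e) (dderiv (0, e) (F heat)) z) = (\<Sum>e\<in>Basis. F (Ds [(0, e), (0, e)] heat) z)"
    using Ds_F_heat[OF b assms] by (intro sum.cong) simp_all
  also have "\<dots> = integral (cbox A B) (\<lambda>p. (\<Sum>e\<in>Basis. Ds [(0, e), (0, e)] heat (\<iota> p - z)) * \<gamma> p)"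
    by (rule F_sum[OF finite_Basis b assms])
  also have "\<dots> = F (dderiv (1, 0) heat) z"
    unfolding superpose_def
  proof (rule integral_cong)
    fix p assume "p \<in> cbox A B"
    then have "fst (\<iota> p - z) > 0" using late[of p] assms by simp
    from heat_equation[OF this] show "(\<Sum>e\<in>Basis. Ds [(0, e), (0, e)] heat (\<iota> p - z)) * \<gamma> p = dderiv (1, 0) heat (\<iota> p - z) * \<gamma> p"
      by simp
  qed
  finally show ?thesis .
qed

lemma backward_heat_F:
  assumes "fst z < c"
  shows "dderiv (1, 0) (F heat) z + (\<Sum>e\<in>Basis. dderiv (0, e) (dderiv (0, e) (F heat)) z) = 0"
  using laplacian_F[OF assms] Ds_F_heat[of "[(1, 0)]" z] assms by (simp add: Basis_spacetime)

end

text \<open>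
  The solution of the backward heat equation before time \<open>S\<close> whose value at time \<open>S\<close> is \<open>g\<close> on the box
  and \<open>0\<close> outside.
\<close>
definition backward :: "'b \<Rightarrow> 'b \<Rightarrow> ('b \<Rightarrow> real) \<Rightarrow> real \<Rightarrow> real \<times> 'b::euclidean_space \<Rightarrow> real" where
  "backward a b g S = superpose (cbox a b) (\<lambda>y. (S, y)) g heat"

text \<open>
  The integral of the backward solutions with final times in \<open>[S, S']\<close>.  As
  \<open>\<integral>\<^sub>S\<^sup>\<infinity> e\<^sup>\<sigma>\<^sup>\<Delta> d\<sigma> = - \<Delta>\<^sup>-\<^sup>1 e\<^sup>S\<^sup>\<Delta>\<close>, this approximates minus the inverse Laplacian of
  \<^const>\<open>backward\<close> when \<open>S'\<close> is large, by means of Gaussian kernels only.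
\<close>
definition potential :: "'b \<Rightarrow> 'b \<Rightarrow> ('b \<Rightarrow> real) \<Rightarrow> real \<Rightarrow> real \<Rightarrow> real \<times> 'b::euclidean_space \<Rightarrow> real" where
  "potential a b g S S' = superpose (cbox (S, a) (S', b)) (\<lambda>p. p) (\<lambda>p. g (snd p)) heat"

definition on_box :: "'b \<Rightarrow> 'b \<Rightarrow> ('b \<Rightarrow> real) \<Rightarrow> 'b::euclidean_space \<Rightarrow> real" where
  "on_box a b g y = indicator (cbox a b) y * g y"

lemma heat_superposition_backward:
  assumes "continuous_on (cbox a b) g" "c < S"
  shows "heat_superposition a b (\<lambda>y. (S, y)) g c"
  by standard (use assms in \<open>auto intro!: continuous_intros\<close>)

lemma heat_superposition_potential:
  assumes "continuous_on (cbox a b) g" "c < S"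
  shows "heat_superposition (S, a) (S', b) (\<lambda>p. p) (\<lambda>p. g (snd p)) c"
proof
  show "continuous_on (cbox (S, a) (S', b)) (\<lambda>p. g (snd p))"
    by (rule continuous_on_compose2[OF assms(1)]) (auto intro!: continuous_intros simp: cbox_Pair_eq)
qed (use assms in \<open>auto intro!: continuous_intros simp: cbox_Pair_eq\<close>)

lemma on_box_measurable:
  assumes "continuous_on (cbox a b) g" shows "on_box a b g \<in> borel_measurable borel"
proof -
  have "(\<lambda>y. indicator (cbox a b) y *\<^sub>R g y) \<in> borel_measurable borel"
    by (rule borel_measurable_continuous_on_indicator[OF _ assms]) simp
  then show ?thesis by (simp add: on_box_def[abs_def])
qed

lemma on_box_bounded:
  assumes "continuous_on (cbox a b) g" obtains M where "M \<ge> 0" "\<And>y. \<bar>on_box a b g y\<bar> \<le> M"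
proof -
  have "bounded (g ` cbox a b)" by (intro compact_imp_bounded compact_continuous_image assms compact_cbox)
  then obtain M where "\<And>y. y \<in> cbox a b \<Longrightarrow> \<bar>g y\<bar> \<le> M" by (auto simp: bounded_iff)
  then have "\<bar>on_box a b g y\<bar> \<le> \<bar>M\<bar>" for y by (cases "y \<in> cbox a b") (force simp: on_box_def)+
  then show thesis using that[of "\<bar>M\<bar>"] by auto
qed

lemma on_box_integrable:
  assumes "continuous_on (cbox a b) g"
  shows "integrable lborel (on_box a b g)" "integrable lborel (\<lambda>y. (on_box a b g y)\<^sup>2)"
proof -
  have i: "integrable lborel (\<lambda>y. indicator (cbox a b) y *\<^sub>R f y)" if "continuous_on (cbox a b) f" for f :: "'a \<Rightarrow> real"
    using borel_integrable_compact[OF compact_cbox that] by simp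
  show "integrable lborel (on_box a b g)" using i[OF assms] by (simp add: on_box_def[abs_def])
  have "continuous_on (cbox a b) (\<lambda>y. (g y)\<^sup>2)" by (intro continuous_intros assms)
  from i[OF this] show "integrable lborel (\<lambda>y. (on_box a b g y)\<^sup>2)"
    by (rule Bochner_Integration.integrable_cong[THEN iffD1, rotated -1]) (auto simp: on_box_def indicator_def)
qed

lemma integral_box_heat:
  assumes "continuous_on (cbox a b) g" "t > 0"
  shows "integral (cbox a b) (\<lambda>y. heat (t, y - x) * g y) = heat_flow t (on_box a b g) x"
proof -
  have c: "continuous_on (cbox a b) (\<lambda>y. heat (t, y - x) * g y)"
    unfolding heat_def using assms by (auto intro!: continuous_intros)
  have "set_integrable lborel (cbox a b) (\<lambda>y. heat (t, y - x) * g y)"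
    unfolding set_integrable_def using borel_integrable_compact[OF compact_cbox c] by simp
  from set_borel_integral_eq_integral(2)[OF this]
  show ?thesis unfolding heat_flow_def set_lebesgue_integral_def on_box_def by (simp add: mult_ac)
qed

lemma backward_eq_heat_flow:
  assumes "continuous_on (cbox a b) g" "fst z < S"
  shows "backward a b g S z = heat_flow (S - fst z) (on_box a b g) (snd z)"
  using integral_box_heat[OF assms(1), of "S - fst z" "snd z"] assms(2)
  by (simp add: backward_def superpose_def minus_prod_def)

text \<open>
  Below the integral the Laplacian of the kernel is its derivative in the time of the pole, so the
  integral over \<open>[S, S']\<close> telescopes.
\<close>
lemma laplacian_potential:
  assumes g: "continuous_on (cbox a b) g" and z: "fst z < S" and S: "S \<le> S'"
  shows "(\<Sum>e\<in>Basis. dderiv (0, e) (dderiv (0, e) (potential a b g S S')) z) = backward a b g S' z - backward a b g S z"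
proof -
  obtain c where c: "fst z < c" "c < S" using z dense by blast
  interpret heat_superposition "(S, a)" "(S', b)" "\<lambda>p. p" "\<lambda>p. g (snd p)" c
    by (rule heat_superposition_potential[OF g c(2)])
  have cont: "continuous_on (cbox (S, a) (S', b)) (\<lambda>p. dderiv (1, 0) heat (p - z) * g (snd p))"
    using integrable_F[of "[(1, 0)]" z] c(1) by (simp add: Basis_spacetime)
  have "(\<Sum>e\<in>Basis. dderiv (0, e) (dderiv (0, e) (potential a b g S S')) z)
      = integral (cbox (S, a) (S', b)) (\<lambda>p. dderiv (1, 0) heat (p - z) * g (snd p))"
    using laplacian_F[OF c(1)] by (simp add: potential_def superpose_def)
  also have "\<dots> = integral (cbox S S') (\<lambda>\<sigma>. integral (cbox a b) (\<lambda>y. dderiv (1, 0) heat ((\<sigma>, y) - z) * g y))"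
    using integral_prod_continuous[OF cont] by simp
  also have "\<dots> = integral (cbox a b) (\<lambda>y. integral (cbox S S') (\<lambda>\<sigma>. dderiv (1, 0) heat ((\<sigma>, y) - z) * g y))"
    by (rule integral_swap_continuous) (use cont in \<open>simp add: case_prod_unfold\<close>)
  also have "\<dots> = integral (cbox a b) (\<lambda>y. heat ((S', y) - z) * g y - heat ((S, y) - z) * g y)"
  proof (rule integral_cong)
    fix y assume y: "y \<in> cbox a b"
    have "((\<lambda>\<sigma>. dderiv (1, 0) heat ((\<sigma>, y) - z) * g y) has_integral heat ((S', y) - z) * g y - heat ((S, y) - z) * g y) {S..S'}"
    proof (rule fundamental_theorem_of_calculus[OF S])
      fix \<sigma> assume "\<sigma> \<in> {S..S'}"
      then have p: "fst ((\<sigma>, y) - z) > 0" using z by auto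
      have d1: "((\<lambda>\<sigma>. heat ((\<sigma>, y) - z)) has_derivative (\<lambda>h. dderiv (h, 0) heat ((\<sigma>, y) - z))) (at \<sigma> within {S..S'})"
        by (rule has_derivative_compose[where f="\<lambda>\<sigma>. (\<sigma>, y) - z" and g=heat, OF _ has_derivative_dderiv[OF dderiv_heat(1)[OF p]]])
          (auto intro!: derivative_eq_intros)
      have lin: "dderiv (h, 0) heat ((\<sigma>, y) - z) = h * dderiv (1, 0) heat ((\<sigma>, y) - z)" for h
        using linear_cmul[OF bounded_linear.linear[OF has_derivative_bounded_linear[OF has_derivative_dderiv[OF dderiv_heat(1)[OF p]]]], of h "(1, 0)"]
        by simp
      have "((\<lambda>\<sigma>. heat ((\<sigma>, y) - z)) has_vector_derivative dderiv (1, 0) heat ((\<sigma>, y) - z)) (at \<sigma> within {S..S'})"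
        unfolding has_vector_derivative_def real_scaleR_def
        by (rule has_derivative_eq_rhs[OF d1]) (rule ext, rule lin)
      from has_vector_derivative_mult_left[OF this, of "g y"]
      show "((\<lambda>\<sigma>. heat ((\<sigma>, y) - z) * g y) has_vector_derivative dderiv (1, 0) heat ((\<sigma>, y) - z) * g y) (at \<sigma> within {S..S'})" .
    qed
    then show "integral (cbox S S') (\<lambda>\<sigma>. dderiv (1, 0) heat ((\<sigma>, y) - z) * g y) = heat ((S', y) - z) * g y - heat ((S, y) - z) * g y"
      unfolding cbox_interval by (rule integral_unique)
  qed
  also have "\<dots> = backward a b g S' z - backward a b g S z"
    unfolding backward_def superpose_def
  proof -
    have "(\<lambda>y. heat ((r, y) - z) * g y) integrable_on cbox a b" if "r = S \<or> r = S'" for r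
      unfolding heat_def using that z S g by (intro integrable_continuous) (auto intro!: continuous_intros)
    then show "integral (cbox a b) (\<lambda>y. heat ((S', y) - z) * g y - heat ((S, y) - z) * g y) =
        integral (cbox a b) (\<lambda>y. heat ((S', y) - z) * g y) - integral (cbox a b) (\<lambda>y. heat ((S, y) - z) * g y)"
      by (intro Henstock_Kurzweil_Integration.integral_diff) simp_all
  qed
  finally show ?thesis .
qed

lemma backward_heat_equation:
  assumes "continuous_on (cbox a b) g" "fst z < S"
  shows "dderiv (1, 0) (backward a b g S) z + (\<Sum>e\<in>Basis. dderiv (0, e) (dderiv (0, e) (backward a b g S)) z) = 0"
proof -
  obtain c where c: "fst z < c" "c < S" using assms(2) dense by blast
  show ?thesis unfolding backward_def
    by (rule heat_superposition.backward_heat_F[OF heat_superposition_backward[OF assms(1) c(2)] c(1)])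
qed

lemma potential_heat_equation:
  assumes "continuous_on (cbox a b) g" "fst z < S"
  shows "dderiv (1, 0) (potential a b g S S') z + (\<Sum>e\<in>Basis. dderiv (0, e) (dderiv (0, e) (potential a b g S S')) z) = 0"
proof -
  obtain c where c: "fst z < c" "c < S" using assms(2) dense by blast
  show ?thesis unfolding potential_def
    by (rule heat_superposition.backward_heat_F[OF heat_superposition_potential[OF assms(1) c(2)] c(1)])
qed

lemma tame_backward:
  assumes "continuous_on (cbox a b) g" "c < S"
  obtains \<kappa> where "\<kappa> > 0"
    "tame {z. l < fst z \<and> fst z < c} (\<lambda>_ z. exp (- (\<kappa> * (norm (snd z))\<^sup>2))) (\<lambda>_. backward a b g S)"
  using heat_superposition.tame_F[OF heat_superposition_backward[OF assms]] unfolding backward_def by blast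

lemma tame_potential:
  assumes "continuous_on (cbox a b) g" "c < S"
  obtains \<kappa> where "\<kappa> > 0"
    "tame {z. l < fst z \<and> fst z < c} (\<lambda>_ z. exp (- (\<kappa> * (norm (snd z))\<^sup>2))) (\<lambda>_. potential a b g S S')"
  using heat_superposition.tame_F[OF heat_superposition_potential[OF assms]] unfolding potential_def by blast

lemma backward_L2:
  fixes a b :: "'b::euclidean_space"
  assumes "continuous_on (cbox a b) g" "t < S"
  shows "in_Lp 2 (\<lambda>x. backward a b g S (t, x))" "Lp_norm 2 (\<lambda>x. backward a b g S (t, x)) \<le> Lp_norm 2 (on_box a b g)"
    "(Lp_norm 2 (\<lambda>x. backward a b g S (t, x)))\<^sup>2
       \<le> (4 * pi * (S - t)) powr (- (real DIM('b) / 2)) * (\<integral>y. \<bar>on_box a b g y\<bar> \<partial>lborel)\<^sup>2"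
  using heat_flow_L2[OF _ on_box_integrable[OF assms(1)], of "S - t"]
    heat_flow_L1_L2[OF _ on_box_integrable[OF assms(1)], of "S - t"] assms
  by (simp_all add: backward_eq_heat_flow[OF assms(1)] cong: if_cong)

text \<open>
  A third derivative of the kernel at time distance \<open>\<tau>\<close> costs \<open>\<tau>\<close> to the power \<open>-3/2\<close> and the passage
  from \<open>L\<^sup>2\<close> to the supremum costs \<open>\<tau>\<close> to the power \<open>-n/4\<close>.  For \<open>t \<le> S/2\<close> the distance to the poles at
  time \<open>\<sigma> \<ge> S\<close> is at least \<open>\<sigma>/2\<close>, and the integral of \<open>\<sigma>\<close> to the power \<open>- 3/2 - n/4\<close> over
  \<open>\<sigma> \<ge> S\<close> is a multiple of \<open>S\<close> to the power \<open>- (n + 2)/4\<close>, uniformly in \<open>S'\<close>.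
\<close>
lemma potential_third_derivative_bound:
  fixes vs :: "(real \<times> 'b::euclidean_space) list"
  assumes vs: "set vs \<subseteq> Basis" "\<And>v. v \<in> set vs \<Longrightarrow> fst v = 0" "length vs = 3"
  shows "\<exists>C\<ge>0. \<forall>a b g S S' z. continuous_on (cbox a b) g \<longrightarrow> 0 < S \<longrightarrow> S \<le> S' \<longrightarrow> fst z \<le> S / 2 \<longrightarrow>
    \<bar>Ds vs (potential a b g S S') z\<bar> \<le> C * S powr (- (real DIM('b) + 2) / 4) * Lp_norm 2 (on_box a b g)"
proof -
  let ?n = "real DIM('b)"
  have w: "sum_list (map weight vs) = 3"
    using vs(2,3) by (simp add: weight_def cong: map_cong) (simp add: map_replicate_const sum_list_replicate)
  obtain C where C0: "C \<ge> 0" "\<And>t x. t > 0 \<Longrightarrow>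
      \<bar>Ds vs heat (t, x :: 'b)\<bar> \<le> C * (t powr (- real (sum_list (map weight vs)) / 2) * heat (2 * t, x))"
    using Ds_heat_bound[OF vs(1)] by blast
  then have C: "C \<ge> 0" "\<And>t x. t > 0 \<Longrightarrow> \<bar>Ds vs heat (t, x :: 'b)\<bar> \<le> C * (t powr (- 3 / 2) * heat (2 * t, x))"
    unfolding w by simp_all
  let ?p = "3 / 2 + ?n / 4"
  have p: "?p > 1" by simp
  let ?K = "C * (8 * pi) powr (- (?n / 4)) * 2 powr ?p"
  have "\<bar>Ds vs (potential a b g S S') z\<bar> \<le> (?K / (?p - 1)) * S powr (- (?n + 2) / 4) * Lp_norm 2 (on_box a b g)"
    if g: "continuous_on (cbox a b) g" and S: "0 < S" "S \<le> S'" and z: "fst z \<le> S / 2" for a b g S S' z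
  proof -
    obtain c where c: "fst z < c" "c < S" using z S dense[of "fst z" S] by auto
    interpret heat_superposition "(S, a)" "(S', b)" "\<lambda>p. p" "\<lambda>p. g (snd p)" c
      by (rule heat_superposition_potential[OF g c(2)])
    let ?N = "Lp_norm 2 (on_box a b g)"
    have ag: "continuous_on (cbox a b) (\<lambda>y. \<bar>g y\<bar>)" by (intro continuous_intros g)
    have N: "Lp_norm 2 (on_box a b (\<lambda>y. \<bar>g y\<bar>)) = ?N" by (simp add: Lp2_norm on_box_def power_mult_distrib)
    have pos: "fst p - fst z > 0" if "p \<in> cbox (S, a) (S', b)" for p
      using that z S by (auto simp: cbox_Pair_eq)
    let ?f = "\<lambda>p. C * ((fst p - fst z) powr (- 3 / 2) * heat (2 * (fst p - fst z), snd p - snd z)) * \<bar>g (snd p)\<bar>"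
    have cf: "continuous_on (cbox (S, a) (S', b)) ?f"
    proof (intro continuous_on_mult continuous_on_const continuous_on_rabs)
      show "continuous_on (cbox (S, a) (S', b)) (\<lambda>p. (fst p - fst z) powr (- 3 / 2))"
      proof (intro continuous_on_powr continuous_intros ballI)
        show "fst p - fst z \<noteq> 0" if "p \<in> cbox (S, a) (S', b)" for p using pos[OF that] by simp
      qed
      show "continuous_on (cbox (S, a) (S', b)) (\<lambda>p. heat (2 * (fst p - fst z), snd p - snd z))"
      proof (rule continuous_on_compose2[OF Ds_heat_continuous[of "[]", simplified]])
        show "(\<lambda>p. (2 * (fst p - fst z), snd p - snd z)) ` cbox (S, a) (S', b) \<subseteq> {z. 0 < fst z}"
          using pos by (simp add: image_subset_iff)
      qed (intro continuous_intros)
    qed (rule \<gamma>)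
    have "\<bar>Ds vs (potential a b g S S') z\<bar> = norm (integral (cbox (S, a) (S', b)) (\<lambda>p. Ds vs heat (p - z) * g (snd p)))"
      using Ds_F_heat[OF vs(1) c(1)] by (simp add: potential_def superpose_def abs_mult power_abs)
    also have "\<dots> \<le> integral (cbox (S, a) (S', b)) ?f"
    proof (rule integral_norm_bound_integral)
      show "(\<lambda>p. Ds vs heat (p - z) * g (snd p)) integrable_on cbox (S, a) (S', b)"
        by (rule integrable_continuous[OF integrable_F[OF vs(1) c(1)]])
      show "?f integrable_on cbox (S, a) (S', b)" by (rule integrable_continuous[OF cf])
      show "norm (Ds vs heat (p - z) * g (snd p)) \<le> ?f p" if "p \<in> cbox (S, a) (S', b)" for p
        using C(2)[OF pos[OF that], of "snd p - snd z"] by (simp add: abs_mult minus_prod_def mult_right_mono)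
    qed
    also have "\<dots> = integral (cbox S S') (\<lambda>\<sigma>. integral (cbox a b) (\<lambda>y. ?f (\<sigma>, y)))"
      by (rule integral_prod_continuous[OF cf])
    also have "\<dots> = integral (cbox S S') (\<lambda>\<sigma>. C * (\<sigma> - fst z) powr (- 3 / 2) * heat_flow (2 * (\<sigma> - fst z)) (on_box a b (\<lambda>y. \<bar>g y\<bar>)) (snd z))"
    proof (rule integral_cong)
      fix \<sigma> assume "\<sigma> \<in> cbox S S'"
      then have "2 * (\<sigma> - fst z) > 0" using z S by auto
      from integral_box_heat[OF ag this, of "snd z"]
      have "integral (cbox a b) (\<lambda>y. (C * (\<sigma> - fst z) powr (- 3 / 2)) * (heat (2 * (\<sigma> - fst z), y - snd z) * \<bar>g y\<bar>))
        = C * (\<sigma> - fst z) powr (- 3 / 2) * heat_flow (2 * (\<sigma> - fst z)) (on_box a b (\<lambda>y. \<bar>g y\<bar>)) (snd z)" by simp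
      then show "integral (cbox a b) (\<lambda>y. ?f (\<sigma>, y)) =
          C * (\<sigma> - fst z) powr (- 3 / 2) * heat_flow (2 * (\<sigma> - fst z)) (on_box a b (\<lambda>y. \<bar>g y\<bar>)) (snd z)"
        by (simp add: mult_ac)
    qed
    also have "\<dots> \<le> integral (cbox S S') (\<lambda>\<sigma>. ?K * ?N * \<sigma> powr (- ?p))"
    proof (rule integral_le)
      have "continuous_on (cbox S S') (\<lambda>\<sigma>. integral (cbox a b) (\<lambda>y. ?f (\<sigma>, y)))"
        using integral_continuous_on_param[of "cbox S S'" a b "\<lambda>\<sigma> y. ?f (\<sigma>, y)"] cf by (simp add: cbox_Pair_eq case_prod_unfold)
      then have "(\<lambda>\<sigma>. integral (cbox a b) (\<lambda>y. ?f (\<sigma>, y))) integrable_on cbox S S'" by (rule integrable_continuous)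
      moreover have "integral (cbox a b) (\<lambda>y. ?f (\<sigma>, y)) =
          C * (\<sigma> - fst z) powr (- 3 / 2) * heat_flow (2 * (\<sigma> - fst z)) (on_box a b (\<lambda>y. \<bar>g y\<bar>)) (snd z)"
        if "\<sigma> \<in> cbox S S'" for \<sigma>
      proof -
        have "2 * (\<sigma> - fst z) > 0" using that z S by auto
        from integral_box_heat[OF ag this, of "snd z"]
        have "integral (cbox a b) (\<lambda>y. (C * (\<sigma> - fst z) powr (- 3 / 2)) * (heat (2 * (\<sigma> - fst z), y - snd z) * \<bar>g y\<bar>))
          = C * (\<sigma> - fst z) powr (- 3 / 2) * heat_flow (2 * (\<sigma> - fst z)) (on_box a b (\<lambda>y. \<bar>g y\<bar>)) (snd z)" by simp
        then show ?thesis by (simp add: mult_ac)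
      qed
      ultimately show "(\<lambda>\<sigma>. C * (\<sigma> - fst z) powr (- 3 / 2) * heat_flow (2 * (\<sigma> - fst z)) (on_box a b (\<lambda>y. \<bar>g y\<bar>)) (snd z)) integrable_on cbox S S'"
        by (rule integrable_eq)
      show "(\<lambda>\<sigma>. ?K * ?N * \<sigma> powr (- ?p)) integrable_on cbox S S'"
        using S by (intro integrable_continuous continuous_intros) auto
      fix \<sigma> assume "\<sigma> \<in> cbox S S'"
      then have \<sigma>: "\<sigma> > 0" "\<sigma> / 2 \<le> \<sigma> - fst z" "\<sigma> - fst z > 0" using z S by auto
      have "heat_flow (2 * (\<sigma> - fst z)) (on_box a b (\<lambda>y. \<bar>g y\<bar>)) (snd z)
          \<le> (4 * pi * (2 * (\<sigma> - fst z))) powr (- (?n / 4)) * ?N"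
        using heat_flow_sup_L2[OF _ on_box_integrable[OF ag], of "2 * (\<sigma> - fst z)" "snd z"] \<sigma> N by simp
      also have "(4 * pi * (2 * (\<sigma> - fst z))) powr (- (?n / 4)) = (8 * pi) powr (- (?n / 4)) * (\<sigma> - fst z) powr (- (?n / 4))"
        using \<sigma> by (simp add: powr_mult[symmetric] mult_ac)
      finally have "C * (\<sigma> - fst z) powr (- 3 / 2) * heat_flow (2 * (\<sigma> - fst z)) (on_box a b (\<lambda>y. \<bar>g y\<bar>)) (snd z)
          \<le> C * (\<sigma> - fst z) powr (- 3 / 2) * ((8 * pi) powr (- (?n / 4)) * (\<sigma> - fst z) powr (- (?n / 4)) * ?N)"
        using C(1) by (intro mult_left_mono) auto
      also have "\<dots> = C * (8 * pi) powr (- (?n / 4)) * ?N * (\<sigma> - fst z) powr (- ?p)"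
      proof -
        have "(\<sigma> - fst z) powr (- ?p) = (\<sigma> - fst z) powr (- 3 / 2) * (\<sigma> - fst z) powr (- (?n / 4))"
          by (simp add: powr_add[symmetric])
        then show ?thesis by (simp add: mult_ac)
      qed
      also have "\<dots> \<le> C * (8 * pi) powr (- (?n / 4)) * ?N * (\<sigma> / 2) powr (- ?p)"
        using C(1) \<sigma> by (intro mult_left_mono powr_mono2') (auto simp: Lp2_norm_nonneg)
      also have "\<dots> = ?K * ?N * \<sigma> powr (- ?p)"
        using \<sigma> by (simp add: powr_divide powr_minus field_simps)
      finally show "C * (\<sigma> - fst z) powr (- 3 / 2) * heat_flow (2 * (\<sigma> - fst z)) (on_box a b (\<lambda>y. \<bar>g y\<bar>)) (snd z)
          \<le> ?K * ?N * \<sigma> powr (- ?p)" .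
    qed
    also have "\<dots> = ?K * ?N * integral (cbox S S') (\<lambda>\<sigma>. \<sigma> powr (- ?p))" by simp
    also have "\<dots> \<le> ?K * ?N * (S powr (1 - ?p) / (?p - 1))"
    proof (rule mult_left_mono)
      have "((\<lambda>\<sigma>. \<sigma> powr (- ?p)) has_integral (- (S' powr (1 - ?p) / (?p - 1))) - (- (S powr (1 - ?p) / (?p - 1)))) {S..S'}"
      proof (rule fundamental_theorem_of_calculus[OF S(2)])
        fix \<sigma> assume "\<sigma> \<in> {S..S'}"
        then have "((\<lambda>\<sigma>. - (\<sigma> powr (1 - ?p) / (?p - 1))) has_real_derivative - ((1 - ?p) * \<sigma> powr (1 - ?p - 1) / (?p - 1))) (at \<sigma>)"
          using S p by (intro DERIV_minus DERIV_cdivide has_real_derivative_powr) auto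
        moreover have "- ((1 - ?p) * \<sigma> powr (1 - ?p - 1) / (?p - 1)) = \<sigma> powr (- ?p)"
        proof -
          have q: "- ((1 - q) * A / (q - 1)) = A" if "q > 1" for q A :: real using that by (simp add: field_simps)
          have e: "1 - ?p - 1 = - ?p" by simp
          show ?thesis unfolding e by (rule q[OF p])
        qed
        ultimately show "((\<lambda>\<sigma>. - (\<sigma> powr (1 - ?p) / (?p - 1))) has_vector_derivative \<sigma> powr (- ?p)) (at \<sigma> within {S..S'})"
          by (simp add: has_real_derivative_iff_has_vector_derivative has_vector_derivative_at_within)
      qed
      then have "integral (cbox S S') (\<lambda>\<sigma>. \<sigma> powr (- ?p)) = S powr (1 - ?p) / (?p - 1) - S' powr (1 - ?p) / (?p - 1)"
        by (simp add: integral_unique)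
      also have "\<dots> \<le> S powr (1 - ?p) / (?p - 1)" using p by simp
      finally show "integral (cbox S S') (\<lambda>\<sigma>. \<sigma> powr (- ?p)) \<le> S powr (1 - ?p) / (?p - 1)" .
    qed (use C(1) in \<open>auto simp: Lp2_norm_nonneg\<close>)
    also have "1 - ?p = - (?n + 2) / 4" by simp
    finally show ?thesis by (simp add: mult_ac)
  qed
  moreover have "0 \<le> ?K / (?p - 1)" using C(1) by simp
  ultimately show ?thesis by (intro exI[of _ "?K / (?p - 1)"] conjI allI impI)
qed

section \<open>Initial trace of the heat semigroup and duality\<close>

lemma heat_second_moment:
  obtains C where "C \<ge> 0" "\<And>t (x :: 'b::euclidean_space). t > 0 \<Longrightarrow> (norm x)\<^sup>2 * heat (t, x) \<le> C * (t * heat (2 * t, x))"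
proof -
  let ?q = "\<lambda>z::real \<times> 'b. \<Sum>c\<in>Basis. ((snd z \<bullet> c) / fst z) * ((snd z \<bullet> c) / fst z)"
  have "parabolic 2 ?q"
    using parabolic_mult[OF parabolic_coord parabolic_coord] by (intro parabolic_sum) (simp add: numeral_2_eq_2)
  then obtain C where C: "C \<ge> 0" "\<And>t x. t > 0 \<Longrightarrow> \<bar>?q (t, x) * heat (t, x)\<bar> \<le> C * (t powr (- real 2 / 2) * heat (2 * t, x))"
    using parabolic_heat_bound by blast
  have "(norm x)\<^sup>2 * heat (t, x) \<le> C * (t * heat (2 * t, x))" if t: "t > 0" for t and x :: 'b
  proof -
    have e: "?q (t, x) = (norm x)\<^sup>2 / (t * t)"
      unfolding power2_norm_eq_inner euclidean_inner[of x x] by (simp add: sum_divide_distrib)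
    have "(norm x)\<^sup>2 / (t * t) * heat (t, x) \<le> C * ((1 / t) * heat (2 * t, x))"
      using C(2)[OF t, of x] t unfolding e by (simp add: powr_minus_divide)
    then have "(t * t) * ((norm x)\<^sup>2 / (t * t) * heat (t, x)) \<le> (t * t) * (C * ((1 / t) * heat (2 * t, x)))"
      using t by (intro mult_left_mono) auto
    then show ?thesis using t by (simp add: mult_ac)
  qed
  then show thesis using that C(1) by blast
qed

text \<open>
  Near \<open>x\<close> the data are almost constant, and away from \<open>x\<close> Chebyshev's inequality with the second
  moment \<open>O(t)\<close> of the kernel bounds the mass.
\<close>
lemma heat_flow_tendsto:
  fixes \<psi> :: "'b::euclidean_space \<Rightarrow> real"
  assumes \<psi>: "integrable lborel \<psi>" and M: "\<And>y. \<bar>\<psi> y\<bar> \<le> M" and x: "isCont \<psi> x"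
  shows "((\<lambda>t. heat_flow t \<psi> x) \<longlongrightarrow> \<psi> x) (at_right 0)"
proof (rule tendstoI)
  fix e :: real assume e: "e > 0"
  obtain C where C: "C \<ge> 0" "\<And>t (x :: 'b). t > 0 \<Longrightarrow> (norm x)\<^sup>2 * heat (t, x) \<le> C * (t * heat (2 * t, x))"
    using heat_second_moment by blast
  have M0: "M \<ge> 0" using M[of x] by linarith
  obtain d where d: "d > 0" "\<And>y. dist y x < d \<Longrightarrow> dist (\<psi> y) (\<psi> x) < e / 2"
    using x e unfolding continuous_at_eps_delta by (metis half_gt_zero)
  let ?A = "2 * M * C / d\<^sup>2"
  have A: "?A \<ge> 0" using M0 C(1) by simp
  have b: "dist (heat_flow t \<psi> x) (\<psi> x) \<le> e / 2 + ?A * t" if t: "t > 0" for t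
  proof -
    have h: "has_bochner_integral lborel (\<lambda>y. heat (s, y - x)) 1" if "s > 0" for s
      using has_integral_heat_translate(1)[OF that] .
    have i: "integrable lborel (\<lambda>y. heat (t, y - x) * \<psi> y)" "integrable lborel (\<lambda>y. heat (t, y - x))"
      "(\<integral>y. heat (t, y - x) \<partial>lborel) = 1" "integrable lborel (\<lambda>y. heat (2 * t, y - x))"
      "(\<integral>y. heat (2 * t, y - x) \<partial>lborel) = 1"
      using heat_times_integrable[OF t \<psi>] h[of t] h[of "2 * t"] t by (auto simp: has_bochner_integral_iff)
    have "heat_flow t \<psi> x - \<psi> x = (\<integral>y. heat (t, y - x) * \<psi> y - \<psi> x * heat (t, y - x) \<partial>lborel)"
      using i by (simp add: heat_flow_def)
    also have "\<bar>\<dots>\<bar> \<le> (\<integral>y. e / 2 * heat (t, y - x) + ?A * t * heat (2 * t, y - x) \<partial>lborel)"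
    proof (rule order_trans[OF integral_abs_bound], rule integral_mono)
      fix y
      have "\<bar>heat (t, y - x) * \<psi> y - \<psi> x * heat (t, y - x)\<bar> = heat (t, y - x) * \<bar>\<psi> y - \<psi> x\<bar>"
        by (simp add: mult.commute[of "\<psi> x"] abs_mult flip: right_diff_distrib)
      also have "\<dots> \<le> e / 2 * heat (t, y - x) + ?A * t * heat (2 * t, y - x)"
      proof (cases "dist y x < d")
        case True
        then have "heat (t, y - x) * \<bar>\<psi> y - \<psi> x\<bar> \<le> heat (t, y - x) * (e / 2)"
          using d(2) by (intro mult_left_mono) (auto simp: dist_real_def less_imp_le)
        moreover have "0 \<le> ?A * t * heat (2 * t, y - x)"
          by (intro mult_nonneg_nonneg A heat_nonneg) (use t in auto)
        ultimately show ?thesis by (simp add: mult.commute)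
      next
        case False
        then have "1 \<le> (norm (y - x))\<^sup>2 / d\<^sup>2" using d(1) by (simp add: dist_norm power_mono)
        then have "heat (t, y - x) * \<bar>\<psi> y - \<psi> x\<bar> \<le> ((norm (y - x))\<^sup>2 / d\<^sup>2 * heat (t, y - x)) * (2 * M)"
          using M[of x] M[of y] mult_right_mono[of 1 "(norm (y - x))\<^sup>2 / d\<^sup>2" "heat (t, y - x)"]
          by (intro mult_mono) auto
        also have "\<dots> = (2 * M / d\<^sup>2) * ((norm (y - x))\<^sup>2 * heat (t, y - x))" by simp
        also have "\<dots> \<le> (2 * M / d\<^sup>2) * (C * (t * heat (2 * t, y - x)))"
          using M0 by (intro mult_left_mono C t) auto
        also have "\<dots> = ?A * t * heat (2 * t, y - x)" by simp
        also have "\<dots> \<le> e / 2 * heat (t, y - x) + ?A * t * heat (2 * t, y - x)" using e by simp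
        finally show ?thesis .
      qed
      finally show "\<bar>heat (t, y - x) * \<psi> y - \<psi> x * heat (t, y - x)\<bar> \<le> e / 2 * heat (t, y - x) + ?A * t * heat (2 * t, y - x)" .
    qed (use i in auto)
    also have "\<dots> = e / 2 + ?A * t" using i by simp
    finally show ?thesis by (simp add: dist_real_def)
  qed
  have "e / 2 + ?A * t < e" if "0 < t" "t < e / (2 * (?A + 1))" for t
  proof -
    have "?A * t \<le> (?A + 1) * t" using that by (simp add: distrib_right)
    also have "\<dots> < e / 2"
    proof -
      have aux: "B * t < e / 2" if "B > 0" "t < e / (2 * B)" for B :: real using that by (simp add: field_simps)
      show ?thesis by (rule aux) (use A that in auto)
    qed
    finally show ?thesis by simp
  qed
  then show "\<forall>\<^sub>F t in at_right 0. dist (heat_flow t \<psi> x) (\<psi> x) < e"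
    unfolding eventually_at_right_field using b e A
    by (intro exI[of _ "e / (2 * (?A + 1))"]) (auto intro: order.strict_trans1)
qed

text \<open>
  A majorant that is uniform in time.  Near the box the flow is bounded by the supremum of the data;
  at distance at least \<open>1\<close> from it the factor \<open>exp (- |w|\<^sup>2 / 4t)\<close> beats the singular power of \<open>t\<close>.
\<close>
lemma heat_flow_on_box_decay:
  fixes a b :: "'b::euclidean_space"
  assumes g: "continuous_on (cbox a b) g"
  obtains D where "\<And>t x. 0 < t \<Longrightarrow> t \<le> 1 \<Longrightarrow> \<bar>heat_flow t (on_box a b g) x\<bar> \<le> D * exp (- (1 / 16 * (norm x)\<^sup>2))"
proof -
  let ?n = "real DIM('b)" and ?\<psi> = "on_box a b g"
  obtain M where M: "M \<ge> 0" "\<And>y. \<bar>?\<psi> y\<bar> \<le> M" using on_box_bounded[OF g] by blast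
  obtain R where R: "R \<ge> 0" "\<And>y. y \<in> cbox a b \<Longrightarrow> norm y \<le> R"
    using bounded_cbox[of a b] unfolding bounded_iff by (meson abs_ge_self abs_ge_zero order_trans)
  obtain L where L: "L \<ge> 0" "\<And>r::real. r \<ge> 0 \<Longrightarrow> (1 + r) ^ DIM('b) * exp (- (r\<^sup>2 / 8)) \<le> L"
    using power_times_gaussian_bounded by blast
  have \<psi>: "integrable lborel (\<lambda>y. \<bar>?\<psi> y\<bar>)" using on_box_integrable(1)[OF g] by simp
  let ?N = "\<integral>y. \<bar>?\<psi> y\<bar> \<partial>lborel"
  let ?D1 = "M * exp ((R + 1)\<^sup>2 / 16)" and ?D2 = "L * exp (R\<^sup>2 / 8) * ?N"
  \<comment> \<open>Half of the exponent is kept as decay in \<open>w\<close>, the other half compensates the powers of \<open>1 / \<surd>t\<close>.\<close>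
  have far: "heat (t, w :: 'b) \<le> L * exp (- ((norm w)\<^sup>2 / 8))" if t: "0 < t" "t \<le> 1" and w: "norm w \<ge> 1" for t w
  proof -
    have w2: "1 \<le> (norm w)\<^sup>2" using w by (simp add: one_le_power)
    have "(4 * pi * t) powr (- (?n / 2)) \<le> t powr (- (?n / 2))"
      using t pi_gt3 by (intro powr_mono2') auto
    also have "\<dots> = (1 / sqrt t) ^ DIM('b)"
    proof -
      have "1 / sqrt t = t powr (- 1 / 2)" using t by (simp add: powr_minus_divide powr_half_sqrt)
      then show ?thesis using t by (simp add: powr_power)
    qed
    also have "\<dots> \<le> (1 + 1 / sqrt t) ^ DIM('b)" using t by (intro power_mono) auto
    finally have 1: "(4 * pi * t) powr (- (?n / 2)) \<le> (1 + 1 / sqrt t) ^ DIM('b)" .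
    have "(norm w)\<^sup>2 / 8 + (1 / sqrt t)\<^sup>2 / 8 \<le> (norm w)\<^sup>2 / (8 * t) + (norm w)\<^sup>2 / (8 * t)"
    proof (rule add_mono)
      show "(norm w)\<^sup>2 / 8 \<le> (norm w)\<^sup>2 / (8 * t)" using t by (intro divide_left_mono) auto
      show "(1 / sqrt t)\<^sup>2 / 8 \<le> (norm w)\<^sup>2 / (8 * t)"
        using t w2 divide_right_mono[of 1 "(norm w)\<^sup>2" "8 * t"] by (simp add: power_divide mult.commute)
    qed
    also have "\<dots> = (norm w)\<^sup>2 / (4 * t)" by simp
    finally have 2: "exp (- ((norm w)\<^sup>2 / (4 * t))) \<le> exp (- ((1 / sqrt t)\<^sup>2 / 8)) * exp (- ((norm w)\<^sup>2 / 8))"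
      unfolding exp_add[symmetric] by simp
    have "heat (t, w) \<le> (1 + 1 / sqrt t) ^ DIM('b) * (exp (- ((1 / sqrt t)\<^sup>2 / 8)) * exp (- ((norm w)\<^sup>2 / 8)))"
      unfolding heat_def fst_conv snd_conv by (intro mult_mono 1 2) (use t in auto)
    also have "\<dots> = ((1 + 1 / sqrt t) ^ DIM('b) * exp (- ((1 / sqrt t)\<^sup>2 / 8))) * exp (- ((norm w)\<^sup>2 / 8))" by simp
    also have "\<dots> \<le> L * exp (- ((norm w)\<^sup>2 / 8))" using t by (intro mult_right_mono L) auto
    finally show ?thesis .
  qed
  have "\<bar>heat_flow t ?\<psi> x\<bar> \<le> max ?D1 ?D2 * exp (- (1 / 16 * (norm x)\<^sup>2))" if t: "0 < t" "t \<le> 1" for t x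
  proof (cases "norm x \<le> R + 1")
    case True
    have h: "has_bochner_integral lborel (\<lambda>y. heat (t, y - x)) 1" using has_integral_heat_translate(1)[OF t(1)] .
    have "\<bar>heat_flow t ?\<psi> x\<bar> \<le> (\<integral>y. \<bar>heat (t, y - x) * ?\<psi> y\<bar> \<partial>lborel)" unfolding heat_flow_def by (rule integral_abs_bound)
    also have "\<dots> \<le> (\<integral>y. M * heat (t, y - x) \<partial>lborel)"
      using h M integrable_abs[OF heat_times_integrable[OF t(1) on_box_integrable(1)[OF g]], of x]
      by (intro integral_mono) (auto simp: has_bochner_integral_iff abs_mult mult.commute[of M] mult_left_mono)
    also have "\<dots> = M" using h by (simp add: has_bochner_integral_iff)
    also have "M \<le> M * (exp ((R + 1)\<^sup>2 / 16) * exp (- (1 / 16 * (norm x)\<^sup>2)))"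
    proof -
      have "(norm x)\<^sup>2 \<le> (R + 1)\<^sup>2" using True by (intro power_mono) auto
      then have "1 \<le> exp ((R + 1)\<^sup>2 / 16) * exp (- (1 / 16 * (norm x)\<^sup>2))" unfolding exp_add[symmetric] by simp
      then show ?thesis using M(1) mult_left_mono by fastforce
    qed
    also have "\<dots> \<le> max ?D1 ?D2 * exp (- (1 / 16 * (norm x)\<^sup>2))"
      unfolding mult.assoc[symmetric] by (intro mult_right_mono) auto
    finally show ?thesis .
  next
    case False
    have "\<bar>heat_flow t ?\<psi> x\<bar> \<le> (\<integral>y. \<bar>heat (t, y - x) * ?\<psi> y\<bar> \<partial>lborel)" unfolding heat_flow_def by (rule integral_abs_bound)
    also have "\<dots> \<le> (\<integral>y. (L * exp (R\<^sup>2 / 8) * exp (- (1 / 16 * (norm x)\<^sup>2))) * \<bar>?\<psi> y\<bar> \<partial>lborel)"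
    proof (rule integral_mono)
      fix y
      show "\<bar>heat (t, y - x) * ?\<psi> y\<bar> \<le> (L * exp (R\<^sup>2 / 8) * exp (- (1 / 16 * (norm x)\<^sup>2))) * \<bar>?\<psi> y\<bar>"
      proof (cases "y \<in> cbox a b")
        case True
        have "norm (y - x) \<ge> 1" using False R(2)[OF True] norm_triangle_ineq2[of x y] by (simp add: norm_minus_commute)
        then have 1: "heat (t, y - x) \<le> L * exp (- ((norm (y - x))\<^sup>2 / 8))" by (rule far[OF t])
        have "(norm x)\<^sup>2 \<le> (norm (y - x) + norm y)\<^sup>2"
          using norm_triangle_sub[of x y] by (intro power_mono) (auto simp: norm_minus_commute add.commute)
        also have "\<dots> \<le> 2 * (norm (y - x))\<^sup>2 + 2 * (norm y)\<^sup>2"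
          using sum_squares_bound[of "norm (y - x)" "norm y"] by (simp add: power2_sum)
        also have "\<dots> \<le> 2 * (norm (y - x))\<^sup>2 + 2 * R\<^sup>2" using R(2)[OF True] by (simp add: power_mono)
        finally have "exp (- ((norm (y - x))\<^sup>2 / 8)) \<le> exp (R\<^sup>2 / 8) * exp (- (1 / 16 * (norm x)\<^sup>2))"
          unfolding exp_add[symmetric] by simp
        with 1 have "heat (t, y - x) \<le> L * (exp (R\<^sup>2 / 8) * exp (- (1 / 16 * (norm x)\<^sup>2)))"
          using L(1) by (meson mult_left_mono order_trans)
        then show ?thesis unfolding abs_mult abs_heat by (intro mult_right_mono) (auto simp: mult.assoc)
      qed (simp add: on_box_def)
    qed (use heat_times_integrable[OF t(1) on_box_integrable(1)[OF g]] \<psi> in auto)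
    also have "\<dots> = ?D2 * exp (- (1 / 16 * (norm x)\<^sup>2))" by simp
    also have "\<dots> \<le> max ?D1 ?D2 * exp (- (1 / 16 * (norm x)\<^sup>2))" by (intro mult_right_mono) auto
    finally show ?thesis .
  qed
  then show thesis using that by blast
qed

text \<open>
  Discontinuities occur on the boundary of the box only.
\<close>
lemma AE_isCont_on_box:
  assumes "continuous_on UNIV g" shows "AE x in lebesgue. isCont (on_box a b g) x"
proof (rule AE_I')
  show "cbox a b - box a b \<in> null_sets lebesgue" using negligible_frontier_interval negligible_iff_null_sets by blast
  have "isCont (on_box a b g) x" if x: "x \<notin> cbox a b - box a b" for x
  proof (cases "x \<in> box a b")
    case True
    have "isCont g x" using assms by (simp add: continuous_on_eq_continuous_at)
    moreover have "\<forall>\<^sub>F y in nhds x. on_box a b g y = g y"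
      unfolding eventually_nhds using True box_subset_cbox[of a b]
      by (intro exI[of _ "box a b"]) (auto simp: on_box_def)
    ultimately show ?thesis using isCont_cong by blast
  next
    case False
    then have "x \<in> - cbox a b" using x by auto
    then have "\<forall>\<^sub>F y in nhds x. on_box a b g y = 0"
      unfolding eventually_nhds by (intro exI[of _ "- cbox a b"]) (auto simp: on_box_def closed_cbox)
    then show ?thesis using isCont_cong[of "on_box a b g" "\<lambda>_. 0"] by simp
  qed
  then show "{x \<in> space lebesgue. \<not> isCont (on_box a b g) x} \<subseteq> cbox a b - box a b" by blast
qed

text \<open>
  The final value of the backward evolution and the removal of the cutoff in one limit, by dominated
  convergence.
\<close>
lemma backward_weak_limit:
  fixes v :: "'b::euclidean_space \<Rightarrow> real"
  assumes v: "in_Lp 2 v" and g: "continuous_on UNIV g"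
    and s: "\<And>k. S - 1 \<le> s k" "\<And>k. s k < S" "s \<longlonglongrightarrow> S" and m: "filterlim m at_top sequentially"
  shows "(\<lambda>k. LINT x|lebesgue. v x * (cutoff (m k) (s k, x) * backward a b g S (s k, x)))
    \<longlonglongrightarrow> (LINT x|lebesgue. v x * on_box a b g x)"
proof -
  have g': "continuous_on (cbox a b) g" using g continuous_on_subset by blast
  obtain D where D: "\<And>t x. 0 < t \<Longrightarrow> t \<le> 1 \<Longrightarrow> \<bar>heat_flow t (on_box a b g) x\<bar> \<le> D * exp (- (1 / 16 * (norm x)\<^sup>2))"
    using heat_flow_on_box_decay[OF g'] by blast
  have D0: "D \<ge> 0" using D[of 1 0] by simp
  obtain M where M: "\<And>y. \<bar>on_box a b g y\<bar> \<le> M" using on_box_bounded[OF g'] by blast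
  have [measurable]: "v \<in> borel_measurable lebesgue" using v by (rule in_Lp2_measurable)
  have ob: "on_box a b g \<in> borel_measurable lebesgue"
    using on_box_measurable[OF g'] by (simp add: measurable_completion)
  have be: "backward a b g S (s k, x) = heat_flow (S - s k) (on_box a b g) x" for k x
    using backward_eq_heat_flow[OF g', of "(s k, x)" S] s(2) by simp
  have bm: "(\<lambda>x. heat_flow (S - s k) (on_box a b g) x) \<in> borel_measurable lebesgue" for k
    using heat_flow_measurable[OF on_box_measurable[OF g']] by (simp add: measurable_completion)
  have cc: "continuous_on UNIV (cutoff j :: real \<times> 'b \<Rightarrow> real)" for j
    by (rule tame_continuous[OF tame_family_member[OF tame_cutoff]])
  have cm: "(\<lambda>x. cutoff (m k) (s k, x :: 'b)) \<in> borel_measurable lebesgue" for k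
  proof -
    have "continuous_on UNIV (\<lambda>x. cutoff (m k) (s k, x :: 'b))"
      by (intro continuous_on_compose2[OF cc] continuous_intros) auto
    from borel_measurable_continuous_onI[OF this] show ?thesis by (simp add: measurable_completion)
  qed
  have "(\<lambda>k. LINT x|lebesgue. v x * (cutoff (m k) (s k, x) * heat_flow (S - s k) (on_box a b g) x))
    \<longlonglongrightarrow> (LINT x|lebesgue. v x * on_box a b g x)"
  proof (rule integral_dominated_convergence)
    show "integrable lebesgue (\<lambda>x. D * \<bar>v x * exp (- (1 / 16 * (norm x)\<^sup>2))\<bar>)"
      using in_Lp2_inner_integrable[OF v in_Lp2_gaussian[of "1/16"]] by simp
    have lim0: "((\<lambda>k. S - s k) \<longlongrightarrow> 0) sequentially" using tendsto_diff[OF tendsto_const s(3), of S] by simp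
    have lim: "filterlim (\<lambda>k. S - s k) (at_right 0) sequentially"
      unfolding filterlim_at using lim0 s(2) by (auto intro!: always_eventually)
    show "AE x in lebesgue. (\<lambda>k. v x * (cutoff (m k) (s k, x) * heat_flow (S - s k) (on_box a b g) x)) \<longlonglongrightarrow> v x * on_box a b g x"
      using AE_isCont_on_box[OF g, of a b]
    proof eventually_elim
      case (elim x)
      have "(\<lambda>k. heat_flow (S - s k) (on_box a b g) x) \<longlonglongrightarrow> on_box a b g x"
        by (rule filterlim_compose[OF heat_flow_tendsto[OF on_box_integrable(1)[OF g'] M elim] lim])
      then have "(\<lambda>k. v x * (cutoff (m k) (s k, x) * heat_flow (S - s k) (on_box a b g) x)) \<longlonglongrightarrow> v x * (1 * on_box a b g x)"
        by (intro tendsto_intros cutoff_tendsto_1 m)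
      then show ?case by simp
    qed
    fix k
    have "\<bar>cutoff (m k) (s k, x) * heat_flow (S - s k) (on_box a b g) x\<bar> \<le> 1 * (D * exp (- (1 / 16 * (norm x)\<^sup>2)))" for x
      unfolding abs_mult using cutoff_nonneg[of "m k" "(s k, x)"] cutoff_le_1[of "m k" "(s k, x)"] s(1)[of k] s(2)[of k]
      by (intro mult_mono D) auto
    then have "\<bar>v x\<bar> * \<bar>cutoff (m k) (s k, x) * heat_flow (S - s k) (on_box a b g) x\<bar> \<le> \<bar>v x\<bar> * (D * exp (- (1 / 16 * (norm x)\<^sup>2)))" for x
      by (intro mult_left_mono) auto
    then show "AE x in lebesgue. norm (v x * (cutoff (m k) (s k, x) * heat_flow (S - s k) (on_box a b g) x)) \<le> D * \<bar>v x * exp (- (1 / 16 * (norm x)\<^sup>2))\<bar>"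
      by (intro AE_I2) (simp add: abs_mult mult_ac)
  qed (use ob bm cm in \<open>auto intro!: borel_measurable_times\<close>)
  then show ?thesis by (simp add: be)
qed

text \<open>
  The best test function would be \<open>h\<close> itself.  It is truncated in space and in size, and the truncation
  is an almost everywhere limit of continuous functions, by the measurability of \<open>h\<close>; clipping these
  preserves the bound needed for dominated convergence.
\<close>
lemma Lp2_norm_le_by_testing:
  fixes h :: "'b::euclidean_space \<Rightarrow> real"
  assumes h: "in_Lp 2 h" and K: "K \<ge> 0"
    and test: "\<And>a b g. continuous_on UNIV g \<Longrightarrow> (LINT x|lebesgue. h x * on_box a b g x) \<le> K * Lp_norm 2 (on_box a b g)"
  shows "Lp_norm 2 h \<le> K"
proof -
  have hm [measurable]: "h \<in> borel_measurable lebesgue" using h by (rule in_Lp2_measurable)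
  define clip where "clip M y = max (- M) (min M y)" for M y :: real
  define B where "B k = cbox (- real k *\<^sub>R One) (real k *\<^sub>R (One :: 'b))" for k :: nat
  define hk where "hk k x = indicator (B k) x * clip (real k) (h x)" for k x
  have clipb: "\<bar>clip (real k) y\<bar> \<le> real k" "\<bar>clip (real k) y\<bar> \<le> \<bar>y\<bar>" "clip (real k) y * clip (real k) y \<le> y * clip (real k) y" for k y
  proof -
    show "\<bar>clip (real k) y\<bar> \<le> real k" "\<bar>clip (real k) y\<bar> \<le> \<bar>y\<bar>" by (auto simp: clip_def)
    have "clip (real k) y * (y - clip (real k) y) \<ge> 0"
      by (auto simp: clip_def max_def min_def zero_le_mult_iff mult_nonneg_nonneg mult_nonpos_nonpos)
    then show "clip (real k) y * clip (real k) y \<le> y * clip (real k) y" by (simp add: algebra_simps)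
  qed
  have [measurable]: "B k \<in> sets lebesgue" for k by (simp add: B_def)
  have [measurable]: "hk k \<in> borel_measurable lebesgue" for k
    unfolding hk_def clip_def by measurable
  have iB: "integrable lebesgue (\<lambda>x. indicator (B k) x * c)" for k and c :: real
    unfolding B_def by (simp add: lmeasurable_cbox[unfolded fmeasurable_def] emeasure_lborel_cbox_eq emeasure_completion)
  have hk2: "in_Lp 2 (hk k)" for k
    by (rule in_Lp2_bounded_by(1)[OF h, of _ 1]) (use clipb(2) in \<open>auto simp: hk_def indicator_def\<close>)
  have key: "(LINT x|lebesgue. (hk k x)\<^sup>2) \<le> K\<^sup>2" for k
  proof -
    have "h measurable_on UNIV" by (rule lebesgue_measurable_imp_measurable_on_real) auto
    then obtain N g where N: "negligible N" and g: "\<And>n. continuous_on UNIV (g n)"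
      and lim: "\<And>x. x \<notin> N \<Longrightarrow> (\<lambda>n. g n x) \<longlonglongrightarrow> h x"
      unfolding measurable_on_def by auto
    define gk where "gk n x = clip (real k) (g n x)" for n x
    have gc: "continuous_on UNIV (gk n)" for n unfolding gk_def clip_def by (intro continuous_intros g)
    have gk_box: "on_box (- real k *\<^sub>R One) (real k *\<^sub>R One) (gk n) x = indicator (B k) x * gk n x" for n x
      by (simp add: on_box_def B_def)
    have AElim: "AE x in lebesgue. (\<lambda>n. indicator (B k) x * gk n x) \<longlonglongrightarrow> hk k x"
    proof -
      have "AE x in lebesgue. x \<notin> N" using N by (simp add: AE_not_in negligible_iff_null_sets)
      then show ?thesis unfolding hk_def gk_def clip_def
        by eventually_elim (intro tendsto_intros lim)
    qed
    have gm [measurable]: "(\<lambda>x. indicator (B k) x * gk n x) \<in> borel_measurable lebesgue" for n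
    proof -
      have "gk n \<in> borel_measurable lebesgue"
        using borel_measurable_continuous_onI[OF gc[of n]] by (simp add: measurable_completion)
      then show ?thesis by measurable
    qed
    have gb: "\<bar>indicator (B k) x * gk n x\<bar> \<le> indicator (B k) x * real k" for n x
      using clipb(1)[of k "g n x"] by (auto simp: gk_def indicator_def)
    have l1: "(\<lambda>n. LINT x|lebesgue. h x * (indicator (B k) x * gk n x)) \<longlonglongrightarrow> (LINT x|lebesgue. h x * hk k x)"
    proof (rule integral_dominated_convergence)
      have "in_Lp 2 (\<lambda>x. indicator (B k) x * real k)"
      proof -
        have "(norm (indicator (B k) x * real k))\<^sup>2 = indicator (B k) x * (real k)\<^sup>2" for x by (simp add: indicator_def)
        then show ?thesis using iB[of k "(real k)\<^sup>2"] by (simp add: in_Lp2_iff)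
      qed
      from in_Lp2_inner_integrable[OF h this]
      show "integrable lebesgue (\<lambda>x. \<bar>h x * (indicator (B k) x * real k)\<bar>)" by simp
      show "AE x in lebesgue. (\<lambda>n. h x * (indicator (B k) x * gk n x)) \<longlonglongrightarrow> h x * hk k x"
        using AElim by eventually_elim (intro tendsto_intros)
      show "AE x in lebesgue. norm (h x * (indicator (B k) x * gk n x)) \<le> \<bar>h x * (indicator (B k) x * real k)\<bar>" for n
        using gb by (intro AE_I2) (simp add: abs_mult mult_left_mono)
    qed measurable
    have l2: "(\<lambda>n. LINT x|lebesgue. (indicator (B k) x * gk n x)\<^sup>2) \<longlonglongrightarrow> (LINT x|lebesgue. (hk k x)\<^sup>2)"
    proof (rule integral_dominated_convergence)
      show "integrable lebesgue (\<lambda>x. indicator (B k) x * (real k)\<^sup>2)" by (rule iB)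
      show "AE x in lebesgue. (\<lambda>n. (indicator (B k) x * gk n x)\<^sup>2) \<longlonglongrightarrow> (hk k x)\<^sup>2"
        using AElim by eventually_elim (intro tendsto_intros)
      have "(indicator (B k) x * gk n x)\<^sup>2 \<le> indicator (B k) x * (real k)\<^sup>2" for n x
        using power_mono[OF gb[of x n], of 2] by (auto simp: indicator_def)
      then show "AE x in lebesgue. norm ((indicator (B k) x * gk n x)\<^sup>2) \<le> indicator (B k) x * (real k)\<^sup>2" for n
        by (intro AE_I2) simp
    qed measurable
    have "(LINT x|lebesgue. h x * hk k x) \<le> K * sqrt (LINT x|lebesgue. (hk k x)\<^sup>2)"
    proof (rule LIMSEQ_le[OF l1 tendsto_mult[OF tendsto_const tendsto_real_sqrt[OF l2]]], intro exI allI impI)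
      fix n :: nat
      show "(LINT x|lebesgue. h x * (indicator (B k) x * gk n x)) \<le> K * sqrt (LINT x|lebesgue. (indicator (B k) x * gk n x)\<^sup>2)"
        using test[OF gc[of n], of "- real k *\<^sub>R One" "real k *\<^sub>R One"] unfolding gk_box Lp2_norm by simp
    qed
    moreover have "(LINT x|lebesgue. (hk k x)\<^sup>2) \<le> (LINT x|lebesgue. h x * hk k x)"
    proof (rule integral_mono)
      show "integrable lebesgue (\<lambda>x. (hk k x)\<^sup>2)" using hk2[of k] by (simp add: in_Lp2_iff)
      show "integrable lebesgue (\<lambda>x. h x * hk k x)" using in_Lp2_inner_integrable[OF h hk2[of k]] by simp
      show "(hk k x)\<^sup>2 \<le> h x * hk k x" for x
        using clipb(3)[of k "h x"] by (auto simp: hk_def indicator_def power2_eq_square)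
    qed
    ultimately have "(LINT x|lebesgue. (hk k x)\<^sup>2) \<le> K * sqrt (LINT x|lebesgue. (hk k x)\<^sup>2)" by linarith
    moreover have "y \<le> K\<^sup>2" if "y \<le> K * sqrt y" "0 \<le> y" for y :: real
    proof -
      have "sqrt y * sqrt y \<le> K * sqrt y" using that by simp
      then have "sqrt y \<le> K" if "0 < sqrt y" using mult_right_le_imp_le that by blast
      then have "sqrt y \<le> K" using K \<open>0 \<le> y\<close> by fastforce
      then show ?thesis by (rule sqrt_le_D)
    qed
    ultimately show ?thesis by simp
  qed
  have "(\<lambda>k. LINT x|lebesgue. (hk k x)\<^sup>2) \<longlonglongrightarrow> (LINT x|lebesgue. (h x)\<^sup>2)"
  proof (rule integral_dominated_convergence)
    show "integrable lebesgue (\<lambda>x. (h x)\<^sup>2)" using h by (simp add: in_Lp2_iff)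
    have "(\<lambda>k. (hk k x)\<^sup>2) \<longlonglongrightarrow> (h x)\<^sup>2" for x
    proof (rule tendsto_eventually)
      obtain j where j: "real j \<ge> \<bar>h x\<bar>" "real j \<ge> norm x" using real_arch_simple[of "max \<bar>h x\<bar> (norm x)"] by auto
      have "hk k x = h x" if "k \<ge> j" for k
      proof -
        have "x \<in> B k"
          unfolding B_def mem_box using Basis_le_norm[of _ x] j that by (force simp: abs_le_iff)
        moreover have "clip (real k) (h x) = h x" using j that by (auto simp: clip_def)
        ultimately show ?thesis by (simp add: hk_def)
      qed
      then show "\<forall>\<^sub>F k in sequentially. (hk k x)\<^sup>2 = (h x)\<^sup>2"
        unfolding eventually_sequentially by (intro exI[of _ j]) simp
    qed
    then show "AE x in lebesgue. (\<lambda>k. (hk k x)\<^sup>2) \<longlonglongrightarrow> (h x)\<^sup>2" by simp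
    show "AE x in lebesgue. norm ((hk k x)\<^sup>2) \<le> (h x)\<^sup>2" for k
      using clipb(2) by (intro AE_I2) (simp add: hk_def indicator_def abs_le_square_iff)
  qed measurable
  then have "(LINT x|lebesgue. (h x)\<^sup>2) \<le> K\<^sup>2" using key by (intro LIMSEQ_le_const2) auto
  then show ?thesis using K by (simp add: Lp2_norm real_le_lsqrt)
qed

section \<open>Pairings of weakly continuous fields with test fields\<close>

definition cc_field :: "(real \<times> 'b::euclidean_space \<Rightarrow> 'c::euclidean_space) \<Rightarrow> bool" where
  "cc_field \<zeta> \<longleftrightarrow> continuous_on UNIV \<zeta> \<and> (\<exists>r. \<forall>z. r < norm z \<longrightarrow> \<zeta> z = 0)"

lemma cc_field_support:
  assumes "cc_field \<zeta>"
  obtains r where "r > 0" "\<And>t x. r < \<bar>t\<bar> \<Longrightarrow> \<zeta> (t, x) = 0" "\<And>t x. r < norm x \<Longrightarrow> \<zeta> (t, x) = 0"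
proof -
  obtain r where r: "\<And>z. r < norm z \<Longrightarrow> \<zeta> z = 0" using assms unfolding cc_field_def by blast
  have "\<zeta> (t, x) = 0" if "\<bar>r\<bar> + 1 < \<bar>t\<bar>" for t x
    using r[of "(t, x)"] norm_fst_le[of t x] that by simp
  moreover have "\<zeta> (t, x) = 0" if "\<bar>r\<bar> + 1 < norm x" for t x
    using r[of "(t, x)"] norm_snd_le[of x t] that by simp
  ultimately show thesis using that[of "\<bar>r\<bar> + 1"] by simp
qed

lemma cc_field_bounded:
  assumes "cc_field \<zeta>" obtains M where "M \<ge> 0" "\<And>z. norm (\<zeta> z) \<le> M"
proof -
  obtain r where r: "\<And>z. r < norm z \<Longrightarrow> \<zeta> z = 0" and c: "continuous_on UNIV \<zeta>"
    using assms unfolding cc_field_def by blast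
  have "bounded (\<zeta> ` cball 0 r)"
    by (intro compact_imp_bounded compact_continuous_image continuous_on_subset[OF c]) auto
  then obtain M where "\<forall>z\<in>cball 0 r. norm (\<zeta> z) \<le> M" by (auto simp: bounded_iff)
  then have M: "\<And>z. norm z \<le> r \<Longrightarrow> norm (\<zeta> z) \<le> M" by simp
  have "norm (\<zeta> z) \<le> \<bar>M\<bar>" for z
    using M[of z] r[of z] by (cases "norm z \<le> r") auto
  then show thesis using that[of "\<bar>M\<bar>"] by simp
qed

lemma cc_field_uniform:
  assumes "cc_field \<zeta>" "e > 0"
  obtains d where "d > 0" "\<And>t t0 x. \<bar>t - t0\<bar> < d \<Longrightarrow> norm (\<zeta> (t, x) - \<zeta> (t0, x)) < e"
proof -
  obtain r where r: "r > 0" "\<And>t x. r < \<bar>t\<bar> \<Longrightarrow> \<zeta> (t, x) = 0" "\<And>t x. r < norm x \<Longrightarrow> \<zeta> (t, x) = 0"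
    using cc_field_support[OF assms(1)] by blast
  let ?K = "{- r - 2..r + 2} \<times> cball 0 r"
  have "uniformly_continuous_on ?K \<zeta>"
    using assms(1) by (intro compact_uniformly_continuous compact_Times) (auto simp: cc_field_def intro: continuous_on_subset)
  then obtain d where d: "d > 0" "\<And>z z'. z \<in> ?K \<Longrightarrow> z' \<in> ?K \<Longrightarrow> dist z' z < d \<Longrightarrow> dist (\<zeta> z') (\<zeta> z) < e"
    using assms(2) unfolding uniformly_continuous_on_def by metis
  have "norm (\<zeta> (t, x) - \<zeta> (t0, x)) < e" if t: "\<bar>t - t0\<bar> < min d 1" for t t0 x
  proof (cases "r < norm x \<or> r + 1 < \<bar>t\<bar>")
    case True
    then have "r < norm x \<or> (r < \<bar>t\<bar> \<and> r < \<bar>t0\<bar>)" using t by auto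
    then show ?thesis using r(2)[of t x] r(2)[of t0 x] r(3)[of x t] r(3)[of x t0] assms(2) by auto
  next
    case False
    then have "(t, x) \<in> ?K" "(t0, x) \<in> ?K" using t by auto
    moreover have "dist (t, x) (t0, x) < d" using t by (simp add: dist_Pair_Pair dist_real_def)
    ultimately show ?thesis using d(2)[of "(t0, x)" "(t, x)"] by (simp add: dist_norm)
  qed
  then show thesis using that[of "min d 1"] d(1) by simp
qed

lemma cc_field_slice_measurable:
  assumes "cc_field \<zeta>" shows "(\<lambda>x. \<zeta> (t, x)) \<in> borel_measurable lebesgue"
proof -
  have "continuous_on UNIV (\<lambda>x. \<zeta> (t, x))"
    using assms by (auto simp: cc_field_def intro!: continuous_on_compose2[of UNIV \<zeta> UNIV] continuous_intros)
  from borel_measurable_continuous_onI[OF this] show ?thesis by (simp add: measurable_completion)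
qed

lemma in_Lp2_indicator_ball: "in_Lp 2 (\<lambda>x::'b::euclidean_space. indicator (cball 0 r) x :: real)"
proof -
  have "integrable lborel (\<lambda>x::'b. indicator (cball 0 r) x :: real)"
    using emeasure_bounded_finite[OF bounded_cball, of "0::'b" r] by (intro integrable_real_indicator) auto
  moreover have "(norm (indicator (cball 0 r) x :: real))\<^sup>2 = indicator (cball 0 r) x" for x :: 'b
    by (simp add: indicator_def)
  ultimately show ?thesis by (subst in_Lp2_lborel) auto
qed

lemma in_Lp2_cc_field:
  assumes "cc_field \<zeta>" shows "in_Lp 2 (\<lambda>x. \<zeta> (t, x))"
proof -
  obtain r where "r > 0" "\<And>t x. r < \<bar>t\<bar> \<Longrightarrow> \<zeta> (t, x) = 0" and r: "\<And>t x. r < norm x \<Longrightarrow> \<zeta> (t, x) = 0"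
    using cc_field_support[OF assms] by blast
  obtain M where M: "M \<ge> 0" "\<And>z. norm (\<zeta> z) \<le> M" using cc_field_bounded[OF assms] by blast
  have "norm (\<zeta> (t, x)) \<le> M * norm (indicator (cball 0 r) x :: real)" for x
    using M(2)[of "(t, x)"] r[of x t] by (cases "r < norm x") (simp_all add: indicator_def)
  then show ?thesis
    by (rule in_Lp2_bounded_by(1)[OF in_Lp2_indicator_ball[of r] cc_field_slice_measurable[OF assms] _ M(1)])
qed

lemma cc_field_L2_continuous:
  assumes "cc_field \<zeta>"
  shows "((\<lambda>t. Lp_norm 2 (\<lambda>x. \<zeta> (t, x) - \<zeta> (t0, x))) \<longlongrightarrow> 0) (at t0 within A)"
proof (rule tendstoI)
  fix e :: real assume e: "e > 0"
  obtain r where "r > 0" "\<And>t x. r < \<bar>t\<bar> \<Longrightarrow> \<zeta> (t, x) = 0" and r: "\<And>t x. r < norm x \<Longrightarrow> \<zeta> (t, x) = 0"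
    using cc_field_support[OF assms] by blast
  let ?V = "Lp_norm 2 (\<lambda>x::'a. indicator (cball 0 r) x :: real)"
  have V: "?V \<ge> 0" by (rule Lp2_norm_nonneg)
  define e' where "e' = e / (2 * (?V + 1))"
  have e': "e' > 0" using e V by (simp add: e'_def)
  have "e' * ?V \<le> e' * (?V + 1)" using e' by (intro mult_left_mono) auto
  also have "\<dots> = e / 2"
  proof -
    have "e / (2 * B) * B = e / 2" if "B > 0" for B :: real using that by simp
    from this[of "?V + 1"] show ?thesis unfolding e'_def using V by linarith
  qed
  also have "\<dots> < e" using e by simp
  finally have e'V: "e' * ?V < e" .
  obtain d where d: "d > 0" "\<And>t t0 x. \<bar>t - t0\<bar> < d \<Longrightarrow> norm (\<zeta> (t, x) - \<zeta> (t0, x)) < e'"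
    using cc_field_uniform[OF assms e'] by blast
  have "Lp_norm 2 (\<lambda>x. \<zeta> (t, x) - \<zeta> (t0, x)) < e" if "\<bar>t - t0\<bar> < d" for t
  proof -
    have "norm (\<zeta> (t, x) - \<zeta> (t0, x)) \<le> e' * norm (indicator (cball 0 r) x :: real)" for x
      using d(2)[OF that, of x] r[of x t] r[of x t0] by (cases "r < norm x") (simp_all add: indicator_def)
    then have "Lp_norm 2 (\<lambda>x. \<zeta> (t, x) - \<zeta> (t0, x)) \<le> e' * ?V"
      using e' by (intro in_Lp2_bounded_by(2)[OF in_Lp2_indicator_ball] borel_measurable_diff
          cc_field_slice_measurable[OF assms]) simp_all
    then show ?thesis using e'V by linarith
  qed
  then show "\<forall>\<^sub>F t in at t0 within A. dist (Lp_norm 2 (\<lambda>x. \<zeta> (t, x) - \<zeta> (t0, x))) 0 < e"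
    unfolding eventually_at using d(1) by (intro exI[of _ d]) (auto simp: dist_real_def Lp2_norm_nonneg)
qed

text \<open>
  The local bound on the norm is what keeps pairings with time dependent fields continuous.
\<close>
definition weakly_continuous :: "(real \<Rightarrow> 'b::euclidean_space \<Rightarrow> 'c::euclidean_space) \<Rightarrow> bool" where
  "weakly_continuous u \<longleftrightarrow> (\<forall>t\<ge>0. in_Lp 2 (u t)) \<and>
     (\<forall>w. in_Lp 2 w \<longrightarrow> continuous_on {0..} (\<lambda>t. LINT x|lebesgue. u t x \<bullet> w x)) \<and>
     (\<forall>T. \<exists>M. \<forall>t\<in>{0..T}. Lp_norm 2 (u t) \<le> M)"

lemma Lp2_norm_continuous:
  fixes v :: "real \<Rightarrow> 'b::euclidean_space \<Rightarrow> 'c::euclidean_space"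
  assumes L: "\<And>t. t \<ge> 0 \<Longrightarrow> in_Lp 2 (v t)"
    and c: "\<And>t. t \<ge> 0 \<Longrightarrow> ((\<lambda>s. Lp_norm 2 (\<lambda>x. v s x - v t x)) \<longlongrightarrow> 0) (at t within {0..})"
  shows "continuous_on {0..} (\<lambda>t. Lp_norm 2 (v t))"
  unfolding continuous_on_def
proof
  fix t :: real assume t: "t \<in> {0..}"
  have b: "\<bar>Lp_norm 2 (v s) - Lp_norm 2 (v t)\<bar> \<le> Lp_norm 2 (\<lambda>x. v s x - v t x)" if s: "s \<in> {0..}" for s
  proof -
    have Ls: "in_Lp 2 (v s)" and Lt: "in_Lp 2 (v t)" using L s t by auto
    have "Lp_norm 2 (\<lambda>x. v t x + (v s x - v t x)) \<le> Lp_norm 2 (v t) + Lp_norm 2 (\<lambda>x. v s x - v t x)"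
      by (intro Lp2_norm_triangle in_Lp2_diff Ls Lt)
    moreover have "Lp_norm 2 (\<lambda>x. v s x + (- 1) *\<^sub>R (v s x - v t x)) \<le> Lp_norm 2 (v s) + Lp_norm 2 (\<lambda>x. (- 1) *\<^sub>R (v s x - v t x))"
      by (intro Lp2_norm_triangle in_Lp2_scaleR in_Lp2_diff Ls Lt)
    moreover have "Lp_norm 2 (\<lambda>x. (- 1) *\<^sub>R (v s x - v t x)) = Lp_norm 2 (\<lambda>x. v s x - v t x)"
      using in_Lp2_scaleR(2)[OF in_Lp2_diff[OF Ls Lt], of "- 1"] by simp
    ultimately show ?thesis by simp
  qed
  have "((\<lambda>s. Lp_norm 2 (v s) - Lp_norm 2 (v t)) \<longlongrightarrow> 0) (at t within {0..})"
  proof (rule Lim_null_comparison[OF _ c])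
    show "\<forall>\<^sub>F s in at t within {0..}. norm (Lp_norm 2 (v s) - Lp_norm 2 (v t)) \<le> Lp_norm 2 (\<lambda>x. v s x - v t x)"
      unfolding eventually_at_filter using b by (intro always_eventually) auto
  qed (use t in auto)
  then show "((\<lambda>s. Lp_norm 2 (v s)) \<longlongrightarrow> Lp_norm 2 (v t)) (at t within {0..})" by (rule LIM_zero_cancel)
qed

lemma L2_continuous_imp_weakly_continuous:
  fixes v :: "real \<Rightarrow> 'b::euclidean_space \<Rightarrow> 'c::euclidean_space"
  assumes L: "\<And>t. t \<ge> 0 \<Longrightarrow> in_Lp 2 (v t)"
    and c: "\<And>t. t \<ge> 0 \<Longrightarrow> ((\<lambda>s. Lp_norm 2 (\<lambda>x. v s x - v t x)) \<longlongrightarrow> 0) (at t within {0..})"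
  shows "weakly_continuous v"
  unfolding weakly_continuous_def
proof (intro conjI allI impI L)
  fix w :: "'b \<Rightarrow> 'c" assume w: "in_Lp 2 w"
  show "continuous_on {0..} (\<lambda>t. LINT x|lebesgue. v t x \<bullet> w x)"
    unfolding continuous_on_def
  proof
    fix t :: real assume t: "t \<in> {0..}"
    have b: "\<bar>(LINT x|lebesgue. v s x \<bullet> w x) - (LINT x|lebesgue. v t x \<bullet> w x)\<bar> \<le> Lp_norm 2 (\<lambda>x. v s x - v t x) * Lp_norm 2 w"
      if s: "s \<in> {0..}" for s
    proof -
      have Ls: "in_Lp 2 (v s)" and Lt: "in_Lp 2 (v t)" using L s t by auto
      show ?thesis
        using Lp2_Cauchy_Schwarz[OF in_Lp2_diff[OF Ls Lt] w] in_Lp2_inner_integrable[OF Ls w] in_Lp2_inner_integrable[OF Lt w]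
        by (simp add: inner_diff_left)
    qed
    have "((\<lambda>s. (LINT x|lebesgue. v s x \<bullet> w x) - (LINT x|lebesgue. v t x \<bullet> w x)) \<longlongrightarrow> 0) (at t within {0..})"
    proof (rule Lim_null_comparison)
      show "\<forall>\<^sub>F s in at t within {0..}. norm ((LINT x|lebesgue. v s x \<bullet> w x) - (LINT x|lebesgue. v t x \<bullet> w x)) \<le> Lp_norm 2 (\<lambda>x. v s x - v t x) * Lp_norm 2 w"
        unfolding eventually_at_filter using b by (intro always_eventually) auto
      show "((\<lambda>s. Lp_norm 2 (\<lambda>x. v s x - v t x) * Lp_norm 2 w) \<longlongrightarrow> 0) (at t within {0..})"
        using tendsto_mult[OF c[of t] tendsto_const[of "Lp_norm 2 w"]] t by simp
    qed
    then show "((\<lambda>s. LINT x|lebesgue. v s x \<bullet> w x) \<longlongrightarrow> (LINT x|lebesgue. v t x \<bullet> w x)) (at t within {0..})" by (rule LIM_zero_cancel)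
  qed
next
  fix T :: real
  have "continuous_on {0..T} (\<lambda>t. Lp_norm 2 (v t))" using Lp2_norm_continuous[OF L c] by (rule continuous_on_subset) auto
  then have "compact ((\<lambda>t. Lp_norm 2 (v t)) ` {0..T})" by (intro compact_continuous_image) auto
  then obtain M where "\<forall>y\<in>(\<lambda>t. Lp_norm 2 (v t)) ` {0..T}. norm y \<le> M" using compact_imp_bounded bounded_iff by metis
  then show "\<exists>M. \<forall>t\<in>{0..T}. Lp_norm 2 (v t) \<le> M" by (intro exI[of _ M]) auto
qed

text \<open>
  Weak continuity of one factor and strong continuity of the other, the weak one being bounded.
\<close>
lemma pairing_continuous:
  assumes u: "weakly_continuous u"
    and Z: "\<And>t. in_Lp 2 (Z t)" "\<And>t0. t0 \<ge> 0 \<Longrightarrow> ((\<lambda>t. Lp_norm 2 (\<lambda>x. Z t x - Z t0 x)) \<longlongrightarrow> 0) (at t0 within {0..})"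
  shows "continuous_on {0..} (\<lambda>t. LINT x|lebesgue. u t x \<bullet> Z t x)"
  unfolding continuous_on_def
proof
  fix t0 :: real assume t0: "t0 \<in> {0..}"
  have uL: "in_Lp 2 (u t)" if "t \<ge> 0" for t using u that by (simp add: weakly_continuous_def)
  obtain M where M: "\<And>t. t \<in> {0..t0+1} \<Longrightarrow> Lp_norm 2 (u t) \<le> M" using u unfolding weakly_continuous_def by blast
  have "((\<lambda>t. LINT x|lebesgue. u t x \<bullet> (Z t x - Z t0 x)) \<longlongrightarrow> 0) (at t0 within {0..})"
  proof (rule Lim_null_comparison)
    show "((\<lambda>t. M * Lp_norm 2 (\<lambda>x. Z t x - Z t0 x)) \<longlongrightarrow> 0) (at t0 within {0..})"
      using tendsto_mult[OF tendsto_const Z(2)[of t0], of M] t0 by simp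
    have "norm (LINT x|lebesgue. u t x \<bullet> (Z t x - Z t0 x)) \<le> M * Lp_norm 2 (\<lambda>x. Z t x - Z t0 x)"
      if "t \<ge> 0" "dist t t0 < 1" for t
    proof -
      have "t \<in> {0..t0+1}" using that by (auto simp: dist_real_def)
      then have "Lp_norm 2 (u t) * Lp_norm 2 (\<lambda>x. Z t x - Z t0 x) \<le> M * Lp_norm 2 (\<lambda>x. Z t x - Z t0 x)"
        by (intro mult_right_mono M Lp2_norm_nonneg)
      then show ?thesis
        using Lp2_Cauchy_Schwarz[OF uL[OF that(1)] in_Lp2_diff[OF Z(1)[of t] Z(1)[of t0]]] by simp
    qed
    then show "\<forall>\<^sub>F t in at t0 within {0..}. norm (LINT x|lebesgue. u t x \<bullet> (Z t x - Z t0 x)) \<le> M * Lp_norm 2 (\<lambda>x. Z t x - Z t0 x)"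
      unfolding eventually_at by (intro exI[of _ 1]) auto
  qed
  moreover have "((\<lambda>t. LINT x|lebesgue. u t x \<bullet> Z t0 x) \<longlongrightarrow> (LINT x|lebesgue. u t0 x \<bullet> Z t0 x)) (at t0 within {0..})"
    using u Z(1) t0 unfolding weakly_continuous_def continuous_on_def by blast
  ultimately have "((\<lambda>t. (LINT x|lebesgue. u t x \<bullet> (Z t x - Z t0 x)) + (LINT x|lebesgue. u t x \<bullet> Z t0 x))
      \<longlongrightarrow> 0 + (LINT x|lebesgue. u t0 x \<bullet> Z t0 x)) (at t0 within {0..})" by (rule tendsto_add)
  moreover have "(LINT x|lebesgue. u t x \<bullet> (Z t x - Z t0 x)) + (LINT x|lebesgue. u t x \<bullet> Z t0 x) = (LINT x|lebesgue. u t x \<bullet> Z t x)"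
    if "t \<ge> 0" for t
    using in_Lp2_inner_integrable[OF uL[OF that] Z(1)] by (simp add: inner_diff_right)
  ultimately show "((\<lambda>t. LINT x|lebesgue. u t x \<bullet> Z t x) \<longlongrightarrow> (LINT x|lebesgue. u t0 x \<bullet> Z t0 x)) (at t0 within {0..})"
    by (auto elim!: Lim_transform_eventually simp: eventually_at intro!: exI[of _ 1])
qed

abbreviation "time \<equiv> lebesgue_on {0::real<..}"

lemma time_integrable:
  fixes h :: "real \<Rightarrow> real"
  assumes "h \<in> borel_measurable time" "\<And>t. 0 < t \<Longrightarrow> t \<le> T \<Longrightarrow> \<bar>h t\<bar> \<le> B" "\<And>t. T < t \<Longrightarrow> h t = 0"
  shows "integrable time h"
proof (rule Bochner_Integration.integrable_bound)
  have "integrable lebesgue (\<lambda>t. indicator {0<..} t *\<^sub>R (indicator {0..T} t * \<bar>B\<bar> :: real))"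
  proof -
    have "integrable lebesgue (\<lambda>t. indicator {0<..T} t * \<bar>B\<bar> :: real)"
      using emeasure_bounded_finite[of "{0<..T}"]
      by (intro integrable_mult_left integrable_real_indicator) auto
    then show ?thesis
      by (rule Bochner_Integration.integrable_cong[THEN iffD1, rotated -1]) (auto simp: indicator_def)
  qed
  then show "integrable time (\<lambda>t. indicator {0..T} t * \<bar>B\<bar> :: real)"
    by (subst integrable_restrict_space) auto
  show "AE t in time. norm (h t) \<le> norm (indicator {0..T} t * \<bar>B\<bar> :: real)"
  proof (rule AE_I2)
    fix t :: real assume "t \<in> space time"
    then have "t > 0" by (simp add: space_restrict_space)
    then show "norm (h t) \<le> norm (indicator {0..T} t * \<bar>B\<bar> :: real)"
      using assms(2)[of t] assms(3)[of t] by (cases "t \<le> T") auto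
  qed
qed (rule assms(1))

lemma time_measurable_continuous:
  fixes h :: "real \<Rightarrow> real"
  assumes "continuous_on {0..} h" shows "h \<in> borel_measurable time"
  by (rule continuous_imp_measurable_on_sets_lebesgue) (auto intro: continuous_on_subset[OF assms])

lemma pairing_integrable:
  assumes u: "weakly_continuous u" and \<zeta>: "cc_field \<zeta>"
  shows "integrable time (\<lambda>t. LINT x|lebesgue. u t x \<bullet> \<zeta> (t, x))"
proof -
  have c: "continuous_on {0..} (\<lambda>t. LINT x|lebesgue. u t x \<bullet> \<zeta> (t, x))"
    by (intro pairing_continuous u in_Lp2_cc_field \<zeta> cc_field_L2_continuous)
  obtain r where "r > 0" and r: "\<And>t x. r < \<bar>t\<bar> \<Longrightarrow> \<zeta> (t, x) = 0" and "\<And>t x. r < norm x \<Longrightarrow> \<zeta> (t, x) = 0"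
    using cc_field_support[OF \<zeta>] by blast
  have "bounded ((\<lambda>t. LINT x|lebesgue. u t x \<bullet> \<zeta> (t, x)) ` {0..\<bar>r\<bar>})"
    by (intro compact_imp_bounded compact_continuous_image continuous_on_subset[OF c]) auto
  then obtain B where "\<forall>t\<in>{0..\<bar>r\<bar>}. \<bar>LINT x|lebesgue. u t x \<bullet> \<zeta> (t, x)\<bar> \<le> B" by (auto simp: bounded_iff)
  then show ?thesis
    by (intro time_integrable[of _ "\<bar>r\<bar>" B] time_measurable_continuous c) (auto simp: r)
qed

text \<open>
  For a simple function of time the pairing is a finite sum of continuous functions on measurable sets;
  the general case follows by approximation in \<open>L\<^sup>2\<close> at almost every time.
\<close>
lemma forcing_pairing_measurable:
  assumes f: "strongly_measurable_L2 f" and \<zeta>: "cc_field \<zeta>"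
  shows "(\<lambda>t. LINT x|lebesgue. f t x \<bullet> \<zeta> (t, x)) \<in> borel_measurable time"
proof -
  obtain s where s: "\<And>k. simple_function time (s k)" "\<And>k t. t > 0 \<Longrightarrow> in_Lp 2 (s k t)"
    and lim: "AE t in time. in_Lp 2 (f t) \<and> (\<lambda>k. Lp_norm 2 (\<lambda>x. s k t x - f t x)) \<longlonglongrightarrow> 0"
    using f unfolding strongly_measurable_L2_def by blast
  have sm: "(\<lambda>t. LINT x|lebesgue. s k t x \<bullet> \<zeta> (t, x)) \<in> borel_measurable time" for k
  proof -
    let ?C = "s k ` {0<..}"
    have fin: "finite ?C" using s(1)[of k] by (simp add: simple_function_def space_restrict_space)
    have cm: "(\<lambda>t. LINT x|lebesgue. c x \<bullet> \<zeta> (t, x)) \<in> borel_measurable time" if "c \<in> ?C" for c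
    proof (rule time_measurable_continuous, rule pairing_continuous[where u="\<lambda>_. c"])
      show "weakly_continuous (\<lambda>_. c)" using s(2) that unfolding weakly_continuous_def by auto
    qed (intro in_Lp2_cc_field \<zeta> cc_field_L2_continuous)+
    have "(\<lambda>t. \<Sum>c\<in>?C. indicator (s k -` {c} \<inter> space time) t * (LINT x|lebesgue. c x \<bullet> \<zeta> (t, x))) \<in> borel_measurable time"
      using s(1)[of k] cm by (intro borel_measurable_sum borel_measurable_times borel_measurable_indicator)
        (auto simp: simple_function_def space_restrict_space)
    moreover have "(LINT x|lebesgue. s k t x \<bullet> \<zeta> (t, x))
        = (\<Sum>c\<in>?C. indicator (s k -` {c} \<inter> space time) t * (LINT x|lebesgue. c x \<bullet> \<zeta> (t, x)))" if "t \<in> space time" for t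
    proof -
      have t: "t > 0" using that by (simp add: space_restrict_space)
      have "(\<Sum>c\<in>?C. indicator (s k -` {c} \<inter> space time) t * (LINT x|lebesgue. c x \<bullet> \<zeta> (t, x)))
          = (\<Sum>c\<in>?C. if c = s k t then LINT x|lebesgue. c x \<bullet> \<zeta> (t, x) else 0)"
        using that by (intro sum.cong) (auto simp: indicator_def)
      then show ?thesis using fin t by simp
    qed
    ultimately show ?thesis using measurable_cong[of time] by (metis (no_types, lifting))
  qed
  have "AE t in lebesgue. t \<in> {0<..} \<longrightarrow> in_Lp 2 (f t) \<and> (\<lambda>k. Lp_norm 2 (\<lambda>x. s k t x - f t x)) \<longlonglongrightarrow> 0"
    using lim by (subst (asm) AE_restrict_space_iff) auto
  then obtain N where N: "N \<in> null_sets lebesgue"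
    and fN: "\<And>t. t > 0 \<Longrightarrow> t \<notin> N \<Longrightarrow> in_Lp 2 (f t)"
      "\<And>t. t > 0 \<Longrightarrow> t \<notin> N \<Longrightarrow> (\<lambda>k. Lp_norm 2 (\<lambda>x. s k t x - f t x)) \<longlonglongrightarrow> 0"
    unfolding completion.AE_iff_null_sets by auto
  let ?H = "\<lambda>k t. LINT x|lebesgue. s k t x \<bullet> \<zeta> (t, x)" and ?F = "\<lambda>t. LINT x|lebesgue. f t x \<bullet> \<zeta> (t, x)"
  have "(\<lambda>t. indicator (- N) t * (if t \<in> {0<..} then ?F t else 0)) \<in> borel_measurable lebesgue"
  proof (rule borel_measurable_LIMSEQ_real)
    show "(\<lambda>t. indicator (- N) t * (if t \<in> {0<..} then ?H k t else 0)) \<in> borel_measurable lebesgue" for k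
    proof (rule borel_measurable_times)
      show "(\<lambda>t. if t \<in> {0<..} then ?H k t else 0) \<in> borel_measurable lebesgue"
        using sm[of k] borel_measurable_if[of "{0<..}" "?H k"] by simp
      have "- N \<in> sets lebesgue" using N by (intro Compl_in_sets_lebesgue[THEN iffD2]) auto
      then show "(\<lambda>t. indicator (- N) t :: real) \<in> borel_measurable lebesgue" by simp
    qed
    fix t :: real
    show "(\<lambda>k. indicator (- N) t * (if t \<in> {0<..} then ?H k t else 0)) \<longlonglongrightarrow> indicator (- N) t * (if t \<in> {0<..} then ?F t else 0)"
    proof (cases "t > 0 \<and> t \<notin> N")
      case True
      have z: "in_Lp 2 (\<lambda>x. \<zeta> (t, x))" by (rule in_Lp2_cc_field[OF \<zeta>])
      have L: "in_Lp 2 (s k t)" for k using s(2) True by simp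
      have "(\<lambda>k. ?H k t - ?F t) \<longlonglongrightarrow> 0"
      proof (rule Lim_null_comparison)
        show "(\<lambda>k. Lp_norm 2 (\<lambda>x. s k t x - f t x) * Lp_norm 2 (\<lambda>x. \<zeta> (t, x))) \<longlonglongrightarrow> 0"
          using fN(2)[of t] True by (intro tendsto_mult_left_zero) auto
        have "?H k t - ?F t = (LINT x|lebesgue. (s k t x - f t x) \<bullet> \<zeta> (t, x))" for k
          using in_Lp2_inner_integrable[OF L z] in_Lp2_inner_integrable[OF fN(1) z] True by (simp add: inner_diff_left)
        then show "\<forall>\<^sub>F k in sequentially. norm (?H k t - ?F t) \<le> Lp_norm 2 (\<lambda>x. s k t x - f t x) * Lp_norm 2 (\<lambda>x. \<zeta> (t, x))"
          using Lp2_Cauchy_Schwarz[OF in_Lp2_diff[OF L fN(1)] z] True by simp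
      qed
      then have "(\<lambda>k. ?H k t) \<longlonglongrightarrow> ?F t" by (simp add: LIM_zero_iff)
      then show ?thesis using True by simp
    qed (auto simp: indicator_def)
  qed
  then have "(\<lambda>t. if t \<in> {0<..} then ?F t else 0) \<in> borel_measurable lebesgue"
  proof (rule borel_measurable_AE)
    have "AE t in lebesgue. t \<notin> N" by (rule AE_not_in[OF N])
    then show "AE t in lebesgue. indicator (- N) t * (if t \<in> {0<..} then ?F t else 0) = (if t \<in> {0<..} then ?F t else 0)"
      by eventually_elim (simp add: indicator_def)
  qed
  then show ?thesis using borel_measurable_if[of "{0<..}" ?F] by simp
qed

subsection \<open>The convection term\<close>

text \<open>
  The convection term \<open>\<Sum>\<^sub>j y\<^sub>j (y \<cdot> \<partial>\<^sub>j\<phi>)\<close> with \<open>b j\<close> in place of \<open>\<partial>\<^sub>j\<phi>\<close>.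
\<close>
definition convection :: "('n \<Rightarrow> real^'n) \<Rightarrow> real^'n \<Rightarrow> real" where
  "convection b y = (\<Sum>j\<in>UNIV. y $ j * (y \<bullet> b j))"

lemma convection_bound: "\<bar>convection b y\<bar> \<le> (norm y)\<^sup>2 * (\<Sum>j\<in>UNIV. norm (b j))"
proof -
  have "\<bar>convection b y\<bar> \<le> (\<Sum>j\<in>UNIV. \<bar>y $ j * (y \<bullet> b j)\<bar>)" unfolding convection_def by (rule sum_abs)
  also have "\<dots> \<le> (\<Sum>j\<in>UNIV. norm y * (norm y * norm (b j)))"
    unfolding abs_mult by (intro sum_mono mult_mono component_le_norm_cart Cauchy_Schwarz_ineq2) auto
  finally show ?thesis by (simp add: sum_distrib_left power2_eq_square mult_ac)
qed

lemma convection_integrable: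
  fixes w :: "real^'n \<Rightarrow> real^'n"
  assumes w: "in_Lp 2 w" and b: "\<And>j. cc_field (b j)"
    and that: "\<And>x. (\<Sum>j\<in>UNIV. norm (b j (t, x))) \<le> C"
  shows "integrable lebesgue (\<lambda>x. convection (\<lambda>j. b j (t, x)) (w x))"
    "\<bar>LINT x|lebesgue. convection (\<lambda>j. b j (t, x)) (w x)\<bar> \<le> (Lp_norm 2 w)\<^sup>2 * C"
proof -
  have C: "C \<ge> 0" using that[of 0] sum_nonneg[of UNIV "\<lambda>j. norm (b j (t, 0))"] by simp
  have bd: "\<bar>convection (\<lambda>j. b j (t, x)) (w x)\<bar> \<le> (norm (w x))\<^sup>2 * C" for x
    using convection_bound[of "\<lambda>j. b j (t, x)" "w x"] mult_left_mono[OF that[of x], of "(norm (w x))\<^sup>2"] by simp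
  have i: "integrable lebesgue (\<lambda>x. (norm (w x))\<^sup>2 * C)" using w by (simp add: in_Lp2_iff)
  have m: "(\<lambda>x. convection (\<lambda>j. b j (t, x)) (w x)) \<in> borel_measurable lebesgue"
    unfolding convection_def
    by (intro borel_measurable_sum borel_measurable_times borel_measurable_inner in_Lp2_measurable
        in_Lp2_component(1) w cc_field_slice_measurable b)
  show i2: "integrable lebesgue (\<lambda>x. convection (\<lambda>j. b j (t, x)) (w x))"
    by (rule Bochner_Integration.integrable_bound[OF i m]) (use bd C in auto)
  have "\<bar>LINT x|lebesgue. convection (\<lambda>j. b j (t, x)) (w x)\<bar> \<le> (LINT x|lebesgue. \<bar>convection (\<lambda>j. b j (t, x)) (w x)\<bar>)"
    by (rule integral_abs_bound)
  also have "\<dots> \<le> (LINT x|lebesgue. (norm (w x))\<^sup>2 * C)"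
    by (intro integral_mono integrable_abs i2 i bd)
  finally show "\<bar>LINT x|lebesgue. convection (\<lambda>j. b j (t, x)) (w x)\<bar> \<le> (Lp_norm 2 w)\<^sup>2 * C"
    by (simp add: Lp2_norm_sq)
qed

text \<open>
  With the multiple \<open>M\<close> of \<open>|y|\<^sup>2\<close> added the quadratic form is nonnegative, hence convex, and lies above
  its tangent planes; \<open>Z\<close> is the gradient at \<open>k\<close>, where the tangent plane touches.
\<close>
lemma convection_polarized:
  fixes b :: "'n::finite \<Rightarrow> real^'n" and y k :: "real^'n" and M :: real
  defines "Z \<equiv> (\<Sum>j\<in>UNIV. (k \<bullet> b j) *\<^sub>R axis j 1 + (k $ j) *\<^sub>R b j) + (2 * M) *\<^sub>R k"
  assumes M: "(\<Sum>j\<in>UNIV. norm (b j)) \<le> M"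
  shows "y \<bullet> Z - (convection b k + M * (norm k)\<^sup>2) \<le> convection b y + M * (norm y)\<^sup>2"
    "k \<bullet> Z - (convection b k + M * (norm k)\<^sup>2) = convection b k + M * (norm k)\<^sup>2"
proof -
  have yZ: "y \<bullet> Z = (\<Sum>j\<in>UNIV. (k \<bullet> b j) * y $ j + k $ j * (y \<bullet> b j)) + 2 * M * (y \<bullet> k)" for y
    unfolding Z_def by (simp add: inner_add_right inner_sum_right inner_axis)
  have "0 \<le> convection b (y - k) + M * (norm (y - k))\<^sup>2"
    using convection_bound[of b "y - k"] mult_left_mono[OF M, of "(norm (y - k))\<^sup>2"] by (simp add: mult.commute)
  also have "convection b (y - k) = convection b y + convection b k - (\<Sum>j\<in>UNIV. (k \<bullet> b j) * y $ j + k $ j * (y \<bullet> b j))"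
    unfolding convection_def sum.distrib[symmetric] sum_subtractf[symmetric]
    by (intro sum.cong) (auto simp: inner_diff_left algebra_simps)
  also have "(norm (y - k))\<^sup>2 = (norm y)\<^sup>2 + (norm k)\<^sup>2 - 2 * (y \<bullet> k)"
    by (simp add: power2_norm_eq_inner inner_diff_left inner_diff_right inner_commute)
  finally show "y \<bullet> Z - (convection b k + M * (norm k)\<^sup>2) \<le> convection b y + M * (norm y)\<^sup>2"
    unfolding yZ by (simp add: algebra_simps)
  show "k \<bullet> Z - (convection b k + M * (norm k)\<^sup>2) = convection b k + M * (norm k)\<^sup>2"
    unfolding yZ convection_def by (simp add: mult.commute power2_norm_eq_inner flip: sum_distrib_left mult_2)
qed

text \<open>
  A quadratic functional of a weakly continuous function need not be continuous in time.  This one is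
  convex, hence a supremum of affine functionals, each of which is continuous in time along \<open>u\<close>.
  So it is lower semicontinuous, and the set where it exceeds a given level is open.
\<close>
lemma quadratic_measurable:
  fixes u :: "real \<Rightarrow> real^'n \<Rightarrow> real^'n"
  assumes u: "weakly_continuous u" and b: "\<And>j. cc_field (b j)" and M: "\<And>z. (\<Sum>j\<in>UNIV. norm (b j z)) \<le> M"
  shows "(\<lambda>t. LINT x|lebesgue. convection (\<lambda>j. b j (t, x)) (u t x) + M * (norm (u t x))\<^sup>2) \<in> borel_measurable time"
proof -
  have uL: "in_Lp 2 (u t)" if "t \<ge> 0" for t using u that by (simp add: weakly_continuous_def)
  define Z where "Z k t x = (\<Sum>j\<in>UNIV. (k x \<bullet> b j (t, x)) *\<^sub>R axis j 1 + (k x $ j) *\<^sub>R b j (t, x)) + (2 * M) *\<^sub>R k x"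
    for k :: "real^'n \<Rightarrow> real^'n" and t x
  define q where "q w t x = convection (\<lambda>j. b j (t, x)) (w x) + M * (norm (w x))\<^sup>2" for w :: "real^'n \<Rightarrow> real^'n" and t x
  have M0: "M \<ge> 0" using M[of undefined] sum_nonneg[of UNIV "\<lambda>j. norm (b j undefined)"] by simp
  have bj: "norm (b j z) \<le> M" for j z using M[of z] member_le_sum[of j UNIV "\<lambda>j. norm (b j z)"] by simp
  have iq: "integrable lebesgue (q w t)" if "in_Lp 2 w" for w t
    unfolding q_def using convection_integrable(1)[OF that b M] that by (simp add: in_Lp2_iff)
  have diffb: "norm ((\<Sum>j\<in>UNIV. (k \<bullet> c j) *\<^sub>R axis j 1 + (k $ j) *\<^sub>R c j) :: real^'n) \<le> (2 * real CARD('n) * e) * norm k"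
    if "\<And>j. norm (c j) \<le> e" for k :: "real^'n" and c and e
  proof -
    have "norm ((\<Sum>j\<in>UNIV. (k \<bullet> c j) *\<^sub>R axis j 1 + (k $ j) *\<^sub>R c j) :: real^'n) \<le> (\<Sum>j\<in>(UNIV::'n set). 2 * e * norm k)"
    proof (rule sum_norm_le)
      fix j :: 'n
      have "norm ((k \<bullet> c j) *\<^sub>R axis j 1 + (k $ j) *\<^sub>R c j) \<le> \<bar>k \<bullet> c j\<bar> * 1 + \<bar>k $ j\<bar> * norm (c j)"
        by (rule order_trans[OF norm_triangle_ineq]) (simp add: norm_axis_1)
      also have "\<dots> \<le> norm k * norm (c j) + norm k * norm (c j)"
        by (intro add_mono mult_right_mono component_le_norm_cart) (auto intro: Cauchy_Schwarz_ineq2)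
      also have "\<dots> \<le> norm k * e + norm k * e" by (intro add_mono mult_left_mono that) auto
      finally show "norm ((k \<bullet> c j) *\<^sub>R axis j 1 + (k $ j) *\<^sub>R c j) \<le> 2 * e * norm k" by simp
    qed
    then show ?thesis by (simp add: mult_ac)
  qed
  have Zm: "Z k t \<in> borel_measurable lebesgue" if "in_Lp 2 k" for k t
    unfolding Z_def using that
    by (intro borel_measurable_add borel_measurable_sum borel_measurable_scaleR borel_measurable_inner
        cc_field_slice_measurable b in_Lp2_measurable in_Lp2_component(1) borel_measurable_const)
  have ZL: "in_Lp 2 (Z k t)" if k: "in_Lp 2 k" for k t
  proof (rule in_Lp2_bounded_by(1)[OF k Zm[OF k]])
    fix x
    have "norm (Z k t x) \<le> (2 * real CARD('n) * M) * norm (k x) + 2 * M * norm (k x)"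
      unfolding Z_def using M0 by (intro order_trans[OF norm_triangle_ineq] add_mono diffb bj) simp
    then show "norm (Z k t x) \<le> (2 * real CARD('n) * M + 2 * M) * norm (k x)" by (simp add: distrib_right)
  qed (use M0 in simp)
  have small: "\<exists>d>0. \<forall>t. \<bar>t - t0\<bar> < d \<longrightarrow> (\<forall>j x. norm (b j (t, x) - b j (t0, x)) \<le> e)" if "e > 0" for e t0
  proof -
    have "\<forall>j. \<exists>d>0. \<forall>t x. \<bar>t - t0\<bar> < d \<longrightarrow> norm (b j (t, x) - b j (t0, x)) < e"
      using cc_field_uniform[OF b that] by metis
    then obtain d where d: "\<And>j. d j > 0" "\<And>j t x. \<bar>t - t0\<bar> < d j \<Longrightarrow> norm (b j (t, x) - b j (t0, x)) < e" by metis
    have "Min (range d) > 0" using d(1) by simp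
    moreover have "norm (b j (t, x) - b j (t0, x)) \<le> e" if "\<bar>t - t0\<bar> < Min (range d)" for t j x
      using that d(2)[of t j x] by (simp add: less_imp_le)
    ultimately show ?thesis by blast
  qed
  have cont: "continuous_on {0..} (\<lambda>t. (LINT x|lebesgue. u t x \<bullet> Z k t x) - (LINT x|lebesgue. q k t x))"
    if k: "in_Lp 2 k" for k
  proof (intro continuous_on_diff pairing_continuous u ZL k)
    fix t0 :: real
    show "((\<lambda>t. Lp_norm 2 (\<lambda>x. Z k t x - Z k t0 x)) \<longlongrightarrow> 0) (at t0 within {0..})"
    proof (rule tendstoI)
      fix e :: real assume e: "e > 0"
      let ?A = "2 * real CARD('n) * (Lp_norm 2 k + 1)"
      have A: "?A > 0" using Lp2_norm_nonneg[of k] by (intro mult_pos_pos) auto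
      have cancel: "e / B * B = e" if "B > 0" for B using that by simp
      obtain d where d: "d > 0" "\<And>t j x. \<bar>t - t0\<bar> < d \<Longrightarrow> norm (b j (t, x) - b j (t0, x)) \<le> e / ?A"
        using small[of "e / ?A" t0] e A by auto
      have "Lp_norm 2 (\<lambda>x. Z k t x - Z k t0 x) < e" if "\<bar>t - t0\<bar> < d" for t
      proof -
        have "Z k t x - Z k t0 x = (\<Sum>j\<in>UNIV. (k x \<bullet> (b j (t, x) - b j (t0, x))) *\<^sub>R axis j 1 + (k x $ j) *\<^sub>R (b j (t, x) - b j (t0, x)))" for x
          unfolding Z_def by (simp add: sum_subtractf[symmetric] inner_diff_right scaleR_diff_left scaleR_diff_right algebra_simps)
        then have "norm (Z k t x - Z k t0 x) \<le> (2 * real CARD('n) * (e / ?A)) * norm (k x)" for x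
          using diffb[OF d(2)[OF that]] by simp
        moreover have "0 \<le> 2 * real CARD('n) * (e / ?A)"
          by (rule mult_nonneg_nonneg[OF _ divide_nonneg_pos[OF less_imp_le[OF e] A]]) simp
        ultimately have "Lp_norm 2 (\<lambda>x. Z k t x - Z k t0 x) \<le> (2 * real CARD('n) * (e / ?A)) * Lp_norm 2 k"
          by (rule in_Lp2_bounded_by(2)[OF k borel_measurable_diff[OF Zm[OF k] Zm[OF k]]])
        also have "\<dots> < (2 * real CARD('n) * (e / ?A)) * (Lp_norm 2 k + 1)"
          using Lp2_norm_nonneg[of k] by (intro mult_strict_left_mono mult_pos_pos divide_pos_pos[OF e A]) auto
        also have "\<dots> = e / ?A * ?A" by (simp add: mult_ac)
        also have "\<dots> = e" by (rule cancel[OF A])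
        finally show ?thesis .
      qed
      then show "\<forall>\<^sub>F t in at t0 within {0..}. dist (Lp_norm 2 (\<lambda>x. Z k t x - Z k t0 x)) 0 < e"
        unfolding eventually_at using d(1) by (intro exI[of _ d]) (auto simp: dist_real_def Lp2_norm_nonneg)
    qed
  next
    show "continuous_on {0..} (\<lambda>t. LINT x|lebesgue. q k t x)"
      unfolding continuous_on_def
    proof (intro ballI tendstoI)
      fix t0 e :: real assume e: "e > 0"
      let ?A = "real CARD('n) * ((Lp_norm 2 k)\<^sup>2 + 1)"
      have A: "?A > 0" by (intro mult_pos_pos) (auto intro: add_nonneg_pos)
      have cancel: "e / B * B = e" if "B > 0" for B using that by simp
      obtain d where d: "d > 0" "\<And>t j x. \<bar>t - t0\<bar> < d \<Longrightarrow> norm (b j (t, x) - b j (t0, x)) \<le> e / ?A"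
        using small[of "e / ?A" t0] e A by auto
      have "dist (LINT x|lebesgue. q k t x) (LINT x|lebesgue. q k t0 x) < e" if "\<bar>t - t0\<bar> < d" for t
      proof -
        have qd: "q k t x - q k t0 x = convection (\<lambda>j. b j (t, x) - b j (t0, x)) (k x)" for x
          unfolding q_def convection_def by (simp add: sum_subtractf[symmetric] inner_diff_right algebra_simps)
        have bd: "\<bar>q k t x - q k t0 x\<bar> \<le> (real CARD('n) * (e / ?A)) * (norm (k x))\<^sup>2" for x
        proof -
          have "(\<Sum>j\<in>UNIV. norm (b j (t, x) - b j (t0, x))) \<le> (\<Sum>j\<in>(UNIV::'n set). e / ?A)"
            by (intro sum_mono d(2) that)
          then show ?thesis unfolding qd
            using convection_bound[of "\<lambda>j. b j (t, x) - b j (t0, x)" "k x"]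
              mult_left_mono[of "\<Sum>j\<in>UNIV. norm (b j (t, x) - b j (t0, x))" "real CARD('n) * (e / ?A)" "(norm (k x))\<^sup>2"]
            by (simp add: mult.commute)
        qed
        have "\<bar>(LINT x|lebesgue. q k t x) - (LINT x|lebesgue. q k t0 x)\<bar> = \<bar>LINT x|lebesgue. q k t x - q k t0 x\<bar>"
          using iq[OF k] by simp
        also have "\<dots> \<le> (LINT x|lebesgue. \<bar>q k t x - q k t0 x\<bar>)" by (rule integral_abs_bound)
        also have "\<dots> \<le> (LINT x|lebesgue. (real CARD('n) * (e / ?A)) * (norm (k x))\<^sup>2)"
          using iq[OF k] k by (intro integral_mono bd) (auto simp: in_Lp2_iff)
        also have "\<dots> = (real CARD('n) * (e / ?A)) * (Lp_norm 2 k)\<^sup>2" by (simp add: Lp2_norm_sq)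
        also have "\<dots> < (real CARD('n) * (e / ?A)) * ((Lp_norm 2 k)\<^sup>2 + 1)"
          by (intro mult_strict_left_mono mult_pos_pos divide_pos_pos[OF e A]) auto
        also have "\<dots> = e / ?A * ?A" by (simp add: mult_ac)
        also have "\<dots> = e" by (rule cancel[OF A])
        finally show ?thesis by (simp add: dist_real_def)
      qed
      then show "\<forall>\<^sub>F t in at t0 within {0..}. dist (LINT x|lebesgue. q k t x) (LINT x|lebesgue. q k t0 x) < e"
        unfolding eventually_at using d(1) by (intro exI[of _ d]) (auto simp: dist_real_def)
    qed
  qed
  let ?Q = "\<lambda>t. LINT x|lebesgue. q (u t) t x"
  let ?\<Lambda> = "\<lambda>k t. (LINT x|lebesgue. u t x \<bullet> Z k t x) - (LINT x|lebesgue. q k t x)"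
  have le: "?\<Lambda> k t \<le> ?Q t" if k: "in_Lp 2 k" and t: "t \<ge> 0" for k t
  proof -
    have "?\<Lambda> k t = (LINT x|lebesgue. u t x \<bullet> Z k t x - q k t x)"
      using in_Lp2_inner_integrable[OF uL[OF t] ZL[OF k]] iq[OF k] by simp
    also have "\<dots> \<le> ?Q t"
    proof (rule integral_mono)
      show "integrable lebesgue (\<lambda>x. u t x \<bullet> Z k t x - q k t x)"
        by (intro Bochner_Integration.integrable_diff in_Lp2_inner_integrable uL t ZL k iq)
      show "u t x \<bullet> Z k t x - q k t x \<le> q (u t) t x" for x
        unfolding Z_def q_def by (rule convection_polarized(1)[OF M])
    qed (rule iq[OF uL[OF t]])
    finally show ?thesis .
  qed
  have eq: "?\<Lambda> (u t) t = ?Q t" if t: "t \<ge> 0" for t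
  proof -
    have "?\<Lambda> (u t) t = (LINT x|lebesgue. u t x \<bullet> Z (u t) t x - q (u t) t x)"
      using in_Lp2_inner_integrable[OF uL[OF t] ZL[OF uL[OF t]]] iq[OF uL[OF t]] by simp
    also have "\<dots> = ?Q t"
      unfolding Z_def q_def by (intro Bochner_Integration.integral_cong refl convection_polarized(2)[OF M])
    finally show ?thesis .
  qed
  have "?Q \<in> borel_measurable time"
    unfolding borel_measurable_iff_greater
  proof
    fix c
    \<comment> \<open>The supremum over all \<open>k\<close> in \<open>L\<^sup>2\<close> is attained at \<open>k = u t\<close>.\<close>
    have "{t \<in> space time. c < ?Q t} = (\<Union>k\<in>{k. in_Lp 2 k}. ?\<Lambda> k -` {c<..} \<inter> {0<..})"
    proof (intro equalityI subsetI)
      fix t assume "t \<in> {t \<in> space time. c < ?Q t}"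
      then have t: "t > 0" "c < ?Q t" by (simp_all add: space_restrict_space)
      then have m: "t \<in> ?\<Lambda> (u t) -` {c<..} \<inter> {0<..}" using eq[of t] by simp
      have "u t \<in> {k. in_Lp 2 k}" using uL[of t] t(1) by simp
      from UN_I[where B="\<lambda>k. ?\<Lambda> k -` {c<..} \<inter> {0<..}", OF this m]
      show "t \<in> (\<Union>k\<in>{k. in_Lp 2 k}. ?\<Lambda> k -` {c<..} \<inter> {0<..})" .
    next
      fix t assume "t \<in> (\<Union>k\<in>{k. in_Lp 2 k}. ?\<Lambda> k -` {c<..} \<inter> {0<..})"
      then obtain k where k: "in_Lp 2 k" "c < ?\<Lambda> k t" "t > 0" by auto
      then have "c < ?Q t" using le[OF k(1), of t] by linarith
      then show "t \<in> {t \<in> space time. c < ?Q t}" using k(3) by (simp add: space_restrict_space)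
    qed
    moreover have "open (?\<Lambda> k -` {c<..} \<inter> {0<..})" if "k \<in> {k. in_Lp 2 k}" for k
    proof -
      have "in_Lp 2 k" using that by simp
      from continuous_on_subset[OF cont[OF this], of "{0<..}"] have c: "continuous_on {0<..} (?\<Lambda> k)" by force
      show ?thesis by (rule c[unfolded continuous_on_open_vimage[OF open_greaterThan], rule_format, OF open_greaterThan])
    qed
    ultimately have o: "open {t \<in> space time. c < ?Q t}" by (simp only:) (intro open_UN ballI)
    then have "{t \<in> space time. c < ?Q t} \<in> sets lebesgue" by simp
    then show "{t \<in> space time. c < ?Q t} \<in> sets time"
      by (subst sets_restrict_space_iff) (auto simp: space_restrict_space)
  qed
  then show ?thesis by (simp add: q_def)
qed

text \<open>
  Difference of two quantities of the convex type.
\<close>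
lemma convection_measurable:
  fixes u :: "real \<Rightarrow> real^'n \<Rightarrow> real^'n"
  assumes u: "weakly_continuous u" and b: "\<And>j. cc_field (b j)"
  shows "(\<lambda>t. LINT x|lebesgue. convection (\<lambda>j. b j (t, x)) (u t x)) \<in> borel_measurable time"
proof -
  have "\<forall>j. \<exists>M. \<forall>z. norm (b j z) \<le> M" using cc_field_bounded[OF b] by metis
  then obtain m where m: "\<And>j z. norm (b j z) \<le> m j" by metis
  let ?M = "\<Sum>j\<in>UNIV. m j"
  have M: "(\<Sum>j\<in>UNIV. norm (b j z)) \<le> ?M" for z by (intro sum_mono m)
  have uL: "in_Lp 2 (u t)" if "t \<ge> 0" for t using u that by (simp add: weakly_continuous_def)
  have z: "cc_field (\<lambda>_::real \<times> (real^'n). 0 :: real^'n)" by (simp add: cc_field_def)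
  have M0: "0 \<le> ?M" using order_trans[OF sum_nonneg[of UNIV "\<lambda>j. norm (b j undefined)"] M[of undefined]] by simp
  have 1: "(\<lambda>t. LINT x|lebesgue. convection (\<lambda>j. b j (t, x)) (u t x) + ?M * (norm (u t x))\<^sup>2) \<in> borel_measurable time"
    by (rule quadratic_measurable[OF u b M])
  have 2: "(\<lambda>t. LINT x|lebesgue. convection (\<lambda>j. 0) (u t x) + ?M * (norm (u t x))\<^sup>2) \<in> borel_measurable time"
    by (rule quadratic_measurable[OF u z]) (use M0 in simp)
  have "(\<lambda>t. (LINT x|lebesgue. convection (\<lambda>j. b j (t, x)) (u t x) + ?M * (norm (u t x))\<^sup>2)
      - (LINT x|lebesgue. convection (\<lambda>j. 0) (u t x) + ?M * (norm (u t x))\<^sup>2)) \<in> borel_measurable time"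
    by (rule borel_measurable_diff[OF 1 2])
  moreover have "(LINT x|lebesgue. convection (\<lambda>j. b j (t, x)) (u t x) + ?M * (norm (u t x))\<^sup>2)
      - (LINT x|lebesgue. convection (\<lambda>j. 0) (u t x) + ?M * (norm (u t x))\<^sup>2) = (LINT x|lebesgue. convection (\<lambda>j. b j (t, x)) (u t x))"
    if "t \<in> space time" for t
  proof -
    have t: "t \<ge> 0" using that by (simp add: space_restrict_space)
    have "integrable lebesgue (\<lambda>x. ?M * (norm (u t x))\<^sup>2)" using uL[OF t] by (simp add: in_Lp2_iff)
    moreover have "convection (\<lambda>j. 0) y = 0" for y :: "real^'n" by (simp add: convection_def)
    ultimately show ?thesis using convection_integrable(1)[OF uL[OF t] b M] by simp
  qed
  ultimately show ?thesis using measurable_cong[of time] by (metis (no_types, lifting))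
qed

section \<open>Testing the equations\<close>

definition smooth_cc :: "('a::euclidean_space \<Rightarrow> real) \<Rightarrow> bool" where
  "smooth_cc Y \<longleftrightarrow> (\<exists>H. tame UNIV H (\<lambda>_. Y)) \<and> (\<exists>r. \<forall>z. r < norm z \<longrightarrow> Y z = 0)"

lemma smooth_cc_differentiable: "smooth_cc Y \<Longrightarrow> Y differentiable (at z)"
  unfolding smooth_cc_def using tame_differentiable by (metis UNIV_I)

lemma smooth_cc_dderiv:
  assumes Y: "smooth_cc Y" and b: "b \<in> Basis"
  shows "smooth_cc (dderiv b Y)"
proof -
  obtain H r where H: "tame UNIV H (\<lambda>_. Y)" and r: "\<And>z. r < norm z \<Longrightarrow> Y z = 0"
    using Y unfolding smooth_cc_def by blast
  have o: "open {z::'a. r < norm z}" by (intro open_Collect_less continuous_intros)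
  have "dderiv b Y z = 0" if "r < norm z" for z
  proof -
    have "dderiv b Y z = dderiv b (\<lambda>_. 0) z" by (rule dderiv_cong_open[OF o]) (use that r in auto)
    then show ?thesis by (simp add: dderiv_const)
  qed
  then show ?thesis unfolding smooth_cc_def using tame_dderiv[OF H b] by blast
qed

lemma smooth_cc_zero: "smooth_cc (\<lambda>z. 0)"
  unfolding smooth_cc_def using tame_zero by blast

lemma smooth_cc_add:
  assumes "smooth_cc Y" "smooth_cc Z" shows "smooth_cc (\<lambda>z. Y z + Z z)"
proof -
  obtain H r where H: "tame UNIV H (\<lambda>_. Y)" and r: "\<And>z. r < norm z \<Longrightarrow> Y z = 0"
    using assms(1) unfolding smooth_cc_def by blast
  obtain H' r' where H': "tame UNIV H' (\<lambda>_. Z)" and r': "\<And>z. r' < norm z \<Longrightarrow> Z z = 0"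
    using assms(2) unfolding smooth_cc_def by blast
  let ?H = "\<lambda>k z. \<bar>H k z\<bar> + \<bar>H' k z\<bar>"
  have ta: "tame UNIV (\<lambda>k z. \<bar>G k z\<bar> + \<bar>G' k z\<bar>) (\<lambda>_. X)" if G: "tame UNIV G (\<lambda>_. X)" for G G' :: "nat \<Rightarrow> 'a \<Rightarrow> real" and X
    unfolding tame_def
  proof (intro allI impI conjI)
    fix vs :: "'a list" assume vs: "set vs \<subseteq> Basis"
    obtain C where C: "\<And>k z. z \<in> UNIV \<Longrightarrow> \<bar>Ds vs X z\<bar> \<le> C * G k z" using tame_Ds_bound[OF G vs] by blast
    have "\<bar>Ds vs X z\<bar> \<le> \<bar>C\<bar> * (\<bar>G k z\<bar> + \<bar>G' k z\<bar>)" for k z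
    proof -
      have "\<bar>Ds vs X z\<bar> \<le> \<bar>C * G k z\<bar>" using C[of z k] by simp
      also have "\<dots> \<le> \<bar>C\<bar> * (\<bar>G k z\<bar> + \<bar>G' k z\<bar>)" unfolding abs_mult by (intro mult_left_mono) auto
      finally show ?thesis .
    qed
    then show "\<exists>C. \<forall>k. \<forall>z\<in>UNIV. \<bar>Ds vs X z\<bar> \<le> C * (\<bar>G k z\<bar> + \<bar>G' k z\<bar>)" by blast
    show "\<forall>z\<in>UNIV. Ds vs X differentiable at z" using tame_Ds_differentiable[OF G vs] by simp
  qed
  have "tame UNIV ?H (\<lambda>_ z. Y z + Z z)"
    using ta[OF H, of H'] ta[OF H', of H] by (intro tame_add open_UNIV) (simp_all add: add.commute)
  moreover have "\<forall>z. max r r' < norm z \<longrightarrow> Y z + Z z = 0" using r r' by simp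
  ultimately show ?thesis unfolding smooth_cc_def by blast
qed

lemma smooth_cc_cmult:
  assumes "smooth_cc Y" shows "smooth_cc (\<lambda>z. c * Y z)"
proof -
  obtain H r where H: "tame UNIV H (\<lambda>_. Y)" and r: "\<And>z. r < norm z \<Longrightarrow> Y z = 0"
    using assms(1) unfolding smooth_cc_def by blast
  have "\<forall>z. r < norm z \<longrightarrow> c * Y z = 0" using r by simp
  then show ?thesis unfolding smooth_cc_def using tame_cmult[OF open_UNIV H, of c] by blast
qed

lemma smooth_cc_diff:
  assumes "smooth_cc Y" "smooth_cc Z" shows "smooth_cc (\<lambda>z. Y z - Z z)"
  using smooth_cc_add[OF assms(1) smooth_cc_cmult[OF assms(2), of "-1"]] by simp

lemma smooth_cc_sum:
  assumes "\<And>i. i \<in> I \<Longrightarrow> smooth_cc (Y i)" shows "smooth_cc (\<lambda>z. \<Sum>i\<in>I. Y i z)"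
  using assms by (induct I rule: infinite_finite_induct) (auto intro: smooth_cc_zero smooth_cc_add)

lemma smooth_cc_C_k: "smooth_cc Y \<Longrightarrow> C_k k Y"
  unfolding smooth_cc_def using tame_imp_C_k by blast

lemma smooth_cc_cc_field: "smooth_cc Y \<Longrightarrow> cc_field Y"
  using smooth_cc_C_k[of Y 0] unfolding smooth_cc_def cc_field_def by auto

lemma dderiv_sum:
  fixes F :: "'i \<Rightarrow> 'a::euclidean_space \<Rightarrow> real"
  assumes "\<And>i. i \<in> I \<Longrightarrow> smooth_cc (F i)"
  shows "dderiv b (\<lambda>z. \<Sum>i\<in>I. F i z) z = (\<Sum>i\<in>I. dderiv b (F i) z)"
  using assms
proof (induct I rule: infinite_finite_induct)
  case (insert i I)
  have "smooth_cc (\<lambda>z. \<Sum>i\<in>I. F i z)" by (rule smooth_cc_sum) (use insert in auto)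
  then show ?case using insert
    by (simp add: dderiv_add smooth_cc_differentiable)
qed (simp_all add: dderiv_const)

lemma smooth_cc_commute:
  assumes "smooth_cc Y" "b \<in> Basis" "c \<in> Basis"
  shows "dderiv b (dderiv c Y) = dderiv c (dderiv b Y)"
  using assms dderiv_commute unfolding smooth_cc_def by blast

lemma Basis_tx [simp]:
  "(1, 0) \<in> (Basis :: (real \<times> (real^'n)) set)" "(0, axis j 1) \<in> (Basis :: (real \<times> (real^'n)) set)"
  by (auto simp: Basis_spacetime Basis_vec_def)

text \<open>
  The heat operator with time reversed, which acts on test functions.
\<close>
definition heat_op :: "(real \<times> (real^'n) \<Rightarrow> real) \<Rightarrow> real \<times> (real^'n) \<Rightarrow> real" where
  "heat_op Y z = dt Y z + laplacian_x Y z"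

lemma smooth_cc_dt: "smooth_cc Y \<Longrightarrow> smooth_cc (dt Y)"
  unfolding dt_def by (simp add: smooth_cc_dderiv)

lemma smooth_cc_dx: "smooth_cc Y \<Longrightarrow> smooth_cc (dx j Y)"
  unfolding dx_def by (simp add: smooth_cc_dderiv)

lemma smooth_cc_laplacian: "smooth_cc Y \<Longrightarrow> smooth_cc (laplacian_x Y)"
  unfolding laplacian_x_def[abs_def] by (intro smooth_cc_sum smooth_cc_dx)

lemma smooth_cc_heat_op: "smooth_cc Y \<Longrightarrow> smooth_cc (heat_op Y)"
  unfolding heat_op_def[abs_def] by (intro smooth_cc_add smooth_cc_dt smooth_cc_laplacian)

lemma dx_commute: "smooth_cc Y \<Longrightarrow> dx j (dx k Y) = dx k (dx j Y)"
  unfolding dx_def by (rule smooth_cc_commute) simp_all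

lemma dt_dx: "smooth_cc Y \<Longrightarrow> dt (dx k Y) = dx k (dt Y)"
  unfolding dx_def dt_def by (rule smooth_cc_commute) simp_all

lemma dx_sum: "(\<And>i. i \<in> I \<Longrightarrow> smooth_cc (F i)) \<Longrightarrow> dx k (\<lambda>z. \<Sum>i\<in>I. F i z) = (\<lambda>z. \<Sum>i\<in>I. dx k (F i) z)"
  unfolding dx_def by (intro ext dderiv_sum)

lemma dx_add: "smooth_cc F \<Longrightarrow> smooth_cc G \<Longrightarrow> dx k (\<lambda>z. F z + G z) = (\<lambda>z. dx k F z + dx k G z)"
  unfolding dx_def by (intro ext dderiv_add smooth_cc_differentiable)

lemma dx_laplacian: "smooth_cc Y \<Longrightarrow> dx k (laplacian_x Y) = laplacian_x (dx k Y)"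
proof -
  assume Y: "smooth_cc Y"
  have "dx k (dx j (dx j Y)) = dx j (dx j (dx k Y))" for j
    using dx_commute[OF smooth_cc_dx[OF Y], of k j j] dx_commute[OF Y, of k j] by simp
  then show ?thesis
    unfolding laplacian_x_def[abs_def] using Y by (simp add: dx_sum smooth_cc_dx)
qed

lemma heat_op_dx: "smooth_cc Y \<Longrightarrow> heat_op (dx k Y) = dx k (heat_op Y)"
  unfolding heat_op_def[abs_def]
  by (simp add: dx_add smooth_cc_dt smooth_cc_laplacian dt_dx dx_laplacian)

lemma dt_sum: "(\<And>i. i \<in> I \<Longrightarrow> smooth_cc (F i)) \<Longrightarrow> dt (\<lambda>z. \<Sum>i\<in>I. F i z) = (\<lambda>z. \<Sum>i\<in>I. dt (F i) z)"
  unfolding dt_def by (intro ext dderiv_sum)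

lemma laplacian_sum:
  "(\<And>i. i \<in> I \<Longrightarrow> smooth_cc (F i)) \<Longrightarrow> laplacian_x (\<lambda>z. \<Sum>i\<in>I. F i z) = (\<lambda>z. \<Sum>i\<in>I. laplacian_x (F i) z)"
  unfolding laplacian_x_def[abs_def] by (subst sum.swap) (simp add: dx_sum smooth_cc_dx)

lemma heat_op_laplacian: "smooth_cc Y \<Longrightarrow> heat_op (laplacian_x Y) = laplacian_x (heat_op Y)"
proof -
  assume Y: "smooth_cc Y"
  have "heat_op (laplacian_x Y) z = (\<Sum>j\<in>UNIV. heat_op (dx j (dx j Y)) z)" for z
    unfolding heat_op_def laplacian_x_def[of Y, abs_def] using Y
    by (simp add: dt_sum laplacian_sum smooth_cc_dx sum.distrib)
  then show ?thesis using Y by (simp add: fun_eq_iff laplacian_x_def heat_op_dx smooth_cc_dx)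
qed

lemma dx_diff: "smooth_cc F \<Longrightarrow> smooth_cc G \<Longrightarrow> dx k (\<lambda>z. F z - G z) = (\<lambda>z. dx k F z - dx k G z)"
  unfolding dx_def by (intro ext dderiv_diff smooth_cc_differentiable)

lemma dt_diff: "smooth_cc F \<Longrightarrow> smooth_cc G \<Longrightarrow> dt (\<lambda>z. F z - G z) = (\<lambda>z. dt F z - dt G z)"
  unfolding dt_def by (intro ext dderiv_diff smooth_cc_differentiable)

lemma heat_op_diff:
  assumes "smooth_cc F" "smooth_cc G" shows "heat_op (\<lambda>z. F z - G z) = (\<lambda>z. heat_op F z - heat_op G z)"
  unfolding heat_op_def[abs_def] laplacian_x_def[abs_def] using assms
  by (simp add: dt_diff dx_diff smooth_cc_dx sum_subtractf algebra_simps)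

lemma heat_op_zero: "heat_op (\<lambda>z. 0) = (\<lambda>z. 0)"
  by (simp add: heat_op_def[abs_def] laplacian_x_def dt_def dx_def dderiv_const[abs_def])

lemma dx_zero: "dx k (\<lambda>z. 0 :: real) = (\<lambda>z. 0)"
  by (simp add: dx_def dderiv_const[abs_def])

subsection \<open>Vector test fields\<close>

definition vfield :: "('n \<Rightarrow> real \<times> (real^'n) \<Rightarrow> real) \<Rightarrow> real \<times> (real^'n) \<Rightarrow> real^'n" where
  "vfield Y z = (\<chi> i. Y i z)"

lemma vfield_nth [simp]: "vfield Y z $ i = Y i z" by (simp add: vfield_def)

lemma vfield_eq_sum: "vfield Y = (\<lambda>z. \<Sum>i\<in>UNIV. Y i z *\<^sub>R axis i 1)"
  by (simp add: fun_eq_iff vec_eq_iff axis_def if_distrib cong: if_cong)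

lemma dderiv_vfield:
  assumes "\<And>i. smooth_cc (Y i)"
  shows "dderiv b (vfield Y) = vfield (\<lambda>i. dderiv b (Y i))" "vfield Y differentiable (at z)"
proof -
  have h: "(vfield Y has_derivative (\<lambda>b. vfield (\<lambda>i. dderiv b (Y i)) z)) (at z)" for z
    unfolding vfield_eq_sum
    by (intro has_derivative_sum has_derivative_scaleR_left has_derivative_dderiv smooth_cc_differentiable assms)
  show "dderiv b (vfield Y) = vfield (\<lambda>i. dderiv b (Y i))" by (intro ext dderiv_eqI h)
  show "vfield Y differentiable (at z)" using h differentiable_def by blast
qed

lemma dx_vfield: "(\<And>i. smooth_cc (Y i)) \<Longrightarrow> dx j (vfield Y) = vfield (\<lambda>i. dx j (Y i))"
  unfolding dx_def by (rule dderiv_vfield)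

lemma dt_vfield: "(\<And>i. smooth_cc (Y i)) \<Longrightarrow> dt (vfield Y) = vfield (\<lambda>i. dt (Y i))"
  unfolding dt_def by (rule dderiv_vfield)

lemma laplacian_vfield: "(\<And>i. smooth_cc (Y i)) \<Longrightarrow> laplacian_x (vfield Y) = vfield (\<lambda>i. laplacian_x (Y i))"
  by (simp add: laplacian_x_def[abs_def] dx_vfield smooth_cc_dx fun_eq_iff vec_eq_iff)

lemma vfield_support:
  assumes "\<And>i. smooth_cc (Y i)" shows "\<exists>r. \<forall>z. r < norm z \<longrightarrow> vfield Y z = 0"
proof -
  have "\<forall>i. \<exists>r. \<forall>z. r < norm z \<longrightarrow> Y i z = 0" using assms unfolding smooth_cc_def by blast
  then obtain r where r: "\<And>i z. r i < norm z \<Longrightarrow> Y i z = 0" by metis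
  have "vfield Y z = 0" if "Max (range r) < norm z" for z
    using that r by (simp add: vec_eq_iff)
  then show ?thesis by (intro exI[of _ "Max (range r)"]) simp
qed

lemma cc_field_vfield:
  assumes "\<And>i. smooth_cc (Y i)" shows "cc_field (vfield Y)"
proof -
  have "\<exists>r. \<forall>z. r < norm z \<longrightarrow> vfield Y z = 0" by (rule vfield_support[of Y, OF assms])
  moreover have "continuous_on UNIV (vfield Y)"
    by (intro continuous_at_imp_continuous_on ballI differentiable_imp_continuous_within dderiv_vfield(2) assms)
  ultimately show ?thesis unfolding cc_field_def by (intro conjI)
qed

lemma test_functionI:
  fixes f :: "'a::euclidean_space \<Rightarrow> 'b::real_normed_vector"
  assumes "\<And>k. C_k k f" "\<And>z. r < norm z \<Longrightarrow> f z = 0"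
  shows "test_function f"
proof -
  have "bounded {z. f z \<noteq> 0}"
    unfolding bounded_iff using assms(2) by (intro exI[of _ r]) (auto simp: not_less[symmetric])
  then show ?thesis using assms(1) by (simp add: test_function_def compact_closure)
qed

lemma test_function_vfield:
  assumes "\<And>i. smooth_cc (Y i)" shows "test_function (vfield Y)"
proof -
  obtain r where r: "\<forall>z. r < norm z \<longrightarrow> vfield Y z = 0" using vfield_support[of Y, OF assms] ..
  have "C_k k (vfield Y)" for k
    unfolding vfield_eq_sum by (intro C_k_sum finite C_k_scaleR_left smooth_cc_C_k assms)
  then show ?thesis by (rule test_functionI) (rule r[rule_format])
qed

lemma dderiv_slice:
  assumes "f differentiable (at (t, x))"
  shows "dderiv v (\<lambda>x. f (t, x)) x = dderiv (0, v) f (t, x)" "(\<lambda>x. f (t, x)) differentiable (at x)"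
proof -
  have "((\<lambda>x. f (t, x)) has_derivative (\<lambda>v. dderiv (0, v) f (t, x))) (at x)"
    by (rule has_derivative_compose[where f="\<lambda>x. (t, x)" and g=f, OF _ has_derivative_dderiv[OF assms]])
      (auto intro!: derivative_eq_intros)
  then show "dderiv v (\<lambda>x. f (t, x)) x = dderiv (0, v) f (t, x)" "(\<lambda>x. f (t, x)) differentiable (at x)"
    using dderiv_eqI differentiable_def by blast+
qed

lemma C_k_slice:
  fixes f :: "real \<times> 'a::euclidean_space \<Rightarrow> 'b::real_normed_vector"
  assumes "C_k k f" shows "C_k k (\<lambda>x. f (t, x))"
  using assms
proof (induct k arbitrary: f)
  case 0
  then show ?case by (auto intro!: continuous_on_compose2[of UNIV f UNIV] continuous_intros)
next
  case (Suc k)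
  have "dderiv v (\<lambda>x. f (t, x)) = (\<lambda>x. dderiv (0, v) f (t, x))" for v
    using Suc.prems by (intro ext dderiv_slice) auto
  then show ?case using Suc by (auto intro: dderiv_slice)
qed

text \<open>
  Weak solenoidality is tested with functions of \<open>x\<close> alone; a time slice of a smooth function of compact
  support is one of them.
\<close>
lemma L2_sigma_orthogonal_gradient:
  fixes w :: "real^'n \<Rightarrow> real^'n"
  assumes w: "w \<in> L2_sigma" and Y: "smooth_cc Y"
  shows "(LINT x|lebesgue. w x \<bullet> vfield (\<lambda>k. dx k Y) (t, x)) = 0"
proof -
  obtain r where r: "\<And>z. r < norm z \<Longrightarrow> Y z = 0" using Y unfolding smooth_cc_def by blast
  have "test_function (\<lambda>x. Y (t, x))"
  proof (rule test_functionI)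
    show "Y (t, x) = 0" if "r < norm x" for x using r[of "(t, x)"] norm_snd_le[of x t] that by simp
  qed (intro C_k_slice smooth_cc_C_k Y)
  then have "(LINT x|lebesgue. (\<Sum>j\<in>UNIV. w x $ j * dderiv (axis j 1) (\<lambda>x. Y (t, x)) x)) = 0"
    using w unfolding L2_sigma_def by blast
  moreover have "dderiv (axis j 1) (\<lambda>x. Y (t, x)) x = dx j Y (t, x)" for j x
    unfolding dx_def by (rule dderiv_slice(1)[OF smooth_cc_differentiable[OF Y]])
  ultimately show ?thesis by (simp add: inner_vec_def)
qed

text \<open>
  The field \<open>\<Delta>Y e\<^sub>i - \<nabla>\<partial>\<^sub>iY\<close>, that is, the projection of \<open>\<Delta>Y e\<^sub>i\<close> to the solenoidal fields.  Having a
  Laplacian to spare makes the projection a differential operator, which preserves compact support.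
\<close>
definition solenoidal_part :: "'n \<Rightarrow> (real \<times> (real^'n) \<Rightarrow> real) \<Rightarrow> 'n \<Rightarrow> real \<times> (real^'n) \<Rightarrow> real" where
  "solenoidal_part i Y k = (\<lambda>z. (if k = i then laplacian_x Y z else 0) - dx k (dx i Y) z)"

lemma smooth_cc_if: "(P \<Longrightarrow> smooth_cc Y) \<Longrightarrow> smooth_cc (\<lambda>z. if P then Y z else 0)"
  by (cases P) (auto intro: smooth_cc_zero)

lemma smooth_cc_solenoidal_part: "smooth_cc Y \<Longrightarrow> smooth_cc (solenoidal_part i Y k)"
  unfolding solenoidal_part_def by (intro smooth_cc_diff smooth_cc_if smooth_cc_laplacian smooth_cc_dx)

lemma solenoidal_test_solenoidal_part:
  assumes Y: "smooth_cc Y" shows "solenoidal_test (vfield (solenoidal_part i Y))"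
proof -
  have "div_x (vfield (solenoidal_part i Y)) z = 0" for z
  proof -
    have "div_x (vfield (solenoidal_part i Y)) z = (\<Sum>k\<in>UNIV. dx k (solenoidal_part i Y k) z)"
      by (simp add: div_x_def dx_vfield smooth_cc_solenoidal_part Y)
    also have "\<dots> = (\<Sum>k\<in>UNIV. (if k = i then dx k (laplacian_x Y) z else 0) - dx k (dx k (dx i Y)) z)"
    proof (rule sum.cong)
      fix k
      have "dx k (\<lambda>z. if k = i then laplacian_x Y z else 0) z = (if k = i then dx k (laplacian_x Y) z else 0)"
        by (cases "k = i") (simp_all add: dx_zero)
      then show "dx k (solenoidal_part i Y k) z = (if k = i then dx k (laplacian_x Y) z else 0) - dx k (dx k (dx i Y)) z"
        unfolding solenoidal_part_def using Y by (simp only: dx_diff smooth_cc_if smooth_cc_laplacian smooth_cc_dx)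
    qed simp
    also have "\<dots> = dx i (laplacian_x Y) z - laplacian_x (dx i Y) z"
      by (simp add: sum_subtractf laplacian_x_def)
    finally show ?thesis using dx_laplacian[OF Y, of i] by simp
  qed
  then show ?thesis unfolding solenoidal_test_def
    using test_function_vfield[of "solenoidal_part i Y"] smooth_cc_solenoidal_part[OF Y] by blast
qed

lemma heat_op_solenoidal_part:
  assumes Y: "smooth_cc Y"
  shows "heat_op (solenoidal_part i Y k) = solenoidal_part i (heat_op Y) k"
proof -
  have "heat_op (\<lambda>z. if k = i then laplacian_x Y z else 0) = (\<lambda>z. if k = i then laplacian_x (heat_op Y) z else 0)"
    using heat_op_laplacian[OF Y] by (cases "k = i") (simp_all add: heat_op_zero)
  then show ?thesis
    unfolding solenoidal_part_def using Y
    by (simp add: heat_op_diff smooth_cc_if smooth_cc_laplacian smooth_cc_dx heat_op_dx)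
qed

text \<open>
  The gradient part is invisible to solenoidal fields, so that a scalar test function acts on the single
  component \<open>w\<^sub>i\<close>, although the test field is solenoidal.
\<close>
lemma L2_sigma_solenoidal_part:
  fixes w :: "real^'n \<Rightarrow> real^'n"
  assumes w: "w \<in> L2_sigma" and Y: "smooth_cc Y"
  shows "(LINT x|lebesgue. w x \<bullet> vfield (solenoidal_part i Y) (t, x)) = (LINT x|lebesgue. w x $ i * laplacian_x Y (t, x))"
proof -
  have wL: "in_Lp 2 w" using w by (simp add: L2_sigma_def)
  have e: "w x \<bullet> vfield (solenoidal_part i Y) (t, x) = w x $ i * laplacian_x Y (t, x) - w x \<bullet> vfield (\<lambda>k. dx k (dx i Y)) (t, x)" for x
  proof -
    have "w x \<bullet> vfield (solenoidal_part i Y) (t, x)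
        = (\<Sum>k\<in>UNIV. (if k = i then w x $ k * laplacian_x Y (t, x) else 0) - w x $ k * dx k (dx i Y) (t, x))"
      unfolding inner_vec_def solenoidal_part_def by (intro sum.cong) (auto simp: right_diff_distrib)
    then show ?thesis by (simp add: sum_subtractf inner_vec_def)
  qed
  have "integrable lebesgue (\<lambda>x. w x $ i * laplacian_x Y (t, x))"
    using in_Lp2_inner_integrable[OF in_Lp2_component(1)[OF wL] in_Lp2_cc_field[OF smooth_cc_cc_field[OF smooth_cc_laplacian[OF Y]]]]
    by simp
  moreover have "integrable lebesgue (\<lambda>x. w x \<bullet> vfield (\<lambda>k. dx k (dx i Y)) (t, x))"
    by (intro in_Lp2_inner_integrable wL in_Lp2_cc_field cc_field_vfield smooth_cc_dx Y)
  ultimately show ?thesis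
    unfolding e using L2_sigma_orthogonal_gradient[OF w smooth_cc_dx[OF Y]] by simp
qed

lemma cc_field_L2_bounded:
  assumes "cc_field \<zeta>" obtains B where "\<And>t. Lp_norm 2 (\<lambda>x. \<zeta> (t, x)) \<le> B"
proof -
  obtain r where "r > 0" "\<And>t x. r < \<bar>t\<bar> \<Longrightarrow> \<zeta> (t, x) = 0" and r: "\<And>t x. r < norm x \<Longrightarrow> \<zeta> (t, x) = 0"
    using cc_field_support[OF assms] by blast
  obtain M where M: "M \<ge> 0" "\<And>z. norm (\<zeta> z) \<le> M" using cc_field_bounded[OF assms] by blast
  have "norm (\<zeta> (t, x)) \<le> M * norm (indicator (cball 0 r) x :: real)" for t x
    using M(2)[of "(t, x)"] r[of x t] by (cases "r < norm x") (simp_all add: indicator_def)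
  from in_Lp2_bounded_by(2)[OF in_Lp2_indicator_ball[of r] cc_field_slice_measurable[OF assms] this M(1)]
  show thesis using that by blast
qed

lemma forcing_pairing_integrable:
  assumes f: "strongly_measurable_L2 f" and \<zeta>: "cc_field \<zeta>"
    and fb: "\<And>t. t > 0 \<Longrightarrow> in_Lp 2 (f t) \<and> Lp_norm 2 (f t) \<le> C"
  shows "integrable time (\<lambda>t. LINT x|lebesgue. f t x \<bullet> \<zeta> (t, x))"
proof -
  obtain r where "r > 0" and r: "\<And>t x. r < \<bar>t\<bar> \<Longrightarrow> \<zeta> (t, x) = 0" and "\<And>t x. r < norm x \<Longrightarrow> \<zeta> (t, x) = 0"
    using cc_field_support[OF \<zeta>] by blast
  obtain B where B: "\<And>t. Lp_norm 2 (\<lambda>x. \<zeta> (t, x)) \<le> B" using cc_field_L2_bounded[OF \<zeta>] by blast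
  show ?thesis
  proof (rule time_integrable[OF forcing_pairing_measurable[OF f \<zeta>], of r "C * B"])
    fix t :: real assume t: "0 < t"
    have "\<bar>LINT x|lebesgue. f t x \<bullet> \<zeta> (t, x)\<bar> \<le> Lp_norm 2 (f t) * Lp_norm 2 (\<lambda>x. \<zeta> (t, x))"
      using fb[OF t] by (intro Lp2_Cauchy_Schwarz in_Lp2_cc_field \<zeta>) auto
    also have "\<dots> \<le> C * B"
      using fb[OF t] B[of t] order_trans[OF Lp2_norm_nonneg] by (intro mult_mono) (auto simp: Lp2_norm_nonneg)
    finally show "\<bar>LINT x|lebesgue. f t x \<bullet> \<zeta> (t, x)\<bar> \<le> C * B" .
  qed (simp add: r)
qed

lemma convection_pairing_integrable:
  fixes u :: "real \<Rightarrow> real^'n \<Rightarrow> real^'n"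
  assumes u: "weakly_continuous u" and b: "\<And>j. cc_field (b j)"
  shows "integrable time (\<lambda>t. LINT x|lebesgue. convection (\<lambda>j. b j (t, x)) (u t x))"
proof -
  have "\<forall>j. \<exists>r. \<forall>t x. r < \<bar>t\<bar> \<longrightarrow> b j (t, x) = 0" using cc_field_support[OF b] by metis
  then obtain r where r: "\<And>j t x. r j < \<bar>t\<bar> \<Longrightarrow> b j (t, x) = 0" by metis
  have "\<forall>j. \<exists>M. \<forall>z. norm (b j z) \<le> M" using cc_field_bounded[OF b] by metis
  then obtain m where m: "\<And>j z. norm (b j z) \<le> m j" by metis
  let ?M = "\<Sum>j\<in>UNIV. m j" and ?R = "\<bar>Max (range r)\<bar>"
  have M: "(\<Sum>j\<in>UNIV. norm (b j z)) \<le> ?M" for z by (intro sum_mono m)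
  have M0: "0 \<le> ?M" using order_trans[OF sum_nonneg[of UNIV "\<lambda>j. norm (b j undefined)"] M[of undefined]] by simp
  obtain K where K: "\<And>t. t \<in> {0..?R} \<Longrightarrow> Lp_norm 2 (u t) \<le> K" using u unfolding weakly_continuous_def by blast
  show ?thesis
  proof (rule time_integrable[OF convection_measurable[OF u b], where T="?R" and B="K\<^sup>2 * ?M"])
    fix t :: real assume t: "0 < t" "t \<le> ?R"
    have "in_Lp 2 (u t)" using u t by (simp add: weakly_continuous_def)
    then have "\<bar>LINT x|lebesgue. convection (\<lambda>j. b j (t, x)) (u t x)\<bar> \<le> (Lp_norm 2 (u t))\<^sup>2 * ?M"
      by (rule convection_integrable(2)[OF _ b M])
    also have "\<dots> \<le> K\<^sup>2 * ?M" using t by (intro mult_right_mono power_mono K M0) (auto simp: Lp2_norm_nonneg)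
    finally show "\<bar>LINT x|lebesgue. convection (\<lambda>j. b j (t, x)) (u t x)\<bar> \<le> K\<^sup>2 * ?M" .
  next
    fix t :: real assume t: "?R < t"
    have m: "r j \<le> Max (range r)" for j by (rule Max_ge) auto
    have "r j < \<bar>t\<bar>" for j using t m[of j] by linarith
    then show "(LINT x|lebesgue. convection (\<lambda>j. b j (t, x)) (u t x)) = 0" by (simp add: r convection_def)
  qed
qed

subsection \<open>The tested equations\<close>

lemma stokes_tested:
  fixes v :: "real \<Rightarrow> real^'n \<Rightarrow> real^'n"
  assumes v: "weakly_continuous v" and f: "strongly_measurable_L2 f"
    and fb: "\<And>t. t > 0 \<Longrightarrow> in_Lp 2 (f t) \<and> Lp_norm 2 (f t) \<le> C"
    and Y: "\<And>k. smooth_cc (Y k)"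
    and eq: "\<And>\<phi>. test_function \<phi> \<Longrightarrow> stokes_form u0 f v \<phi> = 0"
  shows "(LINT t|time. LINT x|lebesgue. v t x \<bullet> vfield (\<lambda>k. heat_op (Y k)) (t, x))
    + (LINT t|time. LINT x|lebesgue. f t x \<bullet> vfield Y (t, x)) + (LINT x|lebesgue. u0 x \<bullet> vfield Y (0, x)) = 0"
proof -
  have ccY: "cc_field (vfield Y)" and ccH: "cc_field (vfield (\<lambda>k. heat_op (Y k)))"
    by (intro cc_field_vfield smooth_cc_heat_op Y)+
  have e: "v t x \<bullet> dt (vfield Y) (t, x) + v t x \<bullet> laplacian_x (vfield Y) (t, x) + f t x \<bullet> vfield Y (t, x)
      = v t x \<bullet> vfield (\<lambda>k. heat_op (Y k)) (t, x) + f t x \<bullet> vfield Y (t, x)" for t x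
    by (simp add: dt_vfield laplacian_vfield Y inner_vec_def heat_op_def distrib_left sum.distrib)
  have "(LINT t|time. LINT x|lebesgue. v t x \<bullet> dt (vfield Y) (t, x) + v t x \<bullet> laplacian_x (vfield Y) (t, x) + f t x \<bullet> vfield Y (t, x))
      = (LINT t|time. (LINT x|lebesgue. v t x \<bullet> vfield (\<lambda>k. heat_op (Y k)) (t, x)) + (LINT x|lebesgue. f t x \<bullet> vfield Y (t, x)))"
  proof (rule Bochner_Integration.integral_cong)
    fix t assume "t \<in> space time"
    then have t: "t > 0" by (simp add: space_restrict_space)
    have "in_Lp 2 (v t)" using v t by (simp add: weakly_continuous_def)
    then show "(LINT x|lebesgue. v t x \<bullet> dt (vfield Y) (t, x) + v t x \<bullet> laplacian_x (vfield Y) (t, x) + f t x \<bullet> vfield Y (t, x))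
      = (LINT x|lebesgue. v t x \<bullet> vfield (\<lambda>k. heat_op (Y k)) (t, x)) + (LINT x|lebesgue. f t x \<bullet> vfield Y (t, x))"
      unfolding e using fb[OF t]
      by (intro Bochner_Integration.integral_add in_Lp2_inner_integrable in_Lp2_cc_field ccY ccH) auto
  qed simp
  also have "\<dots> = (LINT t|time. LINT x|lebesgue. v t x \<bullet> vfield (\<lambda>k. heat_op (Y k)) (t, x))
    + (LINT t|time. LINT x|lebesgue. f t x \<bullet> vfield Y (t, x))"
    by (intro Bochner_Integration.integral_add pairing_integrable v ccH forcing_pairing_integrable[OF f ccY fb])
  finally show ?thesis using eq[OF test_function_vfield[of Y, OF Y]] unfolding stokes_form_def by simp
qed

lemma navier_stokes_tested:
  fixes u :: "real \<Rightarrow> real^'n \<Rightarrow> real^'n"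
  assumes u: "weakly_continuous u" and f: "strongly_measurable_L2 f"
    and fb: "\<And>t. t > 0 \<Longrightarrow> in_Lp 2 (f t) \<and> Lp_norm 2 (f t) \<le> C"
    and Y: "\<And>k. smooth_cc (Y k)" and sol: "solenoidal_test (vfield Y)"
    and eq: "navier_stokes_weak u0 f u"
  shows "(LINT t|time. LINT x|lebesgue. u t x \<bullet> vfield (\<lambda>k. heat_op (Y k)) (t, x))
    + (LINT t|time. LINT x|lebesgue. convection (\<lambda>j. vfield (\<lambda>k. dx j (Y k)) (t, x)) (u t x))
    + (LINT t|time. LINT x|lebesgue. f t x \<bullet> vfield Y (t, x)) + (LINT x|lebesgue. u0 x \<bullet> vfield Y (0, x)) = 0"
proof -
  have ccY: "cc_field (vfield Y)" and ccH: "cc_field (vfield (\<lambda>k. heat_op (Y k)))"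
    and ccD: "cc_field (vfield (\<lambda>k. dx j (Y k)))" for j
    by (intro cc_field_vfield smooth_cc_heat_op smooth_cc_dx Y)+
  let ?B = "\<lambda>t x. convection (\<lambda>j. vfield (\<lambda>k. dx j (Y k)) (t, x)) (u t x)"
  have e: "u t x \<bullet> dt (vfield Y) (t, x) + (\<Sum>j\<in>UNIV. u t x $ j * (u t x \<bullet> dx j (vfield Y) (t, x)))
        + u t x \<bullet> laplacian_x (vfield Y) (t, x) + f t x \<bullet> vfield Y (t, x)
      = (u t x \<bullet> vfield (\<lambda>k. heat_op (Y k)) (t, x) + ?B t x) + f t x \<bullet> vfield Y (t, x)" for t x
  proof -
    have "u t x \<bullet> dt (vfield Y) (t, x) + u t x \<bullet> laplacian_x (vfield Y) (t, x) = u t x \<bullet> vfield (\<lambda>k. heat_op (Y k)) (t, x)"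
      by (simp add: dt_vfield laplacian_vfield Y inner_vec_def heat_op_def distrib_left sum.distrib)
    then show ?thesis by (simp add: convection_def dx_vfield Y)
  qed
  have bdd: "\<exists>M. \<forall>x. (\<Sum>j\<in>UNIV. norm (vfield (\<lambda>k. dx j (Y k)) (t, x))) \<le> M" for t
  proof -
    have "\<forall>j. \<exists>M. \<forall>z. norm (vfield (\<lambda>k. dx j (Y k)) z) \<le> M" using cc_field_bounded[OF ccD] by metis
    then obtain m where "\<And>j z. norm (vfield (\<lambda>k. dx j (Y k)) z) \<le> m j" by metis
    then show ?thesis by (intro exI[of _ "\<Sum>j\<in>UNIV. m j"] allI sum_mono)
  qed
  have "(LINT t|time. LINT x|lebesgue. u t x \<bullet> dt (vfield Y) (t, x) + (\<Sum>j\<in>UNIV. u t x $ j * (u t x \<bullet> dx j (vfield Y) (t, x)))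
        + u t x \<bullet> laplacian_x (vfield Y) (t, x) + f t x \<bullet> vfield Y (t, x))
      = (LINT t|time. ((LINT x|lebesgue. u t x \<bullet> vfield (\<lambda>k. heat_op (Y k)) (t, x)) + (LINT x|lebesgue. ?B t x))
          + (LINT x|lebesgue. f t x \<bullet> vfield Y (t, x)))"
  proof (rule Bochner_Integration.integral_cong)
    fix t assume "t \<in> space time"
    then have t: "t > 0" by (simp add: space_restrict_space)
    have ut: "in_Lp 2 (u t)" using u t by (simp add: weakly_continuous_def)
    obtain M where M: "\<And>x. (\<Sum>j\<in>UNIV. norm (vfield (\<lambda>k. dx j (Y k)) (t, x))) \<le> M" using bdd[of t] by blast
    have i1: "integrable lebesgue (\<lambda>x. u t x \<bullet> vfield (\<lambda>k. heat_op (Y k)) (t, x))"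
      by (intro in_Lp2_inner_integrable in_Lp2_cc_field ccH ut)
    have i2: "integrable lebesgue (?B t)" by (rule convection_integrable(1)[OF ut ccD M])
    have i3: "integrable lebesgue (\<lambda>x. f t x \<bullet> vfield Y (t, x))"
      using fb[OF t] by (intro in_Lp2_inner_integrable in_Lp2_cc_field ccY) auto
    show "(LINT x|lebesgue. u t x \<bullet> dt (vfield Y) (t, x) + (\<Sum>j\<in>UNIV. u t x $ j * (u t x \<bullet> dx j (vfield Y) (t, x)))
        + u t x \<bullet> laplacian_x (vfield Y) (t, x) + f t x \<bullet> vfield Y (t, x))
      = ((LINT x|lebesgue. u t x \<bullet> vfield (\<lambda>k. heat_op (Y k)) (t, x)) + (LINT x|lebesgue. ?B t x))
          + (LINT x|lebesgue. f t x \<bullet> vfield Y (t, x))"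
      unfolding e using i1 i2 i3 by simp
  qed simp
  also have "\<dots> = ((LINT t|time. LINT x|lebesgue. u t x \<bullet> vfield (\<lambda>k. heat_op (Y k)) (t, x))
      + (LINT t|time. LINT x|lebesgue. ?B t x)) + (LINT t|time. LINT x|lebesgue. f t x \<bullet> vfield Y (t, x))"
    using pairing_integrable[OF u ccH] convection_pairing_integrable[OF u ccD] forcing_pairing_integrable[OF f ccY fb]
    by simp
  finally show ?thesis using eq sol unfolding navier_stokes_weak_def navier_stokes_form_def by fastforce
qed

text \<open>
  Both equations are tested with the same solenoidal field.  The force and the initial datum cancel and
  the pressure does not contribute, which leaves the quadratic term alone.
\<close>
lemma difference_tested:
  fixes u v :: "real \<Rightarrow> real^'n \<Rightarrow> real^'n"
  assumes u: "weakly_continuous u" "\<And>t. t \<ge> 0 \<Longrightarrow> u t \<in> L2_sigma"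
    and v: "weakly_continuous v" "\<And>t. t \<ge> 0 \<Longrightarrow> v t \<in> L2_sigma"
    and f: "strongly_measurable_L2 f" "\<And>t. t > 0 \<Longrightarrow> in_Lp 2 (f t) \<and> Lp_norm 2 (f t) \<le> C"
    and nse: "navier_stokes_weak u0 f u" and st: "\<And>\<phi>. test_function \<phi> \<Longrightarrow> stokes_form u0 f v \<phi> = 0"
    and Y: "smooth_cc Y"
  shows "(LINT t|time. LINT x|lebesgue. (v t x $ i - u t x $ i) * laplacian_x (heat_op Y) (t, x))
    = (LINT t|time. LINT x|lebesgue. convection (\<lambda>j. vfield (\<lambda>k. dx j (solenoidal_part i Y k)) (t, x)) (u t x))"
proof -
  let ?P = "solenoidal_part i Y"
  have P: "smooth_cc (?P k)" for k by (rule smooth_cc_solenoidal_part[OF Y])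
  have H: "(\<lambda>k. heat_op (?P k)) = solenoidal_part i (heat_op Y)" using heat_op_solenoidal_part[OF Y] by blast
  let ?a = "\<lambda>w t. LINT x|lebesgue. w t x \<bullet> vfield (solenoidal_part i (heat_op Y)) (t, x)"
  have ccH: "cc_field (vfield (solenoidal_part i (heat_op Y)))"
    by (intro cc_field_vfield smooth_cc_solenoidal_part smooth_cc_heat_op Y)
  have "(LINT t|time. ?a v t) - (LINT t|time. ?a u t)
    = (LINT t|time. LINT x|lebesgue. convection (\<lambda>j. vfield (\<lambda>k. dx j (?P k)) (t, x)) (u t x))"
    using navier_stokes_tested[where Y="?P", OF u(1) f P solenoidal_test_solenoidal_part[OF Y] nse] stokes_tested[where Y="?P", OF v(1) f P st]
    unfolding H by simp
  moreover have "(LINT t|time. ?a v t) - (LINT t|time. ?a u t) = (LINT t|time. ?a v t - ?a u t)"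
    using pairing_integrable[OF u(1) ccH] pairing_integrable[OF v(1) ccH] by simp
  moreover have "(LINT t|time. ?a v t - ?a u t) = (LINT t|time. LINT x|lebesgue. (v t x $ i - u t x $ i) * laplacian_x (heat_op Y) (t, x))"
  proof (rule Bochner_Integration.integral_cong)
    fix t assume "t \<in> space time"
    then have t: "t \<ge> 0" by (simp add: space_restrict_space)
    have i: "integrable lebesgue (\<lambda>x. w x $ i * laplacian_x (heat_op Y) (t, x))" if "in_Lp 2 w" for w
      using in_Lp2_inner_integrable[OF in_Lp2_component(1)[OF that]
          in_Lp2_cc_field[OF smooth_cc_cc_field[OF smooth_cc_laplacian[OF smooth_cc_heat_op[OF Y]]]]] by simp
    have "in_Lp 2 (u t)" "in_Lp 2 (v t)" using u(2)[OF t] v(2)[OF t] by (simp_all add: L2_sigma_def)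
    then show "?a v t - ?a u t = (LINT x|lebesgue. (v t x $ i - u t x $ i) * laplacian_x (heat_op Y) (t, x))"
      using L2_sigma_solenoidal_part[OF u(2)[OF t] smooth_cc_heat_op[OF Y]]
        L2_sigma_solenoidal_part[OF v(2)[OF t] smooth_cc_heat_op[OF Y]] i by (simp add: left_diff_distrib)
  qed simp
  ultimately show ?thesis by simp
qed

text \<open>
  The Stokes equation decouples into heat equations for the components.
\<close>
lemma stokes_tested_component:
  fixes v :: "real \<Rightarrow> real^'n \<Rightarrow> real^'n"
  assumes v: "weakly_continuous v" and f: "strongly_measurable_L2 f"
    and fb: "\<And>t. t > 0 \<Longrightarrow> in_Lp 2 (f t) \<and> Lp_norm 2 (f t) \<le> C"
    and Y: "smooth_cc Y"
    and eq: "\<And>\<phi>. test_function \<phi> \<Longrightarrow> stokes_form u0 f v \<phi> = 0"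
    and Y0: "\<And>x. Y (0, x) = 0"
  shows "(LINT t|time. LINT x|lebesgue. v t x $ i * heat_op Y (t, x))
    + (LINT t|time. LINT x|lebesgue. f t x $ i * Y (t, x)) = 0"
proof -
  let ?P = "\<lambda>k z. if k = i then Y z else 0"
  have P: "smooth_cc (?P k)" for k by (rule smooth_cc_if[OF Y])
  have H: "heat_op (?P k) = (\<lambda>z. if k = i then heat_op Y z else 0)" for k
    by (cases "k = i") (simp_all add: heat_op_zero)
  have c: "y \<bullet> vfield (\<lambda>k z. if k = i then F z else 0) z = y $ i * F z" for y :: "real^'n" and F z
    by (simp add: inner_vec_def if_distrib cong: if_cong)
  show ?thesis using stokes_tested[where Y="?P", OF v f fb P eq] unfolding H c by (simp add: Y0)
qed

section \<open>Localized solutions of the backward heat equation as test fields\<close>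

lemma dderiv_sum_differentiable:
  fixes F :: "'i \<Rightarrow> 'a::real_normed_vector \<Rightarrow> real"
  assumes "\<And>i. i \<in> I \<Longrightarrow> F i differentiable (at z)"
  shows "dderiv b (\<lambda>z. \<Sum>i\<in>I. F i z) z = (\<Sum>i\<in>I. dderiv b (F i) z)"
  by (rule dderiv_eqI, intro has_derivative_sum has_derivative_dderiv assms)

lemma laplacian_eq_Basis:
  fixes F :: "real \<times> (real^'n) \<Rightarrow> real"
  shows "laplacian_x F z = (\<Sum>e\<in>Basis. dderiv (0, e) (dderiv (0, e) F) z)"
proof -
  have B: "(Basis :: (real^'n) set) = range (\<lambda>j. axis j 1)" by (auto simp: Basis_vec_def)
  have i: "inj (\<lambda>j::'n. axis j (1::real))" by (auto simp: inj_on_def axis_eq_axis)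
  show ?thesis unfolding laplacian_x_def dx_def B by (simp add: sum.reindex[OF i])
qed

abbreviation et :: "real \<times> (real^'n)" where "et \<equiv> (1, 0)"
abbreviation ex :: "'n \<Rightarrow> real \<times> (real^'n)" where "ex j \<equiv> (0, axis j 1)"

lemma heat_op_Ds: "heat_op F z = Ds [et] F z + (\<Sum>j\<in>UNIV. Ds [ex j, ex j] F z)"
  by (simp add: heat_op_def laplacian_x_def dt_def dx_def)

lemma laplacian_heat_op_Ds:
  assumes F: "tame UNIV H (\<lambda>_. F)"
  shows "laplacian_x (heat_op F) z = (\<Sum>j\<in>UNIV. Ds [et, ex j, ex j] F z + (\<Sum>l\<in>UNIV. Ds [ex l, ex l, ex j, ex j] F z))"
proof -
  have d: "Ds vs F differentiable (at z)" if "set vs \<subseteq> Basis" for vs z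
    using tame_Ds_differentiable[OF F that] by simp
  have 0: "heat_op F = (\<lambda>z. Ds [et] F z + (\<Sum>l\<in>UNIV. Ds [ex l, ex l] F z))" by (rule ext) (rule heat_op_Ds)
  have 1: "dderiv (ex j) (heat_op F) = (\<lambda>z. Ds [et, ex j] F z + (\<Sum>l\<in>UNIV. Ds [ex l, ex l, ex j] F z))" for j
  proof
    fix z
    have "dderiv (ex j) (heat_op F) z = dderiv (ex j) (Ds [et] F) z + dderiv (ex j) (\<lambda>z. \<Sum>l\<in>UNIV. Ds [ex l, ex l] F z) z"
      unfolding 0 by (intro dderiv_add differentiable_sum ballI d) auto
    also have "dderiv (ex j) (\<lambda>z. \<Sum>l\<in>UNIV. Ds [ex l, ex l] F z) z = (\<Sum>l\<in>UNIV. dderiv (ex j) (Ds [ex l, ex l] F) z)"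
      by (intro dderiv_sum_differentiable d) auto
    finally show "dderiv (ex j) (heat_op F) z = Ds [et, ex j] F z + (\<Sum>l\<in>UNIV. Ds [ex l, ex l, ex j] F z)" by simp
  qed
  have 2: "dderiv (ex j) (dderiv (ex j) (heat_op F)) z = Ds [et, ex j, ex j] F z + (\<Sum>l\<in>UNIV. Ds [ex l, ex l, ex j, ex j] F z)" for j
  proof -
    have "dderiv (ex j) (dderiv (ex j) (heat_op F)) z = dderiv (ex j) (Ds [et, ex j] F) z
        + dderiv (ex j) (\<lambda>z. \<Sum>l\<in>UNIV. Ds [ex l, ex l, ex j] F z) z"
      unfolding 1 by (intro dderiv_add differentiable_sum ballI d) auto
    also have "dderiv (ex j) (\<lambda>z. \<Sum>l\<in>UNIV. Ds [ex l, ex l, ex j] F z) z = (\<Sum>l\<in>UNIV. dderiv (ex j) (Ds [ex l, ex l, ex j] F) z)"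
      by (intro dderiv_sum_differentiable d) auto
    finally show ?thesis by simp
  qed
  show ?thesis unfolding laplacian_x_def dx_def 2 ..
qed

text \<open>
  A solution \<open>W\<close> of the backward heat equation on a time slab, made into a test function \<open>Y k\<close> by a cutoff
  \<open>\<eta>\<close> in time, supported inside the slab, and a wide cutoff in space.  The backward heat operator then
  hits the cutoffs only: it yields the main term \<open>\<eta>' W\<close>, and errors \<open>O(1/k)\<close> with a Gaussian tail.
\<close>
locale localized =
  fixes W :: "real \<times> (real^'n) \<Rightarrow> real" and \<eta> \<eta>' :: "real \<Rightarrow> real" and l l' c' c \<kappa> :: real
  assumes W: "tame {z. l < fst z \<and> fst z < c} (\<lambda>_ z. exp (- (\<kappa> * (norm (snd z))\<^sup>2))) (\<lambda>_. W)"
    and \<kappa>: "\<kappa> > 0"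
    and heatW: "\<And>z. l < fst z \<Longrightarrow> fst z < c \<Longrightarrow> dderiv (1, 0) W z + (\<Sum>e\<in>Basis. dderiv (0, e) (dderiv (0, e) W) z) = 0"
    and \<eta>: "tame UNIV (\<lambda>_ _. 1) (\<lambda>_. \<eta>)" "\<And>t. (\<eta> has_real_derivative \<eta>' t) (at t)"
    and supp: "\<And>t. t \<le> l' \<or> c' \<le> t \<Longrightarrow> \<eta> t = 0" and order: "l < l'" "c' < c"
begin

abbreviation "U \<equiv> {z :: real \<times> (real^'n). l < fst z \<and> fst z < c}"
definition H :: "real \<times> (real^'n) \<Rightarrow> real" where "H z = exp (- (\<kappa> * (norm (snd z))\<^sup>2))"
definition Z :: "real \<times> (real^'n) \<Rightarrow> real" where "Z z = \<eta> (fst z) * W z"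
definition Y :: "nat \<Rightarrow> real \<times> (real^'n) \<Rightarrow> real" where "Y k z = cutoff k z * Z z"

lemma H_bounds: "0 \<le> H z" "H z \<le> 1" using \<kappa> by (simp_all add: H_def)

lemma tameW: "tame U (\<lambda>_. H) (\<lambda>_. W)" using W by (simp add: H_def[abs_def])

lemma open_U: "open U" by (intro open_Collect_conj open_Collect_less continuous_intros)

lemma open_off: "open {z :: real \<times> (real^'n). fst z < l' \<or> c' < fst z}"
  by (intro open_Collect_disj open_Collect_less continuous_intros)

lemma U_off: "z \<in> U \<or> fst z < l' \<or> c' < fst z" using order by auto

lemma Z_off: "fst z < l' \<or> c' < fst z \<Longrightarrow> Z z = 0" using supp[of "fst z"] by (auto simp: Z_def)

lemma tameZ: "tame UNIV (\<lambda>_. H) (\<lambda>_. Z)"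
proof -
  have "tame U (\<lambda>k z. 1 * H z) (\<lambda>k z. \<eta> (fst z) * W z)"
    by (rule tame_mult[OF open_U tame_subset[OF tame_comp_fst[OF \<eta>(1)]] tameW]) simp
  then have 1: "tame U (\<lambda>_. H) (\<lambda>_. Z)" by (simp add: Z_def[abs_def])
  have 2: "tame {z. fst z < l' \<or> c' < fst z} (\<lambda>_. H) (\<lambda>_. Z)"
    by (rule tame_cong[OF open_off _ tame_zero]) (use Z_off in auto)
  have "U \<union> {z. fst z < l' \<or> c' < fst z} = UNIV" using U_off by auto
  then show ?thesis using tame_Un[OF 1 2] H_bounds by simp
qed

lemma tameY: "tame UNIV (\<lambda>_. H) Y"
  using tame_mult[OF open_UNIV tame_cutoff tameZ] by (simp add: Y_def[abs_def])

lemma Y_off: "fst z < l' \<or> c' < fst z \<Longrightarrow> Y k z = 0" using Z_off by (simp add: Y_def)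

lemma smooth_cc_Y: "smooth_cc (Y k)"
proof -
  have "Y k z = 0" if "\<bar>l'\<bar> + \<bar>c'\<bar> + real (Suc k) < norm z" for z
  proof -
    have "norm z \<le> \<bar>fst z\<bar> + norm (snd z)" using norm_Pair_le[of "fst z" "snd z"] by simp
    then have "\<bar>l'\<bar> + \<bar>c'\<bar> < \<bar>fst z\<bar> \<or> real (Suc k) \<le> norm (snd z)" using that by linarith
    then show ?thesis
    proof
      assume "\<bar>l'\<bar> + \<bar>c'\<bar> < \<bar>fst z\<bar>"
      then have "fst z < l' \<or> c' < fst z" by linarith
      then show ?thesis by (rule Y_off)
    qed (simp add: Y_def cutoff_support)
  qed
  then show ?thesis unfolding smooth_cc_def using tame_family_member[OF tameY, of k] by blast
qed

lemma Ds_Y_error: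
  assumes "set vs \<subseteq> Basis"
  shows "\<exists>C. \<forall>k z. \<bar>Ds vs (Y k) z - cutoff k z * Ds vs Z z\<bar> \<le> C * (1 / real (Suc k) * H z)"
  using tame_bound[OF tame_commutator[OF open_UNIV tame_cutoff tame_dderiv_cutoff tameZ assms]]
  unfolding Y_def[abs_def] by (metis UNIV_I)

lemma \<eta>_differentiable: "\<eta> differentiable (at t)" "dderiv 1 \<eta> = \<eta>'"
proof -
  have h: "(\<eta> has_derivative (\<lambda>h. \<eta>' t * h)) (at t)" for t using \<eta>(2)[of t] by (simp add: has_field_derivative_def)
  then show "\<eta> differentiable (at t)" using differentiable_def by blast
  show "dderiv 1 \<eta> = \<eta>'" using dderiv_eqI[OF h, of 1] by (simp add: fun_eq_iff)
qed

lemma tame_\<eta>': "tame UNIV (\<lambda>_ _. 1) (\<lambda>_. \<eta>')"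
  using tame_dderiv[OF \<eta>(1), of 1] \<eta>_differentiable(2) by simp

lemma \<eta>'_off: "t < l' \<or> c' < t \<Longrightarrow> \<eta>' t = 0"
proof -
  assume t: "t < l' \<or> c' < t"
  have "open {t. t < l' \<or> c' < t}" by (intro open_Collect_disj open_Collect_less continuous_intros)
  then have "dderiv 1 \<eta> t = dderiv 1 (\<lambda>_. 0) t"
    by (rule dderiv_cong_open) (use t supp in auto)
  then show ?thesis by (simp add: \<eta>_differentiable(2) dderiv_const)
qed

lemma spatial_product:
  assumes \<mu>: "\<And>t. \<mu> differentiable (at t)" and vs: "set vs \<subseteq> Basis" "\<And>v. v \<in> set vs \<Longrightarrow> fst v = 0" and z: "z \<in> U"
    and F: "tame U (\<lambda>_. H) (\<lambda>_. F)"
  shows "Ds vs (\<lambda>z. \<mu> (fst z) * F z) z = \<mu> (fst z) * Ds vs F z"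
  using vs z F
proof (induct vs arbitrary: F z)
  case (Cons v vs)
  have "Ds vs (dderiv v (\<lambda>z. \<mu> (fst z) * F z)) z = Ds vs (\<lambda>z. \<mu> (fst z) * dderiv v F z) z"
  proof (rule Ds_cong_open[OF open_U _ Cons.prems(3)])
    fix y :: "real \<times> (real^'n)" assume y: "y \<in> U"
    have v: "fst v = 0" using Cons.prems(2) by simp
    show "dderiv v (\<lambda>z. \<mu> (fst z) * F z) y = \<mu> (fst y) * dderiv v F y"
      using dderiv_comp_fst(1)[where z=y, OF \<mu>] dderiv_comp_fst(2)[where z=y and b=v, OF \<mu>] tame_differentiable[OF Cons.prems(4) y] v by (simp add: dderiv_mult)
  qed
  also have "\<dots> = \<mu> (fst z) * Ds vs (dderiv v F) z"
    by (rule Cons.hyps) (use Cons.prems in \<open>auto intro: tame_dderiv\<close>)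
  finally show ?case by simp
qed simp

lemma heat_op_Z: "heat_op Z z = \<eta>' (fst z) * W z"
proof (cases "z \<in> U")
  case True
  have W1: "W differentiable (at z)" by (rule tame_differentiable[OF tameW True])
  have "dt Z z = \<eta>' (fst z) * W z + \<eta> (fst z) * dderiv et W z"
    unfolding dt_def Z_def[abs_def]
    using dderiv_comp_fst(1)[where z=z, OF \<eta>_differentiable(1)] dderiv_comp_fst(2)[where z=z and b=et, OF \<eta>_differentiable(1)] \<eta>_differentiable(2) W1 by (simp add: dderiv_mult)
  moreover have "Ds [ex j, ex j] Z z = \<eta> (fst z) * Ds [ex j, ex j] W z" for j
    unfolding Z_def[abs_def] by (rule spatial_product[OF \<eta>_differentiable(1) _ _ True tameW]) auto
  then have "laplacian_x Z z = \<eta> (fst z) * laplacian_x W z"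
    by (simp add: laplacian_x_def dx_def sum_distrib_left)
  moreover have "dderiv et W z + laplacian_x W z = 0" using heatW[of z] True by (simp add: laplacian_eq_Basis)
  ultimately show ?thesis by (simp add: heat_op_def flip: distrib_left)
next
  case False
  then have off: "z \<in> {z. fst z < l' \<or> c' < fst z}" using U_off[of z] False by auto
  have "Ds vs Z z = Ds vs (\<lambda>_. 0) z" for vs by (rule Ds_cong_open[OF open_off _ off]) (use Z_off in auto)
  moreover have "Ds vs (\<lambda>_::real \<times> (real^'n). 0::real) = (\<lambda>_. 0)" for vs
    by (induct vs) (auto simp: dderiv_const[abs_def])
  ultimately have "heat_op Z z = 0" unfolding heat_op_Ds by (simp del: Ds.simps)
  then show ?thesis using \<eta>'_off[of "fst z"] off by simp
qed

lemma laplacian_heat_op_Z: "laplacian_x (heat_op Z) z = \<eta>' (fst z) * laplacian_x W z"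
proof (cases "z \<in> U")
  case True
  have m: "\<eta>' differentiable (at t)" for t by (rule tame_differentiable[OF tame_\<eta>']) simp
  have "heat_op Z = (\<lambda>z. \<eta>' (fst z) * W z)" by (rule ext) (rule heat_op_Z)
  moreover have "Ds [ex j, ex j] (\<lambda>z. \<eta>' (fst z) * W z) z = \<eta>' (fst z) * Ds [ex j, ex j] W z" for j
    by (rule spatial_product[OF m _ _ True tameW]) auto
  ultimately show ?thesis by (simp add: laplacian_x_def dx_def sum_distrib_left)
next
  case False
  then have off: "z \<in> {z. fst z < l' \<or> c' < fst z}" using U_off[of z] False by auto
  have "Ds vs (heat_op Z) z = Ds vs (\<lambda>_. 0) z" for vs
    by (rule Ds_cong_open[OF open_off _ off]) (use \<eta>'_off in \<open>auto simp: heat_op_Z\<close>)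
  moreover have "Ds vs (\<lambda>_::real \<times> (real^'n). 0::real) = (\<lambda>_. 0)" for vs
    by (induct vs) (auto simp: dderiv_const[abs_def])
  ultimately have "Ds [ex j, ex j] (heat_op Z) z = 0" for j by (simp del: Ds.simps)
  then show ?thesis using \<eta>'_off[of "fst z"] off by (simp add: laplacian_x_def dx_def)
qed

lemma sum_error:
  fixes F G :: "'i \<Rightarrow> nat \<Rightarrow> real \<times> (real^'n) \<Rightarrow> real"
  assumes "\<And>i. i \<in> I \<Longrightarrow> \<exists>C. \<forall>k z. \<bar>F i k z - cutoff k z * G i k z\<bar> \<le> C * (1 / real (Suc k) * H z)"
  shows "\<exists>C. \<forall>k z. \<bar>(\<Sum>i\<in>I. F i k z) - cutoff k z * (\<Sum>i\<in>I. G i k z)\<bar> \<le> C * (1 / real (Suc k) * H z)"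
proof -
  obtain C where C: "\<And>i k z. i \<in> I \<Longrightarrow> \<bar>F i k z - cutoff k z * G i k z\<bar> \<le> C i * (1 / real (Suc k) * H z)"
    using assms by metis
  have "\<bar>(\<Sum>i\<in>I. F i k z) - cutoff k z * (\<Sum>i\<in>I. G i k z)\<bar> \<le> (\<Sum>i\<in>I. C i) * (1 / real (Suc k) * H z)" for k z
    unfolding sum_distrib_left sum_subtractf[symmetric] sum_distrib_right
    by (intro order_trans[OF sum_abs] sum_mono C)
  then show ?thesis by blast
qed

lemma add_error:
  fixes F G F' G' :: "nat \<Rightarrow> real \<times> (real^'n) \<Rightarrow> real"
  assumes "\<exists>C. \<forall>k z. \<bar>F k z - cutoff k z * G k z\<bar> \<le> C * (1 / real (Suc k) * H z)"
    "\<exists>C. \<forall>k z. \<bar>F' k z - cutoff k z * G' k z\<bar> \<le> C * (1 / real (Suc k) * H z)"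
  shows "\<exists>C. \<forall>k z. \<bar>(F k z + F' k z) - cutoff k z * (G k z + G' k z)\<bar> \<le> C * (1 / real (Suc k) * H z)"
proof -
  obtain C D where C: "\<And>k z. \<bar>F k z - cutoff k z * G k z\<bar> \<le> C * (1 / real (Suc k) * H z)"
    and D: "\<And>k z. \<bar>F' k z - cutoff k z * G' k z\<bar> \<le> D * (1 / real (Suc k) * H z)" using assms by metis
  have "\<bar>(F k z + F' k z) - cutoff k z * (G k z + G' k z)\<bar> \<le> (C + D) * (1 / real (Suc k) * H z)" for k z
  proof -
    have "(F k z + F' k z) - cutoff k z * (G k z + G' k z) = (F k z - cutoff k z * G k z) + (F' k z - cutoff k z * G' k z)"
      by (simp add: algebra_simps)
    then show ?thesis unfolding distrib_right using C[of k z] D[of k z] by linarith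
  qed
  then show ?thesis by blast
qed

lemma Ds_Y_off:
  assumes "fst z < l' \<or> c' < fst z" shows "Ds vs (Y k) z = 0"
proof -
  have "Ds vs (Y k) z = Ds vs (\<lambda>_. 0) z"
    by (rule Ds_cong_open[OF open_off]) (use assms Y_off in auto)
  moreover have "Ds vs (\<lambda>_::real \<times> (real^'n). 0::real) = (\<lambda>_. 0)" for vs
    by (induct vs) (auto simp: dderiv_const[abs_def])
  ultimately show ?thesis by simp
qed

lemma laplacian_heat_op_Y_off: "fst z < l' \<or> c' < fst z \<Longrightarrow> laplacian_x (heat_op (Y k)) z = 0"
  unfolding laplacian_heat_op_Ds[OF tame_family_member[OF tameY]] by (simp add: Ds_Y_off del: Ds.simps)

lemma heat_op_Y_off: "fst z < l' \<or> c' < fst z \<Longrightarrow> heat_op (Y k) z = 0"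
  unfolding heat_op_Ds by (simp add: Ds_Y_off del: Ds.simps)

lemma heat_op_Y_error:
  "\<exists>C. \<forall>k z. \<bar>heat_op (Y k) z - cutoff k z * (\<eta>' (fst z) * W z)\<bar> \<le> C * (1 / real (Suc k) * H z)"
  unfolding heat_op_Z[symmetric] heat_op_Ds
  by (intro add_error sum_error Ds_Y_error) auto

lemma laplacian_heat_op_Y_error:
  "\<exists>C. \<forall>k z. \<bar>laplacian_x (heat_op (Y k)) z - cutoff k z * (\<eta>' (fst z) * laplacian_x W z)\<bar> \<le> C * (1 / real (Suc k) * H z)"
  unfolding laplacian_heat_op_Z[symmetric] laplacian_heat_op_Ds[OF tameZ] laplacian_heat_op_Ds[OF tame_family_member[OF tameY]]
  by (intro add_error sum_error Ds_Y_error) auto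

lemma spatial_Y_bound:
  assumes vs: "set vs \<subseteq> Basis" "\<And>v. v \<in> set vs \<Longrightarrow> fst v = 0" and \<eta>1: "\<And>t. \<bar>\<eta> t\<bar> \<le> 1"
  shows "\<exists>C. \<forall>k. \<forall>z\<in>U. \<bar>Ds vs (Y k) z\<bar> \<le> \<bar>Ds vs W z\<bar> + C * (1 / real (Suc k))"
proof -
  obtain C where C: "\<And>k z. \<bar>Ds vs (Y k) z - cutoff k z * Ds vs Z z\<bar> \<le> C * (1 / real (Suc k) * H z)"
    using Ds_Y_error[OF vs(1)] by blast
  have "\<bar>Ds vs (Y k) z\<bar> \<le> \<bar>Ds vs W z\<bar> + \<bar>C\<bar> * (1 / real (Suc k))" if z: "z \<in> U" for k z
  proof -
    have "Ds vs Z z = \<eta> (fst z) * Ds vs W z"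
      unfolding Z_def[abs_def] by (rule spatial_product[OF \<eta>_differentiable(1) vs z tameW])
    then have "\<bar>cutoff k z * Ds vs Z z\<bar> = cutoff k z * (\<bar>\<eta> (fst z)\<bar> * \<bar>Ds vs W z\<bar>)"
      using cutoff_nonneg[of k z] by (simp add: abs_mult)
    also have "\<dots> \<le> 1 * (1 * \<bar>Ds vs W z\<bar>)" using cutoff_nonneg[of k z] by (intro mult_mono cutoff_le_1 \<eta>1) auto
    finally have 1: "\<bar>cutoff k z * Ds vs Z z\<bar> \<le> \<bar>Ds vs W z\<bar>" by simp
    have "C * (1 / real (Suc k) * H z) \<le> \<bar>C\<bar> * (1 / real (Suc k) * 1)"
      using H_bounds[of z] by (intro mult_mono) auto
    then show ?thesis using C[of k z] 1 by simp
  qed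
  then show ?thesis by blast
qed

end

section \<open>Time integrals and pairings with localized test functions\<close>

lemma smooth_stepD:
  assumes "smooth_step l r \<sigma> \<rho>"
  shows "l < r" "tame UNIV (\<lambda>_ _. 1) (\<lambda>_. \<sigma>)" "(\<sigma> has_real_derivative \<rho> t) (at t)"
    "0 \<le> \<rho> t" "t \<le> l \<or> r \<le> t \<Longrightarrow> \<rho> t = 0" "continuous_on UNIV \<rho>"
    "t \<le> l \<Longrightarrow> \<sigma> t = 0" "t \<ge> r \<Longrightarrow> \<sigma> t = 1" "0 \<le> \<sigma> t" "\<sigma> t \<le> 1"
  using assms unfolding smooth_step_def by blast+

lemma smooth_step_density:
  assumes s: "smooth_step l r \<sigma> \<rho>"
  obtains \<rho>' where "tame UNIV (\<lambda>_ _. 1) (\<lambda>_. \<rho>)" "\<And>t. (\<rho> has_real_derivative \<rho>' t) (at t)"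
proof -
  have "(\<sigma> has_derivative (\<lambda>h. \<rho> t * h)) (at t)" for t
    using smooth_stepD(3)[OF s, of t] by (simp add: has_field_derivative_def)
  then have "dderiv 1 \<sigma> = \<rho>" using dderiv_eqI[of \<sigma> _ _ 1] by fastforce
  then have t: "tame UNIV (\<lambda>_ _. 1) (\<lambda>_. \<rho>)" using tame_dderiv[OF smooth_stepD(2)[OF s], of 1] by simp
  then have "\<rho> differentiable (at t)" for t by (rule tame_differentiable) simp
  then have "\<exists>d. (\<rho> has_real_derivative d) (at t)" for t using real_differentiable_def by blast
  then obtain \<rho>' where "\<And>t. (\<rho> has_real_derivative \<rho>' t) (at t)" by metis
  then show thesis using that t by blast
qed

lemma smooth_step_mass:
  assumes s: "smooth_step l r \<sigma> \<rho>" and l: "0 \<le> l"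
  shows "integrable time \<rho>" "(LINT t|time. \<rho> t) = 1"
proof -
  have c: "continuous_on {l..r} \<rho>" using smooth_stepD(6)[OF s] continuous_on_subset by blast
  have i: "integrable (lebesgue_on {l..r}) \<rho>" by (rule continuous_imp_integrable_real[OF c])
  have e: "indicator {0<..} t *\<^sub>R \<rho> t = indicator {l..r} t *\<^sub>R \<rho> t" for t
    using smooth_stepD(5)[OF s, of t] l by (auto simp: indicator_def)
  have i': "integrable lebesgue (\<lambda>t. indicator {l..r} t *\<^sub>R \<rho> t)"
    using i by (simp add: integrable_restrict_space)
  then have "integrable lebesgue (\<lambda>t. indicator {0<..} t *\<^sub>R \<rho> t)" unfolding e .
  then show "integrable time \<rho>" by (subst integrable_restrict_space) simp_all
  have "(LINT t|time. \<rho> t) = (LINT t|lebesgue. indicator {0<..} t *\<^sub>R \<rho> t)"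
    by (subst integral_restrict_space) simp_all
  also have "\<dots> = (LINT t|lebesgue. indicator {l..r} t *\<^sub>R \<rho> t)" unfolding e ..
  also have "\<dots> = (LINT t|lebesgue_on {l..r}. \<rho> t)" by (subst integral_restrict_space) auto
  also have "\<dots> = integral {l..r} \<rho>" by (rule lebesgue_integral_eq_integral[OF i]) simp
  also have "\<dots> = \<sigma> r - \<sigma> l"
    using smooth_stepD(1,3)[OF s]
    by (intro integral_unique fundamental_theorem_of_calculus)
      (auto simp: has_real_derivative_iff_has_vector_derivative[symmetric] intro: has_field_derivative_at_within)
  also have "\<dots> = 1" using smooth_stepD(7)[OF s, of l] smooth_stepD(8)[OF s, of r] by simp
  finally show "(LINT t|time. \<rho> t) = 1" .
qed

lemma space_time [simp]: "space time = {0<..}" by (simp add: space_restrict_space)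

lemma time_integral_bound:
  fixes h B :: "real \<Rightarrow> real"
  assumes B: "integrable time B" and h: "\<And>t. 0 < t \<Longrightarrow> \<bar>h t\<bar> \<le> B t"
  shows "\<bar>LINT t|time. h t\<bar> \<le> (LINT t|time. B t)"
proof (cases "integrable time h")
  case True
  have "\<bar>LINT t|time. h t\<bar> \<le> (LINT t|time. \<bar>h t\<bar>)" by (rule integral_abs_bound)
  also have "\<dots> \<le> (LINT t|time. B t)" using True B h by (intro integral_mono) auto
  finally show ?thesis .
next
  case False
  have "0 \<le> B t" if "0 < t" for t using h[OF that] by linarith
  then have "0 \<le> (LINT t|time. B t)" by (intro Bochner_Integration.integral_nonneg) auto
  then show ?thesis using False by (simp add: not_integrable_integral_eq)
qed

lemma time_interval_mass:
  fixes T B :: real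
  assumes "0 \<le> T"
  shows "integrable time (\<lambda>t. indicator {0..T} t * B)" "(LINT t|time. indicator {0..T} t * B) = T * B"
proof -
  have e: "indicator {0<..} t *\<^sub>R (indicator {0..T} t * B) = indicator {0<..T} t * B" for t :: real
    by (auto simp: indicator_def)
  have f: "emeasure lebesgue {0<..T} < \<infinity>" using emeasure_bounded_finite[of "{0<..T}"] by simp
  have i: "integrable lebesgue (\<lambda>t. indicator {0<..T} t * B)" using f by (intro integrable_mult_left integrable_real_indicator) auto
  then have "integrable lebesgue (\<lambda>t. indicator {0<..} t *\<^sub>R (indicator {0..T} t * B))" unfolding e .
  then show "integrable time (\<lambda>t. indicator {0..T} t * B)" by (subst integrable_restrict_space) simp_all
  have "(LINT t|time. indicator {0..T} t * B) = (LINT t|lebesgue. indicator {0<..} t *\<^sub>R (indicator {0..T} t * B))"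
    by (subst integral_restrict_space) simp_all
  also have "\<dots> = (LINT t|lebesgue. indicator {0<..T} t * B)" unfolding e ..
  also have "\<dots> = T * B" using f assms by (simp add: measure_def emeasure_lborel_Ioc)
  finally show "(LINT t|time. indicator {0..T} t * B) = T * B" .
qed

lemma power_time_integral:
  fixes p T :: real
  assumes p: "p + 1 \<noteq> 0" and T: "0 \<le> T"
  shows "integrable time (\<lambda>t. indicator {0..T} t * (1 + t) powr p)"
    "(LINT t|time. indicator {0..T} t * (1 + t) powr p) = ((1 + T) powr (p + 1) - 1) / (p + 1)"
proof -
  let ?h = "\<lambda>t::real. (1 + t) powr p"
  have c: "continuous_on {0..T} ?h" by (intro continuous_intros) auto
  have i: "integrable (lebesgue_on {0..T}) ?h" by (rule continuous_imp_integrable_real[OF c])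
  have i': "integrable lebesgue (\<lambda>t. indicator {0..T} t *\<^sub>R ?h t)" using i by (simp add: integrable_restrict_space)
  have e: "indicator {0<..} t *\<^sub>R (indicator {0..T} t * ?h t) = indicator {0<..} t *\<^sub>R (indicator {0..T} t *\<^sub>R ?h t)" for t :: real by simp
  have i2: "integrable lebesgue (\<lambda>t. indicator {0<..} t *\<^sub>R (indicator {0..T} t *\<^sub>R ?h t))"
    by (rule integrable_mult_indicator[OF _ i']) simp
  then show "integrable time (\<lambda>t. indicator {0..T} t * ?h t)" by (subst integrable_restrict_space) simp_all
  have ae: "AE t in lebesgue. t \<noteq> (0::real)" using AE_lborel_singleton[of "0::real"] by (rule AE_completion)
  have "(LINT t|time. indicator {0..T} t * ?h t) = (LINT t|lebesgue. indicator {0<..} t *\<^sub>R (indicator {0..T} t *\<^sub>R ?h t))"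
    by (subst integral_restrict_space) simp_all
  also have "\<dots> = (LINT t|lebesgue. indicator {0..T} t *\<^sub>R ?h t)"
  proof (rule integral_cong_AE)
    show "AE t in lebesgue. indicator {0<..} t *\<^sub>R (indicator {0..T} t *\<^sub>R ?h t) = indicator {0..T} t *\<^sub>R ?h t"
      using ae by eventually_elim (auto simp: indicator_def)
  qed (use i' i2 in \<open>simp_all only: borel_measurable_integrable\<close>)
  also have "\<dots> = (LINT t|lebesgue_on {0..T}. ?h t)" by (subst integral_restrict_space) auto
  also have "\<dots> = integral {0..T} ?h" by (rule lebesgue_integral_eq_integral[OF i]) simp
  also have "\<dots> = (1 + T) powr (p + 1) / (p + 1) - (1 + 0) powr (p + 1) / (p + 1)"
  proof (intro integral_unique fundamental_theorem_of_calculus T)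
    fix t assume t: "t \<in> {0..T}"
    have "((\<lambda>t. (1 + t) powr (p + 1) / (p + 1)) has_real_derivative (1 + t) powr p) (at t)"
      using t p by (auto intro!: derivative_eq_intros)
    then show "((\<lambda>t. (1 + t) powr (p + 1) / (p + 1)) has_vector_derivative (1 + t) powr p) (at t within {0..T})"
      by (simp add: has_real_derivative_iff_has_vector_derivative[symmetric] has_field_derivative_at_within)
  qed
  finally show "(LINT t|time. indicator {0..T} t * ?h t) = ((1 + T) powr (p + 1) - 1) / (p + 1)"
    by (simp add: diff_divide_distrib)
qed

lemma time_weighted_bound:
  fixes h \<rho> :: "real \<Rightarrow> real"
  assumes s: "smooth_step l r \<sigma> \<rho>" "0 \<le> l" and h: "\<And>t. 0 < t \<Longrightarrow> \<bar>h t\<bar> \<le> \<rho> t * B"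
  shows "\<bar>LINT t|time. h t\<bar> \<le> B"
  using time_integral_bound[of "\<lambda>t. \<rho> t * B" h] smooth_step_mass[OF s] h by simp

lemma component_pairing_integrable:
  fixes w :: "real \<Rightarrow> real^'n \<Rightarrow> real^'n"
  assumes w: "weakly_continuous w" and \<zeta>: "smooth_cc \<zeta>"
  shows "integrable time (\<lambda>t. LINT x|lebesgue. w t x $ i * \<zeta> (t, x))"
proof -
  have c: "y \<bullet> vfield (\<lambda>k z. if k = i then F z else 0) z = y $ i * F z" for y :: "real^'n" and F z
    by (simp add: inner_vec_def if_distrib cong: if_cong)
  have "cc_field (vfield (\<lambda>k z. if k = i then \<zeta> z else 0))" by (intro cc_field_vfield smooth_cc_if \<zeta>)
  from pairing_integrable[OF w this] show ?thesis unfolding c .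
qed

lemma component_integrable:
  fixes w :: "real^'n \<Rightarrow> real^'n"
  assumes "in_Lp 2 w" "in_Lp 2 F"
  shows "integrable lebesgue (\<lambda>x. w x $ i * F x)" "\<bar>LINT x|lebesgue. w x $ i * F x\<bar> \<le> Lp_norm 2 w * Lp_norm 2 F"
proof -
  show "integrable lebesgue (\<lambda>x. w x $ i * F x)"
    using in_Lp2_inner_integrable[OF in_Lp2_component(1)[OF assms(1)] assms(2)] by simp
  have "\<bar>LINT x|lebesgue. w x $ i * F x\<bar> \<le> Lp_norm 2 (\<lambda>x. w x $ i) * Lp_norm 2 F"
    using Lp2_Cauchy_Schwarz[OF in_Lp2_component(1)[OF assms(1)] assms(2)] by simp
  also have "\<dots> \<le> Lp_norm 2 w * Lp_norm 2 F"
    by (intro mult_right_mono in_Lp2_component assms Lp2_norm_nonneg)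
  finally show "\<bar>LINT x|lebesgue. w x $ i * F x\<bar> \<le> Lp_norm 2 w * Lp_norm 2 F" .
qed

lemma smooth_cc_slice:
  fixes \<zeta> :: "real \<times> 'b::euclidean_space \<Rightarrow> real"
  shows "smooth_cc \<zeta> \<Longrightarrow> in_Lp 2 (\<lambda>x. \<zeta> (t, x))"
  by (rule in_Lp2_cc_field[OF smooth_cc_cc_field])

lemma weakly_continuous_diff:
  assumes u: "weakly_continuous u" and v: "weakly_continuous v"
  shows "weakly_continuous (\<lambda>t x. v t x - u t x)"
  unfolding weakly_continuous_def
proof (intro conjI allI impI)
  have uL: "in_Lp 2 (u t)" and vL: "in_Lp 2 (v t)" if "t \<ge> 0" for t
    using u v that by (simp_all add: weakly_continuous_def)
  show "in_Lp 2 (\<lambda>x. v t x - u t x)" if "0 \<le> t" for t using in_Lp2_diff[OF vL uL] that by simp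
  show "continuous_on {0..} (\<lambda>t. LINT x|lebesgue. (v t x - u t x) \<bullet> w x)" if w: "in_Lp 2 w" for w
  proof (rule continuous_on_eq)
    show "continuous_on {0..} (\<lambda>t. (LINT x|lebesgue. v t x \<bullet> w x) - (LINT x|lebesgue. u t x \<bullet> w x))"
      using u v w unfolding weakly_continuous_def by (intro continuous_on_diff) blast+
    show "(LINT x|lebesgue. v t x \<bullet> w x) - (LINT x|lebesgue. u t x \<bullet> w x) = (LINT x|lebesgue. (v t x - u t x) \<bullet> w x)"
      if "t \<in> {0..}" for t
      using in_Lp2_inner_integrable[OF uL w] in_Lp2_inner_integrable[OF vL w] that by (simp add: inner_diff_left)
  qed
  fix T :: real
  obtain M where M: "\<And>t. t \<in> {0..T} \<Longrightarrow> Lp_norm 2 (u t) \<le> M" using u unfolding weakly_continuous_def by blast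
  obtain M' where M': "\<And>t. t \<in> {0..T} \<Longrightarrow> Lp_norm 2 (v t) \<le> M'" using v unfolding weakly_continuous_def by blast
  have "Lp_norm 2 (\<lambda>x. v t x - u t x) \<le> M' + M" if "t \<in> {0..T}" for t
  proof -
    have "Lp_norm 2 (\<lambda>x. v t x + (-1) *\<^sub>R u t x) \<le> Lp_norm 2 (v t) + Lp_norm 2 (\<lambda>x. (-1) *\<^sub>R u t x)"
      using that by (intro Lp2_norm_triangle vL in_Lp2_scaleR(1) uL) auto
    then show ?thesis using M[OF that] M'[OF that] in_Lp2_scaleR(2)[OF uL, of t "-1"] that by simp
  qed
  then show "\<exists>M. \<forall>t\<in>{0..T}. Lp_norm 2 (\<lambda>x. v t x - u t x) \<le> M" by blast
qed

text \<open>
  The errors of the localization are \<open>O(1/k)\<close> in \<open>L\<^sup>2\<close>, uniformly on a bounded time interval.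
\<close>
lemma pairing_error_bound:
  fixes w :: "real \<Rightarrow> real^'n \<Rightarrow> real^'n"
  assumes w: "weakly_continuous w" and T: "0 \<le> T" and \<kappa>: "\<kappa> > 0"
    and e: "\<And>k. smooth_cc (e k)" "\<And>k t x. 0 < t \<Longrightarrow> \<bar>e k (t, x)\<bar> \<le> C * (1 / real (Suc k) * exp (- (\<kappa> * (norm x)\<^sup>2)))"
    and off: "\<And>k t x. T < t \<Longrightarrow> e k (t, x) = 0"
  shows "(\<lambda>k. LINT t|time. LINT x|lebesgue. w t x $ i * e k (t, x)) \<longlonglongrightarrow> 0"
proof -
  let ?H = "\<lambda>x::real^'n. exp (- (\<kappa> * (norm x)\<^sup>2))"
  have HL: "in_Lp 2 ?H" by (rule in_Lp2_gaussian[OF \<kappa>])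
  obtain M where M: "\<And>t. t \<in> {0..T} \<Longrightarrow> Lp_norm 2 (w t) \<le> M" using w unfolding weakly_continuous_def by blast
  have M0: "0 \<le> M" using order_trans[OF Lp2_norm_nonneg M[of 0]] T by simp
  let ?B = "\<lambda>k. M * (\<bar>C\<bar> * (1 / real (Suc k)) * Lp_norm 2 ?H)"
  have b: "\<bar>LINT t|time. LINT x|lebesgue. w t x $ i * e k (t, x)\<bar> \<le> T * ?B k" for k
  proof -
    have "\<bar>LINT x|lebesgue. w t x $ i * e k (t, x)\<bar> \<le> indicator {0..T} t * ?B k" if t: "0 < t" for t
    proof (cases "t \<le> T")
      case True
      have wt: "in_Lp 2 (w t)" using w t by (simp add: weakly_continuous_def)
      have n: "Lp_norm 2 (\<lambda>x. e k (t, x)) \<le> \<bar>C\<bar> * (1 / real (Suc k)) * Lp_norm 2 ?H"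
      proof (rule in_Lp2_bounded_by(2)[OF HL])
        show "(\<lambda>x. e k (t, x)) \<in> borel_measurable lebesgue" by (rule in_Lp2_measurable[OF smooth_cc_slice[OF e(1)]])
        have "C * (1 / real (Suc k) * ?H x) \<le> \<bar>C\<bar> * (1 / real (Suc k) * ?H x)" for x by (intro mult_right_mono) auto
        then show "norm (e k (t, x)) \<le> \<bar>C\<bar> * (1 / real (Suc k)) * norm (?H x)" for x
          using order_trans[OF e(2)[OF t, of k x]] by (simp add: mult.assoc)
      qed simp
      have "\<bar>LINT x|lebesgue. w t x $ i * e k (t, x)\<bar> \<le> Lp_norm 2 (w t) * Lp_norm 2 (\<lambda>x. e k (t, x))"
        by (rule component_integrable(2)[OF wt smooth_cc_slice[OF e(1)]])
      also have "\<dots> \<le> ?B k" using M[of t] t True n M0 by (intro mult_mono) (auto simp: Lp2_norm_nonneg)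
      finally show ?thesis using t True by simp
    next
      case False
      then show ?thesis using off[of t] by simp
    qed
    from time_integral_bound[OF time_interval_mass(1)[OF T] this] show ?thesis
      unfolding time_interval_mass(2)[OF T] .
  qed
  have "(\<lambda>k. T * ?B k) \<longlonglongrightarrow> T * (M * (\<bar>C\<bar> * 0 * Lp_norm 2 ?H))"
    by (intro tendsto_intros lim_1_over_n[THEN LIMSEQ_Suc])
  then have lim: "(\<lambda>k. T * ?B k) \<longlonglongrightarrow> 0" by simp
  show ?thesis
  proof (rule Lim_null_comparison[OF _ lim])
    show "\<forall>\<^sub>F k in sequentially. norm (LINT t|time. LINT x|lebesgue. w t x $ i * e k (t, x)) \<le> T * ?B k"
      unfolding real_norm_def using b by (rule always_eventually[OF allI])
  qed
qed

lemma uniform_over_finite: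
  fixes P :: "'p::finite \<Rightarrow> real \<Rightarrow> bool"
  assumes "\<And>p. \<exists>C. P p C" "\<And>p C C'. P p C \<Longrightarrow> C \<le> C' \<Longrightarrow> P p C'"
  shows "\<exists>C\<ge>0. \<forall>p. P p C"
proof -
  obtain c where c: "\<And>p. P p (c p)" using choice[of P] assms(1) by blast
  have "c p \<le> (\<Sum>p\<in>UNIV. \<bar>c p\<bar>)" for p
    using member_le_sum[of p UNIV "\<lambda>p. \<bar>c p\<bar>"] by simp
  then have "P p (\<Sum>p\<in>UNIV. \<bar>c p\<bar>)" for p using assms(2)[OF c] by blast
  then show ?thesis by (intro exI[of _ "\<Sum>p\<in>UNIV. \<bar>c p\<bar>"]) (auto intro: sum_nonneg)
qed

lemma third_derivative_uniform_bound:
  obtains C where "C \<ge> 0" "\<And>j l m a b g S S' z. continuous_on (cbox a b) g \<Longrightarrow> 0 < S \<Longrightarrow> S \<le> S' \<Longrightarrow> fst z \<le> S / 2 \<Longrightarrow>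
    \<bar>Ds [ex j, ex l, ex m] (potential a b g S S') z\<bar>
      \<le> C * S powr (- (real CARD('n) + 2) / 4) * Lp_norm 2 (on_box a b g :: real^'n \<Rightarrow> real)"
proof -
  define Q where "Q j l m C \<longleftrightarrow> 0 \<le> C \<and> (\<forall>a b g S S' z. continuous_on (cbox a b) g \<longrightarrow> 0 < S \<longrightarrow> S \<le> S' \<longrightarrow> fst z \<le> S / 2 \<longrightarrow>
    \<bar>Ds [ex j, ex l, ex m] (potential a b g S S') z\<bar>
      \<le> C * S powr (- (real CARD('n) + 2) / 4) * Lp_norm 2 (on_box a b g :: real^'n \<Rightarrow> real))" for j l m :: 'n and C
  have "\<exists>C. Q j l m C" for j l m
  proof -
    have "set [ex j, ex l, ex m] \<subseteq> Basis" "\<And>v. v \<in> set [ex j, ex l, ex m] \<Longrightarrow> fst v = 0" "length [ex j, ex l, ex m] = 3"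
      by auto
    from potential_third_derivative_bound[OF this] show ?thesis unfolding Q_def by (simp del: Ds.simps)
  qed
  then have "\<forall>p. \<exists>C. Q (fst p) (fst (snd p)) (snd (snd p)) C" by blast
  from choice[OF this] obtain c where c: "\<forall>p. Q (fst p) (fst (snd p)) (snd (snd p)) (c p)" ..
  define C where "C j l m = c (j, l, m)" for j l m
  have Q: "Q j l m (C j l m)" for j l m using c[rule_format, of "(j, l, m)"] by (simp add: C_def)
  have C1: "0 \<le> C j l m" for j l m using Q[of j l m] by (simp add: Q_def)
  let ?C = "\<Sum>j\<in>UNIV. \<Sum>l\<in>UNIV. \<Sum>m\<in>UNIV. C j l m"
  have le: "C j l m \<le> ?C" for j l m
  proof -
    have "C j l m \<le> (\<Sum>m\<in>UNIV. C j l m)" by (rule member_le_sum) (use C1 in auto)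
    also have "\<dots> \<le> (\<Sum>l\<in>UNIV. \<Sum>m\<in>UNIV. C j l m)" by (rule member_le_sum[of l UNIV "\<lambda>l. \<Sum>m\<in>UNIV. C j l m"]) (use C1 in \<open>auto intro!: sum_nonneg\<close>)
    also have "\<dots> \<le> ?C" by (rule member_le_sum[of j UNIV "\<lambda>j. \<Sum>l\<in>UNIV. \<Sum>m\<in>UNIV. C j l m"]) (use C1 in \<open>auto intro!: sum_nonneg\<close>)
    finally show ?thesis .
  qed
  show thesis
  proof (rule that[of ?C])
    show "0 \<le> ?C" by (intro sum_nonneg C1)
    fix j l m :: 'n and a b :: "real^'n" and g :: "real^'n \<Rightarrow> real" and S S' :: real and z :: "real \<times> (real^'n)"
    assume h: "continuous_on (cbox a b) g" "0 < S" "S \<le> S'" "fst z \<le> S / 2"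
    have "\<bar>Ds [ex j, ex l, ex m] (potential a b g S S') z\<bar> \<le> C j l m * S powr (- (real CARD('n) + 2) / 4) * Lp_norm 2 (on_box a b g)"
      by (rule Q[of j l m, unfolded Q_def, THEN conjunct2, rule_format, OF h])
    also have "C j l m * S powr (- (real CARD('n) + 2) / 4) * Lp_norm 2 (on_box a b g) \<le> ?C * S powr (- (real CARD('n) + 2) / 4) * Lp_norm 2 (on_box a b g)"
      by (intro mult_right_mono le) (auto simp: Lp2_norm_nonneg)
    finally show "\<bar>Ds [ex j, ex l, ex m] (potential a b g S S') z\<bar> \<le> ?C * S powr (- (real CARD('n) + 2) / 4) * Lp_norm 2 (on_box a b g)" .
  qed
qed

text \<open>
  The solenoidal test field involves two derivatives of \<open>Y\<close> and the convection term one more.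
\<close>
lemma solenoidal_gradient_bound:
  fixes Y :: "real \<times> (real^'n) \<Rightarrow> real"
  assumes Y: "smooth_cc Y" and D: "\<And>j l m. \<bar>Ds [ex j, ex l, ex m] Y z\<bar> \<le> D"
  shows "(\<Sum>j\<in>UNIV. norm (vfield (\<lambda>k. dx j (solenoidal_part i Y k)) z)) \<le> 2 * real CARD('n) ^ 3 * D"
proof -
  have D0: "0 \<le> D" using D[of undefined undefined undefined] by linarith
  have c: "\<bar>dx j (solenoidal_part i Y k) z\<bar> \<le> 2 * real CARD('n) * D" for j k
  proof -
    have l: "dx j (laplacian_x Y) z = (\<Sum>l\<in>UNIV. Ds [ex l, ex l, ex j] Y z)"
      unfolding laplacian_x_def[abs_def] using Y by (simp add: dx_sum smooth_cc_dx) (simp add: dx_def)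
    have "dx j (\<lambda>z. if k = i then laplacian_x Y z else 0) z = (if k = i then dx j (laplacian_x Y) z else 0)"
      by (cases "k = i") (simp_all add: dx_zero)
    then have "dx j (solenoidal_part i Y k) z = (if k = i then dx j (laplacian_x Y) z else 0) - Ds [ex i, ex k, ex j] Y z"
      unfolding solenoidal_part_def using Y by (simp only: dx_diff smooth_cc_if smooth_cc_laplacian smooth_cc_dx) (simp add: dx_def)
    moreover have "\<bar>if k = i then dx j (laplacian_x Y) z else 0\<bar> \<le> real CARD('n) * D"
    proof -
      have "\<bar>\<Sum>l\<in>(UNIV::'n set). Ds [ex l, ex l, ex j] Y z\<bar> \<le> (\<Sum>l\<in>(UNIV::'n set). D)"
        by (intro order_trans[OF sum_abs] sum_mono D)
      then show ?thesis unfolding l using D0 by simp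
    qed
    moreover have "D \<le> real CARD('n) * D" using D0 by (simp add: mult_le_cancel_right1 Suc_leI)
    ultimately show ?thesis using D[of i k j] by (simp del: Ds.simps)
  qed
  have "norm (vfield (\<lambda>k. dx j (solenoidal_part i Y k)) z) \<le> real CARD('n) * (2 * real CARD('n) * D)" for j
  proof -
    have "norm (vfield (\<lambda>k. dx j (solenoidal_part i Y k)) z) \<le> (\<Sum>k\<in>UNIV. \<bar>vfield (\<lambda>k. dx j (solenoidal_part i Y k)) z $ k\<bar>)"
      by (rule norm_le_l1_cart)
    also have "\<dots> \<le> (\<Sum>k\<in>(UNIV::'n set). 2 * real CARD('n) * D)" by (intro sum_mono) (simp add: c)
    finally show ?thesis by simp
  qed
  then have "(\<Sum>j\<in>UNIV. norm (vfield (\<lambda>k. dx j (solenoidal_part i Y k)) z)) \<le> (\<Sum>j\<in>(UNIV::'n set). real CARD('n) * (2 * real CARD('n) * D))"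
    by (intro sum_mono)
  also have "\<dots> = 2 * real CARD('n) ^ 3 * D" by (simp add: power3_eq_cube)
  finally show ?thesis .
qed

section \<open>Decay of the Stokes flow\<close>

lemma component_pairing_diff:
  fixes w :: "real \<Rightarrow> real^'n \<Rightarrow> real^'n"
  assumes w: "weakly_continuous w" and F: "smooth_cc F" and G: "smooth_cc G"
  shows "(LINT t|time. LINT x|lebesgue. w t x $ i * (F (t, x) - G (t, x)))
    = (LINT t|time. LINT x|lebesgue. w t x $ i * F (t, x)) - (LINT t|time. LINT x|lebesgue. w t x $ i * G (t, x))"
proof -
  have "(LINT t|time. LINT x|lebesgue. w t x $ i * (F (t, x) - G (t, x)))
      = (LINT t|time. (LINT x|lebesgue. w t x $ i * F (t, x)) - (LINT x|lebesgue. w t x $ i * G (t, x)))"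
  proof (rule Bochner_Integration.integral_cong)
    fix t assume "t \<in> space time"
    then have "in_Lp 2 (w t)" using w by (simp add: weakly_continuous_def)
    from component_integrable(1)[OF this smooth_cc_slice[OF F]] component_integrable(1)[OF this smooth_cc_slice[OF G]]
    show "(LINT x|lebesgue. w t x $ i * (F (t, x) - G (t, x)))
        = (LINT x|lebesgue. w t x $ i * F (t, x)) - (LINT x|lebesgue. w t x $ i * G (t, x))"
      by (simp add: right_diff_distrib)
  qed simp
  also have "\<dots> = (LINT t|time. LINT x|lebesgue. w t x $ i * F (t, x)) - (LINT t|time. LINT x|lebesgue. w t x $ i * G (t, x))"
    by (intro Bochner_Integration.integral_diff component_pairing_integrable w F G)
  finally show ?thesis .
qed

lemma weighted_backward_smooth:
  fixes a b :: "real^'n"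
  assumes g: "continuous_on (cbox a b) g" and s: "smooth_step l r \<sigma> \<rho>" and r: "r < S"
  shows "smooth_cc (\<lambda>z. cutoff k z * (\<rho> (fst z) * backward a b g S z))"
proof -
  obtain \<rho>' where \<rho>: "tame UNIV (\<lambda>_ _. 1) (\<lambda>_. \<rho>)" "\<And>t. (\<rho> has_real_derivative \<rho>' t) (at t)"
    using smooth_step_density[OF s] by blast
  have c: "(r + S) / 2 < S" using r by simp
  obtain \<kappa> where \<kappa>: "\<kappa> > 0" "tame {z. l - 1 < fst z \<and> fst z < (r + S) / 2} (\<lambda>_ z. exp (- (\<kappa> * (norm (snd z))\<^sup>2))) (\<lambda>_. backward a b g S)"
    using tame_backward[OF g c] by blast
  interpret L: localized "backward a b g S" \<rho> \<rho>' "l - 1" l r "(r + S) / 2" \<kappa>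
  proof (unfold_locales, fact \<kappa>(2), fact \<kappa>(1))
    show "dderiv et (backward a b g S) z + (\<Sum>e\<in>Basis. dderiv (0, e) (dderiv (0, e) (backward a b g S)) z) = 0"
      if "fst z < (r + S) / 2" for z
      by (rule backward_heat_equation[OF g]) (use that c in linarith)
  qed (use \<rho> smooth_stepD(5)[OF s] r in auto)
  show ?thesis using L.smooth_cc_Y[of k] unfolding L.Y_def[abs_def] L.Z_def .
qed

lemma cutoff_slice_measurable: "(\<lambda>x. cutoff k (t, x :: 'b::euclidean_space)) \<in> borel_measurable lebesgue"
proof -
  have cc: "continuous_on UNIV (cutoff k :: real \<times> 'b \<Rightarrow> real)"
    by (rule tame_continuous[OF tame_family_member[OF tame_cutoff]])
  have "continuous_on UNIV (\<lambda>x. cutoff k (t, x :: 'b))"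
    by (intro continuous_on_compose2[OF cc] continuous_intros) auto
  from borel_measurable_continuous_onI[OF this] show ?thesis by (simp add: measurable_completion)
qed

lemma cutoff_slice_L2:
  fixes F :: "'b::euclidean_space \<Rightarrow> real"
  assumes F: "in_Lp 2 F"
  shows "in_Lp 2 (\<lambda>x. cutoff k (t, x) * (c * F x))" "Lp_norm 2 (\<lambda>x. cutoff k (t, x) * (c * F x)) \<le> \<bar>c\<bar> * Lp_norm 2 F"
proof -
  have m: "(\<lambda>x. cutoff k (t, x) * (c * F x)) \<in> borel_measurable lebesgue"
    by (intro borel_measurable_times cutoff_slice_measurable borel_measurable_const in_Lp2_measurable F)
  have b: "norm (cutoff k (t, x) * (c * F x)) \<le> \<bar>c\<bar> * norm (F x)" for x
  proof -
    have "\<bar>cutoff k (t, x)\<bar> * \<bar>c * F x\<bar> \<le> 1 * \<bar>c * F x\<bar>"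
      using cutoff_nonneg[of k "(t, x)"] cutoff_le_1[of k "(t, x)"] by (intro mult_right_mono) auto
    then show ?thesis by (simp add: abs_mult)
  qed
  show "in_Lp 2 (\<lambda>x. cutoff k (t, x) * (c * F x))" "Lp_norm 2 (\<lambda>x. cutoff k (t, x) * (c * F x)) \<le> \<bar>c\<bar> * Lp_norm 2 F"
    using in_Lp2_bounded_by[OF F m b] by auto
qed

lemma weighted_pairing_bound:
  fixes w :: "real^'n \<Rightarrow> real^'n"
  assumes w: "in_Lp 2 w" and F: "in_Lp 2 F" and M: "Lp_norm 2 w \<le> M" and N: "Lp_norm 2 F \<le> N"
  shows "\<bar>LINT x|lebesgue. w x $ i * (cutoff k (t, x) * (c * F x))\<bar> \<le> \<bar>c\<bar> * (M * N)"
proof -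
  have M0: "0 \<le> M" using M Lp2_norm_nonneg order_trans by blast
  have "\<bar>LINT x|lebesgue. w x $ i * (cutoff k (t, x) * (c * F x))\<bar> \<le> Lp_norm 2 w * Lp_norm 2 (\<lambda>x. cutoff k (t, x) * (c * F x))"
    by (rule component_integrable(2)[OF w cutoff_slice_L2(1)[OF F]])
  also have "\<dots> \<le> M * (\<bar>c\<bar> * N)"
  proof (intro mult_mono M M0 Lp2_norm_nonneg)
    show "Lp_norm 2 (\<lambda>x. cutoff k (t, x) * (c * F x)) \<le> \<bar>c\<bar> * N"
      using cutoff_slice_L2(2)[OF F, of k t c] mult_left_mono[OF N, of "\<bar>c\<bar>"] by linarith
  qed
  finally show ?thesis by (simp add: mult_ac)
qed

context localized
begin

lemma third_spatial_Y_bound: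
  assumes \<eta>1: "\<And>t. \<bar>\<eta> t\<bar> \<le> 1"
  shows "\<exists>C\<ge>0. \<forall>j l m k z. z \<in> U \<longrightarrow> \<bar>Ds [ex j, ex l, ex m] (Y k) z\<bar> \<le> \<bar>Ds [ex j, ex l, ex m] W z\<bar> + C * (1 / real (Suc k))"
proof -
  define P where "P p C \<longleftrightarrow> (\<forall>k. \<forall>z\<in>U. \<bar>Ds [ex (fst p), ex (fst (snd p)), ex (snd (snd p))] (Y k) z\<bar>
      \<le> \<bar>Ds [ex (fst p), ex (fst (snd p)), ex (snd (snd p))] W z\<bar> + C * (1 / real (Suc k)))" for p :: "'n \<times> 'n \<times> 'n" and C
  have "\<exists>C. P p C" for p unfolding P_def by (rule spatial_Y_bound) (use \<eta>1 in auto)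
  moreover have "P p C'" if "P p C" "C \<le> C'" for p C C'
    unfolding P_def
  proof (intro allI ballI)
    fix k z assume "z \<in> U"
    then have "\<bar>Ds [ex (fst p), ex (fst (snd p)), ex (snd (snd p))] (Y k) z\<bar>
      \<le> \<bar>Ds [ex (fst p), ex (fst (snd p)), ex (snd (snd p))] W z\<bar> + C * (1 / real (Suc k))"
      using that(1) unfolding P_def by blast
    moreover have "C * (1 / real (Suc k)) \<le> C' * (1 / real (Suc k))" by (intro mult_right_mono that(2)) simp
    ultimately show "\<bar>Ds [ex (fst p), ex (fst (snd p)), ex (snd (snd p))] (Y k) z\<bar>
      \<le> \<bar>Ds [ex (fst p), ex (fst (snd p)), ex (snd (snd p))] W z\<bar> + C' * (1 / real (Suc k))" by linarith
  qed
  ultimately obtain C where C: "C \<ge> 0" "\<And>p. P p C" using uniform_over_finite[of P] by blast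
  have "\<bar>Ds [ex j, ex l, ex m] (Y k) z\<bar> \<le> \<bar>Ds [ex j, ex l, ex m] W z\<bar> + C * (1 / real (Suc k))" if "z \<in> U" for j l m k z
    by (rule C(2)[of "(j, l, m)", unfolded P_def fst_conv snd_conv, rule_format, OF that])
  then show ?thesis using C(1) by (intro exI[of _ C] conjI allI impI)
qed

end

locale two_flows =
  fixes u v f :: "real \<Rightarrow> real^'n \<Rightarrow> real^'n" and u0 :: "real^'n \<Rightarrow> real^'n" and \<alpha> Cu Cf :: real
  assumes n: "2 \<le> CARD('n)" and \<alpha>: "0 < \<alpha>" and Cu: "0 \<le> Cu" and Cf: "0 \<le> Cf"
    and u: "weakly_continuous u" "\<And>t. t \<ge> 0 \<Longrightarrow> u t \<in> L2_sigma"
    and v: "weakly_continuous v" "\<And>t. t \<ge> 0 \<Longrightarrow> v t \<in> L2_sigma"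
    and v_cont: "\<And>t. t \<ge> 0 \<Longrightarrow> ((\<lambda>s. Lp_norm 2 (\<lambda>x. v s x - v t x)) \<longlongrightarrow> 0) (at t within {0..})"
    and f: "strongly_measurable_L2 f"
    and f_decay: "\<And>t. t > 0 \<Longrightarrow> in_Lp 2 (f t) \<and> Lp_norm 2 (f t) \<le> Cf * (1 + t) powr (- \<alpha> - 1)"
    and nse: "navier_stokes_weak u0 f u" and st: "\<And>\<phi>. test_function \<phi> \<Longrightarrow> stokes_form u0 f v \<phi> = 0"
    and u_decay: "\<And>t. t \<ge> 0 \<Longrightarrow> Lp_norm 2 (u t) \<le> Cu * (1 + t) powr (- \<alpha>)"
begin

definition w :: "real \<Rightarrow> real^'n \<Rightarrow> real^'n" where "w t x = v t x - u t x"

lemma w: "weakly_continuous w" using weakly_continuous_diff[OF u(1) v(1)] by (simp add: w_def[abs_def])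

lemma L2: "t \<ge> 0 \<Longrightarrow> in_Lp 2 (u t)" "t \<ge> 0 \<Longrightarrow> in_Lp 2 (v t)" "t \<ge> 0 \<Longrightarrow> in_Lp 2 (w t)"
  using u(1) v(1) w by (simp_all add: weakly_continuous_def)

lemma f_bounded: "t > 0 \<Longrightarrow> in_Lp 2 (f t) \<and> Lp_norm 2 (f t) \<le> Cf"
proof -
  assume t: "t > 0"
  have "Cf * (1 + t) powr (- \<alpha> - 1) \<le> Cf * 1"
    using t \<alpha> powr_mono[of "- \<alpha> - 1" 0 "1 + t"] by (intro mult_left_mono Cf) auto
  then show ?thesis using f_decay[OF t] by simp
qed

text \<open>
  A bound for \<open>\<integral>\<^sub>0\<^sup>S\<^sup>/\<^sup>2 \<parallel>u\<parallel>\<^sup>2 dt\<close> up to the factor \<open>Cu\<^sup>2\<close>.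
\<close>
definition kinetic :: "real \<Rightarrow> real" where
  "kinetic S = (LINT t|time. indicator {0..S / 2} t * (1 + t) powr (- 2 * \<alpha>))"

lemma kinetic_integrable: "integrable time (\<lambda>t. indicator {0..S / 2} t * (1 + t) powr (- 2 * \<alpha>))"
proof (rule time_integrable[where T="S / 2" and B=1])
  have "(\<lambda>t. (1 + t) powr (- 2 * \<alpha>)) \<in> borel_measurable time"
    by (rule time_measurable_continuous) (auto intro!: continuous_intros)
  moreover have "(\<lambda>t. indicator {0..S / 2} t :: real) \<in> borel_measurable time"
    by (rule measurable_restrict_space1[OF borel_measurable_indicator]) simp
  ultimately show "(\<lambda>t. indicator {0..S / 2} t * (1 + t) powr (- 2 * \<alpha>)) \<in> borel_measurable time" by measurable
  show "\<bar>indicator {0..S / 2} t * (1 + t) powr (- 2 * \<alpha>)\<bar> \<le> 1" if "0 < t" for t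
    using that \<alpha> powr_mono[of "- 2 * \<alpha>" 0 "1 + t"] by (auto simp: indicator_def)
qed auto

lemma kinetic_nonneg: "0 \<le> kinetic S" unfolding kinetic_def by simp

text \<open>
  The difference \<open>w\<close> of the flows, averaged over times between \<open>S/4\<close> and \<open>S/2\<close> against the backward
  heat evolution from time \<open>S\<close>.  The test function of the difference is \<open>Y = (\<sigma>0 - \<sigma>) X\<close> with the
  potential \<open>X\<close>: its time cutoff equals \<open>1\<close> on \<open>[-1, S/4]\<close>, so that at positive times only the switching
  off by \<open>\<sigma>\<close> is seen, and, up to the errors of the cutoff in space,
  \<open>\<Delta>(\<partial>\<^sub>t + \<Delta>)Y = - \<rho> \<Delta>X = \<rho> E - \<rho> E'\<close> with the backward evolutions \<open>E\<close>
  and \<open>E'\<close> from the times \<open>S\<close> and \<open>S'\<close>.  The first term is the one to be estimated, the second is small for large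
  \<open>S'\<close>, and the right-hand side of the tested equation is at most \<open>\<integral> \<parallel>u\<parallel>\<^sup>2 sup |D\<^sup>3Y| dt\<close>.
\<close>
lemma difference_estimate:
  obtains K where "K \<ge> 0" "\<And>a b g S \<sigma> \<rho> i \<epsilon>. continuous_on (cbox a b) g \<Longrightarrow> 1 \<le> S \<Longrightarrow> smooth_step (S / 4) (S / 2) \<sigma> \<rho> \<Longrightarrow> 0 < \<epsilon> \<Longrightarrow>
    \<exists>k0. \<forall>k\<ge>k0. \<bar>LINT t|time. LINT x|lebesgue. w t x $ i * (cutoff k (t, x) * (\<rho> t * backward a b g S (t, x)))\<bar>
      \<le> K * S powr (- (real CARD('n) + 2) / 4) * kinetic S * Lp_norm 2 (on_box a b g) + \<epsilon>"
proof -
  let ?\<beta> = "(real CARD('n) + 2) / 4"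
  obtain C3 where C3: "C3 \<ge> 0" "\<And>j l m a b g S S' z. continuous_on (cbox a b) g \<Longrightarrow> 0 < S \<Longrightarrow> S \<le> S' \<Longrightarrow> fst z \<le> S / 2 \<Longrightarrow>
    \<bar>Ds [ex j, ex l, ex m] (potential a b g S S') z\<bar>
      \<le> C3 * S powr (- (real CARD('n) + 2) / 4) * Lp_norm 2 (on_box a b g :: real^'n \<Rightarrow> real)"
    by (rule third_derivative_uniform_bound) blast
  let ?n3 = "2 * real CARD('n) ^ 3"
  let ?K = "?n3 * C3 * Cu\<^sup>2"
  have "\<exists>k0. \<forall>k\<ge>k0. \<bar>LINT t|time. LINT x|lebesgue. w t x $ i * (cutoff k (t, x) * (\<rho> t * backward a b g S (t, x)))\<bar>
      \<le> ?K * S powr (- (real CARD('n) + 2) / 4) * kinetic S * Lp_norm 2 (on_box a b g) + \<epsilon>"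
    if g: "continuous_on (cbox a b) g" and S: "1 \<le> S" and \<rho>: "smooth_step (S / 4) (S / 2) \<sigma> \<rho>" and \<epsilon>: "0 < \<epsilon>"
    for a b :: "real^'n" and g S \<sigma> \<rho> i \<epsilon>
  proof -
    let ?N = "Lp_norm 2 (on_box a b g)" and ?Q = "\<integral>y. \<bar>on_box a b g y\<bar> \<partial>lborel"
    have Q0: "0 \<le> ?Q" by simp
    have N0: "0 \<le> ?N" by (rule Lp2_norm_nonneg)
    obtain Mw where Mw: "\<And>t. t \<in> {0..S} \<Longrightarrow> Lp_norm 2 (w t) \<le> Mw" using w unfolding weakly_continuous_def by blast
    have Mw0: "0 \<le> Mw" using order_trans[OF Lp2_norm_nonneg Mw[of 0]] S by simp
    \<comment> \<open>The final time \<open>S'\<close> is so late that the evolution from there is smaller than \<open>\<epsilon> / 3\<close> against \<open>w\<close>.\<close>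
    define X where "X = 3 * Mw * ?Q / \<epsilon> + 1"
    have X: "1 \<le> X" "Mw * (?Q / X) \<le> \<epsilon> / 3"
    proof -
      show 1: "1 \<le> X" using Mw0 Q0 \<epsilon> by (simp add: X_def)
      have "3 * Mw * ?Q = (X - 1) * \<epsilon>" using \<epsilon> by (simp add: X_def)
      also have "\<dots> \<le> X * \<epsilon>" using \<epsilon> by (simp add: algebra_simps)
      finally show "Mw * (?Q / X) \<le> \<epsilon> / 3" using 1 by (simp add: field_simps)
    qed
    define S' where "S' = S + X\<^sup>2"
    have S': "S \<le> S'" "1 \<le> X\<^sup>2" using X(1) by (simp_all add: S'_def one_le_power)
    define \<zeta> where "\<zeta> k z = cutoff k z * (\<rho> (fst z) * backward a b g S z)" for k z
    define \<zeta>' where "\<zeta>' k z = cutoff k z * (\<rho> (fst z) * backward a b g S' z)" for k z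
    have cc\<zeta>: "smooth_cc (\<zeta> k)" "smooth_cc (\<zeta>' k)" for k
      unfolding \<zeta>_def[abs_def] \<zeta>'_def[abs_def] using S S' by (auto intro!: weighted_backward_smooth[OF g \<rho>])
    \<comment> \<open>The time cutoff must have compact support; switching on at negative times has no effect on the equation.\<close>
    obtain \<sigma>0 \<rho>0 where \<rho>0: "smooth_step (- 2) (- 1) \<sigma>0 \<rho>0" using smooth_step_exists[of "- 2" "- 1"] by auto
    have c: "3 * S / 4 < S" using S by simp
    obtain \<kappa> where \<kappa>: "\<kappa> > 0" "tame {z. - 3 < fst z \<and> fst z < 3 * S / 4} (\<lambda>_ z. exp (- (\<kappa> * (norm (snd z))\<^sup>2))) (\<lambda>_. potential a b g S S')"
      using tame_potential[OF g c] by blast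
    let ?\<eta> = "\<lambda>t. \<sigma>0 t - \<sigma> t" and ?\<eta>' = "\<lambda>t. \<rho>0 t - \<rho> t"
    interpret L: localized "potential a b g S S'" ?\<eta> ?\<eta>' "- 3" "- 2" "S / 2" "3 * S / 4" \<kappa>
    proof (unfold_locales, fact \<kappa>(2), fact \<kappa>(1))
      show "dderiv et (potential a b g S S') z + (\<Sum>e\<in>Basis. dderiv (0, e) (dderiv (0, e) (potential a b g S S')) z) = 0"
        if "fst z < 3 * S / 4" for z
        by (rule potential_heat_equation[OF g]) (use that c in linarith)
      show "tame UNIV (\<lambda>_ _. 1) (\<lambda>_ t. \<sigma>0 t - \<sigma> t)"
        by (intro tame_diff open_UNIV smooth_stepD(2)[OF \<rho>0] smooth_stepD(2)[OF \<rho>])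
      show "((\<lambda>t. \<sigma>0 t - \<sigma> t) has_real_derivative \<rho>0 t - \<rho> t) (at t)" for t
        by (intro DERIV_diff smooth_stepD(3)[OF \<rho>0] smooth_stepD(3)[OF \<rho>])
      show "\<sigma>0 t - \<sigma> t = 0" if "t \<le> - 2 \<or> S / 2 \<le> t" for t
        using that S smooth_stepD(7)[OF \<rho>0, of t] smooth_stepD(8)[OF \<rho>0, of t] smooth_stepD(7)[OF \<rho>, of t] smooth_stepD(8)[OF \<rho>, of t]
        by auto
    qed (use S in auto)
    have \<eta>1: "\<bar>\<sigma>0 t - \<sigma> t\<bar> \<le> 1" for t
      using smooth_stepD(9,10)[OF \<rho>0, of t] smooth_stepD(9,10)[OF \<rho>, of t] by linarith
    define A where "A F = (LINT t|time. LINT x|lebesgue. w t x $ i * F (t, x))" for F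
    define lap where "lap k = laplacian_x (heat_op (L.Y k))" for k
    have cclap: "smooth_cc (lap k)" for k unfolding lap_def by (intro smooth_cc_laplacian smooth_cc_heat_op L.smooth_cc_Y)
    define e where "e k z = lap k z - (\<zeta> k z - \<zeta>' k z)" for k z
    have cce: "smooth_cc (e k)" for k unfolding e_def[abs_def] by (intro smooth_cc_diff cclap cc\<zeta>)
    have Ae: "A (e k) = A (lap k) - (A (\<zeta> k) - A (\<zeta>' k))" for k
      unfolding A_def e_def component_pairing_diff[OF w cclap smooth_cc_diff[OF cc\<zeta>]] component_pairing_diff[OF w cc\<zeta>] ..
    obtain C where C: "\<And>k z. \<bar>laplacian_x (heat_op (L.Y k)) z - cutoff k z * (?\<eta>' (fst z) * laplacian_x (potential a b g S S') z)\<bar>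
        \<le> C * (1 / real (Suc k) * L.H z)"
      using L.laplacian_heat_op_Y_error by blast
    have main: "cutoff k (t, x) * (?\<eta>' t * laplacian_x (potential a b g S S') (t, x)) = \<zeta> k (t, x) - \<zeta>' k (t, x)" if "0 < t" for k t x
    proof -
      have r0: "\<rho>0 t = 0" using smooth_stepD(5)[OF \<rho>0, of t] that by simp
      show ?thesis
      proof (cases "t < S")
        case True
        have "laplacian_x (potential a b g S S') (t, x) = backward a b g S' (t, x) - backward a b g S (t, x)"
          using laplacian_potential[OF g, of "(t, x)" S S'] True S' by (simp add: laplacian_eq_Basis)
        show ?thesis unfolding \<zeta>_def \<zeta>'_def \<open>laplacian_x _ _ = _\<close> using r0 by (simp add: algebra_simps)
      next
        case False
        then have "\<rho> t = 0" using smooth_stepD(5)[OF \<rho>, of t] S by simp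
        then show ?thesis using r0 by (simp add: \<zeta>_def \<zeta>'_def)
      qed
    qed
    have eb: "\<bar>e k (t, x)\<bar> \<le> C * (1 / real (Suc k) * exp (- (\<kappa> * (norm x)\<^sup>2)))" if "0 < t" for k t x
      using C[of k "(t, x)"] main[OF that, of k x] by (simp add: e_def lap_def L.H_def)
    have eoff: "e k (t, x) = 0" if "S / 2 < t" for k t x
    proof -
      have "\<rho> t = 0" using smooth_stepD(5)[OF \<rho>, of t] that by simp
      moreover have "lap k (t, x) = 0" unfolding lap_def by (rule L.laplacian_heat_op_Y_off) (use that in auto)
      ultimately show ?thesis by (simp add: e_def \<zeta>_def \<zeta>'_def)
    qed
    have Ae0: "(\<lambda>k. A (e k)) \<longlonglongrightarrow> 0"
      unfolding A_def by (rule pairing_error_bound[where T="S / 2", OF w _ \<kappa>(1) cce eb eoff]) (use S in auto)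
    have A\<zeta>': "\<bar>A (\<zeta>' k)\<bar> \<le> \<epsilon> / 3" for k
    proof -
      have "\<bar>A (\<zeta>' k)\<bar> \<le> Mw * (?Q / X)"
        unfolding A_def
      proof (rule time_weighted_bound[OF \<rho>])
        fix t :: real assume t: "0 < t"
        show "\<bar>LINT x|lebesgue. w t x $ i * \<zeta>' k (t, x)\<bar> \<le> \<rho> t * (Mw * (?Q / X))"
        proof (cases "t < S / 2")
          case True
          have tS': "t < S'" "X\<^sup>2 \<le> S' - t" using True S' S by (auto simp: S'_def)
          \<comment> \<open>The power \<open>- n/2\<close> is at most \<open>- 1\<close>, which gives decay like \<open>1/X\<close> of the \<open>L\<^sup>2\<close> norm.\<close>
          have "(4 * pi * (S' - t)) powr (- (real CARD('n) / 2)) \<le> (4 * pi * (S' - t)) powr (- 1)"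
          proof (rule powr_mono)
            show "1 \<le> 4 * pi * (S' - t)" using mult_mono[of 1 "4 * pi" 1 "S' - t"] tS' S' pi_gt3 by simp
          qed (use n in auto)
          also have "\<dots> = 1 / (4 * pi * (S' - t))" using tS' by (simp add: powr_minus_divide)
          also have "\<dots> \<le> 1 / X\<^sup>2"
            using mult_mono[of 1 "4 * pi" "X\<^sup>2" "S' - t"] tS' S' pi_gt3
            by (intro frac_le) auto
          finally have p: "(4 * pi * (S' - t)) powr (- (real CARD('n) / 2)) \<le> 1 / X\<^sup>2" .
          have "(Lp_norm 2 (\<lambda>x. backward a b g S' (t, x)))\<^sup>2 \<le> (4 * pi * (S' - t)) powr (- (real CARD('n) / 2)) * ?Q\<^sup>2"
            using backward_L2(3)[OF g tS'(1)] by simp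
          also have "\<dots> \<le> 1 / X\<^sup>2 * ?Q\<^sup>2" by (intro mult_right_mono p) simp
          finally have "(Lp_norm 2 (\<lambda>x. backward a b g S' (t, x)))\<^sup>2 \<le> (?Q / X)\<^sup>2" by (simp add: power_divide)
          then have E: "Lp_norm 2 (\<lambda>x. backward a b g S' (t, x)) \<le> ?Q / X"
            by (rule power2_le_imp_le) (use Q0 X in auto)
          have wt: "Lp_norm 2 (w t) \<le> Mw" using Mw[of t] t True by simp
          have "0 \<le> \<rho> t" by (rule smooth_stepD(4)[OF \<rho>])
          then show ?thesis unfolding \<zeta>'_def
            using weighted_pairing_bound[OF L2(3) backward_L2(1)[OF g tS'(1)] wt E, of i k t "\<rho> t"] t by simp
        next
          case False
          then have "\<rho> t = 0" using smooth_stepD(5)[OF \<rho>, of t] by simp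
          then show ?thesis by (simp add: \<zeta>'_def)
        qed
      qed (use S in auto)
      then show ?thesis using X(2) by linarith
    qed
    obtain C4 where C4: "C4 \<ge> 0" "\<And>j l m k z. z \<in> L.U \<Longrightarrow>
        \<bar>Ds [ex j, ex l, ex m] (L.Y k) z\<bar> \<le> \<bar>Ds [ex j, ex l, ex m] (potential a b g S S') z\<bar> + C4 * (1 / real (Suc k))"
      using L.third_spatial_Y_bound[OF \<eta>1] by blast
    let ?D = "\<lambda>k. C3 * S powr (- (real CARD('n) + 2) / 4) * ?N + C4 * (1 / real (Suc k))"
    have D0: "0 \<le> ?D k" for k using C3(1) C4(1) N0 by simp
    have Alap: "\<bar>A (lap k)\<bar> \<le> kinetic S * (Cu\<^sup>2 * (?n3 * ?D k))" for k
    proof -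
      let ?b = "\<lambda>j. vfield (\<lambda>m. dx j (solenoidal_part i (L.Y k) m))"
      have ccb: "cc_field (?b j)" for j by (intro cc_field_vfield smooth_cc_dx smooth_cc_solenoidal_part L.smooth_cc_Y)
      have id: "A (lap k) = (LINT t|time. LINT x|lebesgue. convection (\<lambda>j. ?b j (t, x)) (u t x))"
        using difference_tested[OF u v f f_bounded nse st L.smooth_cc_Y[of k], of i]
        unfolding A_def lap_def w_def by simp
      have "\<bar>LINT t|time. LINT x|lebesgue. convection (\<lambda>j. ?b j (t, x)) (u t x)\<bar>
          \<le> (LINT t|time. indicator {0..S / 2} t * (1 + t) powr (- 2 * \<alpha>) * (Cu\<^sup>2 * (?n3 * ?D k)))"
      proof (rule time_integral_bound)
        show "integrable time (\<lambda>t. indicator {0..S / 2} t * (1 + t) powr (- 2 * \<alpha>) * (Cu\<^sup>2 * (?n3 * ?D k)))"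
          by (intro integrable_mult_left kinetic_integrable)
        fix t :: real assume t: "0 < t"
        have ut: "in_Lp 2 (u t)" using L2(1) t by simp
        show "\<bar>LINT x|lebesgue. convection (\<lambda>j. ?b j (t, x)) (u t x)\<bar>
            \<le> indicator {0..S / 2} t * (1 + t) powr (- 2 * \<alpha>) * (Cu\<^sup>2 * (?n3 * ?D k))"
        proof (cases "t \<le> S / 2")
          case True
          have "\<bar>Ds [ex j, ex l, ex m] (L.Y k) (t, x)\<bar> \<le> ?D k" for j l m x
          proof -
            have "(t, x) \<in> L.U" using t True S by simp
            from C4(2)[OF this, of j l m k] C3(2)[OF g _ S'(1), of "(t, x)" j l m] S True
            show ?thesis by (simp del: Ds.simps)
          qed
          then have "(\<Sum>j\<in>UNIV. norm (?b j (t, x))) \<le> ?n3 * ?D k" for x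
            by (intro solenoidal_gradient_bound L.smooth_cc_Y)
          then have "\<bar>LINT x|lebesgue. convection (\<lambda>j. ?b j (t, x)) (u t x)\<bar> \<le> (Lp_norm 2 (u t))\<^sup>2 * (?n3 * ?D k)"
            by (intro convection_integrable(2)[OF ut ccb])
          also have "(Lp_norm 2 (u t))\<^sup>2 \<le> (Cu * (1 + t) powr (- \<alpha>))\<^sup>2"
            using u_decay[of t] t by (intro power_mono Lp2_norm_nonneg) auto
          also have "(Cu * (1 + t) powr (- \<alpha>))\<^sup>2 = (1 + t) powr (- 2 * \<alpha>) * Cu\<^sup>2"
            using t by (simp add: power_mult_distrib powr_power)
          finally have "\<bar>LINT x|lebesgue. convection (\<lambda>j. ?b j (t, x)) (u t x)\<bar> \<le> (1 + t) powr (- 2 * \<alpha>) * Cu\<^sup>2 * (?n3 * ?D k)"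
            using D0[of k] by (simp add: mult_right_mono)
          then show ?thesis using t True by (simp add: mult_ac)
        next
          case False
          have "\<bar>Ds [ex j, ex l, ex m] (L.Y k) (t, x)\<bar> \<le> 0" for j l m x
            using L.Ds_Y_off[of "(t, x)" "[ex j, ex l, ex m]" k] False by (simp del: Ds.simps)
          then have "(\<Sum>j\<in>UNIV. norm (?b j (t, x))) \<le> ?n3 * 0" for x
            by (intro solenoidal_gradient_bound L.smooth_cc_Y)
          then have "\<bar>LINT x|lebesgue. convection (\<lambda>j. ?b j (t, x)) (u t x)\<bar> \<le> (Lp_norm 2 (u t))\<^sup>2 * (?n3 * 0)"
            by (intro convection_integrable(2)[OF ut ccb])
          then show ?thesis using False by simp
        qed
      qed
      also have "\<dots> = kinetic S * (Cu\<^sup>2 * (?n3 * ?D k))" unfolding kinetic_def by simp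
      finally show ?thesis unfolding id .
    qed
    have "(\<lambda>k. kinetic S * (Cu\<^sup>2 * (?n3 * (C4 * (1 / real (Suc k)))))) \<longlonglongrightarrow> kinetic S * (Cu\<^sup>2 * (?n3 * (C4 * 0)))"
      by (intro tendsto_intros lim_1_over_n[THEN LIMSEQ_Suc])
    then have "(\<lambda>k. kinetic S * (Cu\<^sup>2 * (?n3 * (C4 * (1 / real (Suc k)))))) \<longlonglongrightarrow> 0" by simp
    then have "\<forall>\<^sub>F k in sequentially. kinetic S * (Cu\<^sup>2 * (?n3 * (C4 * (1 / real (Suc k))))) < \<epsilon> / 3"
      using \<epsilon> by (intro order_tendstoD(2)) auto
    moreover have "\<forall>\<^sub>F k in sequentially. \<bar>A (e k)\<bar> < \<epsilon> / 3"
      using tendstoD[OF Ae0, of "\<epsilon> / 3"] \<epsilon> by (simp add: dist_real_def)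
    ultimately have "\<forall>\<^sub>F k in sequentially. \<bar>A (\<zeta> k)\<bar> \<le> ?K * S powr (- (real CARD('n) + 2) / 4) * kinetic S * ?N + \<epsilon>"
    proof eventually_elim
      case (elim k)
      have "\<bar>A (\<zeta> k)\<bar> \<le> \<bar>A (lap k)\<bar> + \<bar>A (\<zeta>' k)\<bar> + \<bar>A (e k)\<bar>" using Ae[of k] by linarith
      also have "\<dots> \<le> kinetic S * (Cu\<^sup>2 * (?n3 * ?D k)) + \<epsilon> / 3 + \<epsilon> / 3"
        using Alap[of k] A\<zeta>'[of k] elim(2) by linarith
      also have "kinetic S * (Cu\<^sup>2 * (?n3 * ?D k)) = ?K * S powr (- (real CARD('n) + 2) / 4) * kinetic S * ?N
          + kinetic S * (Cu\<^sup>2 * (?n3 * (C4 * (1 / real (Suc k)))))"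
        by (simp only: distrib_left) (simp add: mult_ac)
      finally show ?case using elim(1) by linarith
    qed
    then show ?thesis unfolding eventually_sequentially A_def \<zeta>_def by simp
  qed
  then show thesis using that[of ?K] C3(1) by simp
qed

text \<open>
  The Stokes equation is tested with the backward heat evolution \<open>E\<close> from time \<open>S\<close>, switched on around
  \<open>[S/4, S/2]\<close> and off around \<open>[S - 2\<delta>, S - \<delta>]\<close>.  So the average of \<open>\<langle>v\<^sub>i, E\<rangle>\<close> over the late times
  is the average over the early ones plus the work of the force in between.  At the early times
  \<open>v = u + w\<close>.  Some late time does not exceed the average.
\<close>
lemma late_time_estimate:
  obtains K where "K \<ge> 0" "\<And>a b g S i \<epsilon> \<delta> k1. continuous_on (cbox a b) g \<Longrightarrow> 1 \<le> S \<Longrightarrow> 0 < \<epsilon> \<Longrightarrow> 0 < \<delta> \<Longrightarrow> \<delta> \<le> 1 / 8 \<Longrightarrow>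
    \<exists>k\<ge>k1. \<exists>s\<in>{S - 2 * \<delta>..S - \<delta>}. (LINT x|lebesgue. v s x $ i * (cutoff k (s, x) * backward a b g S (s, x)))
      \<le> (K * S powr (- (real CARD('n) + 2) / 4) * kinetic S + Cu * (1 + S / 4) powr (- \<alpha>)
          + S * (Cf * (1 + S / 4) powr (- \<alpha> - 1))) * Lp_norm 2 (on_box a b g) + \<epsilon>"
proof -
  obtain K where K: "K \<ge> 0" "\<And>a b g S \<sigma> \<rho> i \<epsilon>. continuous_on (cbox a b) g \<Longrightarrow> 1 \<le> S \<Longrightarrow> smooth_step (S / 4) (S / 2) \<sigma> \<rho> \<Longrightarrow> 0 < \<epsilon> \<Longrightarrow>
    \<exists>k0. \<forall>k\<ge>k0. \<bar>LINT t|time. LINT x|lebesgue. w t x $ i * (cutoff k (t, x) * (\<rho> t * backward a b g S (t, x)))\<bar>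
      \<le> K * S powr (- (real CARD('n) + 2) / 4) * kinetic S * Lp_norm 2 (on_box a b g) + \<epsilon>"
    by (rule difference_estimate) blast
  have "\<exists>k\<ge>k1. \<exists>s\<in>{S - 2 * \<delta>..S - \<delta>}. (LINT x|lebesgue. v s x $ i * (cutoff k (s, x) * backward a b g S (s, x)))
      \<le> (K * S powr (- (real CARD('n) + 2) / 4) * kinetic S + Cu * (1 + S / 4) powr (- \<alpha>)
          + S * (Cf * (1 + S / 4) powr (- \<alpha> - 1))) * Lp_norm 2 (on_box a b g) + \<epsilon>"
    if g: "continuous_on (cbox a b) g" and S: "1 \<le> S" and \<epsilon>: "0 < \<epsilon>" and \<delta>: "0 < \<delta>" "\<delta> \<le> 1 / 8"
    for a b :: "real^'n" and g S i \<epsilon> \<delta> and k1 :: nat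
  proof -
    let ?N = "Lp_norm 2 (on_box a b g)"
    have N0: "0 \<le> ?N" by (rule Lp2_norm_nonneg)
    obtain \<sigma>1 \<rho>1 where \<rho>1: "smooth_step (S / 4) (S / 2) \<sigma>1 \<rho>1" using smooth_step_exists[of "S / 4" "S / 2"] S by auto
    obtain \<sigma>2 \<rho>2 where \<rho>2: "smooth_step (S - 2 * \<delta>) (S - \<delta>) \<sigma>2 \<rho>2"
      using smooth_step_exists[of "S - 2 * \<delta>" "S - \<delta>"] \<delta> by auto
    have order: "S / 2 < S - 2 * \<delta>" using S \<delta> by simp
    have c: "S - \<delta> / 2 < S" using \<delta> by simp
    obtain \<kappa> where \<kappa>: "\<kappa> > 0" "tame {z. - 1 < fst z \<and> fst z < S - \<delta> / 2} (\<lambda>_ z. exp (- (\<kappa> * (norm (snd z))\<^sup>2))) (\<lambda>_. backward a b g S)"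
      using tame_backward[OF g c] by blast
    let ?\<eta> = "\<lambda>t. \<sigma>1 t - \<sigma>2 t" and ?\<eta>' = "\<lambda>t. \<rho>1 t - \<rho>2 t"
    interpret L: localized "backward a b g S" ?\<eta> ?\<eta>' "- 1" "S / 4" "S - \<delta>" "S - \<delta> / 2" \<kappa>
    proof (unfold_locales, fact \<kappa>(2), fact \<kappa>(1))
      show "dderiv et (backward a b g S) z + (\<Sum>e\<in>Basis. dderiv (0, e) (dderiv (0, e) (backward a b g S)) z) = 0"
        if "fst z < S - \<delta> / 2" for z
        by (rule backward_heat_equation[OF g]) (use that c in linarith)
      show "tame UNIV (\<lambda>_ _. 1) (\<lambda>_ t. \<sigma>1 t - \<sigma>2 t)"
        by (intro tame_diff open_UNIV smooth_stepD(2)[OF \<rho>1] smooth_stepD(2)[OF \<rho>2])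
      show "((\<lambda>t. \<sigma>1 t - \<sigma>2 t) has_real_derivative \<rho>1 t - \<rho>2 t) (at t)" for t
        by (intro DERIV_diff smooth_stepD(3)[OF \<rho>1] smooth_stepD(3)[OF \<rho>2])
      show "\<sigma>1 t - \<sigma>2 t = 0" if "t \<le> S / 4 \<or> S - \<delta> \<le> t" for t
        using that order S \<delta> smooth_stepD(7)[OF \<rho>1, of t] smooth_stepD(8)[OF \<rho>1, of t] smooth_stepD(7)[OF \<rho>2, of t] smooth_stepD(8)[OF \<rho>2, of t]
        by auto
    qed (use S \<delta> in auto)
    define \<zeta>1 where "\<zeta>1 k z = cutoff k z * (\<rho>1 (fst z) * backward a b g S z)" for k z
    define \<zeta>2 where "\<zeta>2 k z = cutoff k z * (\<rho>2 (fst z) * backward a b g S z)" for k z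
    have cc\<zeta>: "smooth_cc (\<zeta>1 k)" "smooth_cc (\<zeta>2 k)" for k
      unfolding \<zeta>1_def[abs_def] \<zeta>2_def[abs_def]
      using S \<delta> by (auto intro!: weighted_backward_smooth[OF g \<rho>1] weighted_backward_smooth[OF g \<rho>2])
    define A where "A h F = (LINT t|time. LINT x|lebesgue. h t x $ i * F (t, x))" for h :: "real \<Rightarrow> real^'n \<Rightarrow> real^'n" and F
    define e where "e k z = heat_op (L.Y k) z - (\<zeta>1 k z - \<zeta>2 k z)" for k z
    have ccH: "smooth_cc (heat_op (L.Y k))" for k by (intro smooth_cc_heat_op L.smooth_cc_Y)
    have cce: "smooth_cc (e k)" for k unfolding e_def[abs_def] by (intro smooth_cc_diff ccH cc\<zeta>)
    have Ae: "A v (e k) = A v (heat_op (L.Y k)) - (A v (\<zeta>1 k) - A v (\<zeta>2 k))" for k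
      unfolding A_def e_def component_pairing_diff[OF v(1) ccH smooth_cc_diff[OF cc\<zeta>]] component_pairing_diff[OF v(1) cc\<zeta>] ..
    obtain C where C: "\<And>k z. \<bar>heat_op (L.Y k) z - cutoff k z * (?\<eta>' (fst z) * backward a b g S z)\<bar>
        \<le> C * (1 / real (Suc k) * L.H z)"
      using L.heat_op_Y_error by blast
    have eb: "\<bar>e k (t, x)\<bar> \<le> C * (1 / real (Suc k) * exp (- (\<kappa> * (norm x)\<^sup>2)))" for k t x
      using C[of k "(t, x)"] by (simp add: e_def \<zeta>1_def \<zeta>2_def L.H_def algebra_simps)
    have eoff: "e k (t, x) = 0" if "S < t" for k t x
    proof -
      have "\<rho>1 t = 0" "\<rho>2 t = 0" using smooth_stepD(5)[OF \<rho>1, of t] smooth_stepD(5)[OF \<rho>2, of t] that S \<delta> by simp_all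
      moreover have "heat_op (L.Y k) (t, x) = 0" by (rule L.heat_op_Y_off) (use that \<delta> in auto)
      ultimately show ?thesis by (simp add: e_def \<zeta>1_def \<zeta>2_def)
    qed
    have Ae0: "(\<lambda>k. A v (e k)) \<longlonglongrightarrow> 0"
      unfolding A_def by (rule pairing_error_bound[where T=S, OF v(1) _ \<kappa>(1) cce eb eoff]) (use S in auto)
    have st_k: "A v (heat_op (L.Y k)) + A f (L.Y k) = 0" for k
    proof -
      have "L.Y k (0, x) = 0" for x by (rule L.Y_off) (use S in auto)
      from stokes_tested_component[OF v(1) f f_bounded L.smooth_cc_Y st this] show ?thesis unfolding A_def .
    qed
    have Av: "A v (\<zeta>1 k) = A u (\<zeta>1 k) + A w (\<zeta>1 k)" for k
    proof -
      have "A v (\<zeta>1 k) = (LINT t|time. (LINT x|lebesgue. u t x $ i * \<zeta>1 k (t, x)) + (LINT x|lebesgue. w t x $ i * \<zeta>1 k (t, x)))"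
        unfolding A_def
      proof (rule Bochner_Integration.integral_cong)
        fix t assume "t \<in> space time"
        then have t: "0 \<le> t" by simp
        have "(LINT x|lebesgue. v t x $ i * \<zeta>1 k (t, x)) = (LINT x|lebesgue. u t x $ i * \<zeta>1 k (t, x) + w t x $ i * \<zeta>1 k (t, x))"
          by (simp add: w_def algebra_simps)
        also have "\<dots> = (LINT x|lebesgue. u t x $ i * \<zeta>1 k (t, x)) + (LINT x|lebesgue. w t x $ i * \<zeta>1 k (t, x))"
          by (intro Bochner_Integration.integral_add component_integrable(1) L2 t smooth_cc_slice cc\<zeta>)
        finally show "(LINT x|lebesgue. v t x $ i * \<zeta>1 k (t, x)) = (LINT x|lebesgue. u t x $ i * \<zeta>1 k (t, x)) + (LINT x|lebesgue. w t x $ i * \<zeta>1 k (t, x))" .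
      qed simp
      then show ?thesis
        unfolding A_def using component_pairing_integrable[OF u(1) cc\<zeta>(1)[of k], of i] component_pairing_integrable[OF w cc\<zeta>(1)[of k], of i] by simp
    qed
    have Au: "\<bar>A u (\<zeta>1 k)\<bar> \<le> Cu * (1 + S / 4) powr (- \<alpha>) * ?N" for k
      unfolding A_def
    proof (rule time_weighted_bound[OF \<rho>1])
      fix t :: real assume t: "0 < t"
      show "\<bar>LINT x|lebesgue. u t x $ i * \<zeta>1 k (t, x)\<bar> \<le> \<rho>1 t * (Cu * (1 + S / 4) powr (- \<alpha>) * ?N)"
      proof (cases "S / 4 < t \<and> t < S / 2")
        case True
        have tS: "t < S" using True S by simp
        have "(1 + t) powr (- \<alpha>) \<le> (1 + S / 4) powr (- \<alpha>)" by (rule powr_mono2') (use True \<alpha> S in auto)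
        then have "Cu * (1 + t) powr (- \<alpha>) \<le> Cu * (1 + S / 4) powr (- \<alpha>)" by (rule mult_left_mono[OF _ Cu])
        then have ut: "Lp_norm 2 (u t) \<le> Cu * (1 + S / 4) powr (- \<alpha>)" using u_decay[of t] t by simp
        have "0 \<le> \<rho>1 t" by (rule smooth_stepD(4)[OF \<rho>1])
        then show ?thesis unfolding \<zeta>1_def
          using weighted_pairing_bound[OF L2(1) backward_L2(1)[OF g tS] ut backward_L2(2)[OF g tS], of i k t "\<rho>1 t"] t by simp
      next
        case False
        then have "\<rho>1 t = 0" using smooth_stepD(5)[OF \<rho>1, of t] by auto
        then show ?thesis by (simp add: \<zeta>1_def)
      qed
    qed (use S in auto)
    have Af: "\<bar>A f (L.Y k)\<bar> \<le> S * (Cf * (1 + S / 4) powr (- \<alpha> - 1) * ?N)" for k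
    proof -
      let ?B = "Cf * (1 + S / 4) powr (- \<alpha> - 1) * ?N"
      have B0: "0 \<le> ?B" using Cf N0 by simp
      have S0: "0 \<le> S" using S by simp
      have "\<bar>A f (L.Y k)\<bar> \<le> (LINT t|time. indicator {0..S} t * ?B)"
        unfolding A_def
      proof (rule time_integral_bound[OF time_interval_mass(1)[OF S0]])
        fix t :: real assume t: "0 < t"
        show "\<bar>LINT x|lebesgue. f t x $ i * L.Y k (t, x)\<bar> \<le> indicator {0..S} t * ?B"
        proof (cases "S / 4 \<le> t \<and> t \<le> S - \<delta>")
          case True
          have tS: "t < S" using True \<delta> by simp
          have "(1 + t) powr (- \<alpha> - 1) \<le> (1 + S / 4) powr (- \<alpha> - 1)" by (rule powr_mono2') (use True \<alpha> S in auto)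
          then have "Cf * (1 + t) powr (- \<alpha> - 1) \<le> Cf * (1 + S / 4) powr (- \<alpha> - 1)" by (rule mult_left_mono[OF _ Cf])
          then have ft: "in_Lp 2 (f t)" "Lp_norm 2 (f t) \<le> Cf * (1 + S / 4) powr (- \<alpha> - 1)" using f_decay[OF t] by auto
          have \<eta>1: "\<bar>\<sigma>1 t - \<sigma>2 t\<bar> \<le> 1"
            using smooth_stepD(9,10)[OF \<rho>1, of t] smooth_stepD(9,10)[OF \<rho>2, of t] by linarith
          have "\<bar>LINT x|lebesgue. f t x $ i * L.Y k (t, x)\<bar> \<le> \<bar>\<sigma>1 t - \<sigma>2 t\<bar> * ?B"
            unfolding L.Y_def L.Z_def fst_conv
            by (rule weighted_pairing_bound[OF ft(1) backward_L2(1)[OF g tS] ft(2) backward_L2(2)[OF g tS]])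
          also have "\<dots> \<le> 1 * ?B" by (rule mult_right_mono[OF \<eta>1 B0])
          finally show ?thesis using t tS by simp
        next
          case False
          then have "L.Y k (t, x) = 0" for x by (intro L.Y_off) auto
          then show ?thesis using B0 by simp
        qed
      qed
      then show ?thesis unfolding time_interval_mass(2)[OF S0] .
    qed
    let ?R = "(K * S powr (- (real CARD('n) + 2) / 4) * kinetic S + Cu * (1 + S / 4) powr (- \<alpha>)
          + S * (Cf * (1 + S / 4) powr (- \<alpha> - 1))) * ?N"
    have e3: "0 < \<epsilon> / 3" using \<epsilon> by simp
    obtain k0 where k0: "\<And>k. k0 \<le> k \<Longrightarrow> \<bar>A w (\<zeta>1 k)\<bar> \<le> K * S powr (- (real CARD('n) + 2) / 4) * kinetic S * ?N + \<epsilon> / 3"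
      using K(2)[OF g S \<rho>1 e3, of i] unfolding A_def \<zeta>1_def by auto
    obtain k2 where k2: "\<And>k. k2 \<le> k \<Longrightarrow> \<bar>A v (e k)\<bar> < \<epsilon> / 3"
      using tendstoD[OF Ae0 e3] unfolding eventually_sequentially by (auto simp: dist_real_def)
    define k where "k = max k1 (max k0 k2)"
    have k: "k1 \<le> k" "k0 \<le> k" "k2 \<le> k" by (simp_all add: k_def)
    have "?R = K * S powr (- (real CARD('n) + 2) / 4) * kinetic S * ?N + Cu * (1 + S / 4) powr (- \<alpha>) * ?N
        + S * (Cf * (1 + S / 4) powr (- \<alpha> - 1) * ?N)" by (simp add: algebra_simps)
    then have tot: "A v (\<zeta>2 k) < ?R + \<epsilon>"
      using Ae[of k] st_k[of k] Av[of k] Au[of k] Af[of k] k0[OF k(2)] k2[OF k(3)] by linarith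
    define p where "p s = (LINT x|lebesgue. v s x $ i * (cutoff k (s, x) * backward a b g S (s, x)))" for s
    have pull: "(LINT x|lebesgue. v t x $ i * \<zeta>2 k (t, x)) = \<rho>2 t * p t" for t
    proof -
      have "v t x $ i * \<zeta>2 k (t, x) = \<rho>2 t * (v t x $ i * (cutoff k (t, x) * backward a b g S (t, x)))" for x
        by (simp add: \<zeta>2_def)
      then show ?thesis unfolding p_def by (simp only: integral_mult_right_zero)
    qed
    have Ap: "A v (\<zeta>2 k) = (LINT t|time. \<rho>2 t * p t)" unfolding A_def pull ..
    have ip: "integrable time (\<lambda>t. \<rho>2 t * p t)"
      using component_pairing_integrable[OF v(1) cc\<zeta>(2)[of k], of i] unfolding pull .
    \<comment> \<open>Otherwise the average of \<open>p\<close> with the probability density \<open>\<rho>2\<close> would be too large.\<close>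
    have "\<exists>s\<in>{S - 2 * \<delta>..S - \<delta>}. p s \<le> ?R + \<epsilon>"
    proof (rule ccontr)
      assume neg: "\<not> ?thesis"
      have l0: "0 \<le> S - 2 * \<delta>" using S \<delta> by simp
      note m = smooth_step_mass[OF \<rho>2 l0]
      have "?R + \<epsilon> = (LINT t|time. \<rho>2 t * (?R + \<epsilon>))" using m by simp
      also have "\<dots> \<le> (LINT t|time. \<rho>2 t * p t)"
      proof (rule integral_mono[OF _ ip])
        show "integrable time (\<lambda>t. \<rho>2 t * (?R + \<epsilon>))" using m(1) by (rule integrable_mult_left)
        show "\<rho>2 t * (?R + \<epsilon>) \<le> \<rho>2 t * p t" for t
        proof (cases "t \<in> {S - 2 * \<delta>..S - \<delta>}")
          case True
          then have "?R + \<epsilon> \<le> p t" using neg by (meson linear)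
          then show ?thesis by (rule mult_left_mono[OF _ smooth_stepD(4)[OF \<rho>2]])
        next
          case False
          then have "\<rho>2 t = 0" using smooth_stepD(5)[OF \<rho>2, of t] by auto
          then show ?thesis by simp
        qed
      qed
      finally show False using tot Ap by simp
    qed
    then show ?thesis unfolding p_def using k(1) by blast
  qed
  then show thesis by (rule that[OF K(1)])
qed

text \<open>
  As the late time approaches \<open>S\<close>, the backward evolution approaches its final value, and \<open>v\<close> is strongly
  continuous.  So the late estimate becomes one for \<open>\<langle>v\<^sub>i(S), \<psi>\<rangle>\<close>, for all \<open>\<psi>\<close> from a dense class.
\<close>
lemma component_bound:
  obtains K where "K \<ge> 0" "\<And>S i. 1 \<le> S \<Longrightarrow> Lp_norm 2 (\<lambda>x. v S x $ i)
      \<le> K * S powr (- (real CARD('n) + 2) / 4) * kinetic S + Cu * (1 + S / 4) powr (- \<alpha>)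
          + S * (Cf * (1 + S / 4) powr (- \<alpha> - 1))"
proof -
  obtain K where K: "K \<ge> 0" "\<And>a b g S i \<epsilon> \<delta> k1. continuous_on (cbox a b) g \<Longrightarrow> 1 \<le> S \<Longrightarrow> 0 < \<epsilon> \<Longrightarrow> 0 < \<delta> \<Longrightarrow> \<delta> \<le> 1 / 8 \<Longrightarrow>
    \<exists>k\<ge>k1. \<exists>s\<in>{S - 2 * \<delta>..S - \<delta>}. (LINT x|lebesgue. v s x $ i * (cutoff k (s, x) * backward a b g S (s, x)))
      \<le> (K * S powr (- (real CARD('n) + 2) / 4) * kinetic S + Cu * (1 + S / 4) powr (- \<alpha>)
          + S * (Cf * (1 + S / 4) powr (- \<alpha> - 1))) * Lp_norm 2 (on_box a b g) + \<epsilon>"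
    by (rule late_time_estimate) blast
  have "Lp_norm 2 (\<lambda>x. v S x $ i)
      \<le> K * S powr (- (real CARD('n) + 2) / 4) * kinetic S + Cu * (1 + S / 4) powr (- \<alpha>)
          + S * (Cf * (1 + S / 4) powr (- \<alpha> - 1))" (is "_ \<le> ?R") if S: "1 \<le> S" for S i
  proof (rule Lp2_norm_le_by_testing)
    have vS: "in_Lp 2 (v S)" using L2(2) S by simp
    show h: "in_Lp 2 (\<lambda>x. v S x $ i)" by (rule in_Lp2_component(1)[OF vS])
    show "0 \<le> ?R" using K(1) kinetic_nonneg[of S] Cu Cf S by simp
    fix a b :: "real^'n" and g :: "real^'n \<Rightarrow> real" assume g: "continuous_on UNIV g"
    then have g': "continuous_on (cbox a b) g" using continuous_on_subset by blast
    let ?N = "Lp_norm 2 (on_box a b g)"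
    \<comment> \<open>Windows that shrink to \<open>S\<close>, tolerances that shrink to \<open>0\<close>, and cutoffs that exhaust the space.\<close>
    have "\<forall>j. \<exists>p. j \<le> fst p \<and> snd p \<in> {S - 2 * (1 / (8 * real (Suc j)))..S - 1 / (8 * real (Suc j))} \<and>
        (LINT x|lebesgue. v (snd p) x $ i * (cutoff (fst p) (snd p, x) * backward a b g S (snd p, x))) \<le> ?R * ?N + 1 / real (Suc j)"
    proof
      fix j
      have "0 < 1 / real (Suc j)" "0 < 1 / (8 * real (Suc j))" "1 / (8 * real (Suc j)) \<le> 1 / 8" by (simp_all add: field_simps)
      from K(2)[OF g' S this, of j i] obtain k s where "j \<le> k" "s \<in> {S - 2 * (1 / (8 * real (Suc j)))..S - 1 / (8 * real (Suc j))}"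
        "(LINT x|lebesgue. v s x $ i * (cutoff k (s, x) * backward a b g S (s, x))) \<le> ?R * ?N + 1 / real (Suc j)" by blast
      then show "\<exists>p. j \<le> fst p \<and> snd p \<in> {S - 2 * (1 / (8 * real (Suc j)))..S - 1 / (8 * real (Suc j))} \<and>
        (LINT x|lebesgue. v (snd p) x $ i * (cutoff (fst p) (snd p, x) * backward a b g S (snd p, x))) \<le> ?R * ?N + 1 / real (Suc j)"
        by (intro exI[of _ "(k, s)"]) simp
    qed
    from choice[OF this] obtain q where q: "\<And>j. j \<le> fst (q j)"
      "\<And>j. snd (q j) \<in> {S - 2 * (1 / (8 * real (Suc j)))..S - 1 / (8 * real (Suc j))}"
      "\<And>j. (LINT x|lebesgue. v (snd (q j)) x $ i * (cutoff (fst (q j)) (snd (q j), x) * backward a b g S (snd (q j), x))) \<le> ?R * ?N + 1 / real (Suc j)"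
      by blast
    define m where "m j = fst (q j)" for j
    define s where "s j = snd (q j)" for j
    have s1: "S - 1 \<le> s j" "s j < S" for j
    proof -
      have "2 * (1 / (8 * real (Suc j))) \<le> 1" "0 < 1 / (8 * real (Suc j))" by (simp_all add: field_simps)
      then show "S - 1 \<le> s j" "s j < S" using q(2)[of j] unfolding s_def atLeastAtMost_iff by linarith+
    qed
    have r0: "(\<lambda>j. 1 / real (Suc j)) \<longlonglongrightarrow> 0" by (rule lim_1_over_n[THEN LIMSEQ_Suc])
    have sS: "s \<longlonglongrightarrow> S"
    proof (rule tendsto_sandwich[of "\<lambda>j. S - 1 / 4 * (1 / real (Suc j))" s sequentially "\<lambda>_. S"])
      show "\<forall>\<^sub>F j in sequentially. S - 1 / 4 * (1 / real (Suc j)) \<le> s j"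
      proof (intro always_eventually allI)
        fix j
        have "1 / 4 * (1 / real (Suc j)) = 2 * (1 / (8 * real (Suc j)))" by (simp add: field_simps)
        then show "S - 1 / 4 * (1 / real (Suc j)) \<le> s j"
          using q(2)[of j] unfolding s_def atLeastAtMost_iff by (simp only: )
      qed
      show "\<forall>\<^sub>F j in sequentially. s j \<le> S" using s1(2) less_imp_le by (intro always_eventually allI) blast
      show "(\<lambda>j. S - 1 / 4 * (1 / real (Suc j))) \<longlonglongrightarrow> S"
        using tendsto_diff[OF tendsto_const[of S] tendsto_mult[OF tendsto_const[of "1 / 4"] r0]] by simp
    qed simp
    have mm: "filterlim m at_top sequentially"
      by (rule filterlim_at_top_mono[OF filterlim_ident]) (use q(1) in \<open>auto simp: m_def\<close>)
    define D where "D j = Lp_norm 2 (\<lambda>x. v (s j) x - v S x)" for j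
    have D0: "D \<longlonglongrightarrow> 0"
      unfolding D_def[abs_def]
    proof (rule filterlim_compose[OF v_cont[of S]])
      show "filterlim s (at S within {0..}) sequentially"
        unfolding filterlim_at using sS s1 S by (auto intro!: always_eventually simp: less_imp_neq) (smt (verit) s1(1))
    qed (use S in auto)
    have b: "(LINT x|lebesgue. v S x $ i * (cutoff (m j) (s j, x) * backward a b g S (s j, x))) \<le> ?R * ?N + 1 / real (Suc j) + D j * ?N" for j
    proof -
      let ?F = "\<lambda>x. cutoff (m j) (s j, x) * (1 * backward a b g S (s j, x))"
      have F: "in_Lp 2 ?F" by (rule cutoff_slice_L2(1)[OF backward_L2(1)[OF g' s1(2)]])
      have "0 \<le> s j" using s1(1)[of j] S by linarith
      then have vs: "in_Lp 2 (v (s j))" by (rule L2(2))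
      have "(LINT x|lebesgue. v (s j) x $ i * ?F x) - (LINT x|lebesgue. v S x $ i * ?F x)
          = (LINT x|lebesgue. (v (s j) x - v S x) $ i * ?F x)"
        using component_integrable(1)[OF vs F, of i] component_integrable(1)[OF vS F, of i] by (simp add: left_diff_distrib)
      moreover have "\<bar>LINT x|lebesgue. (v (s j) x - v S x) $ i * ?F x\<bar> \<le> \<bar>1\<bar> * (D j * ?N)"
        by (rule weighted_pairing_bound[OF in_Lp2_diff[OF vs vS] backward_L2(1)[OF g' s1(2)] _ backward_L2(2)[OF g' s1(2)]]) (simp add: D_def)
      moreover have "(LINT x|lebesgue. v (s j) x $ i * ?F x) \<le> ?R * ?N + 1 / real (Suc j)"
        using q(3)[of j] by (simp add: m_def s_def)
      ultimately show ?thesis by simp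
    qed
    have "(\<lambda>j. ?R * ?N + 1 / real (Suc j) + D j * ?N) \<longlonglongrightarrow> ?R * ?N + 0 + 0 * ?N"
      by (intro tendsto_intros r0 D0)
    from LIMSEQ_le[OF backward_weak_limit[OF h g s1 sS mm] this] b
    show "(LINT x|lebesgue. v S x $ i * on_box a b g x) \<le> ?R * ?N" by auto
  qed
  then show thesis by (rule that[OF K(1)])
qed

text \<open>
  For \<open>\<alpha> < 1\<close> the integrand is at most \<open>(1 + t)\<close> to the power \<open>- \<alpha>\<close>, whose integral grows with
  exponent \<open>1 - \<alpha> \<le> \<beta> - \<alpha>\<close>; otherwise it is integrable on the half line.
\<close>
lemma kinetic_growth:
  assumes \<beta>: "\<alpha> \<le> \<beta>" "1 \<le> \<beta>"
  shows "\<exists>C\<ge>0. \<forall>S\<ge>0. kinetic S \<le> C * (1 + S) powr (\<beta> - \<alpha>)"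
proof -
  have mono: "kinetic S \<le> ((1 + S / 2) powr (p + 1) - 1) / (p + 1)" if p: "- 2 * \<alpha> \<le> p" "p + 1 \<noteq> 0" and S: "0 \<le> S" for p S
  proof -
    have T: "0 \<le> S / 2" using S by simp
    have "kinetic S \<le> (LINT t|time. indicator {0..S / 2} t * (1 + t) powr p)"
      unfolding kinetic_def
    proof (rule integral_mono[OF kinetic_integrable power_time_integral(1)[OF p(2) T]])
      fix t assume "t \<in> space time"
      then show "indicator {0..S / 2} t * (1 + t) powr (- 2 * \<alpha>) \<le> indicator {0..S / 2} t * (1 + t) powr p"
        using p(1) by (intro mult_left_mono powr_mono) auto
    qed
    then show ?thesis using power_time_integral(2)[OF p(2) T] by simp
  qed
  show ?thesis
  proof (cases "\<alpha> < 1")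
    case True
    have "kinetic S \<le> 1 / (1 - \<alpha>) * (1 + S) powr (\<beta> - \<alpha>)" if S: "0 \<le> S" for S
    proof -
      have "kinetic S \<le> ((1 + S / 2) powr (1 - \<alpha>) - 1) / (1 - \<alpha>)" using mono[of "- \<alpha>" S] \<alpha> True S by simp
      also have "\<dots> \<le> (1 + S) powr (\<beta> - \<alpha>) / (1 - \<alpha>)"
      proof (rule divide_right_mono)
        have "(1 + S / 2) powr (1 - \<alpha>) \<le> (1 + S) powr (1 - \<alpha>)" using S True by (intro powr_mono2) auto
        also have "\<dots> \<le> (1 + S) powr (\<beta> - \<alpha>)" using S \<beta> by (intro powr_mono) auto
        finally show "(1 + S / 2) powr (1 - \<alpha>) - 1 \<le> (1 + S) powr (\<beta> - \<alpha>)" by simp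
      qed (use True in simp)
      finally show ?thesis by simp
    qed
    then show ?thesis using True by (intro exI[of _ "1 / (1 - \<alpha>)"]) auto
  next
    case False
    have "kinetic S \<le> 1 * (1 + S) powr (\<beta> - \<alpha>)" if S: "0 \<le> S" for S
    proof -
      have "kinetic S \<le> ((1 + S / 2) powr (- 1) - 1) / (- 1)" using mono[of "- 2" S] False S by simp
      also have "\<dots> \<le> 1" by simp
      also have "1 \<le> (1 + S) powr (\<beta> - \<alpha>)" using S \<beta> by (intro ge_one_powr_ge_zero) auto
      finally show ?thesis by simp
    qed
    then show ?thesis by (intro exI[of _ 1]) auto
  qed
qed

text \<open>
  The three contributions: \<open>S\<close> to the power \<open>- \<beta>\<close> times the growth exponent \<open>\<beta> - \<alpha>\<close> for the nonlinear one,
  the rate of \<open>u\<close> at time \<open>S/4\<close>, and \<open>S\<close> times the rate \<open>- \<alpha> - 1\<close> of the force.  That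
  \<open>\<beta> = (n + 2)/4\<close> is at least \<open>1\<close> is the condition \<open>n \<ge> 2\<close>.
\<close>
lemma v_decay:
  assumes \<beta>: "\<alpha> \<le> (real CARD('n) + 2) / 4"
  shows "\<exists>C\<ge>0. \<forall>S\<ge>1. Lp_norm 2 (v S) \<le> C * (1 + S) powr (- \<alpha>)"
proof -
  let ?\<beta> = "(real CARD('n) + 2) / 4"
  obtain K where K: "K \<ge> 0" "\<And>S i. 1 \<le> S \<Longrightarrow> Lp_norm 2 (\<lambda>x. v S x $ i)
      \<le> K * S powr (- (real CARD('n) + 2) / 4) * kinetic S + Cu * (1 + S / 4) powr (- \<alpha>)
          + S * (Cf * (1 + S / 4) powr (- \<alpha> - 1))"
    by (rule component_bound) blast
  have \<beta>1: "1 \<le> ?\<beta>" using n by simp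
  obtain C where C: "C \<ge> 0" "\<And>S. S \<ge> 0 \<Longrightarrow> kinetic S \<le> C * (1 + S) powr (?\<beta> - \<alpha>)"
    using kinetic_growth[OF \<beta> \<beta>1] by blast
  let ?M = "K * 2 powr ?\<beta> * C + Cu * 4 powr \<alpha> + Cf * 4 powr (\<alpha> + 1)"
  have scale: "(c * S') powr (- q) = c powr (- q) * S' powr (- q)" if "c > 0" "S' > 0" for c S' q :: real
    using that by (simp add: powr_mult)
  have comp: "Lp_norm 2 (\<lambda>x. v S x $ i) \<le> ?M * (1 + S) powr (- \<alpha>)" if S: "1 \<le> S" for S i
  proof -
    let ?P = "(1 + S) powr (- \<alpha>)"
    have 1: "K * S powr (- (real CARD('n) + 2) / 4) * kinetic S \<le> K * 2 powr ?\<beta> * C * ?P"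
    proof -
      have "S powr (- ?\<beta>) \<le> ((1 + S) / 2) powr (- ?\<beta>)" by (rule powr_mono2') (use S in auto)
      also have "\<dots> = 2 powr ?\<beta> * (1 + S) powr (- ?\<beta>)" using S scale[of "1 / 2" "1 + S" ?\<beta>] by (simp add: powr_minus powr_divide)
      finally have "S powr (- (real CARD('n) + 2) / 4) \<le> 2 powr ?\<beta> * (1 + S) powr (- ?\<beta>)" by (simp add: minus_divide_left)
      then have "K * S powr (- (real CARD('n) + 2) / 4) * kinetic S
          \<le> K * (2 powr ?\<beta> * (1 + S) powr (- ?\<beta>)) * (C * (1 + S) powr (?\<beta> - \<alpha>))"
        using K(1) C S kinetic_nonneg by (intro mult_mono) auto
      also have "\<dots> = K * 2 powr ?\<beta> * C * ((1 + S) powr (- ?\<beta>) * (1 + S) powr (?\<beta> - \<alpha>))" by simp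
      also have "(1 + S) powr (- ?\<beta>) * (1 + S) powr (?\<beta> - \<alpha>) = ?P" by (simp flip: powr_add)
      finally show ?thesis .
    qed
    have q: "(1 + S / 4) powr (- p) \<le> 4 powr p * (1 + S) powr (- p)" if "p > 0" for p
    proof -
      have "(1 + S / 4) powr (- p) \<le> ((1 + S) / 4) powr (- p)" by (rule powr_mono2') (use S that in auto)
      also have "\<dots> = 4 powr p * (1 + S) powr (- p)" using S scale[of "1 / 4" "1 + S" p] by (simp add: powr_minus powr_divide)
      finally show ?thesis .
    qed
    have 2: "Cu * (1 + S / 4) powr (- \<alpha>) \<le> Cu * 4 powr \<alpha> * ?P"
      using mult_left_mono[OF q[OF \<alpha>] Cu] by simp
    have 3: "S * (Cf * (1 + S / 4) powr (- \<alpha> - 1)) \<le> Cf * 4 powr (\<alpha> + 1) * ?P"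
    proof -
      have "S * (Cf * (1 + S / 4) powr (- \<alpha> - 1)) \<le> (1 + S) * (Cf * (4 powr (\<alpha> + 1) * (1 + S) powr (- \<alpha> - 1)))"
        using q[of "\<alpha> + 1"] \<alpha> S Cf by (intro mult_mono) auto
      also have "\<dots> = Cf * 4 powr (\<alpha> + 1) * ((1 + S) powr 1 * (1 + S) powr (- \<alpha> - 1))" using S by simp
      also have "(1 + S) powr 1 * (1 + S) powr (- \<alpha> - 1) = ?P" by (simp only: flip: powr_add) simp
      finally show ?thesis .
    qed
    have "Lp_norm 2 (\<lambda>x. v S x $ i) \<le> K * 2 powr ?\<beta> * C * ?P + Cu * 4 powr \<alpha> * ?P + Cf * 4 powr (\<alpha> + 1) * ?P"
      using K(2)[OF S, of i] 1 2 3 by linarith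
    then show ?thesis by (simp add: distrib_right)
  qed
  have "Lp_norm 2 (v S) \<le> real CARD('n) * ?M * (1 + S) powr (- \<alpha>)" if S: "1 \<le> S" for S
  proof -
    have "Lp_norm 2 (v S) \<le> (\<Sum>i\<in>UNIV. Lp_norm 2 (\<lambda>x. v S x $ i))" using S by (intro Lp2_norm_components L2) simp
    also have "\<dots> \<le> (\<Sum>i\<in>(UNIV::'n set). ?M * (1 + S) powr (- \<alpha>))" by (intro sum_mono comp S)
    finally show ?thesis by simp
  qed
  moreover have "0 \<le> real CARD('n) * ?M" using K(1) C(1) Cu Cf by simp
  ultimately show ?thesis by blast
qed

end

lemma decays_at_rateD:
  assumes "decays_at_rate \<alpha> g"
  shows "\<exists>C\<ge>0. \<forall>t\<ge>0. \<bar>g t\<bar> \<le> C * (1 + t) powr (- \<alpha>)"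
proof -
  obtain C where C: "\<And>t. t \<ge> 0 \<Longrightarrow> norm ((1 + t) powr \<alpha> * g t) \<le> C" using assms unfolding decays_at_rate_def bounded_iff by auto
  have "\<bar>g t\<bar> \<le> C * (1 + t) powr (- \<alpha>)" if t: "t \<ge> 0" for t
  proof -
    have "\<bar>g t\<bar> = norm ((1 + t) powr \<alpha> * g t) * (1 + t) powr (- \<alpha>)" using t by (simp add: abs_mult powr_minus field_simps)
    also have "\<dots> \<le> C * (1 + t) powr (- \<alpha>)" by (intro mult_right_mono C t) simp
    finally show ?thesis .
  qed
  moreover have "0 \<le> C" using order_trans[OF norm_ge_zero C[of 0]] by simp
  ultimately show ?thesis by blast
qed

theorem theorem2p1:
  fixes \<alpha> C\<^sub>f K\<^sub>f :: real
    and u\<^sub>0 :: "real^'n \<Rightarrow> real^'n"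
    and f u v :: "real \<Rightarrow> real^'n \<Rightarrow> real^'n"
  assumes "CARD('n) \<ge> 2"
    and "0 < \<alpha>" and "\<alpha> \<le> (real CARD('n) + 2) / 4"
    and "u\<^sub>0 \<in> L2_sigma"
    and "L1_L2_sigma f"
    and "0 < C\<^sub>f" and "0 < K\<^sub>f"
    and "\<And>t. t > 0 \<Longrightarrow> in_Lp 2 (f t) \<and> Lp_norm 2 (f t) \<le> C\<^sub>f * (1 + t) powr (- \<alpha> - 1)"
    and "\<And>t. t > 0 \<Longrightarrow> in_Lp (real CARD('n)) (f t) \<and>
           Lp_norm (real CARD('n)) (f t) \<le> K\<^sub>f * t powr (- \<alpha> - (real CARD('n) + 2) / 4)"
    and "leray_solution u\<^sub>0 f u"
    and "stokes_solution u\<^sub>0 f v"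
    and "decays_at_rate \<alpha> (\<lambda>t. Lp_norm 2 (u t))"
  shows "decays_at_rate \<alpha> (\<lambda>t. Lp_norm 2 (v t))"
proof -
  obtain Cu where Cu: "Cu \<ge> 0" "\<And>t. t \<ge> 0 \<Longrightarrow> \<bar>Lp_norm 2 (u t)\<bar> \<le> Cu * (1 + t) powr (- \<alpha>)"
    using decays_at_rateD[OF assms(12)] by blast
  have u: "Cw_L2_sigma u" "navier_stokes_weak u\<^sub>0 f u" using assms(10) by (simp_all add: leray_solution_def)
  have us: "u t \<in> L2_sigma" if "t \<ge> 0" for t using u(1) that by (simp add: Cw_L2_sigma_def)
  have v: "C_L2_sigma v" "\<And>\<phi>. test_function \<phi> \<Longrightarrow> stokes_form u\<^sub>0 f v \<phi> = 0" using assms(11) by (simp_all add: stokes_solution_def)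
  have vs: "v t \<in> L2_sigma" if "t \<ge> 0" for t using v(1) that by (simp add: C_L2_sigma_def)
  then have vL: "in_Lp 2 (v t)" if "t \<ge> 0" for t using that by (simp add: L2_sigma_def)
  have vc: "((\<lambda>s. Lp_norm 2 (\<lambda>x. v s x - v t x)) \<longlongrightarrow> 0) (at t within {0..})" if "t \<ge> 0" for t
    using v(1) that by (simp add: C_L2_sigma_def)
  have ud: "Lp_norm 2 (u t) \<le> Cu * (1 + t) powr (- \<alpha>)" if "t \<ge> 0" for t using Cu(2)[OF that] by simp
  have uw: "weakly_continuous u"
    unfolding weakly_continuous_def
  proof (intro conjI allI impI)
    show "in_Lp 2 (u t)" if "0 \<le> t" for t using us[OF that] by (simp add: L2_sigma_def)
    show "continuous_on {0..} (\<lambda>t. LINT x|lebesgue. u t x \<bullet> w x)" if "in_Lp 2 w" for w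
      using u(1) that by (simp add: Cw_L2_sigma_def)
    have "Lp_norm 2 (u t) \<le> Cu" if "0 \<le> t" for t
    proof -
      have "(1 + t) powr (- \<alpha>) \<le> 1" using that assms(2) powr_mono[of "- \<alpha>" 0 "1 + t"] by simp
      from mult_left_mono[OF this Cu(1)] ud[OF that] show ?thesis by simp
    qed
    then show "\<exists>M. \<forall>t\<in>{0..T}. Lp_norm 2 (u t) \<le> M" for T by (intro exI[of _ Cu]) auto
  qed
  interpret two_flows u v f u\<^sub>0 \<alpha> Cu C\<^sub>f
  proof (unfold_locales; (rule assms(1,2) Cu(1) uw us v(2) vs vc assms(8) u(2) ud; assumption)?)
    show "0 \<le> C\<^sub>f" using assms(6) by simp
    show "weakly_continuous v" by (rule L2_continuous_imp_weakly_continuous[OF vL vc])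
    show "strongly_measurable_L2 f" using assms(5) by (simp add: L1_L2_sigma_def bochner_Lq_L2_def)
  qed
  obtain C where C: "C \<ge> 0" "\<And>S. S \<ge> 1 \<Longrightarrow> Lp_norm 2 (v S) \<le> C * (1 + S) powr (- \<alpha>)" using v_decay[OF assms(3)] by blast
  obtain M where M: "\<And>t. t \<in> {0..1} \<Longrightarrow> Lp_norm 2 (v t) \<le> M" using two_flows.v(1)[OF two_flows_axioms] unfolding weakly_continuous_def by blast
  have "norm ((1 + t) powr \<alpha> * Lp_norm 2 (v t)) \<le> max C (2 powr \<alpha> * M)" if t: "t \<ge> 0" for t
  proof -
    have e: "norm ((1 + t) powr \<alpha> * Lp_norm 2 (v t)) = (1 + t) powr \<alpha> * Lp_norm 2 (v t)" by (simp add: Lp2_norm_nonneg)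
    show ?thesis
    proof (cases "t \<le> 1")
      case True
      then have "(1 + t) powr \<alpha> * Lp_norm 2 (v t) \<le> 2 powr \<alpha> * M"
        using t assms(2) by (intro mult_mono powr_mono2 M Lp2_norm_nonneg) auto
      then show ?thesis unfolding e by simp
    next
      case False
      then have "(1 + t) powr \<alpha> * Lp_norm 2 (v t) \<le> (1 + t) powr \<alpha> * (C * (1 + t) powr (- \<alpha>))"
        by (intro mult_left_mono C) auto
      also have "\<dots> = C" using t by (simp add: powr_minus)
      finally show ?thesis unfolding e by simp
    qed
  qed
  then show ?thesis unfolding decays_at_rate_def bounded_iff by (intro exI[of _ "max C (2 powr \<alpha> * M)"]) auto
qed

end
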